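(* Let $X$ be the $m$-symmetric Hunt process on $S$ described in the context (regular Dirichlet form, absolute continuity condition (AC), extended transition density $p$). Let $A=(A_t)_{t\ge0}$ and $B=(B_t)_{t\ge0}$ be PCAFs in the strict sense of $X$, and let $\mu$ and $\nu$ be the Revuz measures of $A$ and $B$, respectively. Then the following statements hold. (i) For any $t\in(0,\infty]$, $x\in S$, and Borel measurable function $f\colon S_\Delta\to[0,\infty]$, $$E_x[f(X_t)A_t]=\int_0^t\int_Sp_s(x,y)\int_{S_\Delta}p_{t-s}(y,z)f(z)\,m_\Delta(dz)\,\mu(dy)\,ds.$$ (ii) For any $t\in(0,\infty]$, $x\in S$, and $k\in\mathbb{N}$, $$E_x[A_t^k]=k!\int_0^tdt_1\int_{t_1}^tdt_2\cdots\int_{t_{k-1}}^tdt_k\int_S\mu(dy_1)\int_S\mu(dy_2)\cdots\int_S\mu(dy_k)\;p_{t_1}(x,y_1)\,p_{t_2-t_1}(y_1,y_2)\cdots p_{t_k-t_{k-1}}(y_{k-1},y_k).$$ (iii) For any $t\in(0,\infty]$ and $x\in S$, $$\begin{aligned}E_x[A_tB_t]=&\int_0^tdt_1\int_{t_1}^tdt_2\int_S\mu(dy_1)\int_S\nu(dy_2)\,p_{t_1}(x,y_1)p_{t_2-t_1}(y_1,y_2)\\&+\int_0^tdt_1\int_{t_1}^tdt_2\int_S\nu(dy_1)\int_S\mu(dy_2)\,p_{t_1}(x,y_1)p_{t_2-t_1}(y_1,y_2).\end{aligned}$$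
   Context: Setting. $S$ is a locally compact separable metrizable topological space, and $S_\Delta=S\cup\{\Delta\}$ is its one-point compactification ($\Delta$ is added as an isolated point if $S$ is compact). $\mathbb{N}$ is the set of positive integers. $\mathcal{B}(E)$ denotes the Borel $\sigma$-algebra of a topological space $E$, and $1_E$ an indicator function. $m$ is a Radon measure on $S$ with full support, $(\mathcal{E},\mathcal{F})$ is a regular symmetric Dirichlet form on $L^2(S,m)$, and $X=(\Omega,\mathscr{M},(X_t)_{t\in[0,\infty]},(P_x)_{x\in S_\Delta},(\theta_t)_{t\in[0,\infty]})$ is an $m$-symmetric Hunt process on $S$ with cemetery $\Delta$ (and $X_\infty=\Delta$) whose Dirichlet form is $(\mathcal{E},\mathcal{F})$. Here $\theta_t\colon\Omega\to\Omega$ is the shift operator, satisfying $X_s\circ\theta_t=X_{s+t}$ for all $s\in[0,\infty]$. $E_x$ is expectation under $P_x$. The life time $\zeta\colon\Omega\to[0,\infty]$ satisfies $\{X_t=\Delta\}=\{\zeta\le t\}$ for each $t\in[0,\infty]$. $\mathscr{F}_*=(\mathscr{F}_t)_{t\in[0,\infty]}$ is the minimum augmented admissible filtration of $X$: with $\mathscr{F}^0_t:=\sigma(X_s: s\le t)$, for each probability measure $\nu$ on $S_\Delta$ let $\mathscr{F}^\nu_\infty$ be the $P_\nu$-completion of $\mathscr{F}^0_\infty$ and $\mathscr{F}^\nu_t$ the $\sigma$-algebra generated by $\mathscr{F}^0_t$ and the $P_\nu$-null sets of $\mathscr{F}^\nu_\infty$; then $\mathscr{F}_t:=\bigcap_\nu\mathscr{F}^\nu_t$.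 Absolute continuity condition (AC) (assumed): for all $x\in S$ and $t\in(0,\infty)$, the Borel measure $P_x(X_t\in dy)$ on $S$ is absolutely continuous with respect to $m(dy)$. Transition density. Under these assumptions there is a unique Borel measurable $p\colon(0,\infty)\times S\times S\to[0,\infty]$ such that, for all $s,t\in(0,\infty)$ and $x,y\in S$, $P_x(X_t\in dz)=p_t(x,z)\,m(dz)$ on $S$, $p_t(x,y)=p_t(y,x)$ and $p_{t+s}(x,y)=\int_S p_t(x,z)p_s(z,y)\,m(dz)$. It is extended to $(0,\infty]\times S\times S_\Delta$ by $p_t(x,\Delta):=1-\int_Sp_t(x,y)\,m(dy)=P_x(X_t=\Delta)$ for $t\in(0,\infty)$, $x\in S$, and $p_\infty(x,y):=1_{\{\Delta\}}(y)$ for $x\in S$, $y\in S_\Delta$. The measure $m$ is extended to the Borel measure $m_\Delta:=m(\cdot\cap S)+\delta_\Delta$ on $S_\Delta$, with $\delta_\Delta$ the unit point mass at $\Delta$. PCAF in the strict sense. An $\mathscr{F}_*$-adapted $[0,\infty]$-valued process $A=(A_t)_{t\ge0}$ on $\Omega$ is a positive continuous additive functional (PCAF) in the strict sense of $X$ if there is a set $\Lambda\in\mathscr{F}_\infty$ (a defining set of $A$) such that $P_x(\Lambda)=1$ for all $x\in S$, $\theta_t(\Lambda)\subseteq\Lambda$ for all $t\in[0,\infty)$, and for every $\omega\in\Lambda$ the map $[0,\infty)\ni t\mapsto A_t(\omega)\in[0,\infty]$ is continuous with $A_0(\omega)=0$ and, for all $s,t\in[0,\infty)$, $A_t(\omega)<\infty$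 if $t<\zeta(\omega)$, $A_t(\omega)=A_{\zeta(\omega)}(\omega)$ if $t\ge\zeta(\omega)$, and $A_{t+s}(\omega)=A_t(\omega)+A_s(\theta_t(\omega))$. Set $A_\infty:=\sup_{t\in[0,\infty)\cap\mathbb{Q}}A_t$. Standing convention: every PCAF in the strict sense with defining set $\Lambda$ satisfies $A_t(\omega)=0$ for all $t\in[0,\infty)$, $\omega\in\Omega\setminus\Lambda$, and $\{\zeta=0\}\subseteq\Lambda$. Revuz measure. The Revuz measure of $A$ is the Borel measure $\mu$ on $S$ given, for $E\in\mathcal{B}(S)$, by $$\mu(E):=\sup_{t\in(0,\infty)}\frac1t\int_S E_x\Bigl[\int_0^t1_E(X_s)\,dA_s\Bigr]m(dx)=\lim_{t\downarrow0}\frac1t\int_S E_x\Bigl[\int_0^t1_E(X_s)\,dA_s\Bigr]m(dx),$$ where $\int_0^t\cdots dA_s$ is a Lebesgue--Stieltjes integral (the measure $dA_s$ has no atoms and is carried by $(0,\zeta)$). *)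

theory Defs
  imports "HOL-Probability.Probability"
begin

subsection \<open>The state space and its one-point compactification\<close>

text \<open>
  The state space \<open>S\<close> is a type \<open>'s\<close>; a metric inducing its topology is supplied by the class
  \<^class>\<open>metric_space\<close> but never occurs in a definition.  The set \<open>S \<union> {\<Delta>}\<close> is \<open>'s option\<close> with
  \<open>\<Delta> = None\<close>.  Time parameters in \<open>[0,\<infinity>]\<close> are elements of \<^typ>\<open>ennreal\<close>.
\<close>

abbreviation Delta :: "'s option" (\<open>\<Delta>\<close>) where
  "\<Delta> \<equiv> None"

definition S_Delta :: "'s::topological_space option topology" where
  "S_Delta = Alexandroff_compactification euclidean"

definition borel_Delta :: "'s::topological_space option measure" where
  "borel_Delta = sigma UNIV {U. openin S_Delta U}"

text \<open>On a locally compact separable metrizable space every Borel measure that is finite on compact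
  sets is automatically regular.\<close>

definition radon_measure :: "'s::topological_space measure \<Rightarrow> bool" where
  "radon_measure m \<longleftrightarrow> sets m = sets borel \<and> (\<forall>K. compact K \<longrightarrow> emeasure m K < \<infinity>)"

definition full_support :: "'s::topological_space measure \<Rightarrow> bool" where
  "full_support m \<longleftrightarrow> (\<forall>U. open U \<and> U \<noteq> {} \<longrightarrow> 0 < emeasure m U)"

definition m_Delta :: "'s::topological_space measure \<Rightarrow> 's option measure" where
  "m_Delta m = measure_of UNIV (sets borel_Delta)
     (\<lambda>E. emeasure m (Some -` E) + indicator E \<Delta>)"


subsection \<open>Regular symmetric Dirichlet forms\<close>

text \<open>Elements of \<open>L\<^sup>2(S,m)\<close> are represented by Borel functions, so a subspace of \<open>L\<^sup>2(S,m)\<close> is a set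
  of functions closed under \<open>m\<close>-a.e. equality.\<close>

definition L2 :: "'s::topological_space measure \<Rightarrow> ('s \<Rightarrow> real) set" where
  "L2 m = {u \<in> borel_measurable m. integrable m (\<lambda>x. (u x)\<^sup>2)}"

definition form1 :: "'s measure \<Rightarrow> (('s \<Rightarrow> real) \<Rightarrow> ('s \<Rightarrow> real) \<Rightarrow> real)
    \<Rightarrow> ('s \<Rightarrow> real) \<Rightarrow> real" where
  "form1 m \<E> u = \<E> u u + (\<integral>x. (u x)\<^sup>2 \<partial>m)"

definition symmetric_form :: "'s::topological_space measure
    \<Rightarrow> (('s \<Rightarrow> real) \<Rightarrow> ('s \<Rightarrow> real) \<Rightarrow> real) \<Rightarrow> ('s \<Rightarrow> real) set \<Rightarrow> bool" where
  "symmetric_form m \<E> \<F> \<longleftrightarrow>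
     \<F> \<subseteq> L2 m \<and>
     (\<forall>u\<in>\<F>. \<forall>v\<in>borel_measurable m. (AE x in m. u x = v x) \<longrightarrow>
        v \<in> \<F> \<and> (\<forall>w\<in>\<F>. \<E> v w = \<E> u w)) \<and>
     (\<lambda>x. 0) \<in> \<F> \<and>
     (\<forall>u\<in>\<F>. \<forall>v\<in>\<F>. \<forall>a b. (\<lambda>x. a * u x + b * v x) \<in> \<F> \<and>
        (\<forall>w\<in>\<F>. \<E> (\<lambda>x. a * u x + b * v x) w = a * \<E> u w + b * \<E> v w)) \<and>
     (\<forall>u\<in>\<F>. \<forall>v\<in>\<F>. \<E> u v = \<E> v u) \<and>
     (\<forall>u\<in>\<F>. 0 \<le> \<E> u u) \<and>
     (\<forall>u\<in>L2 m. \<forall>e>0. \<exists>v\<in>\<F>. (\<integral>x. (u x - v x)\<^sup>2 \<partial>m) < e)"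

definition closed_form :: "'s measure
    \<Rightarrow> (('s \<Rightarrow> real) \<Rightarrow> ('s \<Rightarrow> real) \<Rightarrow> real) \<Rightarrow> ('s \<Rightarrow> real) set \<Rightarrow> bool" where
  "closed_form m \<E> \<F> \<longleftrightarrow>
     (\<forall>u::nat \<Rightarrow> 's \<Rightarrow> real. (\<forall>n. u n \<in> \<F>) \<and>
        (\<forall>e>0. \<exists>N. \<forall>i\<ge>N. \<forall>j\<ge>N. form1 m \<E> (\<lambda>x. u i x - u j x) < e) \<longrightarrow>
        (\<exists>v\<in>\<F>. (\<lambda>n. form1 m \<E> (\<lambda>x. u n x - v x)) \<longlonglongrightarrow> 0))"

definition markovian_form :: "(('s \<Rightarrow> real) \<Rightarrow> ('s \<Rightarrow> real) \<Rightarrow> real) \<Rightarrow> ('s \<Rightarrow> real) set \<Rightarrow> bool" where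
  "markovian_form \<E> \<F> \<longleftrightarrow>
     (\<forall>u\<in>\<F>. (\<lambda>x. min (max (u x) 0) 1) \<in> \<F> \<and>
        \<E> (\<lambda>x. min (max (u x) 0) 1) (\<lambda>x. min (max (u x) 0) 1) \<le> \<E> u u)"

definition dirichlet_form :: "'s::topological_space measure
    \<Rightarrow> (('s \<Rightarrow> real) \<Rightarrow> ('s \<Rightarrow> real) \<Rightarrow> real) \<Rightarrow> ('s \<Rightarrow> real) set \<Rightarrow> bool" where
  "dirichlet_form m \<E> \<F> \<longleftrightarrow> symmetric_form m \<E> \<F> \<and> closed_form m \<E> \<F> \<and> markovian_form \<E> \<F>"

definition C_c :: "('s::topological_space \<Rightarrow> real) set" where
  "C_c = {f. continuous_on UNIV f \<and> compact (closure {x. f x \<noteq> 0})}"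

definition regular_form :: "'s::topological_space measure
    \<Rightarrow> (('s \<Rightarrow> real) \<Rightarrow> ('s \<Rightarrow> real) \<Rightarrow> real) \<Rightarrow> ('s \<Rightarrow> real) set \<Rightarrow> bool" where
  "regular_form m \<E> \<F> \<longleftrightarrow>
     (\<forall>u\<in>\<F>. \<forall>e>0. \<exists>v\<in>\<F> \<inter> C_c. form1 m \<E> (\<lambda>x. u x - v x) < e) \<and>
     (\<forall>f\<in>C_c. \<forall>e>0. \<exists>v\<in>\<F> \<inter> C_c. \<forall>x. \<bar>f x - v x\<bar> < e)"


subsection \<open>Hunt processes\<close>

record ('w, 's) process =
  events :: "'w measure"  \<comment> \<open>only the \<open>\<sigma>\<close>-algebra \<open>(\<Omega>, \<M>)\<close> is used\<close>
  path :: "ennreal \<Rightarrow> 'w \<Rightarrow> 's option"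
  law :: "'s option \<Rightarrow> 'w measure"
  shift :: "ennreal \<Rightarrow> 'w \<Rightarrow> 'w"

abbreviation sample_space :: "('w, 's) process \<Rightarrow> 'w set" where
  "sample_space X \<equiv> space (events X)"

text \<open>For the paths of a Hunt process, which stay at \<open>\<Delta>\<close> from time \<open>\<zeta>\<close> on (also if \<open>\<zeta> = \<infinity>\<close>, as
  \<open>X\<^sub>\<infinity> = \<Delta>\<close>), this infimum is attained, so that \<open>{X\<^sub>t = \<Delta>} = {\<zeta> \<le> t}\<close>.\<close>

definition lifetime :: "('w, 's) process \<Rightarrow> 'w \<Rightarrow> ennreal" where
  "lifetime X \<omega> = Inf {t. path X t \<omega> = \<Delta>}"

definition natural_filtration :: "('w, 's::topological_space) process \<Rightarrow> ennreal \<Rightarrow> 'w measure" where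
  "natural_filtration X t = sigma (sample_space X)
     {path X s -` E \<inter> sample_space X | s E. s \<le> t \<and> E \<in> sets borel_Delta}"

definition law_mixture :: "('w, 's::topological_space) process \<Rightarrow> 's option measure \<Rightarrow> 'w measure" where
  "law_mixture X \<nu> = measure_of (sample_space X) (sets (natural_filtration X \<infinity>))
     (\<lambda>\<Lambda>. \<integral>\<^sup>+x. emeasure (law X x) \<Lambda> \<partial>\<nu>)"

definition initial_distributions :: "'s::topological_space option measure set" where
  "initial_distributions = {\<nu>. prob_space \<nu> \<and> sets \<nu> = sets borel_Delta}"

text \<open>The minimum augmented admissible filtration.  The null sets of
  \<^term>\<open>completion (law_mixture X \<nu>)\<close> are the \<open>P\<^sub>\<nu>\<close>-null sets of the \<open>P\<^sub>\<nu>\<close>-completion of the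
  \<open>\<sigma>\<close>-algebra generated by all \<open>X\<^sub>s\<close>.\<close>

definition augmented_filtration :: "('w, 's::topological_space) process \<Rightarrow> ennreal \<Rightarrow> 'w measure" where
  "augmented_filtration X t = sigma (sample_space X)
     (\<Inter>\<nu>\<in>initial_distributions. sigma_sets (sample_space X)
        (sets (natural_filtration X t) \<union> null_sets (completion (law_mixture X \<nu>))))"

definition markov_process :: "('w, 's::topological_space) process \<Rightarrow> bool" where
  "markov_process X \<longleftrightarrow>
     (\<forall>x. prob_space (law X x) \<and> sets (law X x) = sets (events X)) \<and>
     (\<forall>t. path X t \<in> events X \<rightarrow>\<^sub>M borel_Delta) \<and>
     (\<forall>t<\<infinity>. \<forall>E\<in>sets borel_Delta.
        (\<lambda>x. emeasure (law X x) {\<omega>\<in>sample_space X. path X t \<omega> \<in> E}) \<in> borel_measurable borel_Delta) \<and>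
     (\<forall>x. \<forall>s<\<infinity>. \<forall>t<\<infinity>. \<forall>E\<in>sets borel_Delta. \<forall>\<Lambda>\<in>sets (natural_filtration X t).
        emeasure (law X x) {\<omega>\<in>\<Lambda>. path X (t + s) \<omega> \<in> E} =
        (\<integral>\<^sup>+\<omega>\<in>\<Lambda>. emeasure (law X (path X t \<omega>)) {\<omega>'\<in>sample_space X. path X s \<omega>' \<in> E} \<partial>law X x)) \<and>
     (\<forall>t<\<infinity>. AE \<omega> in law X \<Delta>. path X t \<omega> = \<Delta>) \<and>
     (\<forall>x. AE \<omega> in law X (Some x). path X 0 \<omega> = Some x)"

definition path_regularity :: "('w, 's::topological_space) process \<Rightarrow> bool" where
  "path_regularity X \<longleftrightarrow>
     (\<forall>\<omega>\<in>sample_space X.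
        path X \<infinity> \<omega> = \<Delta> \<and>
        (\<forall>t\<ge>lifetime X \<omega>. path X t \<omega> = \<Delta>) \<and>
        (\<forall>t. shift X t \<omega> \<in> sample_space X \<and> (\<forall>s. path X s (shift X t \<omega>) = path X (s + t) \<omega>)) \<and>
        (\<forall>t<\<infinity>. limitin S_Delta (\<lambda>s. path X s \<omega>) (path X t \<omega>) (at_right t)) \<and>
        (\<forall>t. 0 < t \<and> t < \<infinity> \<longrightarrow> (\<exists>l. limitin S_Delta (\<lambda>s. path X s \<omega>) l (at_left t))))"

definition strong_markov :: "('w, 's::topological_space) process \<Rightarrow> bool" where
  "strong_markov X \<longleftrightarrow>
     (\<forall>\<nu>\<in>initial_distributions. \<forall>\<sigma>. stopping_time (augmented_filtration X) \<sigma> \<longrightarrow>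
        (\<forall>\<Lambda>\<in>sets (filtration.pre_sigma (sample_space X) (augmented_filtration X) \<sigma>).
         \<forall>s<\<infinity>. \<forall>E\<in>sets borel_Delta.
           emeasure (completion (law_mixture X \<nu>)) {\<omega>\<in>\<Lambda>. path X (\<sigma> \<omega> + s) \<omega> \<in> E} =
           (\<integral>\<^sup>+\<omega>\<in>\<Lambda>. emeasure (law X (path X (\<sigma> \<omega>) \<omega>)) {\<omega>'\<in>sample_space X. path X s \<omega>' \<in> E}
              \<partial>completion (law_mixture X \<nu>))))"

definition quasi_left_continuous :: "('w, 's::topological_space) process \<Rightarrow> bool" where
  "quasi_left_continuous X \<longleftrightarrow>
     (\<forall>\<nu>\<in>initial_distributions. \<forall>\<sigma>. \<forall>\<tau>::nat \<Rightarrow> 'w \<Rightarrow> ennreal.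
        (\<forall>n. stopping_time (augmented_filtration X) (\<tau> n)) \<and>
        (\<forall>\<omega>\<in>sample_space X. incseq (\<lambda>n. \<tau> n \<omega>) \<and> \<sigma> \<omega> = (SUP n. \<tau> n \<omega>)) \<longrightarrow>
        (AE \<omega> in completion (law_mixture X \<nu>). \<sigma> \<omega> < \<infinity> \<longrightarrow>
           limitin S_Delta (\<lambda>n. path X (\<tau> n \<omega>) \<omega>) (path X (\<sigma> \<omega>) \<omega>) sequentially))"

definition hunt_process :: "('w, 's::topological_space) process \<Rightarrow> bool" where
  "hunt_process X \<longleftrightarrow> markov_process X \<and> path_regularity X \<and>
     (\<forall>t<\<infinity>. sets (augmented_filtration X t) = (\<Inter>u\<in>{t<..}. sets (augmented_filtration X u))) \<and>
     strong_markov X \<and> quasi_left_continuous X"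

text \<open>\<open>transition_kernel X t x\<close> is the Borel measure \<open>P\<^sub>x(X\<^sub>t \<in> dy)\<close> on \<open>S\<close> (without the mass at \<open>\<Delta>\<close>).\<close>

definition transition_kernel :: "('w, 's::topological_space) process \<Rightarrow> ennreal \<Rightarrow> 's \<Rightarrow> 's measure" where
  "transition_kernel X t x = distr (restrict_space (law X (Some x)) {\<omega>. path X t \<omega> \<noteq> \<Delta>}) borel
     (\<lambda>\<omega>. the (path X t \<omega>))"

text \<open>Functions measurable with respect to \<open>\<F>\<^sub>\<infinity>\<close> need only be measurable with respect to the
  completion of \<open>P\<^sub>x\<close>.\<close>

definition expect :: "('w, 's) process \<Rightarrow> 's \<Rightarrow> ('w \<Rightarrow> ennreal) \<Rightarrow> ennreal" where
  "expect X x Y = (\<integral>\<^sup>+\<omega>. Y \<omega> \<partial>completion (law X (Some x)))"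

definition symmetric_process :: "('w, 's::topological_space) process \<Rightarrow> 's measure \<Rightarrow> bool" where
  "symmetric_process X m \<longleftrightarrow>
     (\<forall>t. 0 < t \<and> t < \<infinity> \<longrightarrow>
        (\<forall>f\<in>borel_measurable borel. \<forall>g\<in>borel_measurable borel.
          (\<integral>\<^sup>+x. (\<integral>\<^sup>+y. f y \<partial>transition_kernel X t x) * g x \<partial>m) =
          (\<integral>\<^sup>+x. f x * (\<integral>\<^sup>+y. g y \<partial>transition_kernel X t x) \<partial>m)))"

text \<open>The form \<open>\<langle>u - P\<^sub>t u, v\<rangle> / t\<close>, which for \<open>v = u\<close> increases as \<open>t\<close> decreases to 0.  Hence its
  limit is finite iff it converges in \<open>\<real>\<close>.\<close>

definition approximating_form :: "('w, 's::topological_space) process \<Rightarrow> 's measure \<Rightarrow> real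
    \<Rightarrow> ('s \<Rightarrow> real) \<Rightarrow> ('s \<Rightarrow> real) \<Rightarrow> real" where
  "approximating_form X m t u v =
     (1 / t) * (\<integral>x. (u x - (\<integral>y. u y \<partial>transition_kernel X (ennreal t) x)) * v x \<partial>m)"

definition dirichlet_form_of_process :: "('w, 's::topological_space) process \<Rightarrow> 's measure
    \<Rightarrow> (('s \<Rightarrow> real) \<Rightarrow> ('s \<Rightarrow> real) \<Rightarrow> real) \<Rightarrow> ('s \<Rightarrow> real) set \<Rightarrow> bool" where
  "dirichlet_form_of_process X m \<E> \<F> \<longleftrightarrow>
     \<F> = {u\<in>L2 m. \<exists>l. ((\<lambda>t. approximating_form X m t u u) \<longlongrightarrow> l) (at_right 0)} \<and>
     (\<forall>u\<in>\<F>. \<forall>v\<in>\<F>. ((\<lambda>t. approximating_form X m t u v) \<longlongrightarrow> \<E> u v) (at_right 0))"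

definition absolute_continuity_condition ::
    "('w, 's::topological_space) process \<Rightarrow> 's measure \<Rightarrow> bool" where
  "absolute_continuity_condition X m \<longleftrightarrow>
     (\<forall>x. \<forall>t. 0 < t \<and> t < \<infinity> \<longrightarrow> absolutely_continuous m (transition_kernel X t x))"


subsection \<open>Transition densities\<close>

definition transition_density :: "('w, 's::topological_space) process \<Rightarrow> 's measure
    \<Rightarrow> (real \<Rightarrow> 's \<Rightarrow> 's \<Rightarrow> ennreal) \<Rightarrow> bool" where
  "transition_density X m p \<longleftrightarrow>
     (\<lambda>(t, x, y). p t x y) \<in> borel_measurable (restrict_space borel ({0<..} \<times> UNIV)) \<and>
     (\<forall>s>0. \<forall>t>0. \<forall>x y.
        transition_kernel X (ennreal t) x = density m (p t x) \<and>
        p t x y = p t y x \<and>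
        p (t + s) x y = (\<integral>\<^sup>+z. p t x z * p s z y \<partial>m))"

definition extended_density :: "'s measure \<Rightarrow> (real \<Rightarrow> 's \<Rightarrow> 's \<Rightarrow> ennreal)
    \<Rightarrow> ennreal \<Rightarrow> 's \<Rightarrow> 's option \<Rightarrow> ennreal" where
  "extended_density m p t x y =
     (if t = \<infinity> then indicator {\<Delta>} y
      else case y of Some y' \<Rightarrow> p (enn2real t) x y'
           | None \<Rightarrow> 1 - (\<integral>\<^sup>+z. p (enn2real t) x z \<partial>m))"


subsection \<open>Positive continuous additive functionals in the strict sense\<close>

text \<open>A functional is a family \<open>A t \<omega>\<close> of which only the times \<open>t \<ge> 0\<close> matter.\<close>

definition defining_set :: "('w, 's::topological_space) process \<Rightarrow> (real \<Rightarrow> 'w \<Rightarrow> ennreal)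
    \<Rightarrow> 'w set \<Rightarrow> bool" where
  "defining_set X A \<Lambda> \<longleftrightarrow>
     \<Lambda> \<in> sets (augmented_filtration X \<infinity>) \<and>
     (\<forall>x. emeasure (completion (law X (Some x))) \<Lambda> = 1) \<and>
     (\<forall>t<\<infinity>. shift X t ` \<Lambda> \<subseteq> \<Lambda>) \<and>
     (\<forall>\<omega>\<in>\<Lambda>. continuous_on {0..} (\<lambda>t. A t \<omega>) \<and> A 0 \<omega> = 0 \<and>
        (\<forall>s\<ge>0. \<forall>t\<ge>0.
           (ennreal t < lifetime X \<omega> \<longrightarrow> A t \<omega> < \<infinity>) \<and>
           (lifetime X \<omega> \<le> ennreal t \<longrightarrow> A t \<omega> = A (enn2real (lifetime X \<omega>)) \<omega>) \<and>
           A (t + s) \<omega> = A t \<omega> + A s (shift X (ennreal t) \<omega>)))"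

text \<open>The last two conditions on \<open>\<Lambda>\<close> are the convention that \<open>A\<close> vanishes off its defining set
  and that the defining set contains \<open>{\<zeta> = 0}\<close>.\<close>

definition pcaf :: "('w, 's::topological_space) process \<Rightarrow> (real \<Rightarrow> 'w \<Rightarrow> ennreal) \<Rightarrow> bool" where
  "pcaf X A \<longleftrightarrow>
     (\<forall>t\<ge>0. A t \<in> borel_measurable (augmented_filtration X (ennreal t))) \<and>
     (\<exists>\<Lambda>. defining_set X A \<Lambda> \<and>
        (\<forall>\<omega>\<in>sample_space X - \<Lambda>. \<forall>t\<ge>0. A t \<omega> = 0) \<and>
        {\<omega>\<in>sample_space X. lifetime X \<omega> = 0} \<subseteq> \<Lambda>)"

definition pcaf_at :: "(real \<Rightarrow> 'w \<Rightarrow> ennreal) \<Rightarrow> ennreal \<Rightarrow> 'w \<Rightarrow> ennreal" where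
  "pcaf_at A t \<omega> = (if t = \<infinity> then SUP q\<in>{0..} \<inter> \<rat>. A q \<omega> else A (enn2real t) \<omega>)"

text \<open>The Lebesgue-Stieltjes measure on \<open>(0,z)\<close> of a function \<open>a\<close> that is continuous, nondecreasing and
  finite on \<open>[0,z)\<close> with \<open>a 0 = 0\<close>.  As \<open>a\<close> may explode at \<open>z\<close>, the measure is the increasing limit of
  those of \<open>a\<close> stopped at \<open>T < z\<close>.\<close>

definition stieltjes_measure :: "ennreal \<Rightarrow> (real \<Rightarrow> ennreal) \<Rightarrow> real measure" where
  "stieltjes_measure z a = measure_of UNIV (sets borel)
     (\<lambda>B. SUP T\<in>{T. 0 \<le> T \<and> ennreal T < z}.
        emeasure (interval_measure (\<lambda>s. enn2real (a (max 0 (min s T))))) B)"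

text \<open>The integrand of the outer integral is in general only universally measurable, whence
  the completion of \<open>m\<close>.\<close>

definition revuz_measure :: "('w, 's::topological_space) process \<Rightarrow> 's measure
    \<Rightarrow> (real \<Rightarrow> 'w \<Rightarrow> ennreal) \<Rightarrow> 's measure \<Rightarrow> bool" where
  "revuz_measure X m A \<mu> \<longleftrightarrow> sets \<mu> = sets borel \<and>
     (\<forall>E\<in>sets borel. emeasure \<mu> E =
        (SUP t\<in>{0<..}. ennreal (1 / t) *
           (\<integral>\<^sup>+x. expect X x (\<lambda>\<omega>. \<integral>\<^sup>+s\<in>{0..t}. indicator (Some ` E) (path X (ennreal s) \<omega>)
              \<partial>stieltjes_measure (lifetime X \<omega>) (\<lambda>s. A s \<omega>)) \<partial>completion m)))"


subsection \<open>Iterated integrals\<close>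

abbreviation times_between :: "real \<Rightarrow> ennreal \<Rightarrow> real set" where
  "times_between a t \<equiv> {s. a < s \<and> ennreal s < t}"

text \<open>\<open>time_integral t k a G\<close> is the integral of \<open>G [t\<^sub>1, \<dots>, t\<^sub>k]\<close> over
  \<open>a < t\<^sub>1 < \<dots> < t\<^sub>k < t\<close>, with \<open>t\<^sub>1\<close> outermost.\<close>

primrec time_integral :: "ennreal \<Rightarrow> nat \<Rightarrow> real \<Rightarrow> (real list \<Rightarrow> ennreal) \<Rightarrow> ennreal" where
  "time_integral t 0 a G = G []"
| "time_integral t (Suc k) a G =
     (\<integral>\<^sup>+s\<in>times_between a t. time_integral t k s (\<lambda>ts. G (s # ts)) \<partial>lborel)"

primrec space_integral :: "'s measure \<Rightarrow> nat \<Rightarrow> ('s list \<Rightarrow> ennreal) \<Rightarrow> ennreal" where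
  "space_integral \<mu> 0 G = G []"
| "space_integral \<mu> (Suc k) G = (\<integral>\<^sup>+y. space_integral \<mu> k (\<lambda>ys. G (y # ys)) \<partial>\<mu>)"

text \<open>For lists of length \<open>k\<close>: the product of \<open>p\<close> along the steps from \<open>x\<close> (at time 0) to \<open>y\<^sub>1\<close> (at
  time \<open>t\<^sub>1\<close>), \<open>\<dots>\<close>, to \<open>y\<^sub>k\<close> (at time \<open>t\<^sub>k\<close>).\<close>

definition path_density :: "(real \<Rightarrow> 's \<Rightarrow> 's \<Rightarrow> ennreal) \<Rightarrow> 's \<Rightarrow> real list \<Rightarrow> 's list \<Rightarrow> ennreal" where
  "path_density p x ts ys =
     (\<Prod>i<length ts. p (ts ! i - (0 # ts) ! i) ((x # ys) ! i) (ys ! i))"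

end

theory Submission
  imports Defs
begin

text \<open>The whole computation rests on two facts about \<open>V G x = E\<^sub>x \<integral> G(s, X\<^sub>s) dA\<^sub>s\<close>.

The first is pathwise. The right inverse \<open>T\<^sub>u = inf {t. A\<^sub>t > u}\<close> of the clock \<open>A\<close> turns \<open>dA\<close> into
Lebesgue measure: \<open>\<integral> h(s) dA\<^sub>s = \<integral> h(T\<^sub>u) du\<close>. Every \<open>T\<^sub>u\<close> is a stopping time, so the strong Markov
property at \<open>T\<^sub>u\<close>, integrated over \<open>u\<close>, shows that \<open>\<integral> \<Phi>(s) \<circ> \<theta>\<^sub>s dA\<^sub>s\<close> has the expectation
\<open>V (\<lambda>s z. E\<^sub>z \<Phi>(s))\<close> (\<open>additive_functional_eq\<close>). The three formulas come from three identities of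
this shape: \<open>f(X\<^sub>t) A\<^sub>t = \<integral>\<^sub>0\<^sup>t f(X\<^sub>t\<^sub>-\<^sub>s) \<circ> \<theta>\<^sub>s dA\<^sub>s\<close>, then
\<open>A\<^sub>t\<^sup>k\<^sup>+\<^sup>1 = (k+1) \<integral>\<^sub>0\<^sup>t (A\<^sub>t\<^sub>-\<^sub>s)\<^sup>k \<circ> \<theta>\<^sub>s dA\<^sub>s\<close>, and
\<open>A\<^sub>t B\<^sub>t = \<integral>\<^sub>0\<^sup>t B\<^sub>t\<^sub>-\<^sub>s \<circ> \<theta>\<^sub>s dA\<^sub>s + \<integral>\<^sub>0\<^sup>t A\<^sub>t\<^sub>-\<^sub>s \<circ> \<theta>\<^sub>s dB\<^sub>s\<close>.

The second fact evaluates \<open>V\<close>: \<open>V G x = \<integral> \<integral> p\<^sub>s(x,y) G(s,y) \<mu>(dy) ds\<close> (\<open>V_eq_density\<close>). Its core is the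
Revuz correspondence \<open>\<integral> g(x) E\<^sub>x[\<integral>\<^sub>0\<^sup>t f(X\<^sub>s) dA\<^sub>s] m(dx) = \<integral> f H\<^sub>t g d\<mu>\<close> with \<open>H\<^sub>t g = \<integral>\<^sub>0\<^sup>t P\<^sub>s g ds\<close>. The left side
\<open>D(t)\<close> grows by \<open>D(s+e) - D(s) = \<integral> P\<^sub>s g \<cdot> E\<^sub>\<cdot>[\<integral>\<^sub>0\<^sup>e f(X) dA] dm\<close> because the semigroup is symmetric, so
\<open>e D(t)\<close> is nearly \<open>E\<^sub>m[H\<^sub>t g(X\<^sub>0) \<integral>\<^sub>0\<^sup>e f(X) dA]\<close>. With \<open>X\<^sub>e\<close> in place of \<open>X\<^sub>0\<close> the
Markov property turns this expectation into \<open>E\<^sub>m[\<integral>\<^sub>0\<^sup>e f(X\<^sub>s) P\<^sub>e\<^sub>-\<^sub>s H\<^sub>t g(X\<^sub>s) dA\<^sub>s]\<close>, which is nearly \<open>e \<integral> f H\<^sub>t g d\<mu>\<close> by the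
definition of \<open>\<mu>\<close>, as \<open>r \<mapsto> P\<^sub>r H\<^sub>t g\<close> is Lipschitz for bounded \<open>g\<close>. The replacement is harmless after
division by \<open>e\<close>: \<open>E\<^sub>m|H\<^sub>t g(X\<^sub>e) - H\<^sub>t g(X\<^sub>0)|\<^sup>2 = O(e)\<close> by symmetry (\<open>variance_H\<close>), while
\<open>E\<^sub>m(\<integral>\<^sub>0\<^sup>e f(X) dA)\<^sup>2 = o(e)\<close> (\<open>C_square_le\<close>). With \<open>g = p\<^sub>e(x,\<cdot>)\<close> and \<open>e \<rightarrow> 0\<close> the correspondence
becomes a statement for every single starting point \<open>x\<close>.

Two technical points remain. These estimates need \<open>f\<close> to have a bounded potential and a finite
\<open>\<mu>\<close>-integral. Such an \<open>f > 0\<close> is \<open>E\<^sub>x \<integral>\<^sub>0\<^sup>T e\<^sup>-\<^sup>s k(X\<^sub>s) ds\<close> for a suitable \<open>k\<close>, where \<open>T = T\<^sub>1\<close>: a time \<open>v\<close>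
satisfies \<open>T\<^sub>u \<le> v \<le> T\<^sub>u\<^sub>+\<^sub>1\<close> only for \<open>u\<close> in a set of length at most 1, so its potential is at most the
resolvent of \<open>k\<close> (\<open>W_unit_cost_le\<close>). In particular \<open>\<mu>\<close> is \<open>\<sigma>\<close>-finite. Moreover \<open>A\<close> is only measurable
for the augmented filtration; as the transition laws have densities, \<open>A\<close> agrees almost surely, from
every starting point, with a functional of the path that is measurable without completion
(\<open>AE_Ah\<close>), and \<open>T\<close> is defined from the latter.\<close>

section \<open>Clocks and their right inverses\<close>

text \<open>The properties of the paths \<open>t \<mapsto> A\<^sub>t(\<omega>)\<close>, with \<open>z\<close> in the role of the lifetime: the additive functional
may explode there.\<close>

definition clock_path :: "ennreal \<Rightarrow> (real \<Rightarrow> ennreal) \<Rightarrow> bool" where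
  "clock_path z a \<longleftrightarrow> continuous_on {0..} a \<and> a 0 = 0 \<and> mono_on {0..} a \<and>
     (\<forall>t\<ge>0. (ennreal t < z \<longrightarrow> a t < \<infinity>) \<and> (z \<le> ennreal t \<longrightarrow> a t = a (enn2real z)))"

definition clock_inverse :: "(real \<Rightarrow> ennreal) \<Rightarrow> real \<Rightarrow> ennreal" where
  "clock_inverse a u = (INF t\<in>{t. 0 \<le> t \<and> ennreal u < a t}. ennreal t)"

lemma ennreal_eqI_less:
  fixes x y :: ennreal
  assumes "\<And>t. 0 \<le> t \<Longrightarrow> x < ennreal t \<longleftrightarrow> y < ennreal t"
  shows "x = y"
proof (rule ccontr)
  assume "x \<noteq> y"
  then have "\<exists>c. min x y < c \<and> c < max x y" by (intro dense) (auto simp: min_def max_def not_le)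
  then obtain c where c: "min x y < c" "c < max x y" by blast
  then have "c \<noteq> \<infinity>" using order.strict_trans2[OF c(2) top_greatest] by auto
  then obtain t where "0 \<le> t" "c = ennreal t" by (cases c) auto
  with assms[of t] c show False by (auto simp: min_def max_def split: if_splits)
qed

lemma clock_pathD:
  assumes "clock_path z a"
  shows "continuous_on {0..} a" "a 0 = 0" "\<And>s t. 0 \<le> s \<Longrightarrow> s \<le> t \<Longrightarrow> a s \<le> a t"
    "\<And>t. 0 \<le> t \<Longrightarrow> ennreal t < z \<Longrightarrow> a t < \<infinity>"
    "\<And>t. 0 \<le> t \<Longrightarrow> z \<le> ennreal t \<Longrightarrow> a t = a (enn2real z)"
  using assms by (auto simp: clock_path_def mono_on_def)

text \<open>The strict inequality in the definition of the right inverse makes this an equivalence: by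
continuity, \<open>{t. u < a t}\<close> is open to the left.\<close>

lemma clock_inverse_less_iff:
  assumes a: "clock_path z a" and t: "0 \<le> t"
  shows "clock_inverse a u < ennreal t \<longleftrightarrow> ennreal u < a t"
proof
  assume "clock_inverse a u < ennreal t"
  then obtain s where "0 \<le> s" "ennreal u < a s" "ennreal s < ennreal t"
    by (auto simp: clock_inverse_def INF_less_iff)
  then show "ennreal u < a t"
    using clock_pathD(3)[OF a, of s t] by (auto simp: ennreal_less_iff)
next
  assume u: "ennreal u < a t"
  with t have "0 < t" using clock_pathD(2)[OF a] by (cases "t = 0") auto
  have "(a \<longlongrightarrow> a t) (at t within {0..})"
    using clock_pathD(1)[OF a] t by (auto simp: continuous_on_def)
  then have "\<forall>\<^sub>F s in at t within {0..}. ennreal u < a s"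
    using u by (rule order_tendstoD)
  then obtain d where d: "d > 0" "\<And>s. 0 \<le> s \<Longrightarrow> s \<noteq> t \<Longrightarrow> dist s t < d \<Longrightarrow> ennreal u < a s"
    by (auto simp: eventually_at)
  define s where "s = max 0 (t - d/2)"
  have "0 \<le> s" "s < t" "dist s t < d"
    using \<open>0 < t\<close> d by (auto simp: s_def dist_real_def)
  then have "ennreal u < a s" "ennreal s < ennreal t" using d by (auto simp: ennreal_less_iff)
  then show "clock_inverse a u < ennreal t"
    using \<open>0 \<le> s\<close> by (auto simp: clock_inverse_def INF_less_iff)
qed

lemma clock_at_inverse:
  assumes a: "clock_path z a" and T: "clock_inverse a u = ennreal T" "0 \<le> T"
  shows "a T = ennreal u"
proof (rule antisym)
  show "a T \<le> ennreal u"
    using clock_inverse_less_iff[OF a T(2), of u] T by (auto simp: not_less[symmetric])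
  have "(a \<longlongrightarrow> a T) (at T within {0..})"
    using clock_pathD(1)[OF a] T by (auto simp: continuous_on_def)
  then have lim: "(a \<longlongrightarrow> a T) (at_right T)"
    by (rule tendsto_within_subset) (use T in auto)
  show "ennreal u \<le> a T"
  proof (rule tendsto_lowerbound[OF lim])
    show "\<forall>\<^sub>F s in at_right T. ennreal u \<le> a s"
      unfolding eventually_at_right_field
    proof (intro exI[of _ "T + 1"] conjI allI impI)
      fix s assume "s > T"
      then show "ennreal u \<le> a s"
        using clock_inverse_less_iff[OF a, of s u] T by (auto simp: ennreal_less_iff)
    qed simp
  qed simp
qed

lemma clock_inverse_lifetime:
  assumes a: "clock_path z a" and "clock_inverse a u < \<infinity>"
  shows "clock_inverse a u < z"
proof (rule ccontr)
  assume "\<not> clock_inverse a u < z"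
  then have z: "z \<le> clock_inverse a u" by simp
  from assms(2) obtain t where t: "0 \<le> t" "clock_inverse a u < ennreal t"
    using dense[of "clock_inverse a u" \<infinity>] by (metis enn2real_nonneg ennreal_enn2real infinity_ennreal_def)
  then have "z \<le> ennreal t" using z by auto
  then have "z \<noteq> \<infinity>" by (auto simp: top_unique)
  then obtain r where r: "z = ennreal r" "0 \<le> r" by (cases z) auto
  have "ennreal u < a t" using t clock_inverse_less_iff[OF a] by simp
  also have "a t = a r" using clock_pathD(5)[OF a \<open>0 \<le> t\<close> \<open>z \<le> ennreal t\<close>] r by simp
  finally have "clock_inverse a u < ennreal r" using clock_inverse_less_iff[OF a] r by simp
  then show False using z r by simp
qed

text \<open>A countable infimum, which makes the inverse of a random clock measurable.\<close>

lemma clock_inverse_rational: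
  assumes a: "clock_path z a"
  shows "clock_inverse a u = (INF q\<in>{0..} \<inter> \<rat>. if ennreal u < a q then ennreal q else \<infinity>)"
    (is "_ = ?R")
proof (rule ennreal_eqI_less)
  fix t :: real assume t: "0 \<le> t"
  show "clock_inverse a u < ennreal t \<longleftrightarrow> ?R < ennreal t"
  proof
    assume "clock_inverse a u < ennreal t"
    then obtain s where s: "0 \<le> s" "ennreal u < a s" "s < t"
      by (auto simp: clock_inverse_def INF_less_iff ennreal_less_iff)
    obtain q where q: "q \<in> \<rat>" "s < q" "q < t" using Rats_dense_in_real[OF \<open>s < t\<close>] by blast
    have "ennreal u < a q" using s q clock_pathD(3)[OF a, of s q] by auto
    then show "?R < ennreal t" using q s
      unfolding INF_less_iff by (intro bexI[of _ q]) (auto simp: ennreal_less_iff)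
  next
    assume "?R < ennreal t"
    then show "clock_inverse a u < ennreal t"
      unfolding INF_less_iff clock_inverse_def by (force split: if_splits)
  qed
qed

lemma lborel_clock_value:
  "(\<integral>\<^sup>+u\<in>{0..}. indicator {u. ennreal u < c} u \<partial>lborel) = (c::ennreal)"
proof -
  have "(\<integral>\<^sup>+u\<in>{0..}. indicator {u. ennreal u < c} u \<partial>lborel) =
      (\<integral>\<^sup>+u. indicator {u::real. 0 \<le> u \<and> ennreal u < c} u \<partial>lborel)"
    by (intro nn_integral_cong) (auto split: split_indicator)
  also have "\<dots> = emeasure lborel {u::real. 0 \<le> u \<and> ennreal u < c}"
    by (rule nn_integral_indicator) measurable
  also have "\<dots> = c"
  proof (cases c)
    case (real r)
    then have "{u::real. 0 \<le> u \<and> ennreal u < c} = {0..<r}" by (auto simp: ennreal_less_iff)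
    then show ?thesis using real by simp
  next
    case top
    then have "{u::real. 0 \<le> u \<and> ennreal u < c} = {0..}" by auto
    moreover have "emeasure lborel {0::real..} = \<infinity>"
    proof -
      have "ennreal (real n) \<le> emeasure lborel {0::real..}" for n
        using emeasure_mono[of "{0..real n}" "{0..}" lborel] by simp
      then have "of_nat n \<le> emeasure lborel {0::real..}" for n
        by (simp add: ennreal_of_nat_eq_real_of_nat)
      then have "(SUP n. of_nat n :: ennreal) \<le> emeasure lborel {0::real..}" by (intro SUP_least)
      then show ?thesis by (simp add: ennreal_SUP_of_nat_eq_top top_unique)
    qed
    ultimately show ?thesis using top by simp
  qed
  finally show ?thesis .
qed

lemma borel_measurable_clock_inverse:
  assumes "clock_path z a"
  shows "clock_inverse a \<in> borel_measurable borel"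
  unfolding clock_inverse_rational[OF assms, abs_def]
  by (intro borel_measurable_INF countable_Int2 countable_rat) measurable

text \<open>The image of Lebesgue measure under the right inverse gives \<open>{c<..d}\<close> the mass of
\<open>{u. c < T\<^sub>u \<le> d}\<close>, which lies between the open and the closed interval with end points
\<open>a c\<close> and \<open>a d\<close>.\<close>

lemma interval_measure_clock:
  assumes a: "clock_path z a" and T: "0 \<le> T" "ennreal T < z"
  shows "interval_measure (\<lambda>s. enn2real (a (max 0 (min s T)))) =
    distr (density lborel (indicator {u. 0 \<le> u \<and> ennreal u < a T})) borel
      (\<lambda>u. enn2real (clock_inverse a u))" (is "interval_measure ?F = distr ?D borel ?R")
proof -
  have [measurable]: "clock_inverse a \<in> borel_measurable borel"
    using borel_measurable_clock_inverse[OF a] .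
  have fin: "a s < \<infinity>" if "0 \<le> s" "s \<le> T" for s
    using clock_pathD(3)[OF a that] clock_pathD(4)[OF a T] by simp
  have mono: "?F s \<le> ?F t" if "s \<le> t" for s t
    using that T fin[of "max 0 (min t T)"] by (intro enn2real_mono clock_pathD(3)[OF a]) auto
  have FT: "?F s \<le> enn2real (a T)" for s
    using T fin[of T] by (intro enn2real_mono clock_pathD(3)[OF a]) auto
  have cont: "continuous_on UNIV ?F"
  proof -
    have "continuous_on UNIV (\<lambda>s. a (max 0 (min s T)))"
      by (intro continuous_on_compose2[OF clock_pathD(1)[OF a]] continuous_intros) auto
    then have lim: "((\<lambda>s. a (max 0 (min s T))) \<longlongrightarrow> a (max 0 (min s0 T))) (at s0)" for s0
      by (auto simp: continuous_on_def)
    have "isCont ?F s0" for s0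
      unfolding isCont_def
    proof (rule tendsto_enn2real)
      show "((\<lambda>s. a (max 0 (min s T))) \<longlongrightarrow> ennreal (?F s0)) (at s0)"
        using lim[of s0] fin[of "max 0 (min s0 T)"] T by simp
    qed simp
    then show ?thesis by (simp add: continuous_on_eq_continuous_at)
  qed
  have low: "?R u \<le> d" if "0 \<le> u" "u < ?F d" "ennreal u < a T" for u d
  proof -
    have "0 \<le> d" using that clock_pathD(2)[OF a] T by (cases "d < 0") (auto simp: max_def min_def)
    have "ennreal u < a (max 0 (min d T))"
      using that fin[of "max 0 (min d T)"] T
      by (metis enn2real_nonneg ennreal_enn2real ennreal_less_iff infinity_ennreal_def max.cobounded1
          max.bounded_iff min.cobounded2)
    then have "clock_inverse a u < ennreal (max 0 (min d T))"
      using clock_inverse_less_iff[OF a, of "max 0 (min d T)" u] by simp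
    then have "?R u \<le> max 0 (min d T)"
      by (intro enn2real_leI) auto
    then show ?thesis using \<open>0 \<le> d\<close> T by auto
  qed
  have up: "u \<le> ?F d" if "0 \<le> u" "?R u \<le> d" "ennreal u < a T" for u d
  proof -
    have "0 \<le> d" using that(2) enn2real_nonneg order_trans by blast
    have lt: "clock_inverse a u < ennreal T" using clock_inverse_less_iff[OF a T(1)] that by simp
    then obtain r where r: "clock_inverse a u = ennreal r" "0 \<le> r" by (cases "clock_inverse a u") auto
    then have "r \<le> d" "r < T" using that lt by (auto simp: ennreal_less_iff)
    have "ennreal u = a r" using clock_at_inverse[OF a r] by simp
    also have "\<dots> \<le> a (max 0 (min d T))"
      using r \<open>r \<le> d\<close> \<open>r < T\<close> by (intro clock_pathD(3)[OF a]) auto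
    finally show ?thesis
      using fin[of "max 0 (min d T)"] T that
      by (metis enn2real_ennreal enn2real_mono infinity_ennreal_def max.cobounded1 max.bounded_iff
          min.cobounded2)
  qed
  have D: "emeasure ?D B = emeasure lborel (B \<inter> {u. 0 \<le> u \<and> ennreal u < a T})"
    if "B \<in> sets borel" for B
    using that by (subst emeasure_density) (auto intro!: nn_integral_cong simp: nn_integral_indicator[symmetric] indicator_inter_arith mult.commute simp del: nn_integral_indicator)
  have eq: "emeasure (interval_measure ?F) {c<..d} = emeasure (distr ?D borel ?R) {c<..d}" for c d
  proof (cases "c \<le> d")
    case True
    have "emeasure (distr ?D borel ?R) {c<..d} =
      emeasure lborel ({u. c < ?R u \<and> ?R u \<le> d} \<inter> {u. 0 \<le> u \<and> ennreal u < a T})" (is "_ = emeasure lborel ?S")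
      by (subst emeasure_distr) (auto simp: D vimage_def greaterThanAtMost_def)
    moreover have "emeasure lborel ?S = ennreal (?F d - ?F c)"
    proof (rule antisym)
      have "?S \<subseteq> {?F c .. ?F d}" using low up by (force simp: not_less[symmetric])
      then have "emeasure lborel ?S \<le> emeasure lborel {?F c .. ?F d}" by (rule emeasure_mono) simp
      then show "emeasure lborel ?S \<le> ennreal (?F d - ?F c)" using mono[OF True] by simp
      have "{?F c <..< ?F d} \<subseteq> ?S"
      proof
        fix u assume u: "u \<in> {?F c <..< ?F d}"
        then have "0 \<le> u" by (auto intro: order_trans[OF enn2real_nonneg less_imp_le])
        have "u < enn2real (a T)" using u FT[of d] by auto
        then have "ennreal u < a T" using fin[of T] T \<open>0 \<le> u\<close>
          by (metis ennreal_enn2real ennreal_less_iff infinity_ennreal_def order_refl)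
        then show "u \<in> ?S" using low[OF \<open>0 \<le> u\<close>, of d] up[OF \<open>0 \<le> u\<close>, of c] u \<open>0 \<le> u\<close> by (force simp: not_le[symmetric])
      qed
      then have "emeasure lborel {?F c <..< ?F d} \<le> emeasure lborel ?S" by (rule emeasure_mono) measurable
      then show "ennreal (?F d - ?F c) \<le> emeasure lborel ?S" using mono[OF True] by simp
    qed
    ultimately show ?thesis
      using emeasure_interval_measure_Ioc_eq[of ?F c d] mono True cont
      by (simp add: continuous_on_eq_continuous_at continuous_at_imp_continuous_within)
  qed simp
  show ?thesis
  proof (rule measure_eqI_generator_eq[where \<Omega>=UNIV and E="range (\<lambda>(a, b). {a<..b::real})" and
        A="\<lambda>n. {- real n <.. real n}"])
    show "Int_stable (range (\<lambda>(a, b). {a<..b::real}))"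
      by (auto simp: Int_stable_def)
    show "emeasure (interval_measure ?F) Y = emeasure (distr ?D borel ?R) Y" if "Y \<in> range (\<lambda>(a, b). {a<..b::real})" for Y
      using that eq by auto
    show "(\<Union>n. {- real n <.. real n}) = UNIV"
    proof (intro set_eqI iffI UNIV_I)
      fix x :: real
      obtain n where "\<bar>x\<bar> < real n" using reals_Archimedean2 by blast
      then show "x \<in> (\<Union>n. {- real n <.. real n})" by (auto intro!: exI[of _ n])
    qed
    show "emeasure (interval_measure ?F) {- real n <.. real n} \<noteq> \<infinity>" for n
      using emeasure_interval_measure_Ioc_eq[of ?F "- real n" "real n"] mono cont
      by (simp add: continuous_on_eq_continuous_at continuous_at_imp_continuous_within)
  qed (auto simp: borel_sigma_sets_Ioc)
qed

text \<open>The supremum over truncation times below the lifetime may be taken along a sequence, so it exhausts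
\<open>{u. clock_inverse a u < \<infinity>}\<close>; a finite value of the inverse is below the lifetime.\<close>

lemma stieltjes_measure_clock:
  assumes a: "clock_path z a"
  shows "stieltjes_measure z a =
    distr (density lborel (indicator {u. 0 \<le> u \<and> clock_inverse a u < \<infinity>})) borel
      (\<lambda>u. enn2real (clock_inverse a u))" (is "_ = ?N")
proof -
  let ?R = "\<lambda>u. enn2real (clock_inverse a u)"
  have [measurable]: "clock_inverse a \<in> borel_measurable borel"
    using borel_measurable_clock_inverse[OF a] .
  have N: "emeasure ?N B = emeasure lborel {u. ?R u \<in> B \<and> 0 \<le> u \<and> clock_inverse a u < \<infinity>}"
    if [measurable]: "B \<in> sets borel" for B
  proof -
    have "?R -` B \<in> sets borel" using measurable_sets[of ?R borel borel B] by simp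
    then have "emeasure ?N B = (\<integral>\<^sup>+u\<in>?R -` B. indicator {u. 0 \<le> u \<and> clock_inverse a u < \<infinity>} u \<partial>lborel)"
      by (simp add: emeasure_distr emeasure_density)
    also have "\<dots> = (\<integral>\<^sup>+u. indicator {u. ?R u \<in> B \<and> 0 \<le> u \<and> clock_inverse a u < \<infinity>} u \<partial>lborel)"
      by (rule nn_integral_cong) (auto split: split_indicator)
    also have "\<dots> = emeasure lborel {u. ?R u \<in> B \<and> 0 \<le> u \<and> clock_inverse a u < \<infinity>}"
      by (rule nn_integral_indicator) measurable
    finally show ?thesis .
  qed
  have I: "emeasure (interval_measure (\<lambda>s. enn2real (a (max 0 (min s T))))) B =
      emeasure lborel {u. ?R u \<in> B \<and> 0 \<le> u \<and> ennreal u < a T}"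
    if [measurable]: "B \<in> sets borel" and T: "0 \<le> T" "ennreal T < z" for B T
  proof -
    have "?R -` B \<in> sets borel" using measurable_sets[of ?R borel borel B] by simp
    then have "emeasure (interval_measure (\<lambda>s. enn2real (a (max 0 (min s T))))) B =
      (\<integral>\<^sup>+u\<in>?R -` B. indicator {u. 0 \<le> u \<and> ennreal u < a T} u \<partial>lborel)"
      by (simp add: interval_measure_clock[OF a T] emeasure_distr emeasure_density)
    also have "\<dots> = (\<integral>\<^sup>+u. indicator {u. ?R u \<in> B \<and> 0 \<le> u \<and> ennreal u < a T} u \<partial>lborel)"
      by (rule nn_integral_cong) (auto split: split_indicator)
    also have "\<dots> = emeasure lborel {u. ?R u \<in> B \<and> 0 \<le> u \<and> ennreal u < a T}"
      by (rule nn_integral_indicator) measurable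
    finally show ?thesis .
  qed
  \<comment> \<open>times increasing to the lifetime\<close>
  define Tn where "Tn n = (if z = \<infinity> then real n else enn2real z * (1 - 1 / (real n + 1)))" for n
  have Tn0: "0 \<le> Tn n" for n by (auto simp: Tn_def)
  have Tn_mono: "incseq Tn"
    unfolding Tn_def by (intro incseq_SucI) (auto intro!: mult_left_mono simp: field_simps)
  have Tn_less: "ennreal (Tn n) < z" if "z \<noteq> 0" for n
  proof (cases z)
    case (real r)
    then have "0 < r" using that by (cases "r = 0") auto
    then show ?thesis using real by (auto simp: Tn_def ennreal_less_iff field_simps)
  qed (auto simp: Tn_def)
  have Tn_ex: "\<exists>n. t < Tn n" if "ennreal t < z" "0 \<le> t" for t
  proof (cases z)
    case (real r)
    then have "t < r" using that by (auto simp: ennreal_less_iff)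
    have "(\<lambda>n. r * (1 - 1 / (real n + 1))) \<longlonglongrightarrow> r * (1 - 0)"
      using LIMSEQ_inverse_real_of_nat by (intro tendsto_intros) (simp add: inverse_eq_divide add.commute)
    then have "\<forall>\<^sub>F n in sequentially. t < r * (1 - 1 / (real n + 1))"
      using \<open>t < r\<close> by (intro order_tendstoD) auto
    then show ?thesis using real by (auto simp: Tn_def eventually_sequentially)
  next
    case top then show ?thesis using reals_Archimedean2 by (auto simp: Tn_def)
  qed
  have "stieltjes_measure z a = measure_of (space ?N) (sets ?N) (emeasure ?N)"
    unfolding stieltjes_measure_def
  proof (simp only: space_distr space_borel sets_distr, rule measure_of_eq)
    fix B :: "real set" assume "B \<in> sigma_sets UNIV (sets borel)"
    then have [measurable]: "B \<in> sets borel" using sets.sigma_sets_eq[of "borel :: real measure"] by simp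
    have "(SUP T\<in>{T. 0 \<le> T \<and> ennreal T < z}. emeasure (interval_measure (\<lambda>s. enn2real (a (max 0 (min s T))))) B)
       = (SUP T\<in>{T. 0 \<le> T \<and> ennreal T < z}. emeasure lborel {u. ?R u \<in> B \<and> 0 \<le> u \<and> ennreal u < a T})"
      by (intro SUP_cong refl I) auto
    also have "\<dots> = emeasure lborel {u. ?R u \<in> B \<and> 0 \<le> u \<and> clock_inverse a u < \<infinity>}" (is "?L = emeasure lborel ?Q")
    proof (cases "z = 0")
      case True
      then have Q: "?Q = {}" using clock_inverse_lifetime[OF a] by fastforce
      show ?thesis unfolding Q using True by (simp add: bot_ennreal)
    next
      case False
      show ?thesis
      proof (rule antisym)
        show "?L \<le> emeasure lborel ?Q"
        proof (intro SUP_least emeasure_mono)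
          fix T assume "T \<in> {T. 0 \<le> T \<and> ennreal T < z}"
          then show "{u. ?R u \<in> B \<and> 0 \<le> u \<and> ennreal u < a T} \<subseteq> ?Q"
            using clock_inverse_less_iff[OF a, of T] by (auto intro: less_trans[OF _ ennreal_less_top])
        qed measurable
        have "?Q = (\<Union>n. {u. ?R u \<in> B \<and> 0 \<le> u \<and> ennreal u < a (Tn n)})"
        proof (intro equalityI subsetI)
          fix u assume u: "u \<in> ?Q"
          then obtain r where r: "clock_inverse a u = ennreal r" "0 \<le> r" by (cases "clock_inverse a u") auto
          then have "ennreal r < z" using clock_inverse_lifetime[OF a, of u] u by simp
          then obtain n where "r < Tn n" using Tn_ex r by blast
          then show "u \<in> (\<Union>n. {u. ?R u \<in> B \<and> 0 \<le> u \<and> ennreal u < a (Tn n)})"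
            using u r clock_inverse_less_iff[OF a Tn0, of u n] by (auto simp: ennreal_less_iff)
        next
          fix u assume "u \<in> (\<Union>n. {u. ?R u \<in> B \<and> 0 \<le> u \<and> ennreal u < a (Tn n)})"
          then show "u \<in> ?Q" using clock_inverse_less_iff[OF a Tn0]
            by (auto intro: less_trans[OF _ ennreal_less_top])
        qed
        also have "emeasure lborel \<dots> = (SUP n. emeasure lborel {u. ?R u \<in> B \<and> 0 \<le> u \<and> ennreal u < a (Tn n)})"
          by (rule SUP_emeasure_incseq[symmetric])
            (use clock_pathD(3)[OF a Tn0] Tn_mono in \<open>auto simp: incseq_def intro: less_le_trans\<close>)
        also have "\<dots> \<le> ?L"
          using Tn0 Tn_less[OF False] by (intro SUP_mono) auto
        finally show "emeasure lborel ?Q \<le> ?L" .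
      qed
    qed
    also have "\<dots> = emeasure ?N B" by (rule N[symmetric]) simp
    finally show "(SUP T\<in>{T. 0 \<le> T \<and> ennreal T < z}. emeasure (interval_measure (\<lambda>s. enn2real (a (max 0 (min s T))))) B)
      = emeasure ?N B" .
  qed simp
  then show ?thesis by (simp only: measure_of_of_measure)
qed

lemma nn_integral_stieltjes_clock:
  assumes a: "clock_path z a" and [measurable]: "f \<in> borel_measurable borel" and t: "0 \<le> t"
  shows "(\<integral>\<^sup>+s\<in>{0..t}. f s \<partial>stieltjes_measure z a) =
    (\<integral>\<^sup>+u\<in>{0..}. (if clock_inverse a u < ennreal t then f (enn2real (clock_inverse a u)) else 0) \<partial>lborel)"
proof -
  let ?R = "\<lambda>u. enn2real (clock_inverse a u)"
  have [measurable]: "clock_inverse a \<in> borel_measurable borel"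
    using borel_measurable_clock_inverse[OF a] .
  have ae: "AE u in lborel. u \<noteq> enn2real (a t)" by (rule AE_lborel_singleton)
  have "(\<integral>\<^sup>+s\<in>{0..t}. f s \<partial>stieltjes_measure z a) =
     (\<integral>\<^sup>+u. indicator {u. 0 \<le> u \<and> clock_inverse a u < \<infinity>} u * (f (?R u) * indicator {0..t} (?R u)) \<partial>lborel)"
    unfolding stieltjes_measure_clock[OF a]
    by (subst nn_integral_distr, simp, simp, subst nn_integral_density) auto
  also have "\<dots> = (\<integral>\<^sup>+u\<in>{0..}. (if clock_inverse a u < ennreal t then f (?R u) else 0) \<partial>lborel)"
  proof (rule nn_integral_cong_AE, use ae in eventually_elim)
    fix u assume u: "u \<noteq> enn2real (a t)"
    show "indicator {u. 0 \<le> u \<and> clock_inverse a u < \<infinity>} u * (f (?R u) * indicator {0..t} (?R u)) =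
      (if clock_inverse a u < ennreal t then f (?R u) else 0) * indicator {0..} u"
    proof (cases "0 \<le> u \<and> clock_inverse a u < \<infinity>")
      case True
      then obtain r where r: "clock_inverse a u = ennreal r" "0 \<le> r" by (cases "clock_inverse a u") auto
      then have "r \<noteq> t" using u clock_at_inverse[OF a r] True by auto
      then show ?thesis using True r t by (auto simp: ennreal_less_iff split: split_indicator)
    next
      case False
      then show ?thesis by (auto simp: not_less top_unique split: split_indicator)
    qed
  qed
  finally show ?thesis .
qed

lemma clock_inverse_shift:
  assumes a: "clock_path z a" and b: "clock_path z' b" and s: "0 \<le> s" "a s < \<infinity>" and w: "0 \<le> w"
    and add: "\<And>r. 0 \<le> r \<Longrightarrow> a (s + r) = a s + b r"
  shows "clock_inverse a (enn2real (a s) + w) = ennreal s + clock_inverse b w"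
proof (rule ennreal_eqI_less)
  fix t :: real assume t: "0 \<le> t"
  have e: "ennreal (enn2real (a s) + w) = a s + ennreal w" using s w by simp
  show "clock_inverse a (enn2real (a s) + w) < ennreal t \<longleftrightarrow> ennreal s + clock_inverse b w < ennreal t"
  proof (cases "s \<le> t")
    case True
    have "clock_inverse a (enn2real (a s) + w) < ennreal t \<longleftrightarrow> a s + ennreal w < a s + b (t - s)"
      using clock_inverse_less_iff[OF a t] add[of "t - s"] True e by simp
    also have "\<dots> \<longleftrightarrow> ennreal w < b (t - s)" using s by (auto simp: ennreal_add_left_cancel_less)
    also have "\<dots> \<longleftrightarrow> clock_inverse b w < ennreal (t - s)"
      using clock_inverse_less_iff[OF b, of "t - s"] True by simp
    also have "\<dots> \<longleftrightarrow> ennreal s + clock_inverse b w < ennreal s + ennreal (t - s)"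
      by (auto simp: ennreal_add_left_cancel_less)
    also have "ennreal s + ennreal (t - s) = ennreal t" using s True by (simp flip: ennreal_plus)
    finally show ?thesis .
  next
    case False
    then have "\<not> ennreal s + clock_inverse b w < ennreal t"
      using s t by (auto simp: not_less intro!: order_trans[of "ennreal t" "ennreal s"] ennreal_leI)
    moreover have "a t \<le> a s + ennreal w"
      using clock_pathD(3)[OF a t, of s] False by (auto intro: order_trans)
    then have "\<not> clock_inverse a (enn2real (a s) + w) < ennreal t"
      using clock_inverse_less_iff[OF a t] e by simp
    ultimately show ?thesis by simp
  qed
qed

lemma clock_inverse_shift_at_inverse:
  assumes a: "clock_path z a" and b: "clock_path z' b" and s: "0 \<le> s" "clock_inverse a u = ennreal s"
    and u: "0 \<le> u" and w: "0 \<le> w" and add: "\<And>r. 0 \<le> r \<Longrightarrow> a (s + r) = a s + b r"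
  shows "clock_inverse a (u + w) = ennreal s + clock_inverse b w"
  using clock_inverse_shift[OF a b s(1) _ w add] clock_at_inverse[OF a s(2,1)] u by simp

text \<open>The clock restarted at time \<open>s\<close> is the old one with the level \<open>a s\<close> subtracted; if
\<open>s\<close> is past the lifetime, both sides vanish.\<close>

lemma nn_integral_clock_shift:
  fixes f :: "ennreal \<Rightarrow> ennreal"
  assumes a: "clock_path z a" and b: "clock_path z' b" and s: "0 \<le> s"
    and z': "z \<le> ennreal s \<Longrightarrow> z' = 0"
    and add: "\<And>r. 0 \<le> r \<Longrightarrow> a (s + r) = a s + b r"
    and [measurable]: "f \<in> borel_measurable borel"
  shows "(\<integral>\<^sup>+u\<in>{0..}. (if ennreal s \<le> clock_inverse a u \<and> clock_inverse a u < \<infinity> then f (clock_inverse a u) else 0) \<partial>lborel)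
    = (\<integral>\<^sup>+w\<in>{0..}. (if clock_inverse b w < \<infinity> then f (ennreal s + clock_inverse b w) else 0) \<partial>lborel)"
proof (cases "z \<le> ennreal s")
  case True
  have "clock_inverse b w = \<infinity>" for w
    using clock_inverse_lifetime[OF b, of w] z'[OF True] by (cases "clock_inverse b w") auto
  moreover have "(if ennreal s \<le> clock_inverse a u \<and> clock_inverse a u < \<infinity> then f (clock_inverse a u) else 0) = 0" for u
    using clock_inverse_lifetime[OF a, of u] True by auto
  ultimately show ?thesis by (simp only:) simp
next
  case False
  have [measurable]: "clock_inverse a \<in> borel_measurable borel" "clock_inverse b \<in> borel_measurable borel"
    using borel_measurable_clock_inverse a b by auto
  have as: "a s < \<infinity>" using clock_pathD(4)[OF a s] False by simp
  have "(\<integral>\<^sup>+u\<in>{0..}. (if ennreal s \<le> clock_inverse a u \<and> clock_inverse a u < \<infinity> then f (clock_inverse a u) else 0) \<partial>lborel)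
    = (\<integral>\<^sup>+u. (if clock_inverse a u < \<infinity> then f (clock_inverse a u) else 0) * indicator {enn2real (a s)..} u \<partial>lborel)"
  proof (intro nn_integral_cong)
    fix u :: real
    have "0 \<le> u \<and> ennreal s \<le> clock_inverse a u \<longleftrightarrow> enn2real (a s) \<le> u"
    proof (cases "0 \<le> u")
      case True
      then show ?thesis using clock_inverse_less_iff[OF a s, of u] as
        by (cases "a s") (auto simp: not_less[symmetric] ennreal_less_iff)
    next
      case False
      then show ?thesis using enn2real_nonneg[of "a s"] by linarith
    qed
    then show "(if ennreal s \<le> clock_inverse a u \<and> clock_inverse a u < \<infinity> then f (clock_inverse a u) else 0) * indicator {0..} u
      = (if clock_inverse a u < \<infinity> then f (clock_inverse a u) else 0) * indicator {enn2real (a s)..} u"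
      by (auto split: split_indicator)
  qed
  also have "\<dots> = (\<integral>\<^sup>+w. (if clock_inverse a (enn2real (a s) + w) < \<infinity> then f (clock_inverse a (enn2real (a s) + w)) else 0)
       * indicator {enn2real (a s)..} (enn2real (a s) + w) \<partial>lborel)"
    by (subst nn_integral_real_affine[where c=1 and t="enn2real (a s)"]) (simp_all only: mult_1 abs_one, simp_all)
  also have "\<dots> = (\<integral>\<^sup>+w\<in>{0..}. (if clock_inverse b w < \<infinity> then f (ennreal s + clock_inverse b w) else 0) \<partial>lborel)"
    using clock_inverse_shift[OF a b s as _ add]
    by (intro nn_integral_cong) (auto split: split_indicator)
  finally show ?thesis .
qed

section \<open>The Borel structure of the compactified state space\<close>

text \<open>Neighbourhoods of \<open>\<Delta>\<close> are complements of compact, hence closed, sets. Therefore the Borel sets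
of the compactification are those whose trace on \<open>S\<close> is Borel.\<close>

lemma borel_Delta_generated:
  "sets borel_Delta = sigma_sets UNIV ((`) Some ` {U::'s::t2_space set. open U})" (is "_ = sigma_sets UNIV ?G")
  and sets_borel_Delta_iff: "E \<in> sets borel_Delta \<longleftrightarrow> Some -` E \<in> sets (borel :: 's measure)"
proof -
  have Some: "Some ` B \<in> sigma_sets UNIV ?G" if "B \<in> sets borel" for B :: "'s set"
  proof -
    from that have "B \<in> sigma_sets UNIV {U. open U}" by (simp add: borel_def)
    then show ?thesis
    proof induction
      case (Compl B)
      interpret sigma_algebra UNIV "sigma_sets UNIV ?G" by (rule sigma_algebra_sigma_sets) auto
      have "range Some \<in> sigma_sets UNIV ?G" by (rule sigma_sets.Basic) auto
      moreover have "Some ` (UNIV - B) = range Some - Some ` B" by auto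
      ultimately show ?case using Compl by (simp add: Diff)
    next
      case (Union B)
      then show ?case by (auto simp: image_UN intro!: sigma_sets.Union)
    qed (auto intro: sigma_sets.Empty)
  qed
  have bk: "E \<in> sigma_sets UNIV ?G" if "Some -` E \<in> sets borel" for E :: "'s option set"
  proof -
    interpret sigma_algebra UNIV "sigma_sets UNIV ?G" by (rule sigma_algebra_sigma_sets) auto
    have "UNIV - range Some \<in> sigma_sets UNIV ?G" using Some[of UNIV] by (intro Diff top) simp
    moreover have "UNIV - range Some = {None :: 's option}" by (auto simp: image_iff)
    ultimately have N: "{None} \<in> sigma_sets UNIV ?G" by simp
    have "x \<in> E \<longleftrightarrow> x \<in> Some ` (Some -` E) \<union> (E \<inter> {None})" for x by (cases x) auto
    then have "E = Some ` (Some -` E) \<union> (E \<inter> {None})" by blast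
    moreover have "E \<inter> {None} \<in> sigma_sets UNIV ?G" using N by (cases "None \<in> E") auto
    ultimately show ?thesis using Some[OF that] Un by metis
  qed
  have sp: "sets (borel_Delta :: 's option measure) = sigma_sets UNIV {U. openin S_Delta U}"
    by (simp add: borel_Delta_def)
  have fw: "Some -` E \<in> sets borel" if "E \<in> sets borel_Delta" for E :: "'s option set"
    using that unfolding sp
  proof induction
    case (Basic E)
    then have "openin (Alexandroff_compactification euclidean) E" by (simp add: S_Delta_def)
    then consider U where "open U" "E = Some ` U" | C where "closed C" "E = insert None (Some ` (- C))"
      unfolding openin_Alexandroff_compactification by (auto simp: Compl_eq_Diff_UNIV)
    then show ?case
    proof cases
      case 1
      then show ?thesis by (simp add: inj_vimage_image_eq)
    next
      case 2
      then have "Some -` E = - C" by auto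
      then show ?thesis using 2 by simp
    qed
  next
    case (Compl E)
    then show ?case by (simp add: vimage_Diff)
  next
    case (Union E)
    then show ?case by (simp add: vimage_UN)
  qed simp
  have sub: "sigma_sets UNIV ?G \<subseteq> sets borel_Delta"
    unfolding sp
    by (intro sigma_sets_mono) (auto simp: S_Delta_def intro!: sigma_sets.Basic)
  show "sets borel_Delta = sigma_sets UNIV ?G"
    using sub fw bk by blast
  show "E \<in> sets borel_Delta \<longleftrightarrow> Some -` E \<in> sets (borel :: 's measure)"
    using sub fw bk by blast
qed

lemma space_borel_Delta [simp]: "space borel_Delta = UNIV"
  by (simp add: borel_Delta_def)

lemma Delta_sets_borel_Delta [measurable, simp]: "{\<Delta>} \<in> sets (borel_Delta :: 's::t2_space option measure)"
  unfolding sets_borel_Delta_iff by (simp add: vimage_def)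

lemma measurable_Some_borel_Delta [measurable]: "Some \<in> (borel :: 's::t2_space measure) \<rightarrow>\<^sub>M borel_Delta"
  unfolding measurable_def by (simp add: sets_borel_Delta_iff)

lemma measurable_the_borel_Delta [measurable]: "the \<in> borel_Delta \<rightarrow>\<^sub>M (borel :: 's::t2_space measure)"
  unfolding measurable_def by (simp add: sets_borel_Delta_iff vimage_def)

lemma measurable_case_option_borel_Delta:
  assumes [measurable]: "(\<lambda>(a, x). f a x) \<in> N \<Otimes>\<^sub>M borel \<rightarrow>\<^sub>M M" "g \<in> N \<rightarrow>\<^sub>M M"
  shows "(\<lambda>(a, z). case z of None \<Rightarrow> g a | Some x \<Rightarrow> f a (x::'s::t2_space)) \<in> N \<Otimes>\<^sub>M borel_Delta \<rightarrow>\<^sub>M M"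
proof -
  have "(\<lambda>w. if snd w \<in> {\<Delta>} then g (fst w) else f (fst w) (the (snd w))) \<in> N \<Otimes>\<^sub>M borel_Delta \<rightarrow>\<^sub>M M"
    by measurable
  also have "(\<lambda>w. if snd w \<in> {\<Delta>} then g (fst w) else f (fst w) (the (snd w))) =
      (\<lambda>(a, z). case z of None \<Rightarrow> g a | Some x \<Rightarrow> f a x)"
    by (auto simp: fun_eq_iff split: option.split)
  finally show ?thesis .
qed

lemma borel_measurable_case_option [measurable]:
  fixes f :: "'s::t2_space \<Rightarrow> 'b::topological_space"
  assumes "f \<in> borel_measurable borel"
  shows "case_option c f \<in> borel_measurable borel_Delta"
  using assms by (auto simp: measurable_def sets_borel_Delta_iff vimage_def)

text \<open>Open subsets of \<open>S\<close> are described by the distance to their complement, so it is enough to test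
with continuous functions.\<close>

lemma measurable_into_borel_Delta:
  fixes g :: "'a \<Rightarrow> 's::metric_space option"
  assumes "\<And>h::'s \<Rightarrow> real. continuous_on UNIV h \<Longrightarrow> (\<lambda>w. case_option 0 h (g w)) \<in> borel_measurable N"
  shows "g \<in> N \<rightarrow>\<^sub>M borel_Delta"
proof -
  have "g \<in> measurable N (sigma UNIV ((`) Some ` {U::'s set. open U}))"
  proof (rule measurable_measure_of)
    fix E assume "E \<in> (`) Some ` {U::'s set. open U}"
    then obtain U where U: "open U" "E = Some ` U" by auto
    define h where "h y = (if U = UNIV then 1 else infdist y (- U))" for y
    have "continuous_on UNIV h" unfolding h_def by (cases "U = UNIV") (auto intro!: continuous_intros)
    then have m: "(\<lambda>w. case_option 0 h (g w)) \<in> borel_measurable N" by (rule assms)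
    have "0 < h y \<longleftrightarrow> y \<in> U" for y
    proof (cases "U = UNIV")
      case False
      then have "- U \<noteq> {}" "closed (- U)" using U by auto
      then show ?thesis using in_closed_iff_infdist_zero[of "- U" y] infdist_nonneg[of y "- U"] False
        by (auto simp: h_def)
    qed (simp add: h_def)
    then have "g -` E \<inter> space N = (\<lambda>w. case_option 0 h (g w)) -` {0<..} \<inter> space N"
      using U by (auto split: option.splits)
    also have "\<dots> \<in> sets N" by (rule measurable_sets[OF m]) simp
    finally show "g -` E \<inter> space N \<in> sets N" .
  qed auto
  then show ?thesis
    by (simp add: measurable_def borel_Delta_generated)
qed

section \<open>Hunt processes: paths and filtrations\<close>

lemma nn_integral_kernel_eq:
  fixes M :: "'a measure" and B :: "'b measure"
  assumes Z [measurable]: "Z \<in> M \<rightarrow>\<^sub>M B" and K [measurable]: "K \<in> M \<rightarrow>\<^sub>M subprob_algebra B"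
    and eq: "\<And>E. E \<in> sets B \<Longrightarrow> emeasure M {w\<in>space M. Z w \<in> E} = (\<integral>\<^sup>+w. emeasure (K w) E \<partial>M)"
    and h [measurable]: "h \<in> borel_measurable B"
  shows "(\<integral>\<^sup>+w. h (Z w) \<partial>M) = (\<integral>\<^sup>+w. (\<integral>\<^sup>+y. h y \<partial>K w) \<partial>M)"
proof (cases "space M = {}")
  case True
  then show ?thesis by (simp add: nn_integral_empty)
next
  case False
  have "distr M B Z = M \<bind> K"
    using False by (intro measure_eqI) (auto simp: emeasure_distr emeasure_bind[OF False K] eq[symmetric] sets_bind[OF sets_kernel[OF K]]
        intro!: arg_cong[where f="emeasure M"])
  moreover have "(\<integral>\<^sup>+w. h (Z w) \<partial>M) = (\<integral>\<^sup>+y. h y \<partial>distr M B Z)"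
    by (simp add: nn_integral_distr)
  ultimately have "(\<integral>\<^sup>+w. h (Z w) \<partial>M) = (\<integral>\<^sup>+y. h y \<partial>(M \<bind> K))" by simp
  then show ?thesis by (simp add: nn_integral_bind[OF h K])
qed

text \<open>The next grid point strictly after \<open>s\<close>, so that right continuity applies.\<close>

definition grid_time :: "nat \<Rightarrow> ennreal \<Rightarrow> ennreal" where
  "grid_time n s = (if s = \<infinity> then \<infinity> else ennreal (real_of_int (\<lfloor>enn2real s * real (Suc n)\<rfloor> + 1) / real (Suc n)))"

lemma grid_time_greater: assumes "s < \<infinity>" shows "s < grid_time n s"
proof -
  obtain r where r: "s = ennreal r" "0 \<le> r" using assms by (cases s) auto
  have "r * real (Suc n) < of_int (\<lfloor>r * real (Suc n)\<rfloor> + 1)" by linarith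
  then show ?thesis using r by (simp add: grid_time_def ennreal_less_iff pos_less_divide_eq)
qed

lemma grid_time_le: assumes "0 \<le> r" shows "grid_time n (ennreal r) \<le> ennreal (r + 1 / real (Suc n))"
proof -
  have "of_int (\<lfloor>r * real (Suc n)\<rfloor> + 1) \<le> r * real (Suc n) + 1" by linarith
  also have "\<dots> = (r + 1 / real (Suc n)) * real (Suc n)" by (simp add: field_simps)
  finally have "of_int (\<lfloor>r * real (Suc n)\<rfloor> + 1) / real (Suc n) \<le> r + 1 / real (Suc n)"
    by (subst pos_divide_le_eq) auto
  then show ?thesis using assms
    by (simp only: grid_time_def) (simp add: ennreal_leI del: of_nat_Suc ennreal_plus)
qed

lemma grid_time_tendsto: "s < \<infinity> \<Longrightarrow> filterlim (\<lambda>n. grid_time n s) (at_right s) sequentially"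
proof -
  assume s: "s < \<infinity>"
  obtain r where r: "s = ennreal r" "0 \<le> r" using s by (cases s) auto
  have "(\<lambda>n. ennreal (r + 1 / real (Suc n))) \<longlonglongrightarrow> ennreal (r + 0)"
    using LIMSEQ_inverse_real_of_nat by (intro tendsto_intros) (simp add: inverse_eq_divide)
  then have "(\<lambda>n. grid_time n s) \<longlonglongrightarrow> s"
    using grid_time_greater[OF s] grid_time_le[OF r(2)] r
    by (intro tendsto_sandwich[of "\<lambda>n. s" "\<lambda>n. grid_time n s" sequentially "\<lambda>n. ennreal (r + 1 / real (Suc n))"])
       (auto intro!: always_eventually less_imp_le)
  then show ?thesis using grid_time_greater[OF s]
    by (auto simp: filterlim_at intro!: always_eventually less_imp_neq[symmetric])
qed

lemma measurable_grid_time: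
  "grid_time n \<in> borel \<rightarrow>\<^sub>M count_space (range (grid_time n))" and countable_range_grid_time: "countable (range (grid_time n))"
proof -
  have "range (grid_time n) \<subseteq> insert \<infinity> (range (\<lambda>i::int. ennreal (real_of_int (i + 1) / real (Suc n))))"
    by (auto simp: grid_time_def)
  then show c: "countable (range (grid_time n))" by (rule countable_subset) simp
  have [measurable]: "grid_time n \<in> borel_measurable borel" unfolding grid_time_def[abs_def] by measurable
  show "grid_time n \<in> borel \<rightarrow>\<^sub>M count_space (range (grid_time n))"
    unfolding measurable_count_space_eq_countable[OF c]
    by (auto intro!: measurable_sets[of "grid_time n" borel borel, simplified])
qed

locale hunt =
  fixes X :: "('w, 's::{metric_space, second_countable_topology}) process"
  assumes hunt: "hunt_process X"
begin

abbreviation "\<Omega> \<equiv> sample_space X"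
abbreviation "N \<equiv> natural_filtration X"
abbreviation "N0 \<equiv> natural_filtration X top"
abbreviation "F \<equiv> augmented_filtration X"
abbreviation "\<theta> \<equiv> shift X"

lemma
  shows markov: "markov_process X" and regular_paths: "path_regularity X" and strong_markov: "strong_markov X"
    and right_continuous: "t < \<infinity> \<Longrightarrow> sets (F t) = (\<Inter>u\<in>{t<..}. sets (F u))"
  using hunt by (auto simp: hunt_process_def)

lemma prob_space_law [simp]: "prob_space (law X x)"
  and sets_law [simp, measurable_cong]: "sets (law X x) = sets (events X)"
  and measurable_path_events: "path X t \<in> events X \<rightarrow>\<^sub>M borel_Delta"
  and measurable_transition: "t < \<infinity> \<Longrightarrow> E \<in> sets borel_Delta \<Longrightarrow>
    (\<lambda>x. emeasure (law X x) {w\<in>\<Omega>. path X t w \<in> E}) \<in> borel_measurable borel_Delta"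
  and markov_property: "s < \<infinity> \<Longrightarrow> t < \<infinity> \<Longrightarrow> E \<in> sets borel_Delta \<Longrightarrow> \<Lambda> \<in> sets (N t) \<Longrightarrow>
    emeasure (law X x) {w\<in>\<Lambda>. path X (t + s) w \<in> E} =
    (\<integral>\<^sup>+w\<in>\<Lambda>. emeasure (law X (path X t w)) {w'\<in>\<Omega>. path X s w' \<in> E} \<partial>law X x)"
  and law_Delta: "t < \<infinity> \<Longrightarrow> AE w in law X \<Delta>. path X t w = \<Delta>"
  and law_start_Some: "AE w in law X (Some y). path X 0 w = Some y"
  using markov unfolding markov_process_def by blast+

lemma space_law [simp]: "space (law X x) = \<Omega>"
  using sets_eq_imp_space_eq[OF sets_law] .

lemma law_start: "AE w in law X x. path X 0 w = x"
  by (cases x) (use law_Delta[of 0] law_start_Some in auto)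

lemma
  assumes "w \<in> \<Omega>"
  shows path_infinity [simp]: "path X \<infinity> w = \<Delta>" and path_top [simp]: "path X top w = \<Delta>"
    and path_after_lifetime: "lifetime X w \<le> t \<Longrightarrow> path X t w = \<Delta>"
    and shift_space [simp]: "\<theta> t w \<in> \<Omega>"
    and path_shift [simp]: "path X s (\<theta> t w) = path X (s + t) w"
    and path_right_limit: "t < \<infinity> \<Longrightarrow> limitin S_Delta (\<lambda>s. path X s w) (path X t w) (at_right t)"
  using regular_paths assms unfolding path_regularity_def by auto

text \<open>The lifetime is an infimum of times at which the path is at \<open>\<Delta>\<close>.\<close>

lemma path_absorbed:
  assumes "w \<in> \<Omega>" "path X s w = \<Delta>" "s \<le> t"
  shows "path X t w = \<Delta>"
  using assms by (intro path_after_lifetime) (auto simp: lifetime_def intro: Inf_lower2)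

lemma space_natural [simp]: "space (N t) = \<Omega>"
  by (simp add: natural_filtration_def space_measure_of_conv)

lemma sets_natural: "sets (N t) = sigma_sets \<Omega>
     {path X s -` E \<inter> \<Omega> | s E. s \<le> t \<and> E \<in> sets borel_Delta}"
  unfolding natural_filtration_def by (rule sets_measure_of) auto

lemma measurable_path_natural: "s \<le> t \<Longrightarrow> path X s \<in> N t \<rightarrow>\<^sub>M borel_Delta"
  unfolding measurable_def sets_natural by (auto intro!: sigma_sets.Basic)

lemma measurable_path [measurable]: "path X s \<in> N0 \<rightarrow>\<^sub>M borel_Delta"
  by (rule measurable_path_natural) simp

lemma natural_mono: "s \<le> t \<Longrightarrow> sets (N s) \<subseteq> sets (N t)"
  unfolding sets_natural by (intro sigma_sets_mono') (auto intro: order_trans)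

lemma natural_subset_events: "sets (N t) \<subseteq> sets (events X)"
  unfolding sets_natural
  by (intro sets.sigma_sets_subset) (auto intro!: measurable_sets[OF measurable_path_events])

lemma measurable_shift: "\<theta> t \<in> N0 \<rightarrow>\<^sub>M N0"
  unfolding natural_filtration_def[of X top]
proof (rule measurable_measure_of)
  show "\<theta> t \<in> space (sigma \<Omega> {path X s -` E \<inter> \<Omega> |s E. s \<le> top \<and> E \<in> sets borel_Delta}) \<rightarrow> \<Omega>"
    by (auto simp: space_measure_of_conv)
  fix B assume "B \<in> {path X s -` E \<inter> \<Omega> |s E. s \<le> top \<and> E \<in> sets borel_Delta}"
  then obtain s E where B: "B = path X s -` E \<inter> \<Omega>" "E \<in> sets borel_Delta" by auto
  have "\<theta> t -` B \<inter> \<Omega> = path X (s + t) -` E \<inter> \<Omega>"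
    unfolding B by auto
  also have "\<dots> \<in> sets N0" using measurable_sets[OF measurable_path B(2)] by simp
  finally show "\<theta> t -` B \<inter> space (sigma \<Omega> {path X s -` E \<inter> \<Omega> |s E. s \<le> top \<and> E \<in> sets borel_Delta})
     \<in> sets (sigma \<Omega> {path X s -` E \<inter> \<Omega> |s E. s \<le> top \<and> E \<in> sets borel_Delta})"
    by (simp add: space_measure_of_conv natural_filtration_def)
qed auto

text \<open>Convergence in the compactification towards a point of \<open>S\<close> is convergence in \<open>S\<close>, and a path at
\<open>\<Delta>\<close> stays there.\<close>

lemma path_right_continuous:
  fixes h :: "'s \<Rightarrow> 'b::topological_space"
  assumes h: "continuous_on UNIV h" and w: "w \<in> \<Omega>" and t: "t < \<infinity>"
  shows "((\<lambda>s. case_option c h (path X s w)) \<longlongrightarrow> case_option c h (path X t w)) (at_right t)"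
proof (cases "path X t w")
  case None
  have "\<forall>\<^sub>F s in at_right t. t < s" by (simp add: eventually_at_filter)
  then have "\<forall>\<^sub>F s in at_right t. case_option c h (path X s w) = c"
  proof eventually_elim
    case (elim s)
    then show ?case using path_absorbed[OF w None, of s] by simp
  qed
  then show ?thesis using None by (simp add: tendsto_eventually)
next
  case (Some y)
  show ?thesis
  proof (rule topological_tendstoI)
    fix V assume V: "open V" "case_option c h (path X t w) \<in> V"
    have "open (h -` V)" using h V by (simp add: open_vimage)
    then have "openin S_Delta (Some ` (h -` V))" by (simp add: S_Delta_def)
    moreover have "path X t w \<in> Some ` (h -` V)" using Some V by auto
    ultimately have "\<forall>\<^sub>F s in at_right t. path X s w \<in> Some ` (h -` V)"
      using path_right_limit[OF w t] by (auto simp: limitin_def)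
    then show "\<forall>\<^sub>F s in at_right t. case_option c h (path X s w) \<in> V"
      by eventually_elim auto
  qed
qed

text \<open>Progressive measurability: the path is the limit of its values at the grid times.\<close>

lemma measurable_path_min:
  "(\<lambda>(s, w). path X (min s t) w) \<in> borel \<Otimes>\<^sub>M N t \<rightarrow>\<^sub>M borel_Delta"
proof (rule measurable_into_borel_Delta)
  fix h :: "'s \<Rightarrow> real" assume h: "continuous_on UNIV h"
  then have [measurable]: "h \<in> borel_measurable borel" by (rule borel_measurable_continuous_onI)
  define u where "u n = (\<lambda>v. case_option 0 h (path X (min (grid_time n (fst v)) t) (snd v)))" for n
  have "u n \<in> borel_measurable (borel \<Otimes>\<^sub>M N t)" for n
    unfolding u_def
  proof (rule measurable_compose_countable'[where f="\<lambda>r v. case_option 0 h (path X (min r t) (snd v))",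
        OF _ _ countable_range_grid_time[of n]])
    fix r
    have "path X (min r t) \<in> N t \<rightarrow>\<^sub>M borel_Delta" by (rule measurable_path_natural) simp
    from measurable_compose[OF this borel_measurable_case_option[of h 0]]
    show "(\<lambda>v. case_option 0 h (path X (min r t) (snd v))) \<in> borel_measurable (borel \<Otimes>\<^sub>M N t)"
      by (rule measurable_compose[OF measurable_snd]) simp
  next
    show "(\<lambda>v. grid_time n (fst v)) \<in> borel \<Otimes>\<^sub>M N t \<rightarrow>\<^sub>M count_space (range (grid_time n))"
      by (rule measurable_compose[OF measurable_fst measurable_grid_time])
  qed
  moreover have "(\<lambda>n. u n v) \<longlonglongrightarrow> case_option 0 h (path X (min (fst v) t) (snd v))"
    if v: "v \<in> space (borel \<Otimes>\<^sub>M N t)" for v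
  proof (cases "fst v < t")
    case True
    then have fin: "fst v < \<infinity>" using order.strict_trans2[OF True top_greatest] by simp
    have "snd v \<in> \<Omega>" using v by (auto simp: space_pair_measure)
    from filterlim_compose[OF path_right_continuous[OF h this fin, of 0] grid_time_tendsto[OF fin]]
    have lim: "(\<lambda>n. case_option 0 h (path X (grid_time n (fst v)) (snd v))) \<longlonglongrightarrow> case_option 0 h (path X (fst v) (snd v))" .
    have "(\<lambda>n. grid_time n (fst v)) \<longlonglongrightarrow> fst v"
      using grid_time_tendsto[OF fin] by (auto simp: filterlim_at)
    then have "\<forall>\<^sub>F n in sequentially. grid_time n (fst v) < t" using True by (rule order_tendstoD)
    then have "\<forall>\<^sub>F n in sequentially. case_option 0 h (path X (grid_time n (fst v)) (snd v)) = u n v"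
      by eventually_elim (auto simp: u_def min_def)
    from Lim_transform_eventually[OF lim this] True show ?thesis by (auto simp: min_def)
  next
    case False
    have "t \<le> grid_time n (fst v)" for n
      using False grid_time_greater[of "fst v" n] by (cases "fst v < \<infinity>") (auto simp: grid_time_def less_top)
    then show ?thesis using False by (simp add: u_def min_absorb2 not_less)
  qed
  ultimately have "(\<lambda>v. case_option 0 h (path X (min (fst v) t) (snd v))) \<in> borel_measurable (borel \<Otimes>\<^sub>M N t)"
    by (rule borel_measurable_LIMSEQ_real[rotated])
  then show "(\<lambda>v. case_option 0 h (case v of (s, w) \<Rightarrow> path X (min s t) w)) \<in> borel_measurable (borel \<Otimes>\<^sub>M N t)"
    by (simp add: case_prod_beta)
qed

lemma measurable_path_joint [measurable]: "(\<lambda>(s, w). path X s w) \<in> borel \<Otimes>\<^sub>M N0 \<rightarrow>\<^sub>M borel_Delta"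
  using measurable_path_min[of top] by (simp add: min_def)

lemma measurable_path_compose:
  assumes [measurable]: "T \<in> borel_measurable M" "S \<in> M \<rightarrow>\<^sub>M N0"
  shows "(\<lambda>w. path X (T w) (S w)) \<in> M \<rightarrow>\<^sub>M borel_Delta"
  using measurable_compose[OF _ measurable_path_joint, of "\<lambda>w. (T w, S w)" M] by simp

lemma return_initial: "return borel_Delta y \<in> initial_distributions"
  by (simp add: initial_distributions_def prob_space_return)

lemma sets_augmented: "sets (F t) = (\<Inter>\<nu>\<in>initial_distributions. sigma_sets \<Omega>
        (sets (N t) \<union> null_sets (completion (law_mixture X \<nu>))))"
proof -
  let ?S = "\<lambda>\<nu>. sigma_sets \<Omega> (sets (N t) \<union> null_sets (completion (law_mixture X \<nu>)))"
  have sub: "sets (N t) \<union> null_sets (completion (law_mixture X \<nu>)) \<subseteq> Pow \<Omega>" for \<nu>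
  proof -
    have "space (completion (law_mixture X \<nu>)) = \<Omega>"
      by (simp add: law_mixture_def space_measure_of_conv)
    then show ?thesis using sets.space_closed[of "N t"] sets.space_closed[of "completion (law_mixture X \<nu>)"]
      by (auto dest!: null_setsD2)
  qed
  have "sigma_algebra \<Omega> (\<Inter>\<nu>\<in>initial_distributions. ?S \<nu>)"
    unfolding sigma_algebra_iff2
  proof (intro conjI ballI allI impI)
    have "?S (return borel_Delta \<Delta>) \<subseteq> Pow \<Omega>" using sigma_sets_into_sp[OF sub] by blast
    then show "(\<Inter>\<nu>\<in>initial_distributions. ?S \<nu>) \<subseteq> Pow \<Omega>" using return_initial by blast
  next
    fix A :: "nat \<Rightarrow> _" assume "range A \<subseteq> (\<Inter>\<nu>\<in>initial_distributions. ?S \<nu>)"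
    then show "(\<Union>i. A i) \<in> (\<Inter>\<nu>\<in>initial_distributions. ?S \<nu>)" by (blast intro: sigma_sets.Union)
  qed (auto intro: sigma_sets.Empty sigma_sets.Compl)
  then show ?thesis
    unfolding augmented_filtration_def
    using sigma_algebra.sets_measure_of_eq sigma_sets_into_sp[OF sub]
    by (metis (no_types, lifting))
qed

lemma space_augmented [simp]: "space (F t) = \<Omega>"
  by (simp add: augmented_filtration_def space_measure_of_conv)

lemma natural_subset_augmented: "sets (N t) \<subseteq> sets (F t)"
  unfolding sets_augmented by (auto intro!: sigma_sets.Basic)

lemma augmented_mono: "s \<le> t \<Longrightarrow> sets (F s) \<subseteq> sets (F t)"
  unfolding sets_augmented using natural_mono[of s t] by (intro INF_mono bexI sigma_sets_mono') auto

sublocale aug: filtration \<Omega> F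
  by standard (use augmented_mono in auto)

lemma stopping_time_add:
  assumes "stopping_time F \<sigma>"
  shows "stopping_time F (\<lambda>w. \<sigma> w + s)"
proof
  fix t
  show "Measurable.pred (F t) (\<lambda>w. \<sigma> w + s \<le> t)"
  proof (cases "s \<le> t")
    case True
    show ?thesis
    proof (cases "t = \<infinity>")
      case False
      then have "\<sigma> w + s \<le> t \<longleftrightarrow> \<sigma> w \<le> t - s" for w
        using True by (auto simp: ennreal_le_minus_iff less_top[symmetric] top_unique)
      then show ?thesis using aug.stopping_time_le_const[OF assms, of "t - s" t] by (simp add: diff_le_self_ennreal)
    qed simp
  next
    case False
    then have "\<not> \<sigma> w + s \<le> t" for w
      by (meson add_increasing le_cases order_trans zero_le)
    then show ?thesis by simp
  qed
qed

text \<open>Progressive measurability, evaluated at the stopping time.\<close>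

lemma stopped_path_pre_sigma:
  assumes \<sigma>: "stopping_time F \<sigma>" and E: "E \<in> sets borel_Delta"
  shows "{w\<in>\<Omega>. path X (\<sigma> w) w \<in> E} \<in> sets (aug.pre_sigma \<sigma>)"
proof (rule aug.sets_pre_sigmaI[OF \<sigma>])
  fix t
  have st: "{w\<in>\<Omega>. \<sigma> w \<le> c} \<in> sets (F t)" if "c \<le> t" for c
    using aug.stopping_time_le_const[OF \<sigma> that] by (simp add: pred_def)
  have "(\<lambda>w. min (\<sigma> w) t) \<in> borel_measurable (F t)"
  proof (rule borel_measurableI_le)
    fix c
    have "{w \<in> space (F t). min (\<sigma> w) t \<le> c} = (if t \<le> c then space (F t) else {w\<in>\<Omega>. \<sigma> w \<le> c})"
      by (auto simp: min_le_iff_disj)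
    then show "{w \<in> space (F t). min (\<sigma> w) t \<le> c} \<in> sets (F t)"
      using st[of c] sets.top[of "F t"] by auto
  qed
  moreover have "(\<lambda>w. w) \<in> F t \<rightarrow>\<^sub>M N t"
    using natural_subset_augmented[of t] by (auto simp: measurable_def Int_absorb2[OF sets.sets_into_space])
  ultimately have "(\<lambda>w. (min (\<sigma> w) t, w)) \<in> F t \<rightarrow>\<^sub>M borel \<Otimes>\<^sub>M N t" by (rule measurable_Pair)
  from measurable_compose[OF this measurable_path_min]
  have "(\<lambda>w. path X (min (\<sigma> w) t) w) \<in> F t \<rightarrow>\<^sub>M borel_Delta" by simp
  from measurable_sets[OF this E]
  have "{w\<in>\<Omega>. path X (min (\<sigma> w) t) w \<in> E} \<inter> {w\<in>\<Omega>. \<sigma> w \<le> t} \<in> sets (F t)"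
    using st[of t] by (intro sets.Int) (auto simp: vimage_def Int_def conj_commute)
  also have "{w\<in>\<Omega>. path X (min (\<sigma> w) t) w \<in> E} \<inter> {w\<in>\<Omega>. \<sigma> w \<le> t} =
      {w \<in> {w \<in> \<Omega>. path X (\<sigma> w) w \<in> E}. \<sigma> w \<le> t}"
    by (auto simp: min_def)
  finally show "{w \<in> {w \<in> \<Omega>. path X (\<sigma> w) w \<in> E}. \<sigma> w \<le> t} \<in> sets (F t)" .
qed

end

section \<open>The law of the path and the Markov property\<close>

lemma set_nn_integral_kernel_eq:
  fixes M :: "'a measure" and B :: "'b measure"
  assumes Z [measurable]: "Z \<in> M \<rightarrow>\<^sub>M B" and K [measurable]: "K \<in> M \<rightarrow>\<^sub>M subprob_algebra B"
    and \<Lambda> [measurable]: "\<Lambda> \<in> sets M"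
    and eq: "\<And>E. E \<in> sets B \<Longrightarrow> emeasure M {w\<in>\<Lambda>. Z w \<in> E} = (\<integral>\<^sup>+w\<in>\<Lambda>. emeasure (K w) E \<partial>M)"
    and h [measurable]: "h \<in> borel_measurable B"
  shows "(\<integral>\<^sup>+w\<in>\<Lambda>. h (Z w) \<partial>M) = (\<integral>\<^sup>+w\<in>\<Lambda>. (\<integral>\<^sup>+y. h y \<partial>K w) \<partial>M)"
proof -
  let ?M = "density M (indicator \<Lambda>)"
  have "(\<integral>\<^sup>+w. h (Z w) \<partial>?M) = (\<integral>\<^sup>+w. (\<integral>\<^sup>+y. h y \<partial>K w) \<partial>?M)"
  proof (rule nn_integral_kernel_eq[where B=B])
    fix E assume [measurable]: "E \<in> sets B"
    have "emeasure ?M {w\<in>space ?M. Z w \<in> E} = (\<integral>\<^sup>+w. indicator \<Lambda> w * indicator {w\<in>space ?M. Z w \<in> E} w \<partial>M)"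
      by (rule emeasure_density) auto
    also have "\<dots> = (\<integral>\<^sup>+w. indicator {w\<in>\<Lambda>. Z w \<in> E} w \<partial>M)"
      by (rule nn_integral_cong) (auto split: split_indicator)
    also have "{w\<in>\<Lambda>. Z w \<in> E} = {w\<in>space M. w \<in> \<Lambda> \<and> Z w \<in> E}"
      using sets.sets_into_space[OF \<Lambda>] by auto
    then have "(\<integral>\<^sup>+w. indicator {w\<in>\<Lambda>. Z w \<in> E} w \<partial>M) = emeasure M {w\<in>\<Lambda>. Z w \<in> E}"
      by (subst nn_integral_indicator) auto
    also have "\<dots> = (\<integral>\<^sup>+w. emeasure (K w) E \<partial>?M)"
      unfolding eq[OF \<open>E \<in> sets B\<close>] by (subst nn_integral_density) (auto simp: mult.commute)
    finally show "emeasure ?M {w\<in>space ?M. Z w \<in> E} = (\<integral>\<^sup>+w. emeasure (K w) E \<partial>?M)" .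
  qed (use Z K in \<open>auto simp: measurable_density_eq1 intro: h\<close>)
  then show ?thesis by (subst (asm) (1 2) nn_integral_density) (auto simp: mult.commute)
qed

context hunt
begin

text \<open>The law on the events generated by the path, which the Markov property determines. On these events it
depends measurably on \<open>y\<close> (\<open>measurable_L\<close>).\<close>

definition L :: "'s option \<Rightarrow> 'w measure" where
  "L y = restr_to_subalg (law X y) N0"

lemma subalgebra_law: "subalgebra (law X y) N0"
  using natural_subset_events[of top] by (simp add: subalgebra_def)

lemma sets_L [simp, measurable_cong]: "sets (L y) = sets N0"
  unfolding L_def by (rule sets_restr_to_subalg[OF subalgebra_law])

lemma space_L [simp]: "space (L y) = \<Omega>"
  using sets_eq_imp_space_eq[OF sets_L] by simp

lemma emeasure_L: "A \<in> sets N0 \<Longrightarrow> emeasure (L y) A = emeasure (law X y) A"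
  unfolding L_def by (rule emeasure_restr_to_subalg[OF subalgebra_law])

lemma nn_integral_L: "f \<in> borel_measurable N0 \<Longrightarrow> (\<integral>\<^sup>+w. f w \<partial>L y) = (\<integral>\<^sup>+w. f w \<partial>law X y)"
  unfolding L_def by (rule nn_integral_subalgebra2[OF subalgebra_law])

lemma prob_space_L [simp]: "prob_space (L y)"
proof
  show "emeasure (L y) (space (L y)) = 1"
    using prob_space.emeasure_space_1[OF prob_space_law[of y]] sets.top[of N0]
    by (simp add: emeasure_L)
qed

lemma measurable_path_law [measurable]: "path X s \<in> law X y \<rightarrow>\<^sub>M borel_Delta"
  using measurable_path_events[of s] by simp

definition Q :: "ennreal \<Rightarrow> 's option \<Rightarrow> 's option measure" where
  "Q s y = distr (law X y) borel_Delta (path X s)"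

lemma sets_Q [simp, measurable_cong]: "sets (Q s y) = sets borel_Delta"
  by (simp add: Q_def)

lemma emeasure_Q: "E \<in> sets borel_Delta \<Longrightarrow> emeasure (Q s y) E = emeasure (law X y) {w\<in>\<Omega>. path X s w \<in> E}"
  by (simp add: Q_def emeasure_distr vimage_def Int_def conj_commute)

lemma nn_integral_Q: "h \<in> borel_measurable borel_Delta \<Longrightarrow> (\<integral>\<^sup>+z. h z \<partial>Q s y) = (\<integral>\<^sup>+w. h (path X s w) \<partial>law X y)"
  by (simp add: Q_def nn_integral_distr)

lemma measurable_Q [measurable]: "s < \<infinity> \<Longrightarrow> Q s \<in> borel_Delta \<rightarrow>\<^sub>M subprob_algebra borel_Delta"
proof (rule measurable_subprob_algebra)
  fix y show "subprob_space (Q s y)" unfolding Q_def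
    by (intro prob_space_imp_subprob_space prob_space.prob_space_distr) auto
qed (use measurable_transition in \<open>auto simp: emeasure_Q\<close>)

lemma markov_integral:
  assumes s: "s < \<infinity>" "t < \<infinity>" and \<Lambda>: "\<Lambda> \<in> sets (N t)" and h: "h \<in> borel_measurable borel_Delta"
  shows "(\<integral>\<^sup>+w\<in>\<Lambda>. h (path X (t + s) w) \<partial>law X y) = (\<integral>\<^sup>+w\<in>\<Lambda>. (\<integral>\<^sup>+z. h z \<partial>Q s (path X t w)) \<partial>law X y)"
proof (rule set_nn_integral_kernel_eq[where B=borel_Delta])
  show "(\<lambda>w. Q s (path X t w)) \<in> law X y \<rightarrow>\<^sub>M subprob_algebra borel_Delta"
    using s by measurable
  show "\<Lambda> \<in> sets (law X y)" using \<Lambda> natural_subset_events by auto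
qed (use s \<Lambda> h markov_property in \<open>auto simp: emeasure_Q\<close>)

text \<open>Finite times and a common index function \<open>E\<close>, so that intersections and shifts stay cylinders.\<close>

definition cylinder :: "ennreal set \<Rightarrow> (ennreal \<Rightarrow> 's option set) \<Rightarrow> 'w set" where
  "cylinder J E = {w\<in>\<Omega>. \<forall>s\<in>J. path X s w \<in> E s}"

definition cylinders :: "'w set set" where
  "cylinders = {cylinder J E | J E. finite J \<and> J \<subseteq> {..<\<infinity>} \<and> range E \<subseteq> sets borel_Delta}"

lemma cylinder_measurable:
  assumes "finite J" "range E \<subseteq> sets borel_Delta"
  shows "cylinder J E \<in> sets N0"
proof -
  have "{w\<in>space N0. path X s w \<in> E s} \<in> sets N0" for s
    using measurable_sets[OF measurable_path[of s], of "E s"] assms by (auto simp: vimage_def Int_def conj_commute)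
  then have "{w\<in>space N0. \<forall>s\<in>J. path X s w \<in> E s} \<in> sets N0"
    using assms(1) by (intro sets.sets_Collect_finite_All) auto
  then show ?thesis by (simp add: cylinder_def)
qed

lemma cylinders_subset: "cylinders \<subseteq> Pow \<Omega>"
  by (auto simp: cylinders_def cylinder_def)

lemma Int_stable_cylinders: "Int_stable cylinders"
proof (rule Int_stableI)
  fix a b assume "a \<in> cylinders" "b \<in> cylinders"
  then obtain J E K D where a: "a = cylinder J E" "finite J" "J \<subseteq> {..<\<infinity>}" "range E \<subseteq> sets borel_Delta"
    and b: "b = cylinder K D" "finite K" "K \<subseteq> {..<\<infinity>}" "range D \<subseteq> sets borel_Delta"
    unfolding cylinders_def by blast
  have "a \<inter> b = cylinder (J \<union> K) (\<lambda>s. (if s \<in> J then E s else UNIV) \<inter> (if s \<in> K then D s else UNIV))"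
    using a b by (auto simp: cylinder_def split: if_splits)
  moreover have "range (\<lambda>s. (if s \<in> J then E s else UNIV) \<inter> (if s \<in> K then D s else UNIV)) \<subseteq> sets borel_Delta"
    using a b sets.top[of "borel_Delta :: 's option measure"] by (auto intro!: sets.Int)
  ultimately show "a \<inter> b \<in> cylinders"
    unfolding cylinders_def using a b by blast
qed

lemma sets_N0_cylinders: "sets N0 = sigma_sets \<Omega> cylinders"
proof
  show "sigma_sets \<Omega> cylinders \<subseteq> sets N0"
    using cylinder_measurable sets.sigma_sets_subset[of cylinders N0] by (auto simp: cylinders_def)
  show "sets N0 \<subseteq> sigma_sets \<Omega> cylinders"
    unfolding sets_natural
  proof (rule sigma_sets_mono, safe)
    fix s E assume E: "E \<in> sets (borel_Delta :: 's option measure)"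
    show "path X s -` E \<inter> \<Omega> \<in> sigma_sets \<Omega> cylinders"
    proof (cases "s = \<infinity>")
      case True
      have "path X s -` E \<inter> \<Omega> = (if \<Delta> \<in> E then \<Omega> else {})" using True by auto
      then show ?thesis by (auto intro: sigma_sets.Empty sigma_sets_top)
    next
      case False
      have "path X s -` E \<inter> \<Omega> = cylinder {s} (\<lambda>_. E)" by (auto simp: cylinder_def)
      also have "\<dots> \<in> cylinders" using False E by (auto simp: cylinders_def less_top intro!: exI[of _ "{s}"] exI[of _ "\<lambda>_. E"])
      finally show ?thesis by (rule sigma_sets.Basic)
    qed
  qed
qed

lemma cylinder_shift:
  "w \<in> \<Omega> \<Longrightarrow> \<theta> t w \<in> cylinder J E \<longleftrightarrow> (\<forall>s\<in>J. path X (s + t) w \<in> E s)"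
  by (simp add: cylinder_def)

text \<open>Splitting off the earliest time \<open>s\<close>: what remains is a smaller cylinder for the path shifted by \<open>s\<close>.
This drives the inductions that extend the Markov properties from one time to many.\<close>

lemma cylinder_split:
  fixes E :: "ennreal \<Rightarrow> 's option set"
  assumes J: "finite J" "J \<noteq> {}" "J \<subseteq> {..<\<infinity>}"
  defines "s \<equiv> Min J"
  defines "J' \<equiv> (\<lambda>r. r - s) ` (J - {s})" and "E' \<equiv> \<lambda>r. E (r + s)"
  shows "w \<in> \<Omega> \<Longrightarrow> \<theta> t w \<in> cylinder J E \<longleftrightarrow> path X (s + t) w \<in> E s \<and> \<theta> (s + t) w \<in> cylinder J' E'"
    and "cylinder J E = {w\<in>\<Omega>. path X s w \<in> E s \<and> \<theta> s w \<in> cylinder J' E'}"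
    and "s < \<infinity>" and "finite J'" and "J' \<subseteq> {..<\<infinity>}" and "card J' < card J"
proof -
  have sJ: "s \<in> J" "\<And>r. r \<in> J \<Longrightarrow> s \<le> r" using J by (auto simp: s_def)
  then show fin: "s < \<infinity>" using J by auto
  have eq: "r - s + s = r" if "r \<in> J" for r
    using sJ(2)[OF that] fin by (simp add: diff_add_cancel_ennreal)
  have all: "(\<forall>r\<in>J. P r) \<longleftrightarrow> P s \<and> (\<forall>r\<in>J'. P (r + s))" for P
    using sJ(1) eq by (auto simp: J'_def)
  show "w \<in> \<Omega> \<Longrightarrow> \<theta> t w \<in> cylinder J E \<longleftrightarrow> path X (s + t) w \<in> E s \<and> \<theta> (s + t) w \<in> cylinder J' E'"
    unfolding cylinder_shift all[of "\<lambda>r. path X (r + t) w \<in> E r"] by (simp add: E'_def add.assoc cylinder_shift)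
  show "cylinder J E = {w\<in>\<Omega>. path X s w \<in> E s \<and> \<theta> s w \<in> cylinder J' E'}"
    unfolding cylinder_def[of J E] all[of "\<lambda>r. path X r _ \<in> E r"] by (auto simp: E'_def cylinder_shift)
  show "finite J'" using J by (simp add: J'_def)
  have "r - s < \<infinity>" if "r \<in> J" for r
    using J that le_less_trans[OF diff_le_self_ennreal[of r s], of \<infinity>] by auto
  then show "J' \<subseteq> {..<\<infinity>}" by (auto simp: J'_def)
  have "card J' \<le> card (J - {s})" unfolding J'_def by (rule card_image_le) (use J in auto)
  also have "\<dots> < card J" using sJ(1) J(1) by (rule card_Diff1_less[rotated])
  finally show "card J' < card J" .
qed

lemma law_cylinder:
  assumes "finite J" "J \<subseteq> {..<\<infinity>}" "range E \<subseteq> sets borel_Delta"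
  shows "(\<lambda>z. emeasure (law X z) (cylinder J E)) \<in> borel_measurable borel_Delta \<and>
    (\<forall>y t \<Lambda>. t < \<infinity> \<longrightarrow> \<Lambda> \<in> sets (N t) \<longrightarrow> emeasure (law X y) {w\<in>\<Lambda>. \<theta> t w \<in> cylinder J E} =
      (\<integral>\<^sup>+w\<in>\<Lambda>. emeasure (law X (path X t w)) (cylinder J E) \<partial>law X y))"
  using assms
proof (induction "card J" arbitrary: J E rule: less_induct)
  case less
  show ?case
  proof (cases "J = {}")
    case True
    have [simp]: "cylinder J E = \<Omega>" "emeasure (law X y) \<Omega> = 1" for y
      using True prob_space.emeasure_space_1[OF prob_space_law[of y]] by (auto simp: cylinder_def)
    have "{w\<in>\<Lambda>. \<theta> t w \<in> \<Omega>} = \<Lambda>" if "\<Lambda> \<in> sets (N t)" for \<Lambda> t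
      using sets.sets_into_space[OF that] by auto
    moreover have "\<Lambda> \<in> sets (events X)" if "\<Lambda> \<in> sets (N t)" for \<Lambda> t
      using that natural_subset_events by blast
    ultimately show ?thesis by simp
  next
    case False
    define s where "s = Min J"
    define J' where "J' = (\<lambda>r. r - s) ` (J - {s})"
    define E' where "E' = (\<lambda>r. E (r + s))"
    note split = cylinder_split(1,2)[OF less.prems(1) False less.prems(2), where E=E, folded s_def, folded J'_def E'_def]
      cylinder_split(3-6)[OF less.prems(1) False less.prems(2), folded s_def, folded J'_def]
    have E': "range E' \<subseteq> sets borel_Delta" using less.prems by (auto simp: E'_def)
    note IH = less.hyps[OF split(6,4,5) E']
    define G where "G z = emeasure (law X z) (cylinder J' E')" for z
    have [measurable]: "G \<in> borel_measurable borel_Delta" "E s \<in> sets borel_Delta"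
      using IH less.prems by (auto simp: G_def[abs_def])
    have IH': "emeasure (law X y) {w\<in>\<Lambda>. \<theta> t w \<in> cylinder J' E'} = (\<integral>\<^sup>+w\<in>\<Lambda>. G (path X t w) \<partial>law X y)"
      if "t < \<infinity>" "\<Lambda> \<in> sets (N t)" for y t \<Lambda>
      using IH that by (simp add: G_def)
    define g where "g z = G z * indicator (E s) z" for z
    have [measurable]: "g \<in> borel_measurable borel_Delta" unfolding g_def by measurable
    have rest: "{w\<in>\<Lambda>. path X (s + t) w \<in> E s} \<in> sets (N (s + t))" if "\<Lambda> \<in> sets (N t)" for \<Lambda> t
    proof -
      have "{w\<in>\<Lambda>. path X (s + t) w \<in> E s} = \<Lambda> \<inter> (path X (s + t) -` E s \<inter> space (N (s + t)))"
        using sets.sets_into_space[OF that] by auto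
      also have "\<dots> \<in> sets (N (s + t))"
        using natural_mono[of t "s + t"] that
        by (intro sets.Int measurable_sets[OF measurable_path_natural]) auto
      finally show ?thesis .
    qed
    have step: "emeasure (law X y) {w\<in>\<Lambda>. \<theta> t w \<in> cylinder J E} = (\<integral>\<^sup>+w\<in>\<Lambda>. g (path X (t + s) w) \<partial>law X y)"
      if t: "t < \<infinity>" and \<Lambda>: "\<Lambda> \<in> sets (N t)" for y t \<Lambda>
    proof -
      have "{w\<in>\<Lambda>. \<theta> t w \<in> cylinder J E} = {w\<in>{w\<in>\<Lambda>. path X (s + t) w \<in> E s}. \<theta> (s + t) w \<in> cylinder J' E'}"
        using sets.sets_into_space[OF \<Lambda>] split(1)[of _ t] by auto
      also have "emeasure (law X y) \<dots> = (\<integral>\<^sup>+w\<in>{w\<in>\<Lambda>. path X (s + t) w \<in> E s}. G (path X (s + t) w) \<partial>law X y)"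
        using t split(3) rest[OF \<Lambda>] by (intro IH') (auto simp: less_top)
      also have "\<dots> = (\<integral>\<^sup>+w\<in>\<Lambda>. g (path X (t + s) w) \<partial>law X y)"
        by (intro nn_integral_cong) (auto simp: g_def add.commute split: split_indicator)
      finally show ?thesis .
    qed
    have G_eq: "emeasure (law X z) (cylinder J E) = (\<integral>\<^sup>+v. g v \<partial>Q s z)" for z
    proof -
      have "{w\<in>\<Omega>. path X s w \<in> E s} \<in> sets (N s)"
        using measurable_sets[OF measurable_path_natural[OF order_refl], of "E s" s]
        by (simp add: vimage_def Int_def conj_commute)
      from IH'[OF split(3) this, of z]
      have "emeasure (law X z) (cylinder J E) = (\<integral>\<^sup>+w\<in>{w\<in>\<Omega>. path X s w \<in> E s}. G (path X s w) \<partial>law X z)"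
        unfolding split(2) by (simp add: conj_assoc)
      also have "\<dots> = (\<integral>\<^sup>+w. g (path X s w) \<partial>law X z)"
        by (intro nn_integral_cong) (auto simp: g_def split: split_indicator)
      finally show ?thesis by (simp add: nn_integral_Q)
    qed
    have "(\<lambda>z. \<integral>\<^sup>+v. g v \<partial>Q s z) \<in> borel_measurable borel_Delta"
      using split(3) by measurable
    then show ?thesis
      unfolding G_eq using step markov_integral[OF split(3)] by auto
  qed
qed

lemma law_cylinder_first:
  assumes J: "finite J" "J \<noteq> {}" "J \<subseteq> {..<\<infinity>}" and E: "range E \<subseteq> sets borel_Delta"
  defines "s \<equiv> Min J"
  defines "J' \<equiv> (\<lambda>r. r - s) ` (J - {s})" and "E' \<equiv> \<lambda>r. E (r + s)"
  shows "emeasure (law X z) (cylinder J E) = (\<integral>\<^sup>+v\<in>E s. emeasure (law X v) (cylinder J' E') \<partial>Q s z)"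
proof -
  note split = cylinder_split(1,2)[OF J, where E=E, folded s_def, folded J'_def E'_def]
      cylinder_split(3-6)[OF J, folded s_def, folded J'_def]
  have [measurable]: "E s \<in> sets borel_Delta" using E by auto
  have lc: "(\<lambda>z. emeasure (law X z) (cylinder J' E')) \<in> borel_measurable borel_Delta"
    "\<And>y t \<Lambda>. t < \<infinity> \<Longrightarrow> \<Lambda> \<in> sets (N t) \<Longrightarrow> emeasure (law X y) {w\<in>\<Lambda>. \<theta> t w \<in> cylinder J' E'} =
      (\<integral>\<^sup>+w\<in>\<Lambda>. emeasure (law X (path X t w)) (cylinder J' E') \<partial>law X y)"
    using law_cylinder[OF split(4,5), of E'] E by (auto simp: E'_def)
  note [measurable] = lc(1)
  have "{w\<in>\<Omega>. path X s w \<in> E s} \<in> sets (N s)"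
    using measurable_sets[OF measurable_path_natural[OF order_refl], of "E s" s]
    by (simp add: vimage_def Int_def conj_commute)
  from lc(2)[OF split(3) this, of z]
  have "emeasure (law X z) (cylinder J E) =
     (\<integral>\<^sup>+w\<in>{w\<in>\<Omega>. path X s w \<in> E s}. emeasure (law X (path X s w)) (cylinder J' E') \<partial>law X z)"
    unfolding split(2) by (simp add: conj_assoc)
  also have "\<dots> = (\<integral>\<^sup>+w. emeasure (law X (path X s w)) (cylinder J' E') * indicator (E s) (path X s w) \<partial>law X z)"
    by (intro nn_integral_cong) (auto split: split_indicator)
  finally show ?thesis by (simp add: nn_integral_Q)
qed

lemma measurable_L [measurable]: "L \<in> borel_Delta \<rightarrow>\<^sub>M prob_algebra N0"
proof (rule measurable_prob_algebra_generated[OF sets_N0_cylinders Int_stable_cylinders cylinders_subset])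
  fix A assume "A \<in> cylinders"
  then show "(\<lambda>a. emeasure (L a) A) \<in> borel_measurable borel_Delta"
    using law_cylinder cylinder_measurable by (auto simp: cylinders_def emeasure_L)
qed auto

lemma measurable_L_subprob [measurable]: "L \<in> borel_Delta \<rightarrow>\<^sub>M subprob_algebra N0"
  by (rule measurable_prob_algebraD[OF measurable_L])

text \<open>Since \<open>L\<close> is a kernel, \<open>P\<^sub>\<nu>\<close> is a genuine measure, namely the composition of \<open>\<nu>\<close> and \<open>L\<close>.\<close>

lemma law_mixture_eq:
  assumes \<nu>: "\<nu> \<in> initial_distributions"
  shows "law_mixture X \<nu> = \<nu> \<bind> L"
proof -
  have sets: "sets \<nu> = sets borel_Delta" and ne: "space \<nu> \<noteq> {}"
    using \<nu> prob_space.not_empty by (auto simp: initial_distributions_def)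
  have L: "L \<in> \<nu> \<rightarrow>\<^sub>M subprob_algebra N0" using measurable_L_subprob sets by (simp cong: measurable_cong_sets)
  have "\<nu> \<bind> L = measure_of (space (\<nu> \<bind> L)) (sets (\<nu> \<bind> L)) (emeasure (\<nu> \<bind> L))"
    by (simp add: measure_of_of_measure)
  also have "\<dots> = measure_of \<Omega> (sets N0) (\<lambda>\<Lambda>. \<integral>\<^sup>+x. emeasure (law X x) \<Lambda> \<partial>\<nu>)"
  proof -
    have s: "sets (\<nu> \<bind> L) = sets N0" by (rule sets_bind[OF sets_kernel[OF L] ne]) auto
    from sets_eq_imp_space_eq[OF this] have sp: "space (\<nu> \<bind> L) = \<Omega>" by simp
    have "emeasure (\<nu> \<bind> L) a = (\<integral>\<^sup>+x. emeasure (law X x) a \<partial>\<nu>)" if "a \<in> sigma_sets \<Omega> (sets N0)" for a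
      using that sets.sigma_sets_eq[of N0] emeasure_bind[OF ne L, of a] by (simp add: emeasure_L)
    then show ?thesis unfolding s sp
      by (intro measure_of_eq) (use sets.space_closed[of N0] in auto)
  qed
  finally show ?thesis by (simp add: law_mixture_def)
qed

lemma emeasure_law_mixture:
  assumes \<nu>: "\<nu> \<in> initial_distributions" and A: "A \<in> sets N0"
  shows "emeasure (law_mixture X \<nu>) A = (\<integral>\<^sup>+x. emeasure (L x) A \<partial>\<nu>)"
proof -
  have sets: "sets \<nu> = sets borel_Delta" and ne: "space \<nu> \<noteq> {}"
    using \<nu> prob_space.not_empty by (auto simp: initial_distributions_def)
  have L: "L \<in> \<nu> \<rightarrow>\<^sub>M subprob_algebra N0" using measurable_L_subprob sets by (simp cong: measurable_cong_sets)
  show ?thesis unfolding law_mixture_eq[OF \<nu>] by (rule emeasure_bind[OF ne L A])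
qed

lemma sets_law_mixture [simp]: "sets (law_mixture X \<nu>) = sets N0"
  unfolding law_mixture_def using sets.sigma_sets_eq[of N0] sets.space_closed[of N0] by simp

lemma space_law_mixture [simp]: "space (law_mixture X \<nu>) = \<Omega>"
  by (simp add: law_mixture_def space_measure_of_conv)

lemma law_mixture_return: "law_mixture X (return borel_Delta y) = L y"
proof (rule measure_eqI)
  fix A assume "A \<in> sets (law_mixture X (return borel_Delta y))"
  then have [measurable]: "A \<in> sets N0" by simp
  then show "emeasure (law_mixture X (return borel_Delta y)) A = emeasure (L y) A"
    by (subst emeasure_law_mixture[OF return_initial]) (auto simp: nn_integral_return)
qed simp

end

section \<open>The strong Markov property\<close>

context hunt
begin

text \<open>All events of the augmented filtration are measurable for these completions.\<close>

definition P :: "'s option \<Rightarrow> 'w measure" where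
  "P y = completion (L y)"

lemma space_P [simp]: "space (P y) = \<Omega>"
  by (simp add: P_def)

lemma N0_subset_P: "sets N0 \<subseteq> sets (P y)"
  using sets_completionI_sets[of _ "L y"] by (auto simp: P_def)

lemma emeasure_completion_N0: "A \<in> sets M \<Longrightarrow> emeasure (completion M) A = emeasure M A"
  using nn_integral_completion[of M "indicator A"] nn_integral_indicator[of A M]
    nn_integral_indicator[of A "completion M"] by (simp add: sets_completionI_sets)

lemma emeasure_P: "A \<in> sets N0 \<Longrightarrow> emeasure (P y) A = emeasure (L y) A"
  unfolding P_def by (rule emeasure_completion_N0) simp

lemma prob_space_P [simp]: "prob_space (P y)"
proof
  show "emeasure (P y) (space (P y)) = 1"
    using prob_space.emeasure_space_1[OF prob_space_L[of y]] sets.top[of N0] emeasure_P[of \<Omega> y] by simp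
qed

lemma augmented_subset_completion:
  assumes "\<nu> \<in> initial_distributions"
  shows "sets (F t) \<subseteq> sets (completion (law_mixture X \<nu>))"
proof -
  have "sets (F t) \<subseteq> sigma_sets \<Omega> (sets (N t) \<union> null_sets (completion (law_mixture X \<nu>)))"
    using assms unfolding sets_augmented by blast
  also have "\<dots> \<subseteq> sets (completion (law_mixture X \<nu>))"
  proof -
    have "sets (N t) \<subseteq> sets (law_mixture X \<nu>)" using natural_mono[of t top] by simp
    then have "sets (N t) \<union> null_sets (completion (law_mixture X \<nu>)) \<subseteq> sets (completion (law_mixture X \<nu>))"
      by (auto intro: sets_completionI_sets)
    from sets.sigma_sets_subset[OF this] show ?thesis by simp
  qed
  finally show ?thesis .
qed

lemma augmented_subset_P: "sets (F t) \<subseteq> sets (P y)"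
  using augmented_subset_completion[OF return_initial, of t y] by (simp add: law_mixture_return P_def)

lemma measurable_N0_P [measurable]: "(\<lambda>w. w) \<in> P y \<rightarrow>\<^sub>M N0"
proof (rule measurableI)
  fix A assume "A \<in> sets N0"
  then show "(\<lambda>w. w) -` A \<inter> space (P y) \<in> sets (P y)"
    using N0_subset_P[of y] sets.sets_into_space[of A N0] by (auto simp: Int_absorb2)
qed simp

lemma measurable_P_of_N0: "f \<in> N0 \<rightarrow>\<^sub>M M \<Longrightarrow> f \<in> P y \<rightarrow>\<^sub>M M"
  by (rule measurable_compose[OF measurable_N0_P])

lemma measurable_P_of_augmented:
  assumes f: "f \<in> F t \<rightarrow>\<^sub>M M" shows "f \<in> P y \<rightarrow>\<^sub>M M"
proof (rule measurableI)
  fix A assume "A \<in> sets M"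
  from measurable_sets[OF f this] show "f -` A \<inter> space (P y) \<in> sets (P y)"
    using augmented_subset_P[of t y] by auto
qed (use measurable_space[OF f] in auto)

lemma nn_integral_P: "f \<in> borel_measurable N0 \<Longrightarrow> (\<integral>\<^sup>+w. f w \<partial>P y) = (\<integral>\<^sup>+w. f w \<partial>L y)"
  by (simp add: P_def nn_integral_completion)

lemma measurable_stopping_P: "stopping_time F \<sigma> \<Longrightarrow> \<sigma> \<in> borel_measurable (P y)"
  using augmented_mono
  by (intro measurable_P_of_augmented[of _ top] measurable_stopping_time[where F=F and M="F top"]) simp_all

lemma measurable_shift_compose:
  assumes T: "T \<in> borel_measurable M" and S: "S \<in> M \<rightarrow>\<^sub>M N0"
  shows "(\<lambda>w. \<theta> (T w) (S w)) \<in> M \<rightarrow>\<^sub>M N0"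
proof -
  have "(\<lambda>w. \<theta> (T w) (S w)) \<in> M \<rightarrow>\<^sub>M sigma \<Omega> {path X s -` E \<inter> \<Omega> |s E. s \<le> top \<and> E \<in> sets borel_Delta}"
  proof (rule measurable_measure_of)
    show "(\<lambda>w. \<theta> (T w) (S w)) \<in> space M \<rightarrow> \<Omega>" using measurable_space[OF S] by auto
    fix B assume "B \<in> {path X s -` E \<inter> \<Omega> |s E. s \<le> top \<and> E \<in> sets borel_Delta}"
    then obtain s E where B: "B = path X s -` E \<inter> \<Omega>" and E: "E \<in> sets borel_Delta" by auto
    have "(\<lambda>w. path X (s + T w) (S w)) \<in> M \<rightarrow>\<^sub>M borel_Delta"
      using T S by (intro measurable_path_compose) measurable
    from measurable_sets[OF this E]
    have "(\<lambda>w. path X (s + T w) (S w)) -` E \<inter> space M \<in> sets M" .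
    also have "(\<lambda>w. path X (s + T w) (S w)) -` E \<inter> space M = (\<lambda>w. \<theta> (T w) (S w)) -` B \<inter> space M"
      using measurable_space[OF S] unfolding B by auto
    finally show "(\<lambda>w. \<theta> (T w) (S w)) -` B \<inter> space M \<in> sets M" .
  qed auto
  then show ?thesis by (simp add: natural_filtration_def)
qed

lemma pre_sigma_subset_P:
  assumes "stopping_time F \<sigma>"
  shows "sets (aug.pre_sigma \<sigma>) \<subseteq> sets (P y)"
proof
  fix \<Lambda> assume "\<Lambda> \<in> sets (aug.pre_sigma \<sigma>)"
  from aug.sets_pre_sigmaD[OF assms this, of top] have "\<Lambda> \<in> sets (F top)" by simp
  then show "\<Lambda> \<in> sets (P y)" using augmented_subset_P by blast
qed

lemma strong_markov_integral:
  assumes \<sigma>: "stopping_time F \<sigma>" and \<Lambda>: "\<Lambda> \<in> sets (aug.pre_sigma \<sigma>)" and s: "s < \<infinity>"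
    and h: "h \<in> borel_measurable borel_Delta"
  shows "(\<integral>\<^sup>+w\<in>\<Lambda>. h (path X (\<sigma> w + s) w) \<partial>P y) = (\<integral>\<^sup>+w\<in>\<Lambda>. (\<integral>\<^sup>+z. h z \<partial>Q s (path X (\<sigma> w) w)) \<partial>P y)"
proof (rule set_nn_integral_kernel_eq[where B=borel_Delta])
  note [measurable] = measurable_stopping_P[OF \<sigma>]
  show "(\<lambda>w. path X (\<sigma> w + s) w) \<in> P y \<rightarrow>\<^sub>M borel_Delta" by (rule measurable_path_compose) measurable
  have "(\<lambda>w. path X (\<sigma> w) w) \<in> P y \<rightarrow>\<^sub>M borel_Delta" by (rule measurable_path_compose) measurable
  from measurable_compose[OF this measurable_Q[OF s]]
  show "(\<lambda>w. Q s (path X (\<sigma> w) w)) \<in> P y \<rightarrow>\<^sub>M subprob_algebra borel_Delta" .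
  show "\<Lambda> \<in> sets (P y)" using pre_sigma_subset_P[OF \<sigma>] \<Lambda> by blast
  fix E assume E: "E \<in> sets (borel_Delta :: 's option measure)"
  have "emeasure (completion (law_mixture X (return borel_Delta y))) {w\<in>\<Lambda>. path X (\<sigma> w + s) w \<in> E} =
      (\<integral>\<^sup>+w\<in>\<Lambda>. emeasure (law X (path X (\<sigma> w) w)) {w'\<in>\<Omega>. path X s w' \<in> E}
              \<partial>completion (law_mixture X (return borel_Delta y)))"
    using strong_markov \<sigma> \<Lambda> s E return_initial[of y] unfolding strong_markov_def by blast
  then show "emeasure (P y) {w\<in>\<Lambda>. path X (\<sigma> w + s) w \<in> E} =
     (\<integral>\<^sup>+w\<in>\<Lambda>. emeasure (Q s (path X (\<sigma> w) w)) E \<partial>P y)"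
    using E by (simp add: emeasure_Q law_mixture_return P_def)
qed (fact h)

text \<open>Induction on the number of times. The earliest time \<open>s\<close> is absorbed into the stopping time
\<open>\<sigma> + s\<close> and into the event, which enlarges by a condition on the path at \<open>\<sigma> + s\<close>.\<close>

lemma strong_markov_cylinder:
  assumes "finite J" "J \<subseteq> {..<\<infinity>}" "range E \<subseteq> sets borel_Delta"
    and "stopping_time F \<sigma>" "\<Lambda> \<in> sets (aug.pre_sigma \<sigma>)"
  shows "emeasure (P y) {w\<in>\<Lambda>. \<theta> (\<sigma> w) w \<in> cylinder J E} =
      (\<integral>\<^sup>+w\<in>\<Lambda>. emeasure (law X (path X (\<sigma> w) w)) (cylinder J E) \<partial>P y)"
  using assms
proof (induction "card J" arbitrary: J E \<sigma> \<Lambda> rule: less_induct)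
  case less
  note \<sigma> = less.prems(4) and \<Lambda> = less.prems(5)
  have \<Lambda>sub: "\<Lambda> \<subseteq> \<Omega>" using sets.sets_into_space[OF \<Lambda>] aug.space_pre_sigma by simp
  have \<Lambda>P: "\<Lambda> \<in> sets (P y)" using pre_sigma_subset_P[OF \<sigma>] \<Lambda> by blast
  show ?case
  proof (cases "J = {}")
    case True
    have [simp]: "cylinder J E = \<Omega>" "emeasure (law X y) \<Omega> = 1" for y
      using True prob_space.emeasure_space_1[OF prob_space_law[of y]] by (auto simp: cylinder_def)
    have "{w\<in>\<Lambda>. \<theta> (\<sigma> w) w \<in> \<Omega>} = \<Lambda>" using \<Lambda>sub by auto
    then show ?thesis using \<Lambda>P by simp
  next
    case False
    define s where "s = Min J"
    define J' where "J' = (\<lambda>r. r - s) ` (J - {s})"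
    define E' where "E' = (\<lambda>r. E (r + s))"
    note split = cylinder_split(1,2)[OF less.prems(1) False less.prems(2), where E=E, folded s_def, folded J'_def E'_def]
      cylinder_split(3-6)[OF less.prems(1) False less.prems(2), folded s_def, folded J'_def]
    have E': "range E' \<subseteq> sets borel_Delta" using less.prems by (auto simp: E'_def)
    define G where "G z = emeasure (law X z) (cylinder J' E')" for z
    have [measurable]: "G \<in> borel_measurable borel_Delta" "E s \<in> sets borel_Delta"
      using law_cylinder[OF split(4,5) E'] less.prems by (auto simp: G_def[abs_def])
    define g where "g z = G z * indicator (E s) z" for z
    have [measurable]: "g \<in> borel_measurable borel_Delta" unfolding g_def by measurable
    have \<sigma>s: "stopping_time F (\<lambda>w. \<sigma> w + s)" by (rule stopping_time_add[OF \<sigma>])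
    have rest: "{w\<in>\<Lambda>. path X (\<sigma> w + s) w \<in> E s} \<in> sets (aug.pre_sigma (\<lambda>w. \<sigma> w + s))"
    proof -
      have "{w\<in>\<Lambda>. path X (\<sigma> w + s) w \<in> E s} = \<Lambda> \<inter> {w\<in>\<Omega>. path X (\<sigma> w + s) w \<in> E s}"
        using \<Lambda>sub by auto
      also have "\<dots> \<in> sets (aug.pre_sigma (\<lambda>w. \<sigma> w + s))"
        using aug.mono_pre_sigma[OF \<sigma> \<sigma>s] \<Lambda> stopped_path_pre_sigma[OF \<sigma>s, of "E s"]
        by (intro sets.Int) auto
      finally show ?thesis .
    qed
    have "{w\<in>\<Lambda>. \<theta> (\<sigma> w) w \<in> cylinder J E} =
        {w\<in>{w\<in>\<Lambda>. path X (\<sigma> w + s) w \<in> E s}. \<theta> (\<sigma> w + s) w \<in> cylinder J' E'}"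
      using \<Lambda>sub split(1)[of _ "\<sigma> _"] by (auto simp: add.commute[of _ s])
    also have "emeasure (P y) \<dots> = (\<integral>\<^sup>+w\<in>{w\<in>\<Lambda>. path X (\<sigma> w + s) w \<in> E s}. G (path X (\<sigma> w + s) w) \<partial>P y)"
      unfolding G_def by (rule less.hyps[OF split(6,4,5) E' \<sigma>s rest])
    also have "\<dots> = (\<integral>\<^sup>+w\<in>\<Lambda>. g (path X (\<sigma> w + s) w) \<partial>P y)"
      by (intro nn_integral_cong) (auto simp: g_def split: split_indicator)
    also have "\<dots> = (\<integral>\<^sup>+w\<in>\<Lambda>. (\<integral>\<^sup>+z. g z \<partial>Q s (path X (\<sigma> w) w)) \<partial>P y)"
      by (rule strong_markov_integral[OF \<sigma> \<Lambda> split(3)]) measurable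
    also have "\<dots> = (\<integral>\<^sup>+w\<in>\<Lambda>. emeasure (law X (path X (\<sigma> w) w)) (cylinder J E) \<partial>P y)"
      using law_cylinder_first[OF less.prems(1) False less.prems(2,3), folded s_def, folded J'_def E'_def]
      by (simp add: g_def G_def)
    finally show ?thesis .
  qed
qed

lemma measurable_stopped_path:
  assumes "stopping_time F \<sigma>"
  shows "(\<lambda>w. path X (\<sigma> w) w) \<in> P y \<rightarrow>\<^sub>M borel_Delta"
  by (rule measurable_path_compose[OF measurable_stopping_P[OF assms] measurable_N0_P])

lemma measurable_stopped_shift:
  assumes "stopping_time F \<sigma>"
  shows "(\<lambda>w. \<theta> (\<sigma> w) w) \<in> P y \<rightarrow>\<^sub>M N0"
  by (rule measurable_shift_compose[OF measurable_stopping_P[OF assms] measurable_N0_P])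

text \<open>The stopping time itself may enter the functional, as \<open>{\<sigma> \<in> A}\<close> belongs to the
\<open>\<sigma>\<close>-algebra of the past of \<open>\<sigma>\<close>. The joint laws agree on products of Borel sets and cylinders.\<close>

theorem strong_markov_joint:
  fixes \<Phi> :: "ennreal \<Rightarrow> 'w \<Rightarrow> ennreal"
  assumes \<sigma>: "stopping_time F \<sigma>" and \<Phi> [measurable]: "(\<lambda>(s, w). \<Phi> s w) \<in> borel_measurable (borel \<Otimes>\<^sub>M N0)"
  shows "(\<integral>\<^sup>+w. \<Phi> (\<sigma> w) (\<theta> (\<sigma> w) w) \<partial>P y) = (\<integral>\<^sup>+w. (\<integral>\<^sup>+w'. \<Phi> (\<sigma> w) w' \<partial>L (path X (\<sigma> w) w)) \<partial>P y)"
proof -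
  let ?B = "borel \<Otimes>\<^sub>M N0 :: (ennreal \<times> 'w) measure"
  note [measurable] = measurable_stopping_P[OF \<sigma>] measurable_stopped_path[OF \<sigma>] measurable_stopped_shift[OF \<sigma>]
  have PM [measurable]: "Pair c \<in> L z \<rightarrow>\<^sub>M ?B" for c z
    using measurable_Pair1'[of c borel N0] by (simp cong: measurable_cong_sets)
  define K where "K w = distr (L (path X (\<sigma> w) w)) ?B (\<lambda>w'. (\<sigma> w, w'))" for w
  have KM [measurable]: "K \<in> P y \<rightarrow>\<^sub>M subprob_algebra ?B"
    unfolding K_def
  proof (rule measurable_distr2[where M=N0])
    show "(\<lambda>(w, w'). (\<sigma> w, w')) \<in> P y \<Otimes>\<^sub>M N0 \<rightarrow>\<^sub>M ?B"
      unfolding case_prod_beta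
      by (intro measurable_Pair measurable_compose[OF measurable_fst measurable_stopping_P[OF \<sigma>]] measurable_snd)
  qed (rule measurable_compose[OF measurable_stopped_path[OF \<sigma>] measurable_L_subprob])
  have ne: "space (P y) \<noteq> {}" using prob_space.not_empty[OF prob_space_P] .
  have Om: "\<Omega> \<in> cylinders" by (auto simp: cylinders_def cylinder_def intro!: exI[of _ "{}"] exI[of _ "\<lambda>_. {}"])
  have gen: "sets ?B = sigma_sets (UNIV \<times> \<Omega>) {a \<times> b | a b. a \<in> sets borel \<and> b \<in> cylinders}"
  proof -
    have "sets ?B = sets (sigma (space borel \<times> space N0) {a \<times> b | a b. a \<in> sets (borel::ennreal measure) \<and> b \<in> cylinders})"
      by (rule sets_pair_eq[where Ca="{UNIV}" and Cb="{\<Omega>}"])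
        (use cylinders_subset Om sets_N0_cylinders sets.sigma_sets_eq[of "borel :: ennreal measure"] in auto)
    also have "\<dots> = sigma_sets (UNIV \<times> \<Omega>) {a \<times> b | a b. a \<in> sets borel \<and> b \<in> cylinders}"
      using cylinders_subset by (subst sets_measure_of) auto
    finally show ?thesis .
  qed
  have eq: "distr (P y) ?B (\<lambda>w. (\<sigma> w, \<theta> (\<sigma> w) w)) = P y \<bind> K" (is "?M1 = ?M2")
  proof (rule measure_eqI_generator_eq[where \<Omega>="UNIV \<times> \<Omega>" and E="{a \<times> b | a b. a \<in> sets borel \<and> b \<in> cylinders}"
        and A="\<lambda>_. UNIV \<times> \<Omega>"])
    show "Int_stable {a \<times> b |a b. a \<in> sets (borel::ennreal measure) \<and> b \<in> cylinders}"
    proof (rule Int_stableI, safe)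
      fix a b a' b' assume "a \<in> sets (borel::ennreal measure)" "a' \<in> sets (borel::ennreal measure)" "b \<in> cylinders" "b' \<in> cylinders"
      then show "\<exists>aa bb. a \<times> b \<inter> a' \<times> b' = aa \<times> bb \<and> aa \<in> sets borel \<and> bb \<in> cylinders"
        using Int_stable_cylinders by (intro exI[of _ "a \<inter> a'"] exI[of _ "b \<inter> b'"]) (auto simp: Int_stable_def)
    qed
    show "{a \<times> b |a b. a \<in> sets (borel::ennreal measure) \<and> b \<in> cylinders} \<subseteq> Pow (UNIV \<times> \<Omega>)"
      using cylinders_subset by auto
    show "sets ?M1 = sigma_sets (UNIV \<times> \<Omega>) {a \<times> b |a b. a \<in> sets borel \<and> b \<in> cylinders}"
      using gen by simp
    show "sets ?M2 = sigma_sets (UNIV \<times> \<Omega>) {a \<times> b |a b. a \<in> sets borel \<and> b \<in> cylinders}"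
      using gen sets_bind[OF sets_kernel[OF KM] ne] by simp
    show "range (\<lambda>_. UNIV \<times> \<Omega>) \<subseteq> {a \<times> b |a b. a \<in> sets borel \<and> b \<in> cylinders}"
      using Om by (auto intro!: exI[of _ UNIV] exI[of _ \<Omega>])
    show "emeasure ?M1 (UNIV \<times> \<Omega>) \<noteq> \<infinity>"
      using prob_space.emeasure_le_1[OF prob_space.prob_space_distr[OF prob_space_P
            measurable_Pair[OF measurable_stopping_P[OF \<sigma>] measurable_stopped_shift[OF \<sigma>]]], of y "UNIV \<times> \<Omega>"]
      by (auto simp: top_unique)
  next
    fix Z assume "Z \<in> {a \<times> b |a b. a \<in> sets (borel::ennreal measure) \<and> b \<in> cylinders}"
    then obtain a b where Z: "Z = a \<times> b" and a [measurable]: "a \<in> sets borel" and b: "b \<in> cylinders" by blast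
    then obtain J E where b': "b = cylinder J E" "finite J" "J \<subseteq> {..<\<infinity>}" "range E \<subseteq> sets borel_Delta"
      unfolding cylinders_def by blast
    have bN [measurable]: "b \<in> sets N0" using cylinder_measurable b' by simp
    have ZB: "Z \<in> sets ?B" unfolding Z by (rule pair_measureI[OF a bN])
    have \<Lambda>: "{w\<in>\<Omega>. \<sigma> w \<in> a} \<in> sets (aug.pre_sigma \<sigma>)"
      using measurable_sets[OF aug.measurable_stopping_time_pre_sigma[OF \<sigma>] a]
      by (simp add: aug.space_pre_sigma vimage_def Int_def conj_commute)
    have "emeasure ?M1 Z = emeasure (P y) {w\<in>{w\<in>\<Omega>. \<sigma> w \<in> a}. \<theta> (\<sigma> w) w \<in> b}"
      using ZB by (subst emeasure_distr) (auto simp: Z intro!: arg_cong[where f="emeasure (P y)"])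
    also have "\<dots> = (\<integral>\<^sup>+w\<in>{w\<in>\<Omega>. \<sigma> w \<in> a}. emeasure (law X (path X (\<sigma> w) w)) b \<partial>P y)"
      unfolding b' by (rule strong_markov_cylinder) (use b' \<sigma> \<Lambda> in auto)
    also have "\<dots> = (\<integral>\<^sup>+w. emeasure (K w) Z \<partial>P y)"
    proof (rule nn_integral_cong)
      fix w assume "w \<in> space (P y)"
      have "emeasure (K w) Z = emeasure (L (path X (\<sigma> w) w)) {w'\<in>\<Omega>. \<sigma> w \<in> a \<and> w' \<in> b}"
        unfolding K_def using ZB
        by (subst emeasure_distr) (auto simp: Z PM intro!: arg_cong[where f="emeasure (L _)"])
      also have "\<dots> = indicator a (\<sigma> w) * emeasure (law X (path X (\<sigma> w) w)) b"
        using sets.sets_into_space[OF bN] by (auto simp: emeasure_L[symmetric] bN Int_absorb1 split: split_indicator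
            intro!: arg_cong[where f="emeasure (L _)"])
      finally show "emeasure (law X (path X (\<sigma> w) w)) b * indicator {w\<in>\<Omega>. \<sigma> w \<in> a} w = emeasure (K w) Z"
        using \<open>w \<in> space (P y)\<close> by (auto split: split_indicator)
    qed
    also have "\<dots> = emeasure ?M2 Z" by (rule emeasure_bind[OF ne KM ZB, symmetric])
    finally show "emeasure ?M1 Z = emeasure ?M2 Z" .
  qed auto
  have "(\<integral>\<^sup>+w. \<Phi> (\<sigma> w) (\<theta> (\<sigma> w) w) \<partial>P y) = (\<integral>\<^sup>+v. (case v of (s, w) \<Rightarrow> \<Phi> s w) \<partial>?M1)"
    by (subst nn_integral_distr) (auto simp: case_prod_beta)
  also have "\<dots> = (\<integral>\<^sup>+w. (\<integral>\<^sup>+v. (case v of (s, w) \<Rightarrow> \<Phi> s w) \<partial>K w) \<partial>P y)"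
    unfolding eq by (rule nn_integral_bind[OF \<Phi> KM])
  also have "\<dots> = (\<integral>\<^sup>+w. (\<integral>\<^sup>+w'. \<Phi> (\<sigma> w) w' \<partial>L (path X (\<sigma> w) w)) \<partial>P y)"
    unfolding K_def by (intro nn_integral_cong) (subst nn_integral_distr, auto simp: PM)
  finally show ?thesis .
qed

lemma stopped_path_law_initial:
  assumes "stopping_time F \<sigma>"
  shows "distr (P y) borel_Delta (\<lambda>w. path X (\<sigma> w) w) \<in> initial_distributions"
  using prob_space.prob_space_distr[OF prob_space_P measurable_stopped_path[OF assms]]
  by (simp add: initial_distributions_def)

lemma AE_shift_N0:
  assumes \<sigma>: "stopping_time F \<sigma>" and B [measurable]: "B \<in> sets N0"
    and null: "AE w in P y. emeasure (L (path X (\<sigma> w) w)) B = 0"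
  shows "AE w in P y. \<theta> (\<sigma> w) w \<notin> B"
proof -
  note [measurable] = measurable_stopped_shift[OF \<sigma>]
  have "(\<integral>\<^sup>+w. indicator B (\<theta> (\<sigma> w) w) \<partial>P y) = (\<integral>\<^sup>+w. (\<integral>\<^sup>+w'. indicator B w' \<partial>L (path X (\<sigma> w) w)) \<partial>P y)"
    by (rule strong_markov_joint[OF \<sigma>]) measurable
  also have "\<dots> = (\<integral>\<^sup>+w. 0 \<partial>P y)"
  proof (rule nn_integral_cong_AE, use null in eventually_elim)
    fix w assume "emeasure (L (path X (\<sigma> w) w)) B = 0"
    then show "(\<integral>\<^sup>+w'. indicator B w' \<partial>L (path X (\<sigma> w) w)) = 0"
      using B by simp
  qed
  finally have "(\<integral>\<^sup>+w. indicator B (\<theta> (\<sigma> w) w) \<partial>P y) = 0" by simp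
  then have "AE w in P y. indicator B (\<theta> (\<sigma> w) w) = (0::ennreal)"
    by (subst (asm) nn_integral_0_iff_AE) measurable
  then show ?thesis by eventually_elim (simp split: split_indicator_asm)
qed

text \<open>The null set need only be measurable for the completions. It is enclosed in a null set of the path
\<open>\<sigma>\<close>-algebra with respect to the mixture by the law of the path at time \<open>\<sigma>\<close>.\<close>

lemma AE_shift_notin:
  assumes \<sigma>: "stopping_time F \<sigma>" and D: "D \<in> sets (F top)" and null: "\<And>z. emeasure (P z) D = 0"
  shows "AE w in P y. \<theta> (\<sigma> w) w \<notin> D"
proof -
  note [measurable] = measurable_stopped_path[OF \<sigma>]
  define \<eta> where "\<eta> = distr (P y) borel_Delta (\<lambda>w. path X (\<sigma> w) w)"
  have \<eta>: "\<eta> \<in> initial_distributions" unfolding \<eta>_def by (rule stopped_path_law_initial[OF \<sigma>])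
  have "D \<in> sets (completion (law_mixture X \<eta>))" using augmented_subset_completion[OF \<eta>] D by blast
  then obtain S M M' where D_eq: "D = S \<union> M" "M \<subseteq> M'" "M' \<in> null_sets (law_mixture X \<eta>)" "S \<in> sets (law_mixture X \<eta>)"
    by (rule sets_completionE)
  then have SM [measurable]: "S \<in> sets N0" "M' \<in> sets N0" by (auto dest: null_setsD2)
  have S: "emeasure (L z) S = 0" for z
    using null[of z] emeasure_mono[of S D "P z"] D_eq D augmented_subset_P[of top z] emeasure_P[of S z] by auto
  have "(\<integral>\<^sup>+z. emeasure (L z) M' \<partial>\<eta>) = 0"
    using null_setsD1[OF D_eq(3)] emeasure_law_mixture[OF \<eta> SM(2)] by simp
  then have "(\<integral>\<^sup>+w. emeasure (L (path X (\<sigma> w) w)) M' \<partial>P y) = 0"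
    unfolding \<eta>_def by (subst (asm) nn_integral_distr) measurable
  then have "AE w in P y. emeasure (L (path X (\<sigma> w) w)) M' = 0"
    by (subst (asm) nn_integral_0_iff_AE) measurable
  then have "AE w in P y. emeasure (L (path X (\<sigma> w) w)) (S \<union> M') = 0"
  proof eventually_elim
    case (elim w)
    then show ?case using S emeasure_subadditive[of S "L (path X (\<sigma> w) w)" M'] SM by simp
  qed
  from AE_shift_N0[OF \<sigma> _ this] have "AE w in P y. \<theta> (\<sigma> w) w \<notin> S \<union> M'" by measurable
  then show ?thesis by eventually_elim (use D_eq in auto)
qed

end

section \<open>Transition densities and the semigroup\<close>

lemma ennreal_eq_minusI: "a + b = c \<Longrightarrow> a < top \<Longrightarrow> b = c - (a::ennreal)"
  by auto

context hunt
begin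

lemma measurable_L_of_N0: "f \<in> N0 \<rightarrow>\<^sub>M M \<Longrightarrow> f \<in> L y \<rightarrow>\<^sub>M M"
  by (simp cong: measurable_cong_sets)

lemma AE_P_of_N0: "{w\<in>\<Omega>. \<not> R w} \<subseteq> B \<Longrightarrow> B \<in> sets N0 \<Longrightarrow> emeasure (L y) B = 0 \<Longrightarrow> AE w in P y. R w"
  by (rule AE_I[where N=B]) (use N0_subset_P emeasure_P in auto)

lemma AE_start: "AE w in P y. path X 0 w = y"
proof (rule AE_P_of_N0)
  have "- {y} \<in> sets borel_Delta"
    unfolding sets_borel_Delta_iff by (cases y) (auto simp: vimage_def Collect_neg_eq)
  from measurable_sets[OF measurable_path this, of 0]
  show *: "{w\<in>\<Omega>. path X 0 w \<noteq> y} \<in> sets N0" by (simp add: vimage_def Int_def conj_commute)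
  show "emeasure (L y) {w\<in>\<Omega>. path X 0 w \<noteq> y} = 0"
    unfolding emeasure_L[OF *] using law_start[of y] * natural_subset_events[of top]
    by (subst (asm) AE_iff_measurable[OF _ refl]) auto
qed simp

text \<open>The two completions, of \<open>law X y\<close> and of its restriction to the path events, integrate the
functions measurable for the smaller one equally.\<close>

lemma expect_eq_P:
  fixes Y :: "'w \<Rightarrow> ennreal"
  assumes Y: "Y \<in> borel_measurable (P (Some x))"
  shows "expect X x Y = (\<integral>\<^sup>+w. Y w \<partial>P (Some x))"
proof -
  from completion_ex_borel_measurable[OF Y[unfolded P_def]]
  obtain Y' where Y' [measurable]: "Y' \<in> borel_measurable (L (Some x))" and ae: "AE w in L (Some x). Y w = Y' w"
    by blast
  then have Y'N: "Y' \<in> borel_measurable N0" by simp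
  obtain B where B: "{w\<in>space (L (Some x)). Y w \<noteq> Y' w} \<subseteq> B" "B \<in> null_sets (L (Some x))"
    using AE_E[OF ae] by (metis null_setsI)
  then have "B \<in> sets N0" by (auto dest: null_setsD2)
  then have "emeasure (law X (Some x)) B = 0" using null_setsD1[OF B(2)] by (simp add: emeasure_L)
  then have "AE w in law X (Some x). Y w = Y' w"
    using B \<open>B \<in> sets N0\<close> natural_subset_events[of top] by (intro AE_I[where N=B]) auto
  then have "expect X x Y = (\<integral>\<^sup>+w. Y' w \<partial>law X (Some x))"
    unfolding expect_def nn_integral_completion by (rule nn_integral_cong_AE)
  also have "\<dots> = (\<integral>\<^sup>+w. Y' w \<partial>L (Some x))" by (rule nn_integral_L[OF Y'N, symmetric])
  also have "\<dots> = (\<integral>\<^sup>+w. Y w \<partial>L (Some x))" by (rule nn_integral_cong_AE) (use ae in auto)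
  finally show ?thesis by (simp add: P_def nn_integral_completion)
qed

lemma sets_P_completion_law: "sets (P y) \<subseteq> sets (completion (law X y))"
proof
  fix A assume "A \<in> sets (P y)"
  then obtain S M M' where A: "A = S \<union> M" "M \<subseteq> M'" "M' \<in> null_sets (L y)" "S \<in> sets (L y)"
    unfolding P_def by (rule sets_completionE)
  then have "M' \<in> null_sets (law X y)" "S \<in> sets (law X y)"
    using natural_subset_events[of top] by (auto simp: null_sets_def emeasure_L)
  then show "A \<in> sets (completion (law X y))" using A by (intro sets_completionI[OF A(1,2)])
qed

end

lemma emeasure_completion_eq_integral:
  "A \<in> sets (completion M) \<Longrightarrow> emeasure (completion M) A = (\<integral>\<^sup>+x. indicator A x \<partial>M)"
  using nn_integral_indicator[of A "completion M"] nn_integral_completion[of M "indicator A"] by simp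

locale ac_hunt = hunt X for X :: "('w, 's::{metric_space, second_countable_topology}) process" +
  fixes m :: "'s measure" and p :: "real \<Rightarrow> 's \<Rightarrow> 's \<Rightarrow> ennreal"
  assumes locally_compact: "locally_compact_space (euclidean :: 's topology)"
    and radon: "radon_measure m" and full: "full_support m" and density_p: "transition_density X m p"
begin

lemma sets_m [simp, measurable_cong]: "sets m = sets borel"
  using radon by (simp add: radon_measure_def)

lemma space_m [simp]: "space m = UNIV"
  using sets_eq_imp_space_eq[OF sets_m] by simp

lemma sigma_finite_m: "sigma_finite_measure m"
proof -
  define \<U> where "\<U> = {U::'s set. open U \<and> (\<exists>K. compact K \<and> U \<subseteq> K)}"
  have cov: "\<Union>\<U> = UNIV"
  proof (intro set_eqI iffI UNIV_I)
    fix x :: 's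
    obtain U K where "open U" "compact K" "x \<in> U" "U \<subseteq> K"
      using locally_compact unfolding locally_compact_space_def by simp metis
    then show "x \<in> \<Union>\<U>" by (auto simp: \<U>_def)
  qed
  obtain \<V> where \<V>: "\<V> \<subseteq> \<U>" "countable \<V>" "\<Union>\<V> = \<Union>\<U>"
    using Lindelof[of \<U>] by (auto simp: \<U>_def)
  show ?thesis
  proof
    show "\<exists>A. countable A \<and> A \<subseteq> sets m \<and> \<Union>A = space m \<and> (\<forall>a\<in>A. emeasure m a \<noteq> \<infinity>)"
    proof (intro exI[of _ \<V>] conjI ballI)
      fix U assume "U \<in> \<V>"
      then obtain K where K: "compact K" "U \<subseteq> K" using \<V> by (auto simp: \<U>_def)
      then have "emeasure m U \<le> emeasure m K" by (intro emeasure_mono) (auto simp: compact_imp_closed)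
      also have "\<dots> < \<infinity>" using radon K by (auto simp: radon_measure_def)
      finally show "emeasure m U \<noteq> \<infinity>" by simp
    qed (use \<V> cov in \<open>auto simp: \<U>_def\<close>)
  qed
qed

sublocale m: sigma_finite_measure m
  by (rule sigma_finite_m)

text \<open>The density continued by 0 to nonpositive times, which makes it Borel on the whole line.\<close>

definition q :: "real \<Rightarrow> 's \<Rightarrow> 's \<Rightarrow> ennreal" where
  "q t x y = (if 0 < t then p t x y else 0)"

lemma measurable_q_triple: "(\<lambda>(t, x, y). q t x y) \<in> borel_measurable (borel \<Otimes>\<^sub>M (borel \<Otimes>\<^sub>M borel))"
proof -
  let ?S = "{0::real<..} \<times> (UNIV :: ('s \<times> 's) set)"
  have S: "?S \<inter> space borel \<in> sets borel" by (auto intro!: borel_open open_Times)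
  have "(\<lambda>(t, x, y). p t x y) \<in> borel_measurable (restrict_space borel ?S)"
    using density_p by (simp add: transition_density_def)
  then have "(\<lambda>w. if w \<in> ?S then (case w of (t, x, y) \<Rightarrow> p t x y) else 0) \<in> borel_measurable borel"
    by (subst (asm) measurable_restrict_space_iff[OF S, of 0]) auto
  also have "(\<lambda>w. if w \<in> ?S then (case w of (t, x, y) \<Rightarrow> p t x y) else 0) = (\<lambda>(t, x, y). q t x y)"
    by (auto simp: q_def fun_eq_iff)
  finally show ?thesis by (simp add: borel_prod)
qed

lemma measurable_q [measurable (raw)]:
  "f \<in> borel_measurable M \<Longrightarrow> g \<in> borel_measurable M \<Longrightarrow> h \<in> borel_measurable M \<Longrightarrow>
    (\<lambda>w. q (f w) (g w) (h w)) \<in> borel_measurable M"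
  using measurable_compose[OF measurable_Pair[OF _ measurable_Pair] measurable_q_triple, of f M g h] by simp

lemma q_sym: "q t x y = q t y x"
  using density_p by (auto simp: transition_density_def q_def)

lemma q_semigroup: "0 < s \<Longrightarrow> 0 < t \<Longrightarrow> q (t + s) x y = (\<integral>\<^sup>+z. q t x z * q s z y \<partial>m)"
  using density_p by (simp add: transition_density_def q_def)

text \<open>The transition semigroup at times \<open>t > 0\<close>; it is 0 for \<open>t \<le> 0\<close>.\<close>

definition Pt :: "real \<Rightarrow> ('s \<Rightarrow> ennreal) \<Rightarrow> 's \<Rightarrow> ennreal" where
  "Pt t h x = (\<integral>\<^sup>+y. q t x y * h y \<partial>m)"

lemma measurable_Pt [measurable (raw)]:
  assumes [measurable]: "f \<in> borel_measurable M" "g \<in> borel_measurable M" "(\<lambda>(w, y). h w y) \<in> borel_measurable (M \<Otimes>\<^sub>M borel)"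
  shows "(\<lambda>w. Pt (f w) (h w) (g w)) \<in> borel_measurable M"
  unfolding Pt_def by measurable

lemma nn_integral_path_Some:
  assumes t: "0 < t" and h [measurable]: "h \<in> borel_measurable borel"
  shows "(\<integral>\<^sup>+w. case_option 0 h (path X (ennreal t) w) \<partial>L (Some x)) = Pt t h x"
proof -
  let ?M = "law X (Some x)" and ?A = "{w. path X (ennreal t) w \<noteq> \<Delta>}"
  have [measurable]: "path X (ennreal t) \<in> ?M \<rightarrow>\<^sub>M borel_Delta" by simp
  have A: "?A \<inter> space ?M \<in> sets ?M"
  proof -
    have "path X (ennreal t) -` (UNIV - {\<Delta>}) \<inter> space ?M \<in> sets ?M"
      by (rule measurable_sets[of _ _ borel_Delta]) (auto intro!: sets.Diff sets.top[of borel_Delta, simplified])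
    also have "path X (ennreal t) -` (UNIV - {\<Delta>}) \<inter> space ?M = ?A \<inter> space ?M" by auto
    finally show ?thesis .
  qed
  have "Pt t h x = (\<integral>\<^sup>+y. h y \<partial>density m (p t x))"
    unfolding Pt_def
  proof (subst nn_integral_density)
    have "(\<lambda>y. q t x y) \<in> borel_measurable m" by measurable
    then show "p t x \<in> borel_measurable m" using t by (simp add: q_def)
  qed (use t in \<open>simp_all add: q_def\<close>)
  also have "density m (p t x) = transition_kernel X (ennreal t) x"
    using density_p t by (simp add: transition_density_def)
  also have "(\<integral>\<^sup>+y. h y \<partial>transition_kernel X (ennreal t) x) =
      (\<integral>\<^sup>+w. h (the (path X (ennreal t) w)) \<partial>restrict_space ?M ?A)"
    unfolding transition_kernel_def
    by (subst nn_integral_distr) (auto intro!: measurable_restrict_space1)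
  also have "\<dots> = (\<integral>\<^sup>+w. h (the (path X (ennreal t) w)) * indicator ?A w \<partial>?M)"
    by (rule nn_integral_restrict_space[OF A])
  also have "\<dots> = (\<integral>\<^sup>+w. case_option 0 h (path X (ennreal t) w) \<partial>?M)"
    by (intro nn_integral_cong) (auto split: option.split split_indicator)
  also have "\<dots> = (\<integral>\<^sup>+w. case_option 0 h (path X (ennreal t) w) \<partial>L (Some x))"
    by (rule nn_integral_L[symmetric]) (rule measurable_compose[OF measurable_path borel_measurable_case_option], simp)
  finally show ?thesis by simp
qed

lemma Pt_le_1:
  assumes "\<And>x. h x \<le> 1" and [measurable]: "h \<in> borel_measurable borel"
  shows "Pt t h x \<le> 1"
proof (cases "0 < t")
  case True
  have "Pt t h x = (\<integral>\<^sup>+w. case_option 0 h (path X (ennreal t) w) \<partial>L (Some x))"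
    using nn_integral_path_Some[OF True] by simp
  also have "\<dots> \<le> (\<integral>\<^sup>+w. 1 \<partial>L (Some x))"
    using assms by (intro nn_integral_mono) (auto split: option.split)
  also have "\<dots> = 1" using prob_space.emeasure_space_1[OF prob_space_L[of "Some x"]] by simp
  finally show ?thesis .
qed (simp add: Pt_def q_def)

lemma nn_integral_path_general:
  assumes t: "0 < t" and h [measurable]: "h \<in> borel_measurable borel_Delta"
  shows "(\<integral>\<^sup>+w. h (path X (ennreal t) w) \<partial>L (Some x)) =
    Pt t (\<lambda>y. h (Some y)) x + h \<Delta> * (1 - Pt t (\<lambda>_. 1) x)"
proof -
  have hS [measurable]: "(\<lambda>y. h (Some y)) \<in> borel_measurable borel" by measurable
  note c = measurable_compose[OF measurable_path borel_measurable_case_option]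
  have [measurable]: "(\<lambda>w. case_option 0 (\<lambda>y. h (Some y)) (path X (ennreal t) w)) \<in> borel_measurable (L (Some x))"
    "(\<lambda>w. case_option 1 (\<lambda>y. 0 :: ennreal) (path X (ennreal t) w)) \<in> borel_measurable (L (Some x))"
    "(\<lambda>w. case_option 0 (\<lambda>y. 1 :: ennreal) (path X (ennreal t) w)) \<in> borel_measurable (L (Some x))"
    by (rule measurable_L_of_N0, rule c, simp)+
  have "(\<integral>\<^sup>+w. case_option 0 (\<lambda>y. 1) (path X (ennreal t) w) \<partial>L (Some x)) +
      (\<integral>\<^sup>+w. case_option 1 (\<lambda>y. 0) (path X (ennreal t) w) \<partial>L (Some x)) = (\<integral>\<^sup>+w. 1 \<partial>L (Some x))"
    by (subst nn_integral_add[symmetric], measurable, rule nn_integral_cong) (simp split: option.split)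
  also have "\<dots> = 1" using prob_space.emeasure_space_1[OF prob_space_L[of "Some x"]] by simp
  finally have "Pt t (\<lambda>_. 1) x + (\<integral>\<^sup>+w. case_option 1 (\<lambda>y. 0) (path X (ennreal t) w) \<partial>L (Some x)) = 1"
    using nn_integral_path_Some[OF t, of "\<lambda>_. 1"] by simp
  then have K: "(\<integral>\<^sup>+w. case_option 1 (\<lambda>y. 0) (path X (ennreal t) w) \<partial>L (Some x)) = 1 - Pt t (\<lambda>_. 1) x"
    using Pt_le_1[of "\<lambda>_. 1" t x] by (intro ennreal_eq_minusI) (auto simp: less_top[symmetric] top_unique)
  have "(\<integral>\<^sup>+w. h (path X (ennreal t) w) \<partial>L (Some x)) =
    (\<integral>\<^sup>+w. case_option 0 (\<lambda>y. h (Some y)) (path X (ennreal t) w) + h \<Delta> * case_option 1 (\<lambda>y. 0) (path X (ennreal t) w) \<partial>L (Some x))"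
    by (intro nn_integral_cong) (auto split: option.split)
  also have "\<dots> = Pt t (\<lambda>y. h (Some y)) x + h \<Delta> * (1 - Pt t (\<lambda>_. 1) x)"
    using nn_integral_path_Some[OF t hS] K by (subst nn_integral_add) (auto simp: nn_integral_cmult)
  finally show ?thesis .
qed

lemma exists_weight: "\<exists>k\<in>borel_measurable borel. (\<forall>x::'s. 0 < k x \<and> k x \<le> 1) \<and> (\<integral>\<^sup>+x. k x \<partial>m) < \<infinity>"
proof -
  obtain h where h: "h \<in> borel_measurable m" "integral\<^sup>N m h \<noteq> \<infinity>" "\<And>x. 0 < h x \<and> h x < \<infinity>"
    using m.Ex_finite_integrable_function by auto
  then have [measurable]: "h \<in> borel_measurable borel" by simp
  have "(\<integral>\<^sup>+x. min (h x) 1 \<partial>m) \<le> integral\<^sup>N m h" by (intro nn_integral_mono) auto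
  then show ?thesis using h by (intro bexI[of _ "\<lambda>x. min (h x) 1"]) (auto simp: less_top[symmetric] top_unique)
qed

text \<open>A function of the augmented \<open>\<sigma>\<close>-algebra is measurable for the completion of \<open>P\<^sub>\<nu>\<close>, where \<open>\<nu>\<close> is
a probability measure on \<open>S\<close> equivalent to \<open>m\<close>. The exceptional set \<open>B\<close> depends on \<open>\<nu>\<close> and is null only
for \<open>m\<close>-almost every starting point.\<close>

lemma N0_version:
  assumes f: "f \<in> borel_measurable (F top)"
  shows "\<exists>f'\<in>borel_measurable N0. \<exists>B\<in>sets N0. (AE y in m. emeasure (L (Some y)) B = 0) \<and> (\<forall>w\<in>\<Omega> - B. (f w :: ennreal) = f' w)"
proof -
  obtain k where [measurable]: "k \<in> borel_measurable borel" and k: "\<And>x::'s. 0 < k x" "(\<integral>\<^sup>+x. k x \<partial>m) < \<infinity>"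
    using exists_weight by auto
  define c where "c = (\<integral>\<^sup>+x. k x \<partial>m)"
  have "c \<noteq> 0"
  proof
    assume "c = 0"
    then have "AE x in m. k x = 0" unfolding c_def by (subst (asm) nn_integral_0_iff_AE) auto
    then have "AE x in m. False" by eventually_elim (use k in \<open>auto simp: less_le\<close>)
    then have "emeasure m UNIV = 0" by (subst (asm) AE_iff_measurable[OF _ refl]) auto
    then show False using full by (auto simp: full_support_def)
  qed
  define \<nu> where "\<nu> = distr (density m (\<lambda>x. k x / c)) borel_Delta Some"
  have "(\<integral>\<^sup>+x. k x / c \<partial>m) = 1"
    using \<open>c \<noteq> 0\<close> k by (subst nn_integral_divide) (auto simp: c_def[symmetric] intro!: ennreal_divide_self)
  then have "prob_space (density m (\<lambda>x. k x / c))"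
    by (intro prob_spaceI) (simp add: emeasure_density)
  then have \<nu>: "\<nu> \<in> initial_distributions"
    unfolding \<nu>_def initial_distributions_def by (auto intro!: prob_space.prob_space_distr)
  have fc: "f \<in> borel_measurable (completion (law_mixture X \<nu>))"
  proof (rule measurableI)
    fix A :: "ennreal set" assume "A \<in> sets borel"
    from measurable_sets[OF f this] show "f -` A \<inter> space (completion (law_mixture X \<nu>)) \<in> sets (completion (law_mixture X \<nu>))"
      using augmented_subset_completion[OF \<nu>, of top] by auto
  qed simp
  from completion_ex_borel_measurable[OF this]
  obtain f' where f': "f' \<in> borel_measurable (law_mixture X \<nu>)" and ae: "AE w in law_mixture X \<nu>. f w = f' w" by blast
  obtain B where B: "{w\<in>space (law_mixture X \<nu>). f w \<noteq> f' w} \<subseteq> B" "B \<in> null_sets (law_mixture X \<nu>)"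
    using AE_E[OF ae] by (metis null_setsI)
  then have [measurable]: "B \<in> sets N0" by (auto dest: null_setsD2)
  have "0 = (\<integral>\<^sup>+z. emeasure (L z) B \<partial>\<nu>)"
    using emeasure_law_mixture[OF \<nu>, of B] null_setsD1[OF B(2)] by simp
  also have "\<dots> = (\<integral>\<^sup>+y. k y / c * emeasure (L (Some y)) B \<partial>m)"
    unfolding \<nu>_def by (subst nn_integral_distr, simp, simp, subst nn_integral_density) auto
  finally have "AE y in m. k y / c * emeasure (L (Some y)) B = 0"
    by (subst (asm) eq_commute, subst (asm) nn_integral_0_iff_AE) auto
  then have "AE y in m. emeasure (L (Some y)) B = 0"
    by eventually_elim (use k in \<open>auto simp: less_le c_def ennreal_divide_eq_0_iff\<close>)
  then show ?thesis using f' B by (intro bexI[of _ f'] bexI[of _ B]) (auto cong: measurable_cong_sets)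
qed

text \<open>The law of the path at a positive time does not charge \<open>m\<close>-null sets, so an exceptional set of
starting points disappears after an arbitrarily short time.\<close>

lemma AE_shift_positive_time:
  assumes B [measurable]: "B \<in> sets N0" and null: "AE y in m. emeasure (L (Some y)) B = 0" and t: "0 < t"
  shows "AE w in P (Some x). path X (ennreal t) w = \<Delta> \<or> \<theta> (ennreal t) w \<notin> B"
proof -
  define C where "C = B \<inter> {w\<in>\<Omega>. path X 0 w \<in> UNIV - {\<Delta>}}"
  have [measurable]: "UNIV - {\<Delta>} \<in> sets (borel_Delta :: 's option measure)"
    using sets.top[of "borel_Delta :: 's option measure"] by (intro sets.Diff) auto
  have [measurable]: "C \<in> sets N0"
    unfolding C_def using measurable_sets[OF measurable_path[of 0], of "UNIV - {\<Delta>}"]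
    by (intro sets.Int B) (simp add: vimage_def Int_def conj_commute)
  define g where "g y = emeasure (L (Some y)) B" for y
  have [measurable]: "g \<in> borel_measurable borel" unfolding g_def by measurable
  have LC: "emeasure (L z) C \<le> case_option 0 g z" for z
  proof (cases z)
    case None
    have "emeasure (P \<Delta>) C = (\<integral>\<^sup>+w. indicator C w \<partial>P \<Delta>)"
      by (rule nn_integral_indicator[symmetric]) (use N0_subset_P \<open>C \<in> sets N0\<close> in blast)
    also have "\<dots> = (\<integral>\<^sup>+w. 0 \<partial>P \<Delta>)"
      using AE_start[of \<Delta>] by (intro nn_integral_cong_AE) (auto simp: C_def elim!: eventually_mono)
    finally show ?thesis using None by (simp add: emeasure_P)
  next
    case (Some y)
    then show ?thesis by (auto simp: g_def C_def intro!: emeasure_mono)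
  qed
  have "(\<integral>\<^sup>+w. case_option 0 g (path X (ennreal t) w) \<partial>P (Some x)) = Pt t g x"
    using nn_integral_path_Some[OF t, of g x]
      measurable_compose[OF measurable_path borel_measurable_case_option[of g 0]] by (subst nn_integral_P) auto
  also have "\<dots> = (\<integral>\<^sup>+y. 0 \<partial>m)"
    unfolding Pt_def using null by (intro nn_integral_cong_AE) (auto simp: g_def)
  finally have "(\<integral>\<^sup>+w. case_option 0 g (path X (ennreal t) w) \<partial>P (Some x)) = 0" by simp
  then have "AE w in P (Some x). case_option 0 g (path X (ennreal t) w) = 0"
    using measurable_P_of_N0[OF measurable_compose[OF measurable_path borel_measurable_case_option[of g 0]]]
    by (subst (asm) nn_integral_0_iff_AE) auto
  then have "AE w in P (Some x). emeasure (L (path X (ennreal t) w)) C = 0"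
    by eventually_elim (use LC in \<open>metis le_zero_eq\<close>)
  from AE_shift_N0[OF stopping_time_const _ this]
  have "AE w in P (Some x). \<theta> (ennreal t) w \<notin> C" by measurable
  then show ?thesis
    using AE_space[of "P (Some x)"] by eventually_elim (auto simp: C_def)
qed

end

section \<open>Inverse clocks with path-measurable versions\<close>

locale strict_pcaf = ac_hunt X m p
  for X :: "('w, 's::{metric_space, second_countable_topology}) process" and m p +
  fixes A :: "real \<Rightarrow> 'w \<Rightarrow> ennreal"
  assumes pcaf: "pcaf X A"
begin

definition \<Lambda> :: "'w set" where
  "\<Lambda> = (SOME \<Lambda>. defining_set X A \<Lambda> \<and> (\<forall>w\<in>\<Omega> - \<Lambda>. \<forall>t\<ge>0. A t w = 0) \<and> {w\<in>\<Omega>. lifetime X w = 0} \<subseteq> \<Lambda>)"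

lemma defining: "defining_set X A \<Lambda>"
  and A_off: "w \<in> \<Omega> \<Longrightarrow> w \<notin> \<Lambda> \<Longrightarrow> 0 \<le> t \<Longrightarrow> A t w = 0"
  and dead_defining: "w \<in> \<Omega> \<Longrightarrow> lifetime X w = 0 \<Longrightarrow> w \<in> \<Lambda>"
proof -
  have "\<exists>\<Lambda>. defining_set X A \<Lambda> \<and> (\<forall>w\<in>\<Omega> - \<Lambda>. \<forall>t\<ge>0. A t w = 0) \<and> {w\<in>\<Omega>. lifetime X w = 0} \<subseteq> \<Lambda>"
    using pcaf by (simp add: pcaf_def)
  from someI_ex[OF this, folded \<Lambda>_def]
  show "defining_set X A \<Lambda>" "w \<in> \<Omega> \<Longrightarrow> w \<notin> \<Lambda> \<Longrightarrow> 0 \<le> t \<Longrightarrow> A t w = 0"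
    "w \<in> \<Omega> \<Longrightarrow> lifetime X w = 0 \<Longrightarrow> w \<in> \<Lambda>" by auto
qed

lemma \<Lambda>_sets: "\<Lambda> \<in> sets (F top)"
  and A_continuous: "w \<in> \<Lambda> \<Longrightarrow> continuous_on {0..} (\<lambda>t. A t w)"
  and A_0: "w \<in> \<Lambda> \<Longrightarrow> A 0 w = 0"
  and A_finite: "w \<in> \<Lambda> \<Longrightarrow> 0 \<le> t \<Longrightarrow> ennreal t < lifetime X w \<Longrightarrow> A t w < \<infinity>"
  and A_after: "w \<in> \<Lambda> \<Longrightarrow> 0 \<le> t \<Longrightarrow> lifetime X w \<le> ennreal t \<Longrightarrow> A t w = A (enn2real (lifetime X w)) w"
  and A_additive: "w \<in> \<Lambda> \<Longrightarrow> 0 \<le> s \<Longrightarrow> 0 \<le> t \<Longrightarrow> A (t + s) w = A t w + A s (\<theta> (ennreal t) w)"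
  using defining unfolding defining_set_def by (force simp: image_subset_iff)+

lemma A_adapted: "0 \<le> t \<Longrightarrow> A t \<in> borel_measurable (F (ennreal t))"
  using pcaf by (simp add: pcaf_def)

lemma \<Lambda>_subset: "\<Lambda> \<subseteq> \<Omega>"
  using sets.sets_into_space[OF \<Lambda>_sets] by simp

text \<open>Off the defining set the path of \<open>A\<close> is zero, which is also a clock.\<close>

lemma clock_path_A:
  assumes "w \<in> \<Omega>" shows "clock_path (lifetime X w) (\<lambda>t. A t w)"
proof (cases "w \<in> \<Lambda>")
  case True
  have "A s w \<le> A t w" if "0 \<le> s" "s \<le> t" for s t
    using A_additive[OF True, of "t - s" s] that by simp
  then show ?thesis
    unfolding clock_path_def mono_on_def
    using A_continuous[OF True] A_0[OF True] A_finite[OF True] A_after[OF True] by auto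
next
  case False
  have "continuous_on {0..} (\<lambda>t. A t w) \<longleftrightarrow> continuous_on {0..} (\<lambda>t::real. 0 :: ennreal)"
    by (rule continuous_on_cong) (auto simp: A_off[OF assms False])
  then show ?thesis using A_off[OF assms False] by (auto simp: clock_path_def mono_on_def)
qed

definition \<tau> :: "real \<Rightarrow> 'w \<Rightarrow> ennreal" where
  "\<tau> u w = clock_inverse (\<lambda>t. A t w) u"

lemma \<tau>_less_iff: "w \<in> \<Omega> \<Longrightarrow> 0 \<le> t \<Longrightarrow> \<tau> u w < ennreal t \<longleftrightarrow> ennreal u < A t w"
  unfolding \<tau>_def by (rule clock_inverse_less_iff[OF clock_path_A])

lemma \<tau>_lifetime: "w \<in> \<Omega> \<Longrightarrow> \<tau> u w < \<infinity> \<Longrightarrow> \<tau> u w < lifetime X w"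
  unfolding \<tau>_def by (rule clock_inverse_lifetime[OF clock_path_A])

lemma A_measurable: "0 \<le> t \<Longrightarrow> A t \<in> borel_measurable (F top)"
  using A_adapted[of t] augmented_mono[of "ennreal t" top]
  by (auto simp: measurable_def)

lemma \<tau>_rational: "w \<in> \<Omega> \<Longrightarrow> \<tau> u w = (INF r\<in>{0..} \<inter> \<rat>. if ennreal u < A r w then ennreal r else \<infinity>)"
  unfolding \<tau>_def by (rule clock_inverse_rational[OF clock_path_A])

text \<open>\<open>\<tau> u \<le> t\<close> means that \<open>A\<close> exceeds \<open>u\<close> immediately after \<open>t\<close>; right continuity of the
filtration makes this an event of time \<open>t\<close>.\<close>

lemma stopping_\<tau>: "stopping_time F (\<tau> u)"
proof
  fix t
  show "Measurable.pred (F t) (\<lambda>w. \<tau> u w \<le> t)"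
  proof (cases t)
    case (real r)
    have "{w\<in>\<Omega>. \<tau> u w \<le> t} \<in> sets (F v)" if v: "t < v" for v
    proof -
      obtain r' where r': "t < ennreal r'" "ennreal r' < v" "0 \<le> r'"
        using dense[OF v] by (metis enn2real_nonneg ennreal_enn2real top_greatest order.strict_trans2)
      have "r < r'" using r' real by (simp add: ennreal_less_iff)
      have "\<tau> u w \<le> t \<longleftrightarrow> (\<forall>n. ennreal u < A (r + (r' - r) / real (Suc n)) w)" if w: "w \<in> \<Omega>" for w
      proof
        assume "\<tau> u w \<le> t"
        show "\<forall>n. ennreal u < A (r + (r' - r) / real (Suc n)) w"
        proof
          fix n
          have "0 < (r' - r) / real (Suc n)" using \<open>r < r'\<close> by simp
          then have "t < ennreal (r + (r' - r) / real (Suc n))"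
            unfolding real(2) by (intro ennreal_lessI) (use real in linarith)+
          with \<open>\<tau> u w \<le> t\<close> have "\<tau> u w < ennreal (r + (r' - r) / real (Suc n))"
            by (rule le_less_trans)
          then show "ennreal u < A (r + (r' - r) / real (Suc n)) w"
            using \<tau>_less_iff[OF w, of "r + (r' - r) / real (Suc n)" u] \<open>r < r'\<close> real by simp
        qed
      next
        assume *: "\<forall>n. ennreal u < A (r + (r' - r) / real (Suc n)) w"
        have "(\<lambda>n. ennreal (r + (r' - r) * inverse (real (Suc n)))) \<longlonglongrightarrow> ennreal (r + (r' - r) * 0)"
          by (intro tendsto_intros LIMSEQ_inverse_real_of_nat)
        moreover have "\<tau> u w \<le> ennreal (r + (r' - r) * inverse (real (Suc n)))" for n
          using *[rule_format, of n] \<tau>_less_iff[OF w, of "r + (r' - r) / real (Suc n)" u] \<open>r < r'\<close> real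
          by (simp add: divide_inverse)
        ultimately show "\<tau> u w \<le> t" using real
          by (auto intro: tendsto_lowerbound[of _ _ sequentially])
      qed
      then have "{w\<in>\<Omega>. \<tau> u w \<le> t} = {w\<in>space (F v). \<forall>n. ennreal u < A (r + (r' - r) / real (Suc n)) w}"
        by auto
      also have "\<dots> \<in> sets (F v)"
      proof (rule sets.sets_Collect_countable_All)
        fix n
        let ?s = "r + (r' - r) / real (Suc n)"
        have "?s \<le> r + (r' - r) / 1" using \<open>r < r'\<close> by (intro add_left_mono divide_left_mono) auto
        then have "ennreal ?s \<le> v" using r' by (auto intro: order_trans[OF ennreal_leI] less_imp_le)
        have "A ?s \<in> borel_measurable (F (ennreal ?s))" using \<open>r < r'\<close> real by (intro A_adapted) auto
        from measurable_sets[OF this, of "{ennreal u<..}"]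
        have "{w\<in>space (F v). ennreal u < A ?s w} \<in> sets (F (ennreal ?s))"
          by (simp add: vimage_def Int_def conj_commute)
        then show "{w\<in>space (F v). ennreal u < A ?s w} \<in> sets (F v)"
          using augmented_mono[OF \<open>ennreal ?s \<le> v\<close>] by blast
      qed
      finally show ?thesis .
    qed
    then have "{w\<in>\<Omega>. \<tau> u w \<le> t} \<in> sets (F t)"
      using right_continuous[of t] real by auto
    then show ?thesis by (simp add: pred_def)
  qed simp
qed

lemma A_bad: "\<exists>f'\<in>borel_measurable N0. \<exists>B\<in>sets N0. (AE y in m. emeasure (L (Some y)) B = 0) \<and>
    (\<forall>w\<in>\<Omega> - B. A r w = f' w)" if "0 \<le> r"
  by (rule N0_version[OF A_measurable[OF that]])

text \<open>A version with respect to \<open>m\<close>-almost every starting point.\<close>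

definition A' :: "real \<Rightarrow> 'w \<Rightarrow> ennreal" where
  "A' r = (SOME f'. f' \<in> borel_measurable N0 \<and> (\<exists>B\<in>sets N0. (AE y in m. emeasure (L (Some y)) B = 0) \<and>
    (\<forall>w\<in>\<Omega> - B. A r w = f' w)))"

lemma A'_props:
  assumes "0 \<le> r"
  shows "A' r \<in> borel_measurable N0"
    and "\<exists>B\<in>sets N0. (AE y in m. emeasure (L (Some y)) B = 0) \<and> (\<forall>w\<in>\<Omega> - B. A r w = A' r w)"
  using someI_ex[of "\<lambda>f'. f' \<in> borel_measurable N0 \<and> (\<exists>B\<in>sets N0. (AE y in m. emeasure (L (Some y)) B = 0) \<and>
    (\<forall>w\<in>\<Omega> - B. A r w = f' w))", folded A'_def] A_bad[OF assms] by blast+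

text \<open>A version with respect to every starting point. As \<open>A\<^sub>r \<circ> \<theta>\<^sub>e = A\<^sub>r\<^sub>+\<^sub>e - A\<^sub>e\<close> tends to \<open>A\<^sub>r\<close>, the value of
\<open>A\<^sub>r\<close> can be read off from the paths shifted by \<open>1/n\<close>, and there \<open>A' r\<close> may replace \<open>A r\<close>.\<close>

definition Ah :: "real \<Rightarrow> 'w \<Rightarrow> ennreal" where
  "Ah r w = (if path X 0 w = \<Delta> then 0
     else limsup (\<lambda>n. if path X (ennreal (1 / real (Suc n))) w = \<Delta> then 0 else A' r (\<theta> (ennreal (1 / real (Suc n))) w)))"

lemma measurable_alive [measurable]: "Measurable.pred N0 (\<lambda>w. path X t w = \<Delta>)"
proof -
  have "path X t -` {\<Delta>} \<inter> space N0 \<in> sets N0" by (rule measurable_sets[OF measurable_path]) simp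
  then show ?thesis by (simp add: pred_def vimage_def Int_def conj_commute)
qed

lemma measurable_Ah: "0 \<le> r \<Longrightarrow> Ah r \<in> borel_measurable N0"
proof -
  assume "0 \<le> r"
  have [measurable]: "(\<lambda>w. A' r (\<theta> t w)) \<in> borel_measurable N0" for t
    by (rule measurable_compose[OF measurable_shift A'_props(1)[OF \<open>0 \<le> r\<close>]])
  show ?thesis unfolding Ah_def[abs_def] by measurable
qed

lemma lifetime_zero_iff: "w \<in> \<Omega> \<Longrightarrow> lifetime X w = 0 \<longleftrightarrow> path X 0 w = \<Delta>"
  using path_after_lifetime[of w 0] by (auto simp: lifetime_def intro!: antisym Inf_lower)

lemma dead_A:
  assumes "w \<in> \<Omega>" "path X 0 w = \<Delta>" "0 \<le> t"
  shows "A t w = 0"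
proof -
  have z: "lifetime X w = 0" using lifetime_zero_iff assms by simp
  then have "w \<in> \<Lambda>" using dead_defining assms by simp
  then show ?thesis using A_after[of w t] A_0[of w] z assms by simp
qed

lemma AE_\<Lambda>: "AE w in P y. w \<in> \<Lambda>"
proof (cases y)
  case (Some x)
  have \<Lambda>P: "\<Lambda> \<in> sets (P y)" for y using \<Lambda>_sets augmented_subset_P by blast
  have "1 = emeasure (completion (law X (Some x))) \<Lambda>"
    using defining by (simp add: defining_set_def)
  also have "\<dots> = (\<integral>\<^sup>+w. indicator \<Lambda> w \<partial>law X (Some x))"
    using \<Lambda>P sets_P_completion_law by (intro emeasure_completion_eq_integral) blast
  also have "\<dots> = expect X x (indicator \<Lambda>)"
    by (simp add: expect_def nn_integral_completion)
  also have "\<dots> = emeasure (P (Some x)) \<Lambda>"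
    using \<Lambda>P by (subst expect_eq_P) auto
  finally have "emeasure (P (Some x)) \<Lambda> = 1" by simp
  then show ?thesis
    using prob_space.AE_in_set_eq_1[OF prob_space_P \<Lambda>P] Some by (simp add: measure_def)
next
  case None
  show ?thesis
    using AE_start[of \<Delta>] AE_space[of "P \<Delta>"] unfolding None
    by eventually_elim (auto intro!: dead_defining simp: lifetime_zero_iff)
qed

lemma AE_Ah: assumes r: "0 \<le> r" shows "AE w in P y. Ah r w = A r w"
proof (cases y)
  case None
  show ?thesis
    using AE_start[of \<Delta>] AE_space[of "P \<Delta>"] unfolding None
    by eventually_elim (auto simp: Ah_def dead_A r)
next
  case (Some x)
  obtain B where B: "B \<in> sets N0" "AE y in m. emeasure (L (Some y)) B = 0" "\<And>w. w \<in> \<Omega> - B \<Longrightarrow> A r w = A' r w"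
    using A'_props(2)[OF r] by blast
  have "AE w in P (Some x). \<forall>n. path X (ennreal (1 / real (Suc n))) w = \<Delta> \<or> \<theta> (ennreal (1 / real (Suc n))) w \<notin> B"
    by (subst AE_all_countable, intro allI AE_shift_positive_time[OF B(1,2)]) simp
  with AE_\<Lambda>[of "Some x"] AE_start[of "Some x"]
  have "AE w in P (Some x). Ah r w = A r w"
  proof eventually_elim
    case (elim w)
    then have w: "w \<in> \<Lambda>" "w \<in> \<Omega>" using \<Lambda>_subset by auto
    let ?e = "\<lambda>n. 1 / real (Suc n)"
    have e: "0 \<le> ?e n" for n by simp
    have "A' r (\<theta> (ennreal (?e n)) w) = A r (\<theta> (ennreal (?e n)) w)" if "path X (ennreal (?e n)) w \<noteq> \<Delta>" for n
      using elim(3)[rule_format, of n] that B(3)[of "\<theta> (ennreal (?e n)) w"] w by auto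
    moreover have "A r (\<theta> (ennreal (?e n)) w) = 0" if "path X (ennreal (?e n)) w = \<Delta>" for n
      using w that r by (intro dead_A) auto
    ultimately have Ah: "Ah r w = limsup (\<lambda>n. A r (\<theta> (ennreal (?e n)) w))"
      using elim(2) by (auto simp: Ah_def intro!: arg_cong[where f=limsup])
    have inv: "(\<lambda>n. ?e n) \<longlonglongrightarrow> 0" using LIMSEQ_inverse_real_of_nat by (simp add: inverse_eq_divide)
    have cont: "(\<lambda>n. A (f n) w) \<longlonglongrightarrow> A l w" if "f \<longlonglongrightarrow> l" "\<And>n. 0 \<le> f n" "0 \<le> l" for f l
      by (rule continuous_on_tendsto_compose[OF A_continuous[OF w(1)] that(1)]) (use that in auto)
    have "lifetime X w \<noteq> 0" using lifetime_zero_iff[OF w(2)] elim(2) by simp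
    then obtain d where d: "0 < d" "ennreal d < lifetime X w"
      using dense[of 0 "lifetime X w"] by (metis ennreal_less_zero_iff enn2real_positive_iff ennreal_enn2real
          top_greatest order.strict_trans2 zero_less_iff_neq_zero)
    have "\<forall>\<^sub>F n in sequentially. ?e n < d" using order_tendstoD(2)[OF inv d(1)] .
    then have "\<forall>\<^sub>F n in sequentially. A (?e n) w < \<infinity>"
    proof eventually_elim
      case (elim n)
      then have "ennreal (?e n) < lifetime X w" using d by (auto intro: le_less_trans[OF ennreal_leI] less_imp_le)
      then show ?case using A_finite[OF w(1) e] by simp
    qed
    then have ev: "\<forall>\<^sub>F n in sequentially. A (?e n + r) w - A (?e n) w = A r (\<theta> (ennreal (?e n)) w)"
      by eventually_elim (use A_additive[OF w(1) r e] in auto)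
    have "(\<lambda>n. A (?e n + r) w - A (?e n) w) \<longlonglongrightarrow> A (0 + r) w - A 0 w"
      using r e A_0[OF w(1)] by (intro tendsto_diff_ennreal_general cont inv tendsto_add tendsto_const) auto
    then have "(\<lambda>n. A r (\<theta> (ennreal (?e n)) w)) \<longlonglongrightarrow> A r w"
      using A_0[OF w(1)] Lim_transform_eventually[OF _ ev] by simp
    then have "limsup (\<lambda>n. A r (\<theta> (ennreal (?e n)) w)) = A r w"
      by (intro lim_imp_Limsup) auto
    then show ?case using Ah by simp
  qed
  then show ?thesis unfolding Some .
qed

text \<open>The inverse clock of \<open>A\<close>, computed from the versions at rational times.\<close>

definition T :: "real \<Rightarrow> 'w \<Rightarrow> ennreal" where
  "T u w = (INF r\<in>{0..} \<inter> \<rat>. if ennreal u < Ah r w then ennreal r else \<infinity>)"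

text \<open>Outside this set, which is null from every starting point, \<open>T\<close> is the inverse clock of \<open>A\<close> and the
additivity of \<open>A\<close> is available.\<close>

definition D :: "'w set" where
  "D = {w\<in>\<Omega>. w \<notin> \<Lambda> \<or> (\<exists>r\<in>{0..} \<inter> \<rat>. Ah r w \<noteq> A r w)}"

lemma measurable_T [measurable (raw)]:
  assumes [measurable]: "f \<in> borel_measurable M" "g \<in> M \<rightarrow>\<^sub>M N0"
  shows "(\<lambda>w. T (f w) (g w)) \<in> borel_measurable M"
  unfolding T_def
proof (intro borel_measurable_INF countable_Int2 countable_rat)
  fix r :: real assume "r \<in> {0..} \<inter> \<rat>"
  then have [measurable]: "(\<lambda>w. Ah r (g w)) \<in> borel_measurable M"
    using measurable_compose[OF assms(2) measurable_Ah] by auto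
  show "(\<lambda>w. if ennreal (f w) < Ah r (g w) then ennreal r else \<infinity>) \<in> borel_measurable M" by measurable
qed

lemma D_sets: "D \<in> sets (F top)"
proof -
  have "{w\<in>space (F top). Ah r w \<noteq> A r w} \<in> sets (F top)" if "0 \<le> r" for r :: real
  proof -
    have [measurable]: "A r \<in> borel_measurable (F top)" using A_measurable[OF that] .
    have [measurable]: "Ah r \<in> borel_measurable (F top)"
      using measurable_Ah[OF that] natural_subset_augmented[of top] by (auto simp: measurable_def)
    show ?thesis by measurable
  qed
  then have "{w\<in>space (F top). \<exists>r\<in>{0..} \<inter> \<rat>. Ah r w \<noteq> A r w} \<in> sets (F top)"
    by (intro sets.sets_Collect_countable_Ex' countable_Int2 countable_rat) auto
  moreover have "D = (\<Omega> - \<Lambda>) \<union> {w\<in>space (F top). \<exists>r\<in>{0..} \<inter> \<rat>. Ah r w \<noteq> A r w}"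
    by (auto simp: D_def)
  moreover have "\<Omega> - \<Lambda> \<in> sets (F top)" using sets.compl_sets[OF \<Lambda>_sets] by simp
  ultimately show ?thesis by auto
qed

lemma AE_D: "AE w in P y. w \<notin> D"
proof -
  have "AE w in P y. \<forall>r\<in>{0..} \<inter> (\<rat> :: real set). Ah r w = A r w"
    by (subst AE_ball_countable) (auto intro: countable_rat AE_Ah)
  then show ?thesis using AE_\<Lambda>[of y] by eventually_elim (auto simp: D_def)
qed

lemma emeasure_D: "emeasure (P y) D = 0"
proof -
  have "D \<in> sets (P y)" using D_sets augmented_subset_P by blast
  then show ?thesis using AE_D[of y] sets.sets_into_space[of D "P y"]
    by (subst (asm) AE_iff_measurable[of D]) (auto simp: D_def)
qed

lemma AE_shift_D: "stopping_time F \<sigma> \<Longrightarrow> AE w in P y. \<theta> (\<sigma> w) w \<notin> D"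
  by (rule AE_shift_notin[OF _ D_sets emeasure_D])

lemma not_D: "w \<in> \<Omega> \<Longrightarrow> w \<notin> D \<Longrightarrow> w \<in> \<Lambda>" "w \<in> \<Omega> \<Longrightarrow> w \<notin> D \<Longrightarrow> T u w = \<tau> u w"
  by (auto simp: D_def T_def \<tau>_rational intro!: INF_cong)

end

section \<open>Integration against the clock\<close>

lemma AE_lborel_neq: "AE v in lborel. v \<noteq> (u::real)"
  by (rule AE_lborel_singleton)

text \<open>Used to identify values of \<open>A\<close>, which are known through the strict inequalities \<open>u < A t\<close>.\<close>

lemma ennreal_eqI_greater:
  fixes x y :: ennreal
  assumes "\<And>t. 0 \<le> t \<Longrightarrow> ennreal t < x \<longleftrightarrow> ennreal t < y"
  shows "x = y"
proof (rule ccontr)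
  assume "x \<noteq> y"
  then have "\<exists>c. min x y < c \<and> c < max x y" by (intro dense) (auto simp: min_def max_def not_le)
  then obtain c where c: "min x y < c" "c < max x y" by blast
  then have "c \<noteq> \<infinity>" using order.strict_trans2[OF c(2) top_greatest] by auto
  then obtain t where "0 \<le> t" "c = ennreal t" by (cases c) auto
  with assms[of t] c show False by (auto simp: min_def max_def split: if_splits)
qed

text \<open>The square is symmetric about the diagonal, which is null.\<close>

lemma square_nn_integral:
  fixes g :: "real \<Rightarrow> ennreal"
  assumes [measurable]: "g \<in> borel_measurable borel"
  shows "(\<integral>\<^sup>+u. g u \<partial>lborel) * (\<integral>\<^sup>+u. g u \<partial>lborel) = 2 * (\<integral>\<^sup>+u. g u * (\<integral>\<^sup>+v\<in>{u<..}. g v \<partial>lborel) \<partial>lborel)"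
proof -
  have "(\<integral>\<^sup>+u. g u \<partial>lborel) * (\<integral>\<^sup>+u. g u \<partial>lborel) = (\<integral>\<^sup>+u. (\<integral>\<^sup>+v. g u * g v \<partial>lborel) \<partial>lborel)"
    by (simp add: nn_integral_cmult nn_integral_multc)
  also have "\<dots> = (\<integral>\<^sup>+u. (\<integral>\<^sup>+v. g u * (g v * indicator {u<..} v) \<partial>lborel) + (\<integral>\<^sup>+v. g v * (g u * indicator {v<..} u) \<partial>lborel) \<partial>lborel)"
  proof (rule nn_integral_cong)
    fix u :: real
    have "(\<integral>\<^sup>+v. g u * g v \<partial>lborel) = (\<integral>\<^sup>+v. g u * (g v * indicator {u<..} v) + g v * (g u * indicator {v<..} u) \<partial>lborel)"
      using AE_lborel_neq[of u] by (intro nn_integral_cong_AE) (auto elim!: eventually_mono split: split_indicator simp: mult.commute)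
    then show "(\<integral>\<^sup>+v. g u * g v \<partial>lborel) = (\<integral>\<^sup>+v. g u * (g v * indicator {u<..} v) \<partial>lborel) + (\<integral>\<^sup>+v. g v * (g u * indicator {v<..} u) \<partial>lborel)"
      by (subst nn_integral_add[symmetric]) (auto simp: greaterThan_def)
  qed
  also have "\<dots> = (\<integral>\<^sup>+u. (\<integral>\<^sup>+v. g u * (g v * indicator {u<..} v) \<partial>lborel) \<partial>lborel) +
      (\<integral>\<^sup>+u. (\<integral>\<^sup>+v. g v * (g u * indicator {v<..} u) \<partial>lborel) \<partial>lborel)"
    by (rule nn_integral_add) (auto simp: greaterThan_def)
  also have "(\<integral>\<^sup>+u. (\<integral>\<^sup>+v. g v * (g u * indicator {v<..} u) \<partial>lborel) \<partial>lborel) =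
      (\<integral>\<^sup>+v. (\<integral>\<^sup>+u. g v * (g u * indicator {v<..} u) \<partial>lborel) \<partial>lborel)"
    by (rule lborel_pair.Fubini') (auto simp: greaterThan_def case_prod_beta)
  finally show ?thesis by (simp add: nn_integral_cmult mult_2)
qed

context strict_pcaf
begin

lemma T_mono: "u \<le> v \<Longrightarrow> T u w \<le> T v w"
  unfolding T_def
proof (rule INF_mono)
  fix r assume "u \<le> v" "r \<in> {0..} \<inter> (\<rat> :: real set)"
  then show "\<exists>r'\<in>{0..} \<inter> \<rat>. (if ennreal u < Ah r' w then ennreal r' else \<infinity>) \<le> (if ennreal v < Ah r w then ennreal r else \<infinity>)"
    by (intro bexI[of _ r]) (auto dest: le_less_trans[OF ennreal_leI])
qed

lemma T_less_iff:
  assumes w: "w \<in> \<Omega>" "w \<notin> D"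
  shows "T u w < t \<longleftrightarrow> ennreal u < pcaf_at A t w"
proof (cases t)
  case (real r)
  then show ?thesis using \<tau>_less_iff[OF w(1), of r u] not_D[OF w] by (simp add: pcaf_at_def)
next
  case top
  then show ?thesis using not_D[OF w] \<tau>_rational[OF w(1), of u]
    by (simp only: pcaf_at_def INF_less_iff less_SUP_iff infinity_ennreal_def if_True simp_thms) (auto intro!: bexI split: if_splits)
qed

lemma pcaf_at_eq:
  assumes w: "w \<in> \<Omega>" "w \<notin> D"
  shows "pcaf_at A t w = (\<integral>\<^sup>+u\<in>{0..}. (if T u w < t then 1 else 0) \<partial>lborel)"
  unfolding T_less_iff[OF w] using lborel_clock_value[of "pcaf_at A t w"]
  by (simp add: indicator_def of_bool_def cong: if_cong)

lemma
  assumes "w \<in> \<Omega>" "w \<notin> D"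
  shows T_inverse: "T u w = ennreal s \<Longrightarrow> 0 \<le> s \<Longrightarrow> A s w = ennreal u"
    and T_alive: "T u w < \<infinity> \<Longrightarrow> path X (T u w) w \<noteq> \<Delta>"
    and T_positive: "0 < u \<Longrightarrow> 0 < T u w"
    and T_strict_mono: "T u w < \<infinity> \<Longrightarrow> 0 \<le> u \<Longrightarrow> u < v \<Longrightarrow> T u w < T v w"
proof -
  show inv: "T u w = ennreal s \<Longrightarrow> 0 \<le> s \<Longrightarrow> A s w = ennreal u" for u s
    using clock_at_inverse[OF clock_path_A[OF assms(1)], of u s] not_D(2)[OF assms] by (simp add: \<tau>_def)
  show "T u w < \<infinity> \<Longrightarrow> path X (T u w) w \<noteq> \<Delta>"
  proof
    assume "T u w < \<infinity>" "path X (T u w) w = \<Delta>"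
    then have "lifetime X w \<le> T u w" by (auto simp: lifetime_def intro: Inf_lower)
    then show False using \<tau>_lifetime[OF assms(1), of u] not_D(2)[OF assms, of u] \<open>T u w < \<infinity>\<close> by simp
  qed
  show "0 < u \<Longrightarrow> 0 < T u w"
    using inv[of u 0] A_0[OF not_D(1)[OF assms]] by (cases "T u w = 0") (auto simp: zero_less_iff_neq_zero)
  assume *: "T u w < \<infinity>" "0 \<le> u" "u < v"
  then obtain s where s: "T u w = ennreal s" "0 \<le> s" by (cases "T u w") auto
  have "T u w \<noteq> T v w" using inv[OF s] inv[of v s] s * by auto
  then show "T u w < T v w" using T_mono[of u v w] * by (simp add: less_le)
qed

lemma shift_lifetime:
  assumes "w \<in> \<Omega>" "lifetime X w \<le> s" shows "lifetime X (\<theta> s w) = 0"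
  using assms lifetime_zero_iff[of "\<theta> s w"] path_after_lifetime[of w s] by simp

lemma T_shift_integral:
  assumes w: "w \<in> \<Omega>" "w \<notin> D" "\<theta> (ennreal s) w \<notin> D" and s: "0 \<le> s" and f: "f \<in> borel_measurable borel"
  shows "(\<integral>\<^sup>+u\<in>{0..}. (if ennreal s \<le> T u w \<and> T u w < \<infinity> then f (T u w) else 0) \<partial>lborel) =
    (\<integral>\<^sup>+v\<in>{0..}. (if T v (\<theta> (ennreal s) w) < \<infinity> then f (ennreal s + T v (\<theta> (ennreal s) w)) else 0) \<partial>lborel)"
  using nn_integral_clock_shift[OF clock_path_A[OF w(1)] clock_path_A[of "\<theta> (ennreal s) w"] s _ _ f]
    shift_lifetime[OF w(1)] A_additive[OF not_D(1)[OF w(1,2)] _ s] w(1) not_D(2)[OF w(1,2)] not_D(2)[of "\<theta> (ennreal s) w"] w(3)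
  by (simp add: \<tau>_def cong: if_cong)

lemma T_shift_at_T:
  assumes w: "w \<in> \<Omega>" "w \<notin> D" "\<theta> (T u w) w \<notin> D" and fin: "T u w < \<infinity>" and u: "0 \<le> u" "0 \<le> v"
  shows "T (u + v) w = T u w + T v (\<theta> (T u w) w)"
proof -
  obtain s where s: "T u w = ennreal s" "0 \<le> s" using fin by (cases "T u w") auto
  have "clock_inverse (\<lambda>t. A t w) (u + v) = ennreal s + clock_inverse (\<lambda>t. A t (\<theta> (ennreal s) w)) v"
    using s w u A_additive[OF not_D(1)[OF w(1,2)] _ s(2)] not_D(2)[OF w(1,2), of u]
    by (intro clock_inverse_shift_at_inverse[OF clock_path_A clock_path_A]) (auto simp: \<tau>_def)
  then show ?thesis
    using s not_D(2)[OF w(1,2), of "u + v"] not_D(2)[of "\<theta> (ennreal s) w" v] w by (simp add: \<tau>_def)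
qed

text \<open>At time \<open>T u\<close> the clock shows \<open>u\<close>.\<close>

lemma pcaf_at_shift_T:
  assumes w: "w \<in> \<Omega>" "w \<notin> D" "\<theta> (T u w) w \<notin> D" and u: "0 \<le> u" and less: "T u w < t"
  shows "pcaf_at A t w = ennreal u + pcaf_at A (t - T u w) (\<theta> (T u w) w)"
proof -
  have fin: "T u w < \<infinity>" using less by (auto intro: less_le_trans)
  have un: "ennreal u < pcaf_at A t w" using T_less_iff[OF w(1,2)] less by simp
  have "ennreal v < pcaf_at A t w \<longleftrightarrow> ennreal v < ennreal u + pcaf_at A (t - T u w) (\<theta> (T u w) w)" if v: "0 \<le> v" for v
  proof (cases "u \<le> v")
    case True
    have "ennreal v < pcaf_at A t w \<longleftrightarrow> T (u + (v - u)) w < t" using T_less_iff[OF w(1,2)] by simp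
    also have "\<dots> \<longleftrightarrow> T u w + T (v - u) (\<theta> (T u w) w) < t"
      using T_shift_at_T[OF w fin u, of "v - u"] True by simp
    also have "\<dots> \<longleftrightarrow> T (v - u) (\<theta> (T u w) w) < t - T u w"
      using less fin by (simp add: less_diff_eq_ennreal add.commute)
    also have "\<dots> \<longleftrightarrow> ennreal (v - u) < pcaf_at A (t - T u w) (\<theta> (T u w) w)"
      using w by (intro T_less_iff) auto
    also have "\<dots> \<longleftrightarrow> ennreal u + ennreal (v - u) < ennreal u + pcaf_at A (t - T u w) (\<theta> (T u w) w)"
      by (auto simp: ennreal_add_left_cancel_less)
    also have "ennreal u + ennreal (v - u) = ennreal v" using True u by (simp flip: ennreal_plus)
    finally show ?thesis .
  next
    case False
    then have "ennreal v < ennreal u" using v by (simp add: ennreal_less_iff)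
    then show ?thesis using un by (auto intro: less_trans less_le_trans)
  qed
  then show ?thesis by (rule ennreal_eqI_greater)
qed

lemma strong_markov_T:
  fixes \<Phi> :: "ennreal \<Rightarrow> 'w \<Rightarrow> ennreal"
  assumes \<Phi> [measurable]: "(\<lambda>(s, w). \<Phi> s w) \<in> borel_measurable (borel \<Otimes>\<^sub>M N0)"
  shows "(\<integral>\<^sup>+w. (if T u w < \<infinity> then \<Phi> (T u w) (\<theta> (T u w) w) else 0) \<partial>P y) =
    (\<integral>\<^sup>+w. (if T u w < \<infinity> then \<integral>\<^sup>+w'. \<Phi> (T u w) w' \<partial>L (path X (T u w) w) else 0) \<partial>P y)"
proof -
  define \<Psi> where "\<Psi> s w = (if s < \<infinity> then \<Phi> s w else 0)" for s w
  have [measurable]: "(\<lambda>(s, w). \<Psi> s w) \<in> borel_measurable (borel \<Otimes>\<^sub>M N0)" unfolding \<Psi>_def by measurable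
  have ae: "AE w in P y. T u w = \<tau> u w"
    using AE_D[of y] AE_space[of "P y"] by eventually_elim (auto simp: not_D)
  have "(\<integral>\<^sup>+w. (if T u w < \<infinity> then \<Phi> (T u w) (\<theta> (T u w) w) else 0) \<partial>P y) = (\<integral>\<^sup>+w. \<Psi> (\<tau> u w) (\<theta> (\<tau> u w) w) \<partial>P y)"
    using ae by (intro nn_integral_cong_AE) (auto simp: \<Psi>_def elim!: eventually_mono)
  also have "\<dots> = (\<integral>\<^sup>+w. (\<integral>\<^sup>+w'. \<Psi> (\<tau> u w) w' \<partial>L (path X (\<tau> u w) w)) \<partial>P y)"
    by (rule strong_markov_joint[OF stopping_\<tau>]) measurable
  also have "\<dots> = (\<integral>\<^sup>+w. (if T u w < \<infinity> then \<integral>\<^sup>+w'. \<Phi> (T u w) w' \<partial>L (path X (T u w) w) else 0) \<partial>P y)"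
    using ae by (intro nn_integral_cong_AE) (auto simp: \<Psi>_def elim!: eventually_mono)
  finally show ?thesis .
qed

text \<open>\<open>V G y = E\<^sub>y \<integral> G(s, X\<^sub>s) dA\<^sub>s\<close>, written with the inverse clock.\<close>

definition V :: "(real \<Rightarrow> 's option \<Rightarrow> ennreal) \<Rightarrow> 's option \<Rightarrow> ennreal" where
  "V G y = (\<integral>\<^sup>+w. (\<integral>\<^sup>+u\<in>{0..}. (if T u w < \<infinity> then G (enn2real (T u w)) (path X (T u w) w) else 0) \<partial>lborel) \<partial>L y)"

lemma measurable_path_T [measurable]: "(\<lambda>w. path X (T (fst w) (snd w)) (snd w)) \<in> borel \<Otimes>\<^sub>M N0 \<rightarrow>\<^sub>M borel_Delta"
  by (rule measurable_path_compose) measurable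

lemma nn_integral_clock_Fubini:
  fixes \<Psi> :: "real \<Rightarrow> 'w \<Rightarrow> ennreal"
  assumes [measurable]: "(\<lambda>(u, w). \<Psi> u w) \<in> borel_measurable (borel \<Otimes>\<^sub>M N0)"
  shows "(\<integral>\<^sup>+w. (\<integral>\<^sup>+u\<in>{0..}. \<Psi> u w \<partial>lborel) \<partial>L y) = (\<integral>\<^sup>+u\<in>{0..}. (\<integral>\<^sup>+w. \<Psi> u w \<partial>P y) \<partial>lborel)"
proof -
  interpret L: prob_space "L y" by simp
  have sec: "\<Psi> u \<in> borel_measurable N0" for u
    using measurable_compose[OF measurable_Pair1'[of u borel N0] assms] by simp
  interpret pair_sigma_finite lborel "L y" ..
  have m: "(\<lambda>(u, w). \<Psi> u w * indicator {0..} u) \<in> borel_measurable (lborel \<Otimes>\<^sub>M L y)"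
    unfolding case_prod_beta atLeast_def by measurable
  have "(\<integral>\<^sup>+w. (\<integral>\<^sup>+u\<in>{0..}. \<Psi> u w \<partial>lborel) \<partial>L y) = (\<integral>\<^sup>+u. (\<integral>\<^sup>+w. \<Psi> u w * indicator {0..} u \<partial>L y) \<partial>lborel)"
    by (rule Fubini'[OF m])
  also have "\<dots> = (\<integral>\<^sup>+u\<in>{0..}. (\<integral>\<^sup>+w. \<Psi> u w \<partial>P y) \<partial>lborel)"
    by (intro nn_integral_cong) (subst nn_integral_multc, auto simp: nn_integral_P sec intro!: measurable_L_of_N0)
  finally show ?thesis .
qed

lemma V_Fubini:
  assumes G [measurable]: "(\<lambda>(s, z). G s z) \<in> borel_measurable (borel \<Otimes>\<^sub>M borel_Delta)"
  shows "V G y = (\<integral>\<^sup>+u\<in>{0..}. (\<integral>\<^sup>+w. (if T u w < \<infinity> then G (enn2real (T u w)) (path X (T u w) w) else 0) \<partial>P y) \<partial>lborel)"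
  unfolding V_def
proof (rule nn_integral_clock_Fubini)
  have "(\<lambda>v. G (enn2real (T (fst v) (snd v))) (path X (T (fst v) (snd v)) (snd v))) \<in> borel_measurable (borel \<Otimes>\<^sub>M N0)"
    using measurable_compose[OF measurable_Pair[OF _ measurable_path_T] G, of "\<lambda>v. enn2real (T (fst v) (snd v))"] by simp
  then show "(\<lambda>(u, w). if T u w < \<infinity> then G (enn2real (T u w)) (path X (T u w) w) else 0) \<in> borel_measurable (borel \<Otimes>\<^sub>M N0)"
    unfolding case_prod_beta by measurable
qed

lemma kernel_section_measurable:
  assumes [measurable]: "(\<lambda>(s, w). \<Phi> s w) \<in> borel_measurable (borel \<Otimes>\<^sub>M N0)"
  shows "(\<lambda>(s, z). \<integral>\<^sup>+w. (\<Phi> (ennreal s) w :: ennreal) \<partial>L z) \<in> borel_measurable (borel \<Otimes>\<^sub>M borel_Delta)"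
proof -
  have "(\<lambda>v. \<integral>\<^sup>+w. \<Phi> (ennreal (fst v)) w \<partial>L (snd v)) \<in> borel_measurable (borel \<Otimes>\<^sub>M borel_Delta)"
    by (rule nn_integral_measurable_subprob_algebra2[where N=N0]) measurable
  then show ?thesis by (simp add: case_prod_beta)
qed

lemma V_strong_markov:
  assumes \<Phi>: "(\<lambda>(s, w). \<Phi> s w) \<in> borel_measurable (borel \<Otimes>\<^sub>M N0)"
  shows "V (\<lambda>s z. \<integral>\<^sup>+w. \<Phi> (ennreal s) w \<partial>L z) y =
    (\<integral>\<^sup>+u\<in>{0..}. (\<integral>\<^sup>+w. (if T u w < \<infinity> then \<Phi> (T u w) (\<theta> (T u w) w) else 0) \<partial>P y) \<partial>lborel)"
  unfolding V_Fubini[OF kernel_section_measurable[OF \<Phi>]] strong_markov_T[OF \<Phi>]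
  by (intro nn_integral_cong arg_cong2[where f="(*)"] refl) (simp add: less_top)

text \<open>The strong Markov property at \<open>T u\<close>, integrated over \<open>u\<close>.\<close>

lemma additive_functional_AE:
  assumes \<Phi>: "(\<lambda>(s, w). \<Phi> s w) \<in> borel_measurable (borel \<Otimes>\<^sub>M N0)"
    and \<Psi>: "(\<lambda>(u, w). \<Psi> u w) \<in> borel_measurable (borel \<Otimes>\<^sub>M N0)"
    and eq: "\<And>u. 0 \<le> u \<Longrightarrow> AE w in P y. \<Psi> u w = (if T u w < \<infinity> then \<Phi> (T u w) (\<theta> (T u w) w) else 0)"
  shows "(\<integral>\<^sup>+w. (\<integral>\<^sup>+u\<in>{0..}. \<Psi> u w \<partial>lborel) \<partial>L y) = V (\<lambda>s z. \<integral>\<^sup>+w. \<Phi> (ennreal s) w \<partial>L z) y"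
  unfolding nn_integral_clock_Fubini[OF \<Psi>] V_strong_markov[OF \<Phi>]
proof (rule nn_integral_cong)
  fix u :: real
  show "(\<integral>\<^sup>+w. \<Psi> u w \<partial>P y) * indicator {0..} u =
      (\<integral>\<^sup>+w. (if T u w < \<infinity> then \<Phi> (T u w) (\<theta> (T u w) w) else 0) \<partial>P y) * indicator {0..} u"
    using nn_integral_cong_AE[OF eq, of u] by (cases "0 \<le> u") auto
qed

lemma AE_regular_at_T: "AE w in P y. w \<in> \<Omega> \<and> w \<notin> D \<and> (T u w < \<infinity> \<longrightarrow> \<theta> (T u w) w \<in> \<Omega> - D)"
  using AE_D[of y] AE_space[of "P y"] AE_shift_D[OF stopping_\<tau>, of u y]
  by eventually_elim (auto simp: not_D)

lemma additive_functional_eq: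
  assumes \<Phi>: "(\<lambda>(s, w). \<Phi> s w) \<in> borel_measurable (borel \<Otimes>\<^sub>M N0)"
    and \<Psi>: "(\<lambda>(u, w). \<Psi> u w) \<in> borel_measurable (borel \<Otimes>\<^sub>M N0)"
    and eq: "\<And>u w. 0 \<le> u \<Longrightarrow> w \<in> \<Omega> \<Longrightarrow> w \<notin> D \<Longrightarrow> (T u w < \<infinity> \<Longrightarrow> \<theta> (T u w) w \<in> \<Omega> - D) \<Longrightarrow>
      \<Psi> u w = (if T u w < \<infinity> then \<Phi> (T u w) (\<theta> (T u w) w) else 0)"
  shows "(\<integral>\<^sup>+w. (\<integral>\<^sup>+u\<in>{0..}. \<Psi> u w \<partial>lborel) \<partial>L y) = V (\<lambda>s z. \<integral>\<^sup>+w. \<Phi> (ennreal s) w \<partial>L z) y"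
proof (rule additive_functional_AE[OF \<Phi> \<Psi>])
  show "AE w in P y. \<Psi> u w = (if T u w < \<infinity> then \<Phi> (T u w) (\<theta> (T u w) w) else 0)" if "0 \<le> u" for u
    using AE_regular_at_T[of u y] by eventually_elim (rule eq[OF that], auto)
qed

lemma additive_functional_le:
  assumes \<Phi>: "(\<lambda>(s, w). \<Phi> s w) \<in> borel_measurable (borel \<Otimes>\<^sub>M N0)"
    and \<Psi>: "(\<lambda>(u, w). \<Psi> u w) \<in> borel_measurable (borel \<Otimes>\<^sub>M N0)"
    and le: "\<And>u w. 0 \<le> u \<Longrightarrow> w \<in> \<Omega> \<Longrightarrow> w \<notin> D \<Longrightarrow> (T u w < \<infinity> \<Longrightarrow> \<theta> (T u w) w \<in> \<Omega> - D) \<Longrightarrow>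
      \<Psi> u w \<le> (if T u w < \<infinity> then \<Phi> (T u w) (\<theta> (T u w) w) else 0)"
  shows "(\<integral>\<^sup>+w. (\<integral>\<^sup>+u\<in>{0..}. \<Psi> u w \<partial>lborel) \<partial>L y) \<le> V (\<lambda>s z. \<integral>\<^sup>+w. \<Phi> (ennreal s) w \<partial>L z) y"
  unfolding nn_integral_clock_Fubini[OF \<Psi>] V_strong_markov[OF \<Phi>]
proof (rule nn_integral_mono)
  fix u :: real
  have "AE w in P y. \<Psi> u w \<le> (if T u w < \<infinity> then \<Phi> (T u w) (\<theta> (T u w) w) else 0)" if "0 \<le> u"
    using AE_regular_at_T[of u y] by eventually_elim (rule le[OF that], auto)
  then show "(\<integral>\<^sup>+w. \<Psi> u w \<partial>P y) * indicator {0..} u \<le>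
      (\<integral>\<^sup>+w. (if T u w < \<infinity> then \<Phi> (T u w) (\<theta> (T u w) w) else 0) \<partial>P y) * indicator {0..} u"
    by (auto intro: nn_integral_mono_AE split: split_indicator)
qed

text \<open>The clock only runs while the process is alive.\<close>

lemma V_cong:
  assumes "\<And>s y. 0 \<le> s \<Longrightarrow> G s (Some y) = G' s (Some y)"
  shows "V G z = V G' z"
proof -
  have "AE w in P z. \<forall>u. T u w < \<infinity> \<longrightarrow> path X (T u w) w \<noteq> \<Delta>"
    using AE_D[of z] AE_space[of "P z"] by eventually_elim (auto dest: T_alive)
  then have "AE w in L z. \<forall>u. T u w < \<infinity> \<longrightarrow> path X (T u w) w \<noteq> \<Delta>"
    unfolding P_def AE_completion_iff .
  then show ?thesis
    unfolding V_def
  proof (intro nn_integral_cong_AE, eventually_elim)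
    fix w assume "\<forall>u. T u w < \<infinity> \<longrightarrow> path X (T u w) w \<noteq> \<Delta>"
    then have "(if T u w < \<infinity> then G (enn2real (T u w)) (path X (T u w) w) else 0) =
        (if T u w < \<infinity> then G' (enn2real (T u w)) (path X (T u w) w) else 0)" for u
      using assms[of "enn2real (T u w)"] by (cases "path X (T u w) w") auto
    then show "(\<integral>\<^sup>+u\<in>{0..}. (if T u w < \<infinity> then G (enn2real (T u w)) (path X (T u w) w) else 0) \<partial>lborel) =
       (\<integral>\<^sup>+u\<in>{0..}. (if T u w < \<infinity> then G' (enn2real (T u w)) (path X (T u w) w) else 0) \<partial>lborel)" by simp
  qed
qed

lemma measurable_V:
  fixes M :: "'b measure"
  assumes [measurable]: "(\<lambda>(r, s, z). G r s z) \<in> borel_measurable (M \<Otimes>\<^sub>M (borel \<Otimes>\<^sub>M borel_Delta))"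
  shows "(\<lambda>(r, y). V (G r) y) \<in> borel_measurable (M \<Otimes>\<^sub>M borel_Delta)"
proof -
  let ?M = "(M \<Otimes>\<^sub>M borel_Delta) \<Otimes>\<^sub>M N0 :: (('b \<times> 's option) \<times> 'w) measure"
  have pth: "(\<lambda>v. path X (T (snd v) (snd (fst v))) (snd (fst v))) \<in> ?M \<Otimes>\<^sub>M lborel \<rightarrow>\<^sub>M borel_Delta"
    by (rule measurable_path_compose) measurable
  have "(\<lambda>v. G (fst (fst (fst v))) (enn2real (T (snd v) (snd (fst v)))) (path X (T (snd v) (snd (fst v))) (snd (fst v))))
      \<in> borel_measurable (?M \<Otimes>\<^sub>M lborel)"
    using measurable_compose[OF measurable_Pair[OF _ measurable_Pair[OF _ pth]] assms,
        of "\<lambda>v. fst (fst (fst v))" "\<lambda>v. enn2real (T (snd v) (snd (fst v)))"] by simp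
  then have "(\<lambda>v. \<integral>\<^sup>+u\<in>{0..}. (if T u (snd v) < \<infinity> then G (fst (fst v)) (enn2real (T u (snd v))) (path X (T u (snd v)) (snd v)) else 0) \<partial>lborel)
     \<in> borel_measurable ?M"
    by measurable
  then have "(\<lambda>r. \<integral>\<^sup>+w. (\<integral>\<^sup>+u\<in>{0..}. (if T u w < \<infinity> then G (fst r) (enn2real (T u w)) (path X (T u w) w) else 0) \<partial>lborel) \<partial>L (snd r))
      \<in> borel_measurable (M \<Otimes>\<^sub>M borel_Delta)"
    by (intro nn_integral_measurable_subprob_algebra2[where N=N0]) (simp_all add: case_prod_beta)
  then show ?thesis by (simp add: V_def case_prod_beta)
qed

end

context ac_hunt
begin

lemma measurable_case_path:
  assumes f: "f \<in> borel_measurable borel" and T: "T \<in> borel_measurable M" and S: "S \<in> M \<rightarrow>\<^sub>M N0"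
  shows "(\<lambda>w. case_option 0 f (path X (T w) (S w)) :: ennreal) \<in> borel_measurable M"
  by (rule measurable_compose[OF measurable_path_compose[OF T S] borel_measurable_case_option[OF f]])

lemma nn_integral_start_cmult:
  assumes g: "g \<in> borel_measurable N0"
  shows "(\<integral>\<^sup>+w. v (path X 0 w) * g w \<partial>L z) = v z * (\<integral>\<^sup>+w. g w \<partial>L z)"
proof -
  have "AE w in L z. path X 0 w = z"
    using AE_start[of z] unfolding P_def AE_completion_iff .
  then have "(\<integral>\<^sup>+w. v (path X 0 w) * g w \<partial>L z) = (\<integral>\<^sup>+w. v z * g w \<partial>L z)"
    by (intro nn_integral_cong_AE) (auto elim!: eventually_mono)
  also have "\<dots> = v z * (\<integral>\<^sup>+w. g w \<partial>L z)"
    by (rule nn_integral_cmult) (rule measurable_L_of_N0[OF g])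
  finally show ?thesis .
qed

text \<open>The 1-resolvent of the process.\<close>

definition R :: "('s \<Rightarrow> ennreal) \<Rightarrow> 's \<Rightarrow> ennreal" where
  "R k x = (\<integral>\<^sup>+s\<in>{0<..}. ennreal (exp (- s)) * Pt s k x \<partial>lborel)"

end

context strict_pcaf
begin

text \<open>\<open>\<integral>\<^sub>0\<^sup>t f(X\<^sub>s) dA\<^sub>s\<close>; its expectation is \<open>a\<close>.\<close>

definition C :: "real \<Rightarrow> ('s \<Rightarrow> ennreal) \<Rightarrow> 'w \<Rightarrow> ennreal" where
  "C t f w = (\<integral>\<^sup>+u\<in>{0..}. (if T u w < ennreal t then case_option 0 f (path X (T u w) w) else 0) \<partial>lborel)"

definition a :: "real \<Rightarrow> ('s \<Rightarrow> ennreal) \<Rightarrow> 's \<Rightarrow> ennreal" where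
  "a t f x = V (\<lambda>s z. if s < t then case_option 0 f z else 0) (Some x)"

lemma measurable_case_path_T [measurable]:
  assumes f: "f \<in> borel_measurable borel"
  shows "(\<lambda>w. case_option 0 f (path X (T (fst w) (snd w)) (snd w)) :: ennreal) \<in> borel_measurable (borel \<Otimes>\<^sub>M N0)"
  by (rule measurable_case_path[OF f]) measurable

lemma measurable_case_path_T':
  assumes f: "f \<in> borel_measurable borel"
  shows "(\<lambda>w. case_option 0 f (path X (T (snd w) (fst w)) (fst w)) :: ennreal) \<in> borel_measurable (N0 \<Otimes>\<^sub>M lborel)"
  by (rule measurable_case_path[OF f]) measurable

lemma measurable_C:
  assumes f: "f \<in> borel_measurable borel"
  shows "C t f \<in> borel_measurable N0"
proof -
  note [measurable] = measurable_case_path_T'[OF f]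
  have "(\<lambda>v. (if T (snd v) (fst v) < ennreal t then case_option 0 f (path X (T (snd v) (fst v)) (fst v)) else 0) * indicator {0..} (snd v))
      \<in> borel_measurable (N0 \<Otimes>\<^sub>M lborel)" unfolding atLeast_def by measurable
  then have "(\<lambda>w. C t f w) \<in> borel_measurable N0"
    unfolding C_def by (intro lborel.borel_measurable_nn_integral) (simp add: case_prod_beta)
  then show ?thesis .
qed

lemma a_eq_C: "a t f x = (\<integral>\<^sup>+w. C t f w \<partial>L (Some x))"
proof -
  have "(if T u w < \<infinity> then if enn2real (T u w) < t then c else 0 else 0) =
      (if T u w < ennreal t then c else (0::ennreal))" for u w c
    by (cases "T u w") (auto simp: ennreal_less_iff)
  then show ?thesis unfolding a_def V_def C_def by (simp only:)
qed

lemma C_dead: "AE w in L \<Delta>. C t f w = 0"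
proof -
  have "AE w in P \<Delta>. C t f w = 0"
    using AE_D[of \<Delta>] AE_start[of \<Delta>] AE_space[of "P \<Delta>"]
  proof eventually_elim
    case (elim w)
    have "\<not> T u w < \<infinity>" for u
      using T_alive[of w u] path_absorbed[of w 0 "T u w"] elim by auto
    then have "T u w = top" for u by (auto simp: not_less top_unique)
    then show ?case by (simp add: C_def)
  qed
  then show ?thesis unfolding P_def AE_completion_iff .
qed

lemma nn_integral_C: "(\<integral>\<^sup>+w. C t f w \<partial>L z) = case_option 0 (a t f) z"
proof (cases z)
  case None
  have "(\<integral>\<^sup>+w. C t f w \<partial>L \<Delta>) = (\<integral>\<^sup>+w. 0 \<partial>L \<Delta>)" by (rule nn_integral_cong_AE[OF C_dead])
  then show ?thesis using None by simp
qed (simp add: a_eq_C)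

lemma measurable_a_joint:
  assumes [measurable]: "f \<in> borel_measurable borel"
  shows "(\<lambda>(t, x). a t f x) \<in> borel_measurable (borel \<Otimes>\<^sub>M borel)"
proof -
  have "(\<lambda>(t :: real, s, z). if s < t then case_option 0 f z else (0::ennreal)) \<in> borel_measurable (borel \<Otimes>\<^sub>M (borel \<Otimes>\<^sub>M borel_Delta))"
    unfolding case_prod_beta
    by (intro measurable_If measurable_const measurable_compose[OF _ borel_measurable_case_option[OF assms]])
       measurable
  from measurable_V[OF this]
  have "(\<lambda>w. V (\<lambda>s z. if s < fst w then case_option 0 f z else 0) (snd w)) \<in> borel_measurable (borel \<Otimes>\<^sub>M borel_Delta)"
    by (simp add: case_prod_beta)
  from measurable_compose[OF _ this, of "\<lambda>w. (fst w, Some (snd w))" "borel \<Otimes>\<^sub>M borel"]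
  show ?thesis by (simp add: a_def case_prod_beta)
qed

lemma measurable_a [measurable (raw)]:
  assumes "f \<in> borel_measurable borel" "g \<in> borel_measurable M" "h \<in> borel_measurable M"
  shows "(\<lambda>w. a (g w) f (h w)) \<in> borel_measurable M"
  using measurable_compose[OF measurable_Pair[OF assms(2,3)] measurable_a_joint[OF assms(1)]] by simp

lemma path_section_measurable: "w \<in> \<Omega> \<Longrightarrow> (\<lambda>r. path X r w) \<in> borel \<rightarrow>\<^sub>M borel_Delta"
  by (rule measurable_path_compose) auto

lemma T_section_measurable: "w \<in> \<Omega> \<Longrightarrow> (\<lambda>u. T u w) \<in> borel_measurable borel"
  by (rule measurable_T) auto

lemma C_add:
  assumes w: "w \<in> \<Omega>" "w \<notin> D" "\<theta> (ennreal t) w \<notin> D" and t: "0 \<le> t" "0 \<le> s" and f: "f \<in> borel_measurable borel"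
  shows "C (t + s) f w = C t f w + C s f (\<theta> (ennreal t) w)"
proof -
  note [measurable] = T_section_measurable[OF w(1)] path_section_measurable[OF w(1)]
    measurable_compose[OF path_section_measurable[OF w(1)] borel_measurable_case_option[OF f, of 0]]
  define g where "g r = (if r < ennreal (t + s) then case_option 0 f (path X r w) else 0)" for r
  have [measurable]: "g \<in> borel_measurable borel" unfolding g_def by measurable
  have [measurable]: "(\<lambda>u. case_option 0 f (path X (T u w) w)) \<in> borel_measurable borel"
    by (rule measurable_compose[OF T_section_measurable[OF w(1)]]) measurable
  have e: "ennreal (t + s) = ennreal t + ennreal s" using t by simp
  have tr: "ennreal t + r < ennreal (t + s) \<longleftrightarrow> r < ennreal s" for r
    unfolding e by (simp add: ennreal_add_left_cancel_less)
  have "C (t + s) f w = (\<integral>\<^sup>+u\<in>{0..}. (if T u w < ennreal t then case_option 0 f (path X (T u w) w) else 0) +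
      (if ennreal t \<le> T u w \<and> T u w < \<infinity> then g (T u w) else 0) \<partial>lborel)"
    unfolding C_def
  proof (intro nn_integral_cong arg_cong2[where f="(*)"] refl)
    fix u
    show "(if T u w < ennreal (t + s) then case_option 0 f (path X (T u w) w) else 0) =
      (if T u w < ennreal t then case_option 0 f (path X (T u w) w) else 0) +
      (if ennreal t \<le> T u w \<and> T u w < \<infinity> then g (T u w) else 0)"
    proof (cases "T u w")
      case (real r)
      then show ?thesis using t by (auto simp: g_def ennreal_less_iff ennreal_le_iff simp del: ennreal_plus)
    qed (auto simp: g_def)
  qed
  also have "\<dots> = C t f w + (\<integral>\<^sup>+u\<in>{0..}. (if ennreal t \<le> T u w \<and> T u w < \<infinity> then g (T u w) else 0) \<partial>lborel)"
    unfolding C_def by (subst nn_integral_add[symmetric]) (auto simp: distrib_right)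
  also have "(\<integral>\<^sup>+u\<in>{0..}. (if ennreal t \<le> T u w \<and> T u w < \<infinity> then g (T u w) else 0) \<partial>lborel) =
    (\<integral>\<^sup>+v\<in>{0..}. (if T v (\<theta> (ennreal t) w) < \<infinity> then g (ennreal t + T v (\<theta> (ennreal t) w)) else 0) \<partial>lborel)"
    by (rule T_shift_integral[OF w t(1)]) measurable
  also have "\<dots> = C s f (\<theta> (ennreal t) w)"
    unfolding C_def using w(1)
    by (intro nn_integral_cong) (auto simp: g_def tr add.commute[of _ "ennreal t"] split: split_indicator dest: less_trans[OF _ ennreal_less_top])
  finally show ?thesis .
qed

lemma a_add:
  assumes t: "0 < t" "0 \<le> s" and f [measurable]: "f \<in> borel_measurable borel"
  shows "a (t + s) f x = a t f x + Pt t (a s f) x"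
proof -
  note [measurable] = measurable_C[OF f]
  have ae: "AE w in P (Some x). C (t + s) f w = C t f w + C s f (\<theta> (ennreal t) w)"
    using AE_D[of "Some x"] AE_space[of "P (Some x)"] AE_shift_D[OF stopping_time_const[of F "ennreal t"], of "Some x"]
    by eventually_elim (use t f in \<open>auto intro: C_add\<close>)
  have "a (t + s) f x = (\<integral>\<^sup>+w. C (t + s) f w \<partial>P (Some x))"
    by (simp add: a_eq_C nn_integral_P)
  also have "\<dots> = (\<integral>\<^sup>+w. C t f w + C s f (\<theta> (ennreal t) w) \<partial>P (Some x))"
    by (rule nn_integral_cong_AE[OF ae])
  also have "\<dots> = (\<integral>\<^sup>+w. C t f w \<partial>P (Some x)) + (\<integral>\<^sup>+w. C s f (\<theta> (ennreal t) w) \<partial>P (Some x))"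
    by (intro nn_integral_add measurable_P_of_N0 measurable_compose[OF measurable_shift]) measurable
  also have "(\<integral>\<^sup>+w. C t f w \<partial>P (Some x)) = a t f x" by (simp add: a_eq_C nn_integral_P)
  also have "(\<integral>\<^sup>+w. C s f (\<theta> (ennreal t) w) \<partial>P (Some x)) = (\<integral>\<^sup>+w. (\<integral>\<^sup>+w'. C s f w' \<partial>L (path X (ennreal t) w)) \<partial>P (Some x))"
    by (rule strong_markov_joint[OF stopping_time_const, of "\<lambda>_. C s f"]) measurable
  also have "\<dots> = (\<integral>\<^sup>+w. case_option 0 (a s f) (path X (ennreal t) w) \<partial>L (Some x))"
    unfolding nn_integral_C by (rule nn_integral_P) (rule measurable_case_path, measurable)
  also have "\<dots> = Pt t (a s f) x" by (rule nn_integral_path_Some[OF t(1)]) measurable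
  finally show ?thesis .
qed

text \<open>\<open>h(X\<^sub>t) = h(X\<^sub>t\<^sub>-\<^sub>s) \<circ> \<theta>\<^sub>s\<close>. The time \<open>t\<close> may be infinite, and \<open>h\<close> may charge \<open>\<Delta>\<close>.\<close>

lemma occupation_terminal:
  assumes r [measurable]: "r \<in> borel_measurable borel_Delta" and h [measurable]: "h \<in> borel_measurable borel_Delta"
  shows "(\<integral>\<^sup>+w. h (path X t w) * (\<integral>\<^sup>+u\<in>{0..}. (if T u w < t then r (path X (T u w) w) else 0) \<partial>lborel) \<partial>L y) =
    V (\<lambda>s z. if ennreal s < t then r z * (\<integral>\<^sup>+w. h (path X (t - ennreal s) w) \<partial>L z) else 0) y"
proof -
  define \<Phi> where "\<Phi> s w = (if s < t then r (path X 0 w) * h (path X (t - s) w) else 0)" for s w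
  define \<Psi> where "\<Psi> u w = h (path X t w) * (if T u w < t then r (path X (T u w) w) else 0)" for u w
  have "(\<lambda>v. path X (t - fst v) (snd v)) \<in> borel \<Otimes>\<^sub>M N0 \<rightarrow>\<^sub>M borel_Delta"
    by (rule measurable_path_compose) measurable
  note [measurable] = measurable_compose[OF this h] measurable_compose[OF measurable_path_T r]
  have m\<Phi>: "(\<lambda>(s, w). \<Phi> s w) \<in> borel_measurable (borel \<Otimes>\<^sub>M N0)"
    unfolding \<Phi>_def case_prod_beta by measurable
  have m\<Psi>: "(\<lambda>(u, w). \<Psi> u w) \<in> borel_measurable (borel \<Otimes>\<^sub>M N0)"
    unfolding \<Psi>_def case_prod_beta by measurable
  have "(\<integral>\<^sup>+w. h (path X t w) * (\<integral>\<^sup>+u\<in>{0..}. (if T u w < t then r (path X (T u w) w) else 0) \<partial>lborel) \<partial>L y) =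
    (\<integral>\<^sup>+w. (\<integral>\<^sup>+u\<in>{0..}. \<Psi> u w \<partial>lborel) \<partial>L y)"
  proof (rule nn_integral_cong)
    fix w assume "w \<in> space (L y)"
    then have w: "w \<in> \<Omega>" by simp
    note [measurable] = T_section_measurable[OF w] measurable_compose[OF measurable_compose[OF T_section_measurable[OF w] path_section_measurable[OF w]] r]
    show "h (path X t w) * (\<integral>\<^sup>+u\<in>{0..}. (if T u w < t then r (path X (T u w) w) else 0) \<partial>lborel) = (\<integral>\<^sup>+u\<in>{0..}. \<Psi> u w \<partial>lborel)"
      unfolding \<Psi>_def by (subst nn_integral_cmult[symmetric]) (auto simp: mult.assoc)
  qed
  also have "\<dots> = V (\<lambda>s z. \<integral>\<^sup>+w. \<Phi> (ennreal s) w \<partial>L z) y"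
  proof (rule additive_functional_eq[OF m\<Phi> m\<Psi>])
    fix u w assume w: "w \<in> \<Omega>"
    show "\<Psi> u w = (if T u w < \<infinity> then \<Phi> (T u w) (\<theta> (T u w) w) else 0)"
    proof (cases "T u w < t")
      case True
      then have "T u w < top" by (auto intro: less_le_trans)
      then show ?thesis using True w
        by (simp add: \<Psi>_def \<Phi>_def diff_add_cancel_ennreal less_imp_le mult.commute)
    qed (simp add: \<Psi>_def \<Phi>_def)
  qed
  also have "(\<lambda>s z. \<integral>\<^sup>+w. \<Phi> (ennreal s) w \<partial>L z) = (\<lambda>s z. if ennreal s < t then r z * (\<integral>\<^sup>+w. h (path X (t - ennreal s) w) \<partial>L z) else 0)"
    unfolding \<Phi>_def by (auto simp: fun_eq_iff intro!: nn_integral_start_cmult)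
  finally show ?thesis .
qed

text \<open>Half the square of \<open>C\<close> is the integral over \<open>s\<close> of \<open>f(X\<^sub>s)\<close> times what accumulates after \<open>s\<close>, and the
latter is at most \<open>C t f \<circ> \<theta>\<^sub>s\<close>.\<close>

lemma C_square_le:
  assumes f [measurable]: "f \<in> borel_measurable borel"
  shows "(\<integral>\<^sup>+w. C t f w * C t f w \<partial>L (Some x)) \<le> 2 * a t (\<lambda>y. f y * a t f y) x"
proof -
  note [measurable] = measurable_C[OF f]
  define g where "g u w = (if T u w < ennreal t then case_option 0 f (path X (T u w) w) else 0)" for u w
  have gm [measurable]: "(\<lambda>(u, w). g u w) \<in> borel_measurable (borel \<Otimes>\<^sub>M N0)"
    unfolding g_def case_prod_beta using measurable_case_path_T[OF f] by measurable
  define \<Psi> where "\<Psi> u w = g u w * (\<integral>\<^sup>+v\<in>{u<..}. g v w * indicator {0..} v \<partial>lborel)" for u w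
  define \<Phi> where "\<Phi> s w = (if s < ennreal t then case_option 0 f (path X 0 w) * C t f w else 0)" for s w
  have c0: "(\<lambda>pt. case_option 0 f (path X 0 (snd pt))) \<in> borel_measurable (borel \<Otimes>\<^sub>M N0)"
    by (rule measurable_case_path[OF f]) measurable
  have m\<Phi>: "(\<lambda>(s, w). \<Phi> s w) \<in> borel_measurable (borel \<Otimes>\<^sub>M N0)"
    unfolding \<Phi>_def case_prod_beta using c0 by measurable
  have gm2: "(\<lambda>pt. g (snd pt) (snd (fst pt)) * indicator {0..} (snd pt) * indicator {fst (fst pt)<..} (snd pt))
      \<in> borel_measurable ((borel \<Otimes>\<^sub>M N0) \<Otimes>\<^sub>M lborel)"
    using measurable_compose[OF measurable_Pair[of snd _ borel "\<lambda>pt. snd (fst pt)" N0] gm, of "(borel \<Otimes>\<^sub>M N0) \<Otimes>\<^sub>M lborel"]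
    unfolding greaterThan_def atLeast_def by (simp add: case_prod_beta)
  have m\<Psi>: "(\<lambda>(u, w). \<Psi> u w) \<in> borel_measurable (borel \<Otimes>\<^sub>M N0)"
    unfolding \<Psi>_def case_prod_beta
    by (intro borel_measurable_times_ennreal lborel.borel_measurable_nn_integral)
       (use gm gm2 in \<open>simp_all add: case_prod_beta\<close>)
  have "(\<integral>\<^sup>+w. C t f w * C t f w \<partial>L (Some x)) = (\<integral>\<^sup>+w. 2 * (\<integral>\<^sup>+u\<in>{0..}. \<Psi> u w \<partial>lborel) \<partial>L (Some x))"
  proof (rule nn_integral_cong)
    fix w assume "w \<in> space (L (Some x))"
    then have "w \<in> space N0" by simp
    from measurable_compose[OF measurable_Pair2'[OF this] gm]
    have [measurable]: "(\<lambda>u. g u w) \<in> borel_measurable borel" by simp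
    have "C t f w * C t f w = 2 * (\<integral>\<^sup>+u. g u w * indicator {0..} u * (\<integral>\<^sup>+v\<in>{u<..}. g v w * indicator {0..} v \<partial>lborel) \<partial>lborel)"
      unfolding C_def g_def[symmetric] by (rule square_nn_integral) measurable
    also have "\<dots> = 2 * (\<integral>\<^sup>+u\<in>{0..}. \<Psi> u w \<partial>lborel)"
      unfolding \<Psi>_def by (simp add: ac_simps)
    finally show "C t f w * C t f w = 2 * (\<integral>\<^sup>+u\<in>{0..}. \<Psi> u w \<partial>lborel)" .
  qed
  also have "\<dots> = 2 * (\<integral>\<^sup>+w. (\<integral>\<^sup>+u\<in>{0..}. \<Psi> u w \<partial>lborel) \<partial>L (Some x))"
  proof (rule nn_integral_cmult)
    have "(\<lambda>pt. \<Psi> (snd pt) (fst pt) * indicator {0..} (snd pt)) \<in> borel_measurable (N0 \<Otimes>\<^sub>M lborel)"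
      using measurable_compose[OF measurable_Pair[of snd _ borel fst N0] m\<Psi>, of "N0 \<Otimes>\<^sub>M lborel"]
      unfolding atLeast_def by (simp add: case_prod_beta)
    then show "(\<lambda>w. \<integral>\<^sup>+u\<in>{0..}. \<Psi> u w \<partial>lborel) \<in> borel_measurable (L (Some x))"
      by (intro measurable_L_of_N0 lborel.borel_measurable_nn_integral) (simp add: case_prod_beta)
  qed
  also have "\<dots> \<le> 2 * V (\<lambda>s z. \<integral>\<^sup>+w. \<Phi> (ennreal s) w \<partial>L z) (Some x)"
  proof (intro mult_left_mono additive_functional_le[OF m\<Phi> m\<Psi>])
    fix u w assume u: "0 \<le> u" and w: "w \<in> \<Omega>" "w \<notin> D" and \<theta>: "T u w < \<infinity> \<Longrightarrow> \<theta> (T u w) w \<in> \<Omega> - D"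
    show "\<Psi> u w \<le> (if T u w < \<infinity> then \<Phi> (T u w) (\<theta> (T u w) w) else 0)"
    proof (cases "T u w < ennreal t")
      case True
      then have fin: "T u w < \<infinity>" by (auto intro: less_le_trans)
      then obtain s where s: "T u w = ennreal s" "0 \<le> s" by (cases "T u w") auto
      define G where "G r = (if r < ennreal t then case_option 0 f (path X r w) else 0)" for r
      have Gm: "G \<in> borel_measurable borel"
        unfolding G_def using measurable_compose[OF path_section_measurable[OF w(1)] borel_measurable_case_option[OF f, of 0]]
        by measurable
      have "(\<integral>\<^sup>+v\<in>{u<..}. g v w * indicator {0..} v \<partial>lborel) \<le>
         (\<integral>\<^sup>+v\<in>{0..}. (if ennreal s \<le> T v w \<and> T v w < \<infinity> then G (T v w) else 0) \<partial>lborel)"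
        using T_mono[of u _ w] s
      proof (intro nn_integral_mono)
        fix v
        have "T v w < \<infinity>" if "T v w < ennreal t" using that by (auto intro: less_le_trans)
        then show "g v w * indicator {0..} v * indicator {u<..} v \<le>
            (if ennreal s \<le> T v w \<and> T v w < \<infinity> then G (T v w) else 0) * indicator {0..} v"
          using T_mono[of u v w] s by (auto simp: g_def G_def less_imp_le split: split_indicator)
      qed
      also have "\<dots> = (\<integral>\<^sup>+pt\<in>{0..}. (if T pt (\<theta> (ennreal s) w) < \<infinity> then G (ennreal s + T pt (\<theta> (ennreal s) w)) else 0) \<partial>lborel)"
        using \<theta>[OF fin] s by (intro T_shift_integral[OF w _ s(2) Gm]) auto
      also have "\<dots> \<le> C t f (\<theta> (ennreal s) w)"
        unfolding C_def
      proof (intro nn_integral_mono mult_right_mono)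
        fix pt
        show "(if T pt (\<theta> (ennreal s) w) < \<infinity> then G (ennreal s + T pt (\<theta> (ennreal s) w)) else 0) \<le>
          (if T pt (\<theta> (ennreal s) w) < ennreal t then case_option 0 f (path X (T pt (\<theta> (ennreal s) w)) (\<theta> (ennreal s) w)) else 0)"
          using w(1) le_less_trans[of "T pt (\<theta> (ennreal s) w)" "ennreal s + T pt (\<theta> (ennreal s) w)" "ennreal t"]
          by (auto simp: G_def add.commute[of _ "ennreal s"])
      qed simp
      finally show ?thesis
        using True fin s w(1) by (auto simp: \<Psi>_def \<Phi>_def g_def intro!: mult_left_mono)
    qed (simp add: \<Psi>_def \<Phi>_def g_def)
  qed simp
  also have "V (\<lambda>s z. \<integral>\<^sup>+w. \<Phi> (ennreal s) w \<partial>L z) (Some x) = a t (\<lambda>y. f y * a t f y) x"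
    unfolding a_def[of _ _ x]
  proof (rule V_cong)
    fix s :: real and y assume s: "0 \<le> s"
    have "(\<integral>\<^sup>+w. case_option 0 f (path X 0 w) * C t f w \<partial>L (Some y)) = f y * a t f y"
      by (subst nn_integral_start_cmult) (auto simp: nn_integral_C)
    then show "(\<integral>\<^sup>+w. \<Phi> (ennreal s) w \<partial>L (Some y)) = (if s < t then case_option 0 (\<lambda>y. f y * a t f y) (Some y) else 0)"
      using s by (auto simp: \<Phi>_def ennreal_less_iff)
  qed
  finally show ?thesis .
qed

end

section \<open>Semigroup, resolvent and potentials\<close>

lemma nn_integral_exp_tail:
  assumes "0 \<le> s"
  shows "(\<integral>\<^sup>+t\<in>{0<..}. ennreal (exp (- t)) * (if s < t then 1 else 0) \<partial>lborel) = ennreal (exp (- s))"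
proof -
  have "(\<integral>\<^sup>+t\<in>{0<..}. ennreal (exp (- t)) * (if s < t then 1 else 0) \<partial>lborel) =
      (\<integral>\<^sup>+t. ennreal (exp (- t)) * indicator {s..} t \<partial>lborel)"
    using AE_lborel_neq[of s] assms
    by (intro nn_integral_cong_AE) (auto elim!: eventually_mono split: split_indicator)
  also have "\<dots> = ennreal (0 - (- exp (- s)))"
  proof (rule nn_integral_FTC_atLeast)
    show "DERIV (\<lambda>t. - exp (- t)) x :> exp (- x)" for x :: real
      by (auto intro!: derivative_eq_intros)
    have "((\<lambda>x::real. exp (- x)) \<longlongrightarrow> 0) at_top"
      by (rule filterlim_compose[OF exp_at_bot filterlim_uminus_at_bot_at_top])
    from tendsto_minus[OF this] show "((\<lambda>t::real. - exp (- t)) \<longlongrightarrow> 0) at_top" by simp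
  qed auto
  finally show ?thesis by simp
qed

lemma nn_integral_greaterThan_shift:
  fixes h :: "real \<Rightarrow> ennreal"
  assumes [measurable]: "h \<in> borel_measurable borel"
  shows "(\<integral>\<^sup>+s\<in>{0<..}. h (c + s) \<partial>lborel) = (\<integral>\<^sup>+s\<in>{c<..}. h s \<partial>lborel)"
proof -
  have "(\<integral>\<^sup>+s\<in>{c<..}. h s \<partial>lborel) = (\<integral>\<^sup>+s. h (c + 1 * s) * indicator {c<..} (c + 1 * s) \<partial>lborel)"
    using nn_integral_real_affine[of "\<lambda>s. h s * indicator {c<..} s" 1 c] by simp
  also have "\<dots> = (\<integral>\<^sup>+s\<in>{0<..}. h (c + s) \<partial>lborel)"
    by (intro nn_integral_cong) (auto split: split_indicator)
  finally show ?thesis by simp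
qed

context ac_hunt
begin

lemma Pt_mono: "(\<And>y. f y \<le> g y) \<Longrightarrow> Pt t f x \<le> Pt t g x"
  unfolding Pt_def by (intro nn_integral_mono mult_left_mono) auto

lemma Pt_cmult: "f \<in> borel_measurable borel \<Longrightarrow> Pt t (\<lambda>y. c * f y) x = c * Pt t f x"
  unfolding Pt_def by (subst nn_integral_cmult[symmetric]) (auto simp: mult.left_commute)

lemma Pt_symmetric:
  assumes [measurable]: "f \<in> borel_measurable borel" "g \<in> borel_measurable borel"
  shows "(\<integral>\<^sup>+x. g x * Pt t f x \<partial>m) = (\<integral>\<^sup>+x. Pt t g x * f x \<partial>m)"
proof -
  interpret mm: pair_sigma_finite m m ..
  have "(\<integral>\<^sup>+x. g x * Pt t f x \<partial>m) = (\<integral>\<^sup>+x. (\<integral>\<^sup>+y. g x * (q t x y * f y) \<partial>m) \<partial>m)"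
    unfolding Pt_def by (intro nn_integral_cong nn_integral_cmult[symmetric]) measurable
  also have "\<dots> = (\<integral>\<^sup>+y. (\<integral>\<^sup>+x. g x * (q t x y * f y) \<partial>m) \<partial>m)"
    by (rule mm.Fubini'[symmetric]) measurable
  also have "\<dots> = (\<integral>\<^sup>+y. Pt t g y * f y \<partial>m)"
    unfolding Pt_def by (intro nn_integral_cong, subst nn_integral_multc[symmetric])
      (auto simp: q_sym[of t] ac_simps intro!: nn_integral_cong)
  finally show ?thesis .
qed

lemma Pt_semigroup:
  assumes "0 < s" "0 < t" and [measurable]: "f \<in> borel_measurable borel"
  shows "Pt (t + s) f x = Pt t (Pt s f) x"
proof -
  interpret mm: pair_sigma_finite m m ..
  have "Pt (t + s) f x = (\<integral>\<^sup>+y. (\<integral>\<^sup>+z. q t x z * q s z y * f y \<partial>m) \<partial>m)"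
    unfolding Pt_def q_semigroup[OF assms(1,2)] by (intro nn_integral_cong nn_integral_multc[symmetric]) measurable
  also have "\<dots> = (\<integral>\<^sup>+z. (\<integral>\<^sup>+y. q t x z * q s z y * f y \<partial>m) \<partial>m)"
    by (rule mm.Fubini') measurable
  also have "\<dots> = Pt t (Pt s f) x"
    unfolding Pt_def by (intro nn_integral_cong, subst nn_integral_cmult[symmetric]) (auto simp: ac_simps)
  finally show ?thesis .
qed

lemma nn_integral_Pt_le:
  assumes [measurable]: "f \<in> borel_measurable borel"
  shows "(\<integral>\<^sup>+x. Pt t f x \<partial>m) \<le> (\<integral>\<^sup>+x. f x \<partial>m)"
proof -
  have "(\<integral>\<^sup>+x. Pt t f x \<partial>m) = (\<integral>\<^sup>+x. Pt t (\<lambda>_. 1) x * f x \<partial>m)"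
    using Pt_symmetric[of f "\<lambda>_. 1" t] by simp
  also have "\<dots> \<le> (\<integral>\<^sup>+x. 1 * f x \<partial>m)"
    by (intro nn_integral_mono mult_right_mono Pt_le_1) auto
  finally show ?thesis by simp
qed

lemma Pt_le_const: "(\<And>y. f y \<le> c) \<Longrightarrow> f \<in> borel_measurable borel \<Longrightarrow> Pt t f x \<le> c"
proof -
  assume "\<And>y. f y \<le> c" "f \<in> borel_measurable borel"
  then have "Pt t f x \<le> Pt t (\<lambda>_. c * 1) x" by (intro Pt_mono) auto
  also have "\<dots> = c * Pt t (\<lambda>_. 1) x" by (rule Pt_cmult) simp
  also have "\<dots> \<le> c * 1" by (intro mult_left_mono Pt_le_1) auto
  finally show ?thesis by simp
qed

lemma Pt_time_integral:
  fixes h :: "real \<Rightarrow> 's \<Rightarrow> ennreal"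
  assumes [measurable]: "(\<lambda>(s, x). h s x) \<in> borel_measurable (borel \<Otimes>\<^sub>M borel)"
  shows "Pt t (\<lambda>y. \<integral>\<^sup>+s. h s y \<partial>lborel) x = (\<integral>\<^sup>+s. Pt t (h s) x \<partial>lborel)"
proof -
  interpret mm: pair_sigma_finite m "lborel :: real measure" ..
  have "Pt t (\<lambda>y. \<integral>\<^sup>+s. h s y \<partial>lborel) x = (\<integral>\<^sup>+y. (\<integral>\<^sup>+s. q t x y * h s y \<partial>lborel) \<partial>m)"
    unfolding Pt_def by (intro nn_integral_cong nn_integral_cmult[symmetric]) measurable
  also have "\<dots> = (\<integral>\<^sup>+s. (\<integral>\<^sup>+y. q t x y * h s y \<partial>m) \<partial>lborel)"
    by (rule mm.Fubini'[symmetric]) measurable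
  finally show ?thesis by (simp add: Pt_def)
qed

lemma measurable_R [measurable]:
  assumes [measurable]: "k \<in> borel_measurable borel"
  shows "R k \<in> borel_measurable borel"
proof -
  have "(\<lambda>w. ennreal (exp (- snd w)) * Pt (snd w) k (fst w) * indicator {0<..} (snd w)) \<in> borel_measurable (borel \<Otimes>\<^sub>M lborel)"
    unfolding greaterThan_def by measurable
  then show ?thesis
    unfolding R_def[abs_def] by (intro lborel.borel_measurable_nn_integral) (simp add: case_prod_beta)
qed

lemma nn_integral_R_le:
  assumes [measurable]: "k \<in> borel_measurable borel"
  shows "(\<integral>\<^sup>+x. R k x \<partial>m) \<le> (\<integral>\<^sup>+x. k x \<partial>m)"
proof -
  interpret mm: pair_sigma_finite m "lborel :: real measure" ..
  have "(\<integral>\<^sup>+x. R k x \<partial>m) = (\<integral>\<^sup>+s. (\<integral>\<^sup>+x. ennreal (exp (- s)) * Pt s k x * indicator {0<..} s \<partial>m) \<partial>lborel)"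
    unfolding R_def by (rule mm.Fubini'[symmetric]) (unfold greaterThan_def case_prod_beta, measurable)
  also have "\<dots> \<le> (\<integral>\<^sup>+s\<in>{0<..}. ennreal (exp (- s)) * (\<integral>\<^sup>+x. k x \<partial>m) \<partial>lborel)"
    by (intro nn_integral_mono, subst nn_integral_multc, measurable, subst nn_integral_cmult)
       (auto intro!: mult_right_mono mult_left_mono nn_integral_Pt_le)
  also have "\<dots> = (\<integral>\<^sup>+s\<in>{0<..}. ennreal (exp (- s)) * (if 0 < s then 1 else 0) \<partial>lborel) * (\<integral>\<^sup>+x. k x \<partial>m)"
    by (subst nn_integral_multc[symmetric]) (auto intro!: nn_integral_cong split: split_indicator)
  also have "\<dots> = (\<integral>\<^sup>+x. k x \<partial>m)" using nn_integral_exp_tail[of 0] by simp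
  finally show ?thesis .
qed

lemma R_le_1:
  assumes [measurable]: "k \<in> borel_measurable borel" and "\<And>y. k y \<le> 1"
  shows "R k x \<le> 1"
proof -
  have "R k x \<le> (\<integral>\<^sup>+s\<in>{0<..}. ennreal (exp (- s)) * (if 0 < s then 1 else 0) \<partial>lborel)"
    unfolding R_def
  proof (intro nn_integral_mono mult_right_mono)
    fix s :: real
    have "0 < s \<longrightarrow> ennreal (exp (- s)) * Pt s k x \<le> ennreal (exp (- s)) * 1"
      using Pt_le_1[OF assms(2,1)] by (auto intro!: mult_left_mono simp del: mult_1_right)
    moreover have "Pt s k x = 0" if "\<not> 0 < s" using that by (simp add: Pt_def q_def)
    ultimately show "ennreal (exp (- s)) * Pt s k x \<le> ennreal (exp (- s)) * (if 0 < s then 1 else 0)" by auto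
  qed simp
  also have "\<dots> = 1" using nn_integral_exp_tail[of 0] by simp
  finally show ?thesis .
qed

text \<open>Split the time axis at \<open>e\<close> and use the semigroup property.\<close>

lemma R_split:
  assumes [measurable]: "k \<in> borel_measurable borel" and e: "0 < e"
  shows "R k x = (\<integral>\<^sup>+s. ennreal (exp (- s)) * Pt s k x * indicator {0<..e} s \<partial>lborel) + ennreal (exp (- e)) * Pt e (R k) x"
proof -
  have "ennreal (exp (- e)) * Pt e (R k) x = ennreal (exp (- e)) * (\<integral>\<^sup>+s. Pt e (\<lambda>y. ennreal (exp (- s)) * Pt s k y * indicator {0<..} s) x \<partial>lborel)"
    unfolding R_def[abs_def]
    by (subst Pt_time_integral) (unfold greaterThan_def case_prod_beta, measurable)
  also have "\<dots> = (\<integral>\<^sup>+s. ennreal (exp (- e)) * Pt e (\<lambda>y. ennreal (exp (- s)) * Pt s k y * indicator {0<..} s) x \<partial>lborel)"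
    by (subst nn_integral_cmult) (unfold greaterThan_def case_prod_beta, measurable)
  also have "\<dots> = (\<integral>\<^sup>+s\<in>{0<..}. ennreal (exp (- (e + s))) * Pt (e + s) k x \<partial>lborel)"
  proof (intro nn_integral_cong)
    fix s :: real
    show "ennreal (exp (- e)) * Pt e (\<lambda>y. ennreal (exp (- s)) * Pt s k y * indicator {0<..} s) x =
      ennreal (exp (- (e + s))) * Pt (e + s) k x * indicator {0<..} s"
    proof (cases "0 < s")
      case True
      have "ennreal (exp (- (e + s))) = ennreal (exp (- e)) * ennreal (exp (- s))"
        by (simp add: exp_add[symmetric] flip: ennreal_mult)
      then show ?thesis using True e
        by (simp add: Pt_cmult Pt_semigroup mult.assoc)
    qed (simp add: Pt_def)
  qed
  also have "\<dots> = (\<integral>\<^sup>+s\<in>{e<..}. ennreal (exp (- s)) * Pt s k x \<partial>lborel)"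
    by (rule nn_integral_greaterThan_shift) measurable
  finally have *: "ennreal (exp (- e)) * Pt e (R k) x = (\<integral>\<^sup>+s\<in>{e<..}. ennreal (exp (- s)) * Pt s k x \<partial>lborel)" .
  show ?thesis
    unfolding * unfolding R_def using e
    by (subst nn_integral_add[symmetric]) (auto intro!: nn_integral_cong split: split_indicator)
qed

lemma expect_eq_N0:
  fixes Y g :: "'w \<Rightarrow> ennreal"
  assumes g: "g \<in> borel_measurable N0" and ae: "AE w in P (Some x). Y w = g w"
  shows "expect X x Y = (\<integral>\<^sup>+w. g w \<partial>L (Some x))"
proof -
  from ae have ae': "AE w in L (Some x). Y w = g w" unfolding P_def AE_completion_iff .
  obtain B where B: "{w\<in>space (L (Some x)). Y w \<noteq> g w} \<subseteq> B" "B \<in> null_sets (L (Some x))"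
    using AE_E[OF ae'] by (metis null_setsI)
  then have "B \<in> sets N0" by (auto dest: null_setsD2)
  then have "emeasure (law X (Some x)) B = 0" using null_setsD1[OF B(2)] by (simp add: emeasure_L)
  then have "AE w in law X (Some x). Y w = g w"
    using B \<open>B \<in> sets N0\<close> natural_subset_events[of top] by (intro AE_I[where N=B]) auto
  then have "expect X x Y = (\<integral>\<^sup>+w. g w \<partial>law X (Some x))"
    unfolding expect_def nn_integral_completion by (rule nn_integral_cong_AE)
  then show ?thesis by (simp add: nn_integral_L[OF g])
qed

end

context strict_pcaf
begin

lemma V_prod:
  assumes G: "(\<lambda>(s, z). G s z) \<in> borel_measurable (borel \<Otimes>\<^sub>M borel_Delta)"
  shows "(\<lambda>w. if 0 \<le> snd w \<and> T (snd w) (fst w) < \<infinity> then G (enn2real (T (snd w) (fst w))) (path X (T (snd w) (fst w)) (fst w)) else 0)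
      \<in> borel_measurable (L y \<Otimes>\<^sub>M lborel)" (is "?g \<in> _")
    and "V G y = (\<integral>\<^sup>+w. (if 0 \<le> snd w \<and> T (snd w) (fst w) < \<infinity> then G (enn2real (T (snd w) (fst w))) (path X (T (snd w) (fst w)) (fst w)) else 0)
      \<partial>(L y \<Otimes>\<^sub>M lborel))"
proof -
  have [measurable]: "fst \<in> L y \<Otimes>\<^sub>M lborel \<rightarrow>\<^sub>M N0"
    using measurable_fst[of "L y" lborel] by (simp cong: measurable_cong_sets)
  have "(\<lambda>w. path X (T (snd w) (fst w)) (fst w)) \<in> L y \<Otimes>\<^sub>M lborel \<rightarrow>\<^sub>M borel_Delta"
    by (rule measurable_path_compose) measurable
  from measurable_compose[OF measurable_Pair[OF _ this] G, of "\<lambda>w. enn2real (T (snd w) (fst w))"]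
  have [measurable]: "(\<lambda>w. G (enn2real (T (snd w) (fst w))) (path X (T (snd w) (fst w)) (fst w))) \<in> borel_measurable (L y \<Otimes>\<^sub>M lborel)"
    by simp
  show m: "?g \<in> borel_measurable (L y \<Otimes>\<^sub>M lborel)" by measurable
  show "V G y = (\<integral>\<^sup>+w. ?g w \<partial>(L y \<Otimes>\<^sub>M lborel))"
    unfolding V_def by (subst lborel.nn_integral_fst[OF m, symmetric])
      (auto intro!: nn_integral_cong split: split_indicator)
qed

lemma V_mono: "(\<And>s z. 0 \<le> s \<Longrightarrow> G s z \<le> G' s z) \<Longrightarrow> V G y \<le> V G' y"
  unfolding V_def by (intro nn_integral_mono) (auto split: split_indicator)

lemma V_cmult:
  assumes "(\<lambda>(s, z). G s z) \<in> borel_measurable (borel \<Otimes>\<^sub>M borel_Delta)"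
  shows "V (\<lambda>s z. c * G s z) y = c * V G y"
proof -
  have "V (\<lambda>s z. c * G s z) y = (\<integral>\<^sup>+w. c * (if 0 \<le> snd w \<and> T (snd w) (fst w) < \<infinity> then G (enn2real (T (snd w) (fst w))) (path X (T (snd w) (fst w)) (fst w)) else 0)
      \<partial>(L y \<Otimes>\<^sub>M lborel))"
    using assms by (subst V_prod(2)) (auto intro!: nn_integral_cong simp: case_prod_beta)
  also have "\<dots> = c * V G y" unfolding V_prod(2)[OF assms] by (rule nn_integral_cmult[OF V_prod(1)[OF assms]])
  finally show ?thesis .
qed

lemma V_time_integral:
  fixes G :: "real \<Rightarrow> real \<Rightarrow> 's option \<Rightarrow> ennreal"
  assumes G: "(\<lambda>(t, s, z). G t s z) \<in> borel_measurable (borel \<Otimes>\<^sub>M (borel \<Otimes>\<^sub>M borel_Delta))"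
  shows "V (\<lambda>s z. \<integral>\<^sup>+t. G t s z \<partial>lborel) y = (\<integral>\<^sup>+t. V (G t) y \<partial>lborel)"
proof -
  interpret Ly: prob_space "L y" by simp
  interpret Lb: pair_sigma_finite "L y" "lborel :: real measure" ..
  interpret pp: pair_sigma_finite "L y \<Otimes>\<^sub>M (lborel :: real measure)" "lborel :: real measure"
    by (intro pair_sigma_finite.intro Lb.sigma_finite_measure_axioms sigma_finite_lborel)
  have Gt: "(\<lambda>(s, z). G t s z) \<in> borel_measurable (borel \<Otimes>\<^sub>M borel_Delta)" for t
    using measurable_compose[OF measurable_Pair1'[of t borel "borel \<Otimes>\<^sub>M borel_Delta"] G] by (simp add: case_prod_beta)
  have GI: "(\<lambda>(s, z). \<integral>\<^sup>+t. G t s z \<partial>lborel) \<in> borel_measurable (borel \<Otimes>\<^sub>M borel_Delta)"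
  proof -
    have "(\<lambda>(w, t). G t (fst w) (snd w)) \<in> borel_measurable ((borel \<Otimes>\<^sub>M borel_Delta) \<Otimes>\<^sub>M lborel)"
    proof -
      have sb: "snd \<in> (borel \<Otimes>\<^sub>M borel_Delta) \<Otimes>\<^sub>M lborel \<rightarrow>\<^sub>M (borel :: real measure)" by measurable
      show ?thesis using measurable_compose[OF measurable_Pair[OF sb measurable_fst] G] by (simp add: case_prod_beta)
    qed
    from lborel.borel_measurable_nn_integral[OF this] show ?thesis by (simp add: case_prod_beta)
  qed
  have [measurable]: "(\<lambda>v. T (snd (fst v)) (fst (fst v))) \<in> borel_measurable ((L y \<Otimes>\<^sub>M lborel) \<Otimes>\<^sub>M lborel)"
  proof (rule measurable_T)
    show "(\<lambda>v. fst (fst v)) \<in> (L y \<Otimes>\<^sub>M lborel) \<Otimes>\<^sub>M lborel \<rightarrow>\<^sub>M N0"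
      using measurable_compose[OF measurable_fst measurable_fst, of "L y" lborel lborel] by (simp cong: measurable_cong_sets)
  qed measurable
  have pm: "(\<lambda>v. path X (T (snd (fst v)) (fst (fst v))) (fst (fst v))) \<in> (L y \<Otimes>\<^sub>M lborel) \<Otimes>\<^sub>M lborel \<rightarrow>\<^sub>M borel_Delta"
  proof (rule measurable_path_compose)
    show "(\<lambda>v. fst (fst v)) \<in> (L y \<Otimes>\<^sub>M lborel) \<Otimes>\<^sub>M lborel \<rightarrow>\<^sub>M N0"
      using measurable_compose[OF measurable_fst measurable_fst, of "L y" lborel lborel] by (simp cong: measurable_cong_sets)
  qed measurable
  have [measurable]: "(\<lambda>v. G (snd v) (enn2real (T (snd (fst v)) (fst (fst v)))) (path X (T (snd (fst v)) (fst (fst v))) (fst (fst v))))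
      \<in> borel_measurable ((L y \<Otimes>\<^sub>M lborel) \<Otimes>\<^sub>M lborel)"
  proof -
    have sb: "snd \<in> (L y \<Otimes>\<^sub>M lborel) \<Otimes>\<^sub>M lborel \<rightarrow>\<^sub>M (borel :: real measure)" by measurable
    have em: "(\<lambda>v. enn2real (T (snd (fst v)) (fst (fst v)))) \<in> (L y \<Otimes>\<^sub>M lborel) \<Otimes>\<^sub>M lborel \<rightarrow>\<^sub>M borel"
      by measurable
    show ?thesis
      using measurable_compose[OF measurable_Pair[OF sb measurable_Pair[OF em pm]] G] by simp
  qed
  have "V (\<lambda>s z. \<integral>\<^sup>+t. G t s z \<partial>lborel) y = (\<integral>\<^sup>+w. (\<integral>\<^sup>+t. (if 0 \<le> snd w \<and> T (snd w) (fst w) < \<infinity>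
      then G t (enn2real (T (snd w) (fst w))) (path X (T (snd w) (fst w)) (fst w)) else 0) \<partial>lborel) \<partial>(L y \<Otimes>\<^sub>M lborel))"
    unfolding V_prod(2)[OF GI] by (intro nn_integral_cong) auto
  also have "\<dots> = (\<integral>\<^sup>+t. V (G t) y \<partial>lborel)"
    unfolding V_prod(2)[OF Gt]
    by (rule pp.Fubini'[symmetric]) (unfold case_prod_beta, measurable)
  finally show ?thesis .
qed

text \<open>The 1-potential \<open>E\<^sub>x \<integral> e\<^sup>-\<^sup>s f(X\<^sub>s) dA\<^sub>s\<close> (see \<open>W_eq_V\<close>), in a form in which additivity of
\<open>a\<close> in time applies directly.\<close>

definition W :: "('s \<Rightarrow> ennreal) \<Rightarrow> 's \<Rightarrow> ennreal" where
  "W f x = (\<integral>\<^sup>+t\<in>{0<..}. ennreal (exp (- t)) * a t f x \<partial>lborel)"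

lemma W_eq_V:
  assumes f [measurable]: "f \<in> borel_measurable borel"
  shows "W f x = V (\<lambda>s z. ennreal (exp (- s)) * case_option 0 f z) (Some x)"
proof -
  have fz: "(\<lambda>w. case_option 0 f (snd (snd w)) :: ennreal) \<in> borel_measurable (borel \<Otimes>\<^sub>M (borel \<Otimes>\<^sub>M borel_Delta))"
    by (rule measurable_compose[OF _ borel_measurable_case_option[OF f]]) measurable
  have fz': "(\<lambda>w. case_option 0 f (snd w) :: ennreal) \<in> borel_measurable (borel \<Otimes>\<^sub>M borel_Delta)"
    by (rule measurable_compose[OF _ borel_measurable_case_option[OF f]]) measurable
  define G where "G t s z = ennreal (exp (- t)) * indicator {0<..} t * (if s < t then case_option 0 f z else 0)" for t s :: real and z
  have G: "(\<lambda>(t, s, z). G t s z) \<in> borel_measurable (borel \<Otimes>\<^sub>M (borel \<Otimes>\<^sub>M borel_Delta))"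
    unfolding G_def greaterThan_def case_prod_beta using fz by measurable
  have VG: "V (G t) (Some x) = ennreal (exp (- t)) * indicator {0<..} t * a t f x" for t
    unfolding G_def a_def
    by (rule V_cmult) (unfold case_prod_beta, use fz' in measurable)
  have "W f x = (\<integral>\<^sup>+t. V (G t) (Some x) \<partial>lborel)"
    unfolding W_def VG by (simp add: ac_simps)
  also have "\<dots> = V (\<lambda>s z. \<integral>\<^sup>+t. G t s z \<partial>lborel) (Some x)"
    by (rule V_time_integral[OF G, symmetric])
  also have "\<dots> = V (\<lambda>s z. ennreal (exp (- s)) * case_option 0 f z) (Some x)"
  proof (rule V_cong)
    fix s :: real and y assume s: "0 \<le> s"
    have "(\<integral>\<^sup>+t. G t s (Some y) \<partial>lborel) = (\<integral>\<^sup>+t. ennreal (exp (- t)) * (if s < t then 1 else 0) * indicator {0<..} t * f y \<partial>lborel)"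
      unfolding G_def by (intro nn_integral_cong) (auto split: split_indicator)
    also have "\<dots> = (\<integral>\<^sup>+t\<in>{0<..}. ennreal (exp (- t)) * (if s < t then 1 else 0) \<partial>lborel) * f y"
      by (rule nn_integral_multc) measurable
    finally show "(\<integral>\<^sup>+t. G t s (Some y) \<partial>lborel) = ennreal (exp (- s)) * case_option 0 f (Some y)"
      using nn_integral_exp_tail[OF s] by simp
  qed
  finally show ?thesis .
qed

lemma measurable_W [measurable]:
  assumes [measurable]: "f \<in> borel_measurable borel"
  shows "W f \<in> borel_measurable borel"
proof -
  have "(\<lambda>w. ennreal (exp (- snd w)) * a (snd w) f (fst w) * indicator {0<..} (snd w)) \<in> borel_measurable (borel \<Otimes>\<^sub>M lborel)"
    unfolding greaterThan_def by measurable
  then show ?thesis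
    unfolding W_def[abs_def] by (intro lborel.borel_measurable_nn_integral) (simp add: case_prod_beta)
qed

text \<open>The mass collected up to time \<open>e\<close> is discounted by at most \<open>exp (-e)\<close>.\<close>

lemma W_superharmonic:
  assumes [measurable]: "f \<in> borel_measurable borel" and e: "0 < e"
  shows "ennreal (exp (- e)) * a e f x + ennreal (exp (- e)) * Pt e (W f) x \<le> W f x"
proof -
  have "Pt e (W f) x = (\<integral>\<^sup>+t. Pt e (\<lambda>y. ennreal (exp (- t)) * a t f y * indicator {0<..} t) x \<partial>lborel)"
    unfolding W_def[abs_def] by (rule Pt_time_integral) (unfold greaterThan_def case_prod_beta, measurable)
  also have "\<dots> = (\<integral>\<^sup>+t\<in>{0<..}. ennreal (exp (- t)) * Pt e (a t f) x \<partial>lborel)"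
    by (intro nn_integral_cong) (auto simp: Pt_cmult Pt_def[of _ "\<lambda>_. 0"] split: split_indicator)
  finally have PW: "Pt e (W f) x = (\<integral>\<^sup>+t\<in>{0<..}. ennreal (exp (- t)) * Pt e (a t f) x \<partial>lborel)" .
  have ae: "a e f x = (\<integral>\<^sup>+t\<in>{0<..}. ennreal (exp (- t)) * a e f x \<partial>lborel)"
  proof -
    have "(\<integral>\<^sup>+t\<in>{0<..}. ennreal (exp (- t)) * a e f x \<partial>lborel) =
       (\<integral>\<^sup>+t\<in>{0<..}. ennreal (exp (- t)) * (if 0 < t then 1 else 0) \<partial>lborel) * a e f x"
      by (subst nn_integral_multc[symmetric]) (auto intro!: nn_integral_cong split: split_indicator)
    then show ?thesis using nn_integral_exp_tail[of 0] by simp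
  qed
  have "ennreal (exp (- e)) * a e f x + ennreal (exp (- e)) * Pt e (W f) x =
     ennreal (exp (- e)) * ((\<integral>\<^sup>+t\<in>{0<..}. ennreal (exp (- t)) * a e f x \<partial>lborel) + (\<integral>\<^sup>+t\<in>{0<..}. ennreal (exp (- t)) * Pt e (a t f) x \<partial>lborel))"
    unfolding PW ae[symmetric] by (simp add: distrib_left)
  also have "\<dots> = ennreal (exp (- e)) * (\<integral>\<^sup>+t\<in>{0<..}. ennreal (exp (- t)) * a (e + t) f x \<partial>lborel)"
    using e by (subst nn_integral_add[symmetric])
      (auto intro!: nn_integral_cong arg_cong2[where f="(*)"] simp: a_add distrib_left split: split_indicator)
  also have "\<dots> = (\<integral>\<^sup>+t\<in>{0<..}. ennreal (exp (- (e + t))) * a (e + t) f x \<partial>lborel)"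
  proof (subst nn_integral_cmult[symmetric], measurable, intro nn_integral_cong)
    fix t
    have "ennreal (exp (- (e + t))) = ennreal (exp (- e)) * ennreal (exp (- t))"
      by (simp add: exp_add[symmetric] flip: ennreal_mult)
    then show "ennreal (exp (- e)) * (ennreal (exp (- t)) * a (e + t) f x * indicator {0<..} t) =
        ennreal (exp (- (e + t))) * a (e + t) f x * indicator {0<..} t"
      by (simp add: mult.assoc)
  qed
  also have "\<dots> = (\<integral>\<^sup>+t\<in>{e<..}. ennreal (exp (- t)) * a t f x \<partial>lborel)"
    by (rule nn_integral_greaterThan_shift) measurable
  also have "\<dots> \<le> W f x"
    unfolding W_def using e by (intro nn_integral_mono) (auto split: split_indicator)
  finally show ?thesis .
qed

lemma a_mono_time: "s \<le> t \<Longrightarrow> a s f x \<le> a t f x"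
  unfolding a_def by (intro V_mono) auto

lemma a_mono: "(\<And>y. f y \<le> g y) \<Longrightarrow> a t f x \<le> a t g x"
  unfolding a_def by (intro V_mono) (auto split: option.split)

lemma a_cmult: assumes f: "f \<in> borel_measurable borel" shows "a t (\<lambda>y. c * f y) x = c * a t f x"
proof -
  have fz': "(\<lambda>w. case_option 0 f (snd w) :: ennreal) \<in> borel_measurable (borel \<Otimes>\<^sub>M borel_Delta)"
    by (rule measurable_compose[OF _ borel_measurable_case_option[OF f]]) measurable
  have "a t (\<lambda>y. c * f y) x = V (\<lambda>s z. c * (if s < t then case_option 0 f z else 0)) (Some x)"
    unfolding a_def by (rule V_cong) simp
  also have "\<dots> = c * a t f x" unfolding a_def
    by (rule V_cmult) (unfold case_prod_beta, use fz' in measurable)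
  finally show ?thesis .
qed

lemma a_le_W:
  assumes f [measurable]: "f \<in> borel_measurable borel"
  shows "a t f x \<le> ennreal (exp t) * W f x"
proof -
  have fz': "(\<lambda>w. case_option 0 f (snd w) :: ennreal) \<in> borel_measurable (borel \<Otimes>\<^sub>M borel_Delta)"
    by (rule measurable_compose[OF _ borel_measurable_case_option[OF f]]) measurable
  have "a t f x \<le> V (\<lambda>s z. ennreal (exp t) * (ennreal (exp (- s)) * case_option 0 f z)) (Some x)"
    unfolding a_def
  proof (rule V_mono)
    fix s :: real and z
    have "s < t \<Longrightarrow> 1 \<le> ennreal (exp t) * ennreal (exp (- s))"
      by (simp add: exp_add[symmetric] flip: ennreal_mult ennreal_1)
    then show "(if s < t then case_option 0 f z else 0) \<le> ennreal (exp t) * (ennreal (exp (- s)) * case_option 0 f z)"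
      using mult_right_mono[of 1 "ennreal (exp t) * ennreal (exp (- s))" "case_option 0 f z"] by (auto simp: mult.assoc)
  qed
  also have "\<dots> = ennreal (exp t) * W f x"
    unfolding W_eq_V[OF f] by (rule V_cmult) (unfold case_prod_beta, use fz' in measurable)
  finally show ?thesis .
qed

end

section \<open>A strictly positive function with bounded potential\<close>

context strict_pcaf
begin

text \<open>The discounted cost at rate \<open>k\<close> until the clock shows 1.\<close>

definition budget :: "('s \<Rightarrow> ennreal) \<Rightarrow> 'w \<Rightarrow> ennreal" where
  "budget k w = (\<integral>\<^sup>+s\<in>{0..}. (if ennreal s \<le> T 1 w then ennreal (exp (- s)) * case_option 0 k (path X (ennreal s) w) else 0) \<partial>lborel)"

definition unit_cost :: "('s \<Rightarrow> ennreal) \<Rightarrow> 's \<Rightarrow> ennreal" where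
  "unit_cost k x = (\<integral>\<^sup>+w. budget k w \<partial>L (Some x))"

lemma measurable_budget:
  assumes k: "k \<in> borel_measurable borel"
  shows "budget k \<in> borel_measurable N0"
proof -
  have [measurable]: "(\<lambda>w. case_option 0 k (path X (ennreal (snd w)) (fst w)) :: ennreal) \<in> borel_measurable (N0 \<Otimes>\<^sub>M lborel)"
    by (rule measurable_case_path[OF k]) measurable
  have "(\<lambda>w. (if ennreal (snd w) \<le> T 1 (fst w) then ennreal (exp (- snd w)) * case_option 0 k (path X (ennreal (snd w)) (fst w)) else 0) *
      indicator {0..} (snd w)) \<in> borel_measurable (N0 \<Otimes>\<^sub>M lborel)"
    unfolding atLeast_def by measurable
  then show ?thesis
    unfolding budget_def[abs_def] by (intro lborel.borel_measurable_nn_integral) (simp add: case_prod_beta)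
qed

lemma measurable_unit_cost [measurable]:
  assumes "k \<in> borel_measurable borel"
  shows "unit_cost k \<in> borel_measurable borel"
proof -
  have "L \<circ> Some \<in> borel \<rightarrow>\<^sub>M subprob_algebra N0" by (rule measurable_comp[OF measurable_Some_borel_Delta measurable_L_subprob])
  from measurable_compose[OF this nn_integral_measurable_subprob_algebra[OF measurable_budget[OF assms]]]
  show ?thesis by (simp add: unit_cost_def[abs_def])
qed

text \<open>The clock is continuous and starts at 0, so \<open>T 1 > 0\<close>, and the process lives for a positive time.\<close>

lemma unit_cost_positive:
  assumes k: "k \<in> borel_measurable borel" and pos: "\<And>y. 0 < k y"
  shows "0 < unit_cost k x"
proof (rule ccontr)
  assume "\<not> 0 < unit_cost k x"
  then have "(\<integral>\<^sup>+w. budget k w \<partial>P (Some x)) = 0"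
    by (simp add: unit_cost_def nn_integral_P measurable_budget[OF k])
  then have "AE w in P (Some x). budget k w = 0"
    by (subst (asm) nn_integral_0_iff_AE) (auto intro: measurable_P_of_N0 measurable_budget[OF k])
  then have "AE w in P (Some x). False"
    using AE_D[of "Some x"] AE_start[of "Some x"] AE_space[of "P (Some x)"]
  proof eventually_elim
    case (elim w)
    then have w: "w \<in> \<Omega>" "w \<notin> D" by auto
    have "0 < min (T 1 w) (lifetime X w)"
      using T_positive[OF w, of 1] lifetime_zero_iff[OF w(1)] elim by (auto simp: zero_less_iff_neq_zero)
    from dense[OF this] obtain d where d: "0 < d" "d < min (T 1 w) (lifetime X w)" by blast
    then obtain r where r: "d = ennreal r" "0 < r" by (cases d) auto
    have pm: "(\<lambda>s. path X (ennreal s) w) \<in> borel \<rightarrow>\<^sub>M borel_Delta"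
      by (rule measurable_compose[OF _ path_section_measurable[OF w(1)]]) measurable
    note [measurable] = measurable_compose[OF pm borel_measurable_case_option[OF k, of 0]]
    have "AE s in lborel. (if ennreal s \<le> T 1 w then ennreal (exp (- s)) * case_option 0 k (path X (ennreal s) w) else 0) * indicator {0..} s = 0"
      using elim(1) unfolding budget_def by (subst (asm) nn_integral_0_iff_AE) auto
    then have "AE s in lborel. s \<notin> {0<..<r}"
    proof eventually_elim
      case (elim s)
      show ?case
      proof
        assume s: "s \<in> {0<..<r}"
        then have "ennreal s < d" using r by (auto intro!: ennreal_lessI)
        then have "ennreal s < T 1 w" "ennreal s < lifetime X w" using d by auto
        have "path X (ennreal s) w \<noteq> \<Delta>"
        proof
          assume "path X (ennreal s) w = \<Delta>"
          then have "lifetime X w \<le> ennreal s" by (auto simp: lifetime_def intro: Inf_lower)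
          then show False using \<open>ennreal s < lifetime X w\<close> by simp
        qed
        then show False using elim s \<open>ennreal s < T 1 w\<close> pos by (auto split: option.splits simp: less_le)
      qed
    qed
    then have "emeasure lborel {0<..<r} = 0" by (subst (asm) AE_iff_measurable[of "{0<..<r}"]) auto
    then show False using r by simp
  qed
  then have "emeasure (P (Some x)) \<Omega> = 0"
    using sets.top[of "P (Some x)"] by (subst (asm) AE_iff_measurable[OF _ refl]) auto
  then show False using prob_space.emeasure_space_1[OF prob_space_P[of "Some x"]] by simp
qed

text \<open>\<open>T u \<le> v \<le> T (u+1)\<close> forces \<open>A v - 1 \<le> u \<le> A v\<close>.\<close>

lemma budget_interval:
  assumes w: "w \<in> \<Omega>" "w \<notin> D" and "0 \<le> v"
  shows "(\<integral>\<^sup>+u\<in>{0..}. (if T u w \<le> ennreal v \<and> ennreal v \<le> T (u + 1) w then 1 else 0) \<partial>lborel) \<le> 1"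
proof -
  define c where "c = pcaf_at A (ennreal v) w"
  have le1: "ennreal u \<le> c" if "T u w \<le> ennreal v" for u
  proof (cases "T u w < ennreal v")
    case True then show ?thesis using T_less_iff[OF w] by (simp add: c_def less_imp_le)
  next
    case False
    then have "T u w = ennreal v" using that by simp
    then show ?thesis using T_inverse[OF w _ \<open>0 \<le> v\<close>, of u] \<open>0 \<le> v\<close> by (simp add: c_def pcaf_at_def)
  qed
  have le2: "c \<le> ennreal (u + 1)" if "ennreal v \<le> T (u + 1) w" for u
    using T_less_iff[OF w, of "u + 1" "ennreal v"] that by (simp add: c_def not_less[symmetric])
  show ?thesis
  proof (cases c)
    case (real b)
    have "(\<integral>\<^sup>+u\<in>{0..}. (if T u w \<le> ennreal v \<and> ennreal v \<le> T (u + 1) w then 1 else 0) \<partial>lborel) \<le>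
        (\<integral>\<^sup>+u. indicator {b - 1..b} u \<partial>lborel)"
    proof (rule nn_integral_mono)
      fix u :: real
      have "u \<in> {b - 1..b}" if "0 \<le> u" "T u w \<le> ennreal v" "ennreal v \<le> T (u + 1) w"
        using le1[OF that(2)] le2[OF that(3)] real that(1) by (auto simp: ennreal_le_iff simp del: ennreal_plus)
      then show "(if T u w \<le> ennreal v \<and> ennreal v \<le> T (u + 1) w then 1 else 0) * indicator {0..} u
        \<le> (indicator {b - 1..b} u :: ennreal)"
        by (auto split: split_indicator)
    qed
    also have "\<dots> = 1" by simp
    finally show ?thesis .
  next
    case top
    then have "\<not> ennreal v \<le> T (u + 1) w" for u using le2[of u] by (auto simp: top_unique)
    then show ?thesis by simp
  qed
qed

text \<open>By the strong Markov property the potential is the expected integral over \<open>u\<close> of the costs incurred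
during \<open>[T u, T (u+1)]\<close>. By the preceding lemma each time is counted at most once.\<close>

lemma W_unit_cost_le:
  assumes k [measurable]: "k \<in> borel_measurable borel"
  shows "W (unit_cost k) x \<le> R k x"
proof -
  note [measurable] = measurable_budget[OF k]
  define \<Phi> where "\<Phi> r w = (if r < \<infinity> then ennreal (exp (- enn2real r)) else 0) * budget k w" for r w
  define \<Psi> where "\<Psi> u w = (\<integral>\<^sup>+v\<in>{0..}. (if T u w \<le> ennreal v \<and> ennreal v \<le> T (u + 1) w
      then ennreal (exp (- v)) * case_option 0 k (path X (ennreal v) w) else 0) \<partial>lborel)" for u w
  have m\<Phi>: "(\<lambda>(s, w). \<Phi> s w) \<in> borel_measurable (borel \<Otimes>\<^sub>M N0)"
    unfolding \<Phi>_def case_prod_beta by measurable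
  have cp: "(\<lambda>pt. case_option 0 k (path X (ennreal (snd pt)) (snd (fst pt))) :: ennreal) \<in> borel_measurable ((borel \<Otimes>\<^sub>M N0) \<Otimes>\<^sub>M lborel)"
    by (rule measurable_case_path[OF k]) measurable
  have m\<Psi>: "(\<lambda>(u, w). \<Psi> u w) \<in> borel_measurable (borel \<Otimes>\<^sub>M N0)"
  proof -
    have "(\<lambda>pt. (if T (fst (fst pt)) (snd (fst pt)) \<le> ennreal (snd pt) \<and> ennreal (snd pt) \<le> T (fst (fst pt) + 1) (snd (fst pt))
      then ennreal (exp (- snd pt)) * case_option 0 k (path X (ennreal (snd pt)) (snd (fst pt))) else 0) * indicator {0..} (snd pt))
      \<in> borel_measurable ((borel \<Otimes>\<^sub>M N0) \<Otimes>\<^sub>M lborel)"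
      unfolding atLeast_def using cp by measurable
    then show ?thesis
      unfolding \<Psi>_def case_prod_beta by (intro lborel.borel_measurable_nn_integral) (simp add: case_prod_beta)
  qed
  have "W (unit_cost k) x = V (\<lambda>s z. \<integral>\<^sup>+w. \<Phi> (ennreal s) w \<partial>L z) (Some x)"
    unfolding W_eq_V[OF measurable_unit_cost[OF k]]
  proof (rule V_cong)
    fix s :: real and y assume "0 \<le> s"
    then show "ennreal (exp (- s)) * case_option 0 (unit_cost k) (Some y) = (\<integral>\<^sup>+w. \<Phi> (ennreal s) w \<partial>L (Some y))"
      unfolding \<Phi>_def by (subst nn_integral_cmult) (auto simp: unit_cost_def intro: measurable_L_of_N0)
  qed
  also have "\<dots> = (\<integral>\<^sup>+w. (\<integral>\<^sup>+u\<in>{0..}. \<Psi> u w \<partial>lborel) \<partial>L (Some x))"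
  proof (rule additive_functional_eq[OF m\<Phi> m\<Psi>, symmetric])
    fix u w assume u: "0 \<le> u" and w: "w \<in> \<Omega>" "w \<notin> D" and \<theta>: "T u w < \<infinity> \<Longrightarrow> \<theta> (T u w) w \<in> \<Omega> - D"
    show "\<Psi> u w = (if T u w < \<infinity> then \<Phi> (T u w) (\<theta> (T u w) w) else 0)"
    proof (cases "T u w")
      case (real r)
      then have T1: "T (u + 1) w = ennreal r + T 1 (\<theta> (ennreal r) w)"
        using T_shift_at_T[OF w _ _ u, of 1] \<theta> by auto
      have pm: "(\<lambda>s. path X (ennreal s) w) \<in> borel \<rightarrow>\<^sub>M borel_Delta"
        by (rule measurable_compose[OF _ path_section_measurable[OF w(1)]]) measurable
      note [measurable] = measurable_compose[OF pm borel_measurable_case_option[OF k, of 0]] T_section_measurable[OF w(1)]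
      have pm': "(\<lambda>s. path X (ennreal s) (\<theta> (ennreal r) w)) \<in> borel \<rightarrow>\<^sub>M borel_Delta"
        by (rule measurable_compose[OF _ path_section_measurable[OF shift_space[OF w(1)]]]) measurable
      note [measurable] = measurable_compose[OF pm' borel_measurable_case_option[OF k, of 0]]
      have "\<Psi> u w = (\<integral>\<^sup>+s. (if T u w \<le> ennreal (r + 1 * s) \<and> ennreal (r + 1 * s) \<le> T (u + 1) w
          then ennreal (exp (- (r + 1 * s))) * case_option 0 k (path X (ennreal (r + 1 * s)) w) else 0) * indicator {0..} (r + 1 * s) \<partial>lborel)"
        unfolding \<Psi>_def by (subst nn_integral_real_affine[where c=1 and t=r]) (simp_all only: mult_1 abs_one, simp_all)
      also have "\<dots> = (\<integral>\<^sup>+s. ennreal (exp (- r)) * ((if ennreal s \<le> T 1 (\<theta> (ennreal r) w)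
          then ennreal (exp (- s)) * case_option 0 k (path X (ennreal s) (\<theta> (ennreal r) w)) else 0) * indicator {0..} s) \<partial>lborel)"
      proof (rule nn_integral_cong)
        fix s :: real
        show "(if T u w \<le> ennreal (r + 1 * s) \<and> ennreal (r + 1 * s) \<le> T (u + 1) w
          then ennreal (exp (- (r + 1 * s))) * case_option 0 k (path X (ennreal (r + 1 * s)) w) else 0) * indicator {0..} (r + 1 * s) =
          ennreal (exp (- r)) * ((if ennreal s \<le> T 1 (\<theta> (ennreal r) w)
          then ennreal (exp (- s)) * case_option 0 k (path X (ennreal s) (\<theta> (ennreal r) w)) else 0) * indicator {0..} s)"
        proof (cases "0 \<le> s")
          case True
          have e1: "ennreal (r + s) = ennreal r + ennreal s" using True real by simp
          have e2: "ennreal (exp (- r - s)) = ennreal (exp (- r)) * ennreal (exp (- s))"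
            by (simp add: exp_add[symmetric] flip: ennreal_mult)
          have e3: "ennreal r + ennreal s \<le> ennreal r + T 1 (\<theta> (ennreal r) w) \<longleftrightarrow> ennreal s \<le> T 1 (\<theta> (ennreal r) w)"
            by (simp add: ennreal_add_left_cancel_le)
          show ?thesis using True real w(1) by (simp add: e1 e2 e3 T1 mult.assoc add.commute[of _ "ennreal r"] del: ennreal_plus)
        next
          case False
          then have "\<not> ennreal r \<le> ennreal (r + s) \<or> r + s < 0"
            using real by (cases "0 \<le> r + s") (auto simp: ennreal_le_iff simp del: ennreal_plus)
          then show ?thesis using False real by (auto simp del: ennreal_plus)
        qed
      qed
      also have "\<dots> = ennreal (exp (- r)) * budget k (\<theta> (ennreal r) w)"
        unfolding budget_def by (rule nn_integral_cmult) measurable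
      finally show ?thesis using real by (simp add: \<Phi>_def)
    qed (simp add: \<Psi>_def top_unique)
  qed
  also have "\<dots> \<le> (\<integral>\<^sup>+w. (\<integral>\<^sup>+v\<in>{0..}. ennreal (exp (- v)) * case_option 0 k (path X (ennreal v) w) \<partial>lborel) \<partial>L (Some x))"
  proof (rule nn_integral_mono_AE)
    have "AE w in L (Some x). w \<in> \<Omega> \<and> w \<notin> D"
      using AE_D[of "Some x"] AE_space[of "L (Some x)"] unfolding P_def AE_completion_iff by eventually_elim simp
    then show "AE w in L (Some x). (\<integral>\<^sup>+u\<in>{0..}. \<Psi> u w \<partial>lborel) \<le>
       (\<integral>\<^sup>+v\<in>{0..}. ennreal (exp (- v)) * case_option 0 k (path X (ennreal v) w) \<partial>lborel)"
    proof eventually_elim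
      case (elim w)
      then have w: "w \<in> \<Omega>" "w \<notin> D" by auto
      define g where "g v = ennreal (exp (- v)) * case_option 0 k (path X (ennreal v) w) * indicator {0..} v" for v
      have pm: "(\<lambda>s. path X (ennreal s) w) \<in> borel \<rightarrow>\<^sub>M borel_Delta"
        by (rule measurable_compose[OF _ path_section_measurable[OF w(1)]]) measurable
      note [measurable] = measurable_compose[OF pm borel_measurable_case_option[OF k, of 0]] T_section_measurable[OF w(1)]
      have [measurable]: "g \<in> borel_measurable borel" unfolding g_def by measurable
      define J where "J u v = (if T u w \<le> ennreal v \<and> ennreal v \<le> T (u + 1) w then 1 else 0 :: ennreal) * indicator {0..} u" for u v :: real
      have [measurable]: "(\<lambda>(u, v). J u v) \<in> borel_measurable (borel \<Otimes>\<^sub>M borel)"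
        unfolding J_def case_prod_beta atLeast_def by measurable
      have "(\<integral>\<^sup>+u\<in>{0..}. \<Psi> u w \<partial>lborel) = (\<integral>\<^sup>+u. (\<integral>\<^sup>+v. J u v * g v \<partial>lborel) \<partial>lborel)"
      proof (rule nn_integral_cong)
        fix u :: real
        show "\<Psi> u w * indicator {0..} u = (\<integral>\<^sup>+v. J u v * g v \<partial>lborel)"
          unfolding \<Psi>_def by (subst nn_integral_multc[symmetric])
            (auto simp: J_def g_def intro!: nn_integral_cong split: split_indicator)
      qed
      also have "\<dots> = (\<integral>\<^sup>+v. (\<integral>\<^sup>+u. J u v * g v \<partial>lborel) \<partial>lborel)"
        by (rule lborel_pair.Fubini') measurable
      also have "\<dots> \<le> (\<integral>\<^sup>+v. 1 * g v \<partial>lborel)"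
      proof (rule nn_integral_mono)
        fix v :: real
        show "(\<integral>\<^sup>+u. J u v * g v \<partial>lborel) \<le> 1 * g v"
        proof (cases "0 \<le> v")
          case True
          have "(\<integral>\<^sup>+u. J u v * g v \<partial>lborel) = (\<integral>\<^sup>+u. J u v \<partial>lborel) * g v" by (rule nn_integral_multc) measurable
          also have "\<dots> \<le> 1 * g v" unfolding J_def by (intro mult_right_mono budget_interval[OF w True]) simp
          finally show ?thesis .
        qed (simp add: g_def)
      qed
      finally show ?case by (simp add: g_def)
    qed
  qed
  also have "\<dots> = (\<integral>\<^sup>+v. (\<integral>\<^sup>+w. ennreal (exp (- v)) * case_option 0 k (path X (ennreal v) w) * indicator {0..} v \<partial>L (Some x)) \<partial>lborel)"
  proof -
    interpret Lx: prob_space "L (Some x)" by simp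
    interpret pp: pair_sigma_finite "L (Some x)" "lborel :: real measure" ..
    have [measurable]: "(\<lambda>pt. case_option 0 k (path X (ennreal (snd pt)) (fst pt)) :: ennreal) \<in> borel_measurable (L (Some x) \<Otimes>\<^sub>M lborel)"
    proof (rule measurable_case_path[OF k])
      show "fst \<in> L (Some x) \<Otimes>\<^sub>M lborel \<rightarrow>\<^sub>M N0" using measurable_fst[of "L (Some x)" lborel] by (simp cong: measurable_cong_sets)
    qed measurable
    show ?thesis
      by (rule pp.Fubini'[symmetric]) (unfold case_prod_beta atLeast_def, measurable)
  qed
  also have "\<dots> = R k x"
    unfolding R_def
  proof (rule nn_integral_cong_AE, use AE_lborel_neq[of 0] in eventually_elim)
    fix v :: real assume "v \<noteq> 0"
    have [measurable]: "(\<lambda>w. case_option 0 k (path X (ennreal v) w)) \<in> borel_measurable (L (Some x))"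
      by (intro measurable_L_of_N0 measurable_case_path[OF k]) measurable
    show "(\<integral>\<^sup>+w. ennreal (exp (- v)) * case_option 0 k (path X (ennreal v) w) * indicator {0..} v \<partial>L (Some x)) =
      ennreal (exp (- v)) * Pt v k x * indicator {0<..} v"
      using \<open>v \<noteq> 0\<close> by (cases "0 < v") (auto simp: nn_integral_cmult nn_integral_path_Some)
  qed
  finally show ?thesis .
qed

lemma a_sum:
  assumes [measurable]: "f \<in> borel_measurable borel" "g \<in> borel_measurable borel"
  shows "a t (\<lambda>y. f y + g y) x = a t f x + a t g x"
proof -
  have "C t (\<lambda>y. f y + g y) w = C t f w + C t g w" if w: "w \<in> \<Omega>" for w
  proof -
    note [measurable] = T_section_measurable[OF w]
      measurable_compose[OF measurable_compose[OF T_section_measurable[OF w] path_section_measurable[OF w]] borel_measurable_case_option[OF assms(1), of 0]]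
      measurable_compose[OF measurable_compose[OF T_section_measurable[OF w] path_section_measurable[OF w]] borel_measurable_case_option[OF assms(2), of 0]]
    show ?thesis unfolding C_def
      by (subst nn_integral_add[symmetric]) (auto intro!: nn_integral_cong split: split_indicator option.split)
  qed
  then have "a t (\<lambda>y. f y + g y) x = (\<integral>\<^sup>+w. C t f w + C t g w \<partial>L (Some x))"
    unfolding a_eq_C by (intro nn_integral_cong) simp
  then show ?thesis
    unfolding a_eq_C by (simp add: nn_integral_add measurable_L_of_N0 measurable_C)
qed

lemma measurable_V_integrand:
  fixes f :: "'s \<Rightarrow> ennreal"
  assumes f: "f \<in> borel_measurable borel"
  shows "(\<lambda>(s :: real, z). if s < t then case_option 0 f z else 0 :: ennreal) \<in> borel_measurable (borel \<Otimes>\<^sub>M borel_Delta)"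
proof -
  have "(\<lambda>w. case_option 0 f (snd w) :: ennreal) \<in> borel_measurable ((borel :: real measure) \<Otimes>\<^sub>M borel_Delta)"
    by (rule measurable_compose[OF _ borel_measurable_case_option[OF f]]) measurable
  then show ?thesis unfolding case_prod_beta by measurable
qed

lemma a_SUP:
  fixes h' :: "nat \<Rightarrow> 's \<Rightarrow> ennreal"
  assumes [measurable]: "\<And>i. h' i \<in> borel_measurable borel" and inc: "incseq h'"
  shows "a t (\<lambda>y. SUP i::nat. h' i y) x = (SUP i. a t (h' i) x)"
proof -
  have m: "(\<lambda>y. SUP i. h' i y) \<in> borel_measurable borel" by measurable
  have mono: "h' i y \<le> h' j y" if "i \<le> j" for i j y using inc that by (auto simp: incseq_def le_fun_def)
  let ?g = "\<lambda>h w. if 0 \<le> snd w \<and> T (snd w) (fst w) < \<infinity> then (\<lambda>s z. if s < t then case_option 0 h z else 0) (enn2real (T (snd w) (fst w))) (path X (T (snd w) (fst w)) (fst w)) else (0::ennreal)"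
  have "a t (\<lambda>y. SUP i. h' i y) x = (\<integral>\<^sup>+w. ?g (\<lambda>y. SUP i. h' i y) w \<partial>(L (Some x) \<Otimes>\<^sub>M lborel))"
    unfolding a_def by (rule V_prod(2)[OF measurable_V_integrand[OF m]])
  also have "\<dots> = (\<integral>\<^sup>+w. (SUP i. ?g (h' i) w) \<partial>(L (Some x) \<Otimes>\<^sub>M lborel))"
    by (intro nn_integral_cong) (auto split: option.split)
  also have "\<dots> = (SUP i. \<integral>\<^sup>+w. ?g (h' i) w \<partial>(L (Some x) \<Otimes>\<^sub>M lborel))"
  proof (rule nn_integral_monotone_convergence_SUP)
    show "incseq (\<lambda>i w. ?g (h' i) w)"
      using mono by (auto simp: incseq_def le_fun_def split: option.split)
    show "?g (h' i) \<in> borel_measurable (L (Some x) \<Otimes>\<^sub>M lborel)" for i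
      by (rule V_prod(1)[OF measurable_V_integrand]) measurable
  qed
  also have "\<dots> = (SUP i. a t (h' i) x)"
    unfolding a_def by (intro SUP_cong refl V_prod(2)[OF measurable_V_integrand, symmetric]) measurable
  finally show ?thesis .
qed

end

section \<open>The Revuz measure as a dyadic limit\<close>

text \<open>Cauchy--Schwarz with a free parameter: \<open>c |h1 - h0| \<le> c\<^sup>2/(2d) + d |h1 - h0|\<^sup>2/2\<close>, rearranged to avoid
subtraction.\<close>

lemma amgm_ennreal:
  fixes c :: ennreal
  assumes h: "0 \<le> h0" "0 \<le> h1" and d: "0 < (d::real)"
  shows "c * ennreal h1 \<le> c * ennreal h0 + (ennreal (1 / (2 * d)) * (c * c) + ennreal (d / 2) * ennreal ((h1 - h0)\<^sup>2))"
proof (cases c)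
  case (real r)
  have "0 \<le> (r - d * (h1 - h0))\<^sup>2" by simp
  then have "2 * d * (r * (h1 - h0)) \<le> r\<^sup>2 + d\<^sup>2 * (h1 - h0)\<^sup>2" by (simp add: power2_eq_square algebra_simps)
  then have "r * (h1 - h0) \<le> (r\<^sup>2 + d\<^sup>2 * (h1 - h0)\<^sup>2) / (2 * d)"
    using d by (simp add: pos_le_divide_eq mult.commute)
  also have "\<dots> = 1 / (2 * d) * (r * r) + d / 2 * (h1 - h0)\<^sup>2"
    using d by (simp add: field_simps power2_eq_square)
  finally have "r * h1 \<le> r * h0 + (1 / (2 * d) * (r * r) + d / 2 * (h1 - h0)\<^sup>2)" by (simp add: algebra_simps)
  then have "ennreal (r * h1) \<le> ennreal (r * h0 + (1 / (2 * d) * (r * r) + d / 2 * (h1 - h0)\<^sup>2))" by (rule ennreal_leI)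
  moreover have "ennreal (1 / (2 * d)) * (ennreal r * ennreal r) = ennreal (1 / (2 * d) * (r * r))"
    "ennreal (d / 2) * ennreal ((h1 - h0)\<^sup>2) = ennreal (d / 2 * (h1 - h0)\<^sup>2)"
    "ennreal r * ennreal h1 = ennreal (r * h1)" "ennreal r * ennreal h0 = ennreal (r * h0)"
    using real h d ennreal_mult[of "1 / (2 * d)" "r * r"] ennreal_mult[of r r] ennreal_mult[of "d / 2" "(h1 - h0)\<^sup>2"]
      ennreal_mult[of r h1] ennreal_mult[of r h0] by simp_all
  moreover have "ennreal (r * h0 + (1 / (2 * d) * (r * r) + d / 2 * (h1 - h0)\<^sup>2)) =
      ennreal (r * h0) + (ennreal (1 / (2 * d) * (r * r)) + ennreal (d / 2 * (h1 - h0)\<^sup>2))"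
    using real h d by (subst ennreal_plus, simp, simp, subst ennreal_plus) auto
  ultimately show ?thesis unfolding real(2) by (simp only:)
next
  case top
  then show ?thesis using d by (simp add: ennreal_mult_eq_top_iff ennreal_top_mult)
qed

lemma ennreal_add_left_leD: "a + b \<le> a + c \<Longrightarrow> a < top \<Longrightarrow> b \<le> (c::ennreal)"
  by (auto simp: ennreal_add_left_cancel_le)

locale revuz_pcaf = strict_pcaf X m p A
  for X :: "('w, 's::{metric_space, second_countable_topology}) process" and m p A +
  fixes \<mu> :: "'s measure"
  assumes revuz: "revuz_measure X m A \<mu>"
begin

lemma sets_\<mu> [simp, measurable_cong]: "sets \<mu> = sets borel"
  using revuz by (simp add: revuz_measure_def)

lemma space_\<mu> [simp]: "space \<mu> = UNIV"
  using sets_eq_imp_space_eq[OF sets_\<mu>] by simp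

definition c :: "('s \<Rightarrow> ennreal) \<Rightarrow> real \<Rightarrow> ennreal" where
  "c f t = (\<integral>\<^sup>+x. a t f x \<partial>m)"

lemma stieltjes_eq_C:
  assumes w: "w \<in> \<Omega>" "w \<notin> D" and t: "0 < t" and E: "E \<in> sets borel"
  shows "(\<integral>\<^sup>+s\<in>{0..t}. indicator (Some ` E) (path X (ennreal s) w) \<partial>stieltjes_measure (lifetime X w) (\<lambda>s. A s w)) =
    C t (indicator E) w"
proof -
  have pm: "(\<lambda>s. path X (ennreal s) w) \<in> borel \<rightarrow>\<^sub>M borel_Delta"
    by (rule measurable_compose[OF _ path_section_measurable[OF w(1)]]) measurable
  have iE: "indicator (Some ` E) z = case_option 0 (indicator E) z" for z
    by (auto split: option.split split_indicator)
  have fm: "(\<lambda>s. indicator (Some ` E) (path X (ennreal s) w) :: ennreal) \<in> borel_measurable borel"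
    unfolding iE by (rule measurable_compose[OF pm borel_measurable_case_option]) (use E in measurable)
  have "(\<integral>\<^sup>+s\<in>{0..t}. indicator (Some ` E) (path X (ennreal s) w) \<partial>stieltjes_measure (lifetime X w) (\<lambda>s. A s w)) =
    (\<integral>\<^sup>+u\<in>{0..}. (if clock_inverse (\<lambda>t. A t w) u < ennreal t
       then indicator (Some ` E) (path X (ennreal (enn2real (clock_inverse (\<lambda>t. A t w) u))) w) else 0) \<partial>lborel)"
    by (rule nn_integral_stieltjes_clock[OF clock_path_A[OF w(1)] fm]) (use t in simp)
  also have "\<dots> = C t (indicator E) w"
    unfolding C_def
  proof (intro nn_integral_cong arg_cong2[where f="(*)"] refl)
    fix u
    have T: "clock_inverse (\<lambda>t. A t w) u = T u w" using not_D(2)[OF w] by (simp add: \<tau>_def)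
    show "(if clock_inverse (\<lambda>t. A t w) u < ennreal t
       then indicator (Some ` E) (path X (ennreal (enn2real (clock_inverse (\<lambda>t. A t w) u))) w) else 0) =
       (if T u w < ennreal t then case_option 0 (indicator E) (path X (T u w) w) else (0::ennreal))"
      unfolding T iE by (cases "T u w") auto
  qed
  finally show ?thesis .
qed

lemma emeasure_\<mu>:
  assumes E: "E \<in> sets borel"
  shows "emeasure \<mu> E = (SUP t\<in>{0<..}. ennreal (1 / t) * c (indicator E) t)"
proof -
  have "expect X x (\<lambda>w. \<integral>\<^sup>+s\<in>{0..t}. indicator (Some ` E) (path X (ennreal s) w) \<partial>stieltjes_measure (lifetime X w) (\<lambda>s. A s w))
     = a t (indicator E) x" if "0 < t" for t x
    unfolding a_eq_C
  proof (rule expect_eq_N0)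
    show "C t (indicator E) \<in> borel_measurable N0" by (rule measurable_C) (use E in measurable)
    show "AE w in P (Some x). (\<integral>\<^sup>+s\<in>{0..t}. indicator (Some ` E) (path X (ennreal s) w) \<partial>stieltjes_measure (lifetime X w) (\<lambda>s. A s w))
        = C t (indicator E) w"
      using AE_D[of "Some x"] AE_space[of "P (Some x)"]
      by eventually_elim (rule stieltjes_eq_C, use that E in auto)
  qed
  note ex = this
  have "emeasure \<mu> E = (SUP t\<in>{0<..}. ennreal (1 / t) * (\<integral>\<^sup>+x. expect X x (\<lambda>w. \<integral>\<^sup>+s\<in>{0..t}.
      indicator (Some ` E) (path X (ennreal s) w) \<partial>stieltjes_measure (lifetime X w) (\<lambda>s. A s w)) \<partial>completion m))"
    using revuz E unfolding revuz_measure_def by blast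
  also have "\<dots> = (SUP t\<in>{0<..}. ennreal (1 / t) * c (indicator E) t)"
    unfolding nn_integral_completion c_def
    by (intro SUP_cong refl arg_cong2[where f="(*)"] nn_integral_cong ex) auto
  finally show ?thesis .
qed

text \<open>\<open>E\<^sub>m\<close> of the increment over \<open>[t, t+s]\<close> is at most \<open>c f s\<close>, as \<open>m\<close> is excessive.\<close>

lemma c_add_le:
  assumes [measurable]: "f \<in> borel_measurable borel" and "0 < t" "0 \<le> s"
  shows "c f (t + s) \<le> c f t + c f s"
proof -
  have "c f (t + s) = c f t + (\<integral>\<^sup>+x. Pt t (a s f) x \<partial>m)"
  proof -
    have "c f (t + s) = (\<integral>\<^sup>+x. a t f x + Pt t (a s f) x \<partial>m)"
      unfolding c_def by (intro nn_integral_cong a_add assms)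
    then show ?thesis unfolding c_def by (subst (asm) nn_integral_add) auto
  qed
  also have "\<dots> \<le> c f t + c f s"
    unfolding c_def by (intro add_left_mono nn_integral_Pt_le) measurable
  finally show ?thesis .
qed

lemma c_mono: "s \<le> t \<Longrightarrow> c f s \<le> c f t"
  unfolding c_def by (intro nn_integral_mono a_mono_time)

lemma c_multiple_le:
  assumes [measurable]: "f \<in> borel_measurable borel" and e: "0 < e"
  shows "c f (real (Suc n) * e) \<le> of_nat (Suc n) * c f e"
proof (induction n)
  case (Suc n)
  have "c f (real (Suc (Suc n)) * e) = c f (e + real (Suc n) * e)" by (simp add: algebra_simps)
  also have "\<dots> \<le> c f e + c f (real (Suc n) * e)" using e by (intro c_add_le) auto
  also have "\<dots> \<le> c f e + of_nat (Suc n) * c f e" using Suc by (intro add_left_mono)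
  also have "\<dots> = of_nat (Suc (Suc n)) * c f e" by (simp add: distrib_right)
  finally show ?case .
qed simp

text \<open>By subadditivity of \<open>c f\<close> these quotients increase to the supremum that defines \<open>\<integral> f d\<mu>\<close>; unlike
that supremum, an increasing limit is visibly additive in \<open>f\<close>.\<close>

definition \<nu> :: "nat \<Rightarrow> ('s \<Rightarrow> ennreal) \<Rightarrow> ennreal" where
  "\<nu> j f = ennreal (2 ^ j) * c f (1 / 2 ^ j)"

lemma incseq_\<nu>:
  assumes f: "f \<in> borel_measurable borel"
  shows "incseq (\<lambda>j. \<nu> j f)"
proof (rule incseq_SucI)
  fix j
  have "c f (1 / 2 ^ j) = c f (real (Suc 1) * (1 / 2 ^ Suc j))" by simp
  also have "\<dots> \<le> of_nat (Suc 1) * c f (1 / 2 ^ Suc j)" by (rule c_multiple_le[OF f]) simp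
  also have "of_nat (Suc 1) = (ennreal 2)" by simp
  finally have "\<nu> j f \<le> ennreal (2 ^ j) * (ennreal 2 * c f (1 / 2 ^ Suc j))"
    unfolding \<nu>_def by (intro mult_left_mono) auto
  also have "\<dots> = \<nu> (Suc j) f"
    unfolding \<nu>_def by (simp only: mult.assoc[symmetric] ennreal_mult[symmetric] power_Suc zero_le_power zero_le_numeral) (simp add: mult.commute)
  finally show "\<nu> j f \<le> \<nu> (Suc j) f" .
qed

lemma SUP_dyadic:
  assumes f: "f \<in> borel_measurable borel"
  shows "(SUP t\<in>{0<..}. ennreal (1 / t) * c f t) = (SUP j. \<nu> j f)"
proof (rule antisym)
  show "(SUP j. \<nu> j f) \<le> (SUP t\<in>{0<..}. ennreal (1 / t) * c f t)"
    unfolding \<nu>_def by (rule SUP_least, rule SUP_upper2[of "1 / 2 ^ _"]) auto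
  show "(SUP t\<in>{0<..}. ennreal (1 / t) * c f t) \<le> (SUP j. \<nu> j f)"
  proof (rule SUP_least)
    fix t :: real assume "t \<in> {0<..}"
    then have t: "0 < t" by simp
    let ?S = "SUP j. \<nu> j f"
    have le: "ennreal (1 / t) * c f t \<le> ennreal (1 + (1 / 2 ^ j) / t) * ?S" for j :: nat
    proof -
      let ?e = "1 / 2 ^ j :: real"
      \<comment> \<open>cover an interval of length \<open>t\<close> by \<open>n + 1\<close> dyadic ones\<close>
      define n where "n = nat \<lfloor>t / ?e\<rfloor>"
      have "t / ?e < real (Suc n)" using t by (auto simp: n_def) linarith
      then have "t \<le> real (Suc n) * ?e" by (simp add: field_simps)
      then have "c f t \<le> c f (real (Suc n) * ?e)" by (rule c_mono)
      also have "\<dots> \<le> of_nat (Suc n) * c f ?e" by (rule c_multiple_le[OF f]) simp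
      also have "\<dots> = ennreal (real (Suc n)) * c f ?e" by (simp only: ennreal_of_nat_eq_real_of_nat)
      finally have "ennreal (1 / t) * c f t \<le> ennreal (1 / t) * (ennreal (real (Suc n)) * c f ?e)"
        by (rule mult_left_mono) simp
      also have "\<dots> = ennreal (1 / t * real (Suc n)) * c f ?e"
        using t by (simp only: mult.assoc[symmetric]) (subst ennreal_mult[symmetric], auto)
      also have "\<dots> \<le> ennreal ((1 + ?e / t) * 2 ^ j) * c f ?e"
      proof (intro mult_right_mono ennreal_leI)
        have "real n \<le> t / ?e" using t by (simp add: n_def)
        then have "1 / t * real (Suc n) \<le> 1 / t * (t / ?e + 1)" using t by (intro mult_left_mono) auto
        also have "\<dots> = (1 + ?e / t) * 2 ^ j" using t by (simp add: field_simps)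
        finally show "1 / t * real (Suc n) \<le> (1 + ?e / t) * 2 ^ j" .
      qed simp
      also have "\<dots> = ennreal (1 + ?e / t) * \<nu> j f"
        unfolding \<nu>_def using t by (subst ennreal_mult) (auto simp: mult.assoc)
      also have "\<dots> \<le> ennreal (1 + ?e / t) * ?S" by (intro mult_left_mono SUP_upper) auto
      finally show ?thesis .
    qed
    show "ennreal (1 / t) * c f t \<le> ?S"
    proof (cases "?S = top")
      case False
      have "(\<lambda>j. 1 + (1 / 2) ^ j / t) \<longlonglongrightarrow> 1 + 0 / t"
        using t by (intro tendsto_intros LIMSEQ_power_zero) auto
      then have "(\<lambda>j. ennreal (1 + (1 / 2 ^ j) / t)) \<longlonglongrightarrow> ennreal 1"
        by (intro tendsto_ennrealI) (simp add: power_one_over)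
      then have "(\<lambda>j. ennreal (1 + (1 / 2 ^ j) / t) * ?S) \<longlonglongrightarrow> ennreal 1 * ?S"
        using False ennreal_tendsto_cmult[of ?S "\<lambda>j. ennreal (1 + (1 / 2 ^ j) / t)" "ennreal 1" sequentially]
        by (simp only: mult.commute[of _ ?S]) (auto simp: less_top[symmetric])
      from LIMSEQ_le_const[OF this, of "ennreal (1 / t) * c f t"] le show ?thesis by auto
    qed (simp only: top_greatest)
  qed
qed

lemma c_sum:
  assumes [measurable]: "f \<in> borel_measurable borel" "g \<in> borel_measurable borel"
  shows "c (\<lambda>y. f y + g y) t = c f t + c g t"
proof -
  have "c (\<lambda>y. f y + g y) t = (\<integral>\<^sup>+x. a t f x + a t g x \<partial>m)"
    unfolding c_def by (intro nn_integral_cong a_sum assms)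
  then show ?thesis unfolding c_def by (subst (asm) nn_integral_add) auto
qed

lemma c_cmult:
  assumes [measurable]: "f \<in> borel_measurable borel"
  shows "c (\<lambda>y. k * f y) t = k * c f t"
proof -
  have "c (\<lambda>y. k * f y) t = (\<integral>\<^sup>+x. k * a t f x \<partial>m)"
    unfolding c_def by (intro nn_integral_cong a_cmult assms)
  then show ?thesis unfolding c_def by (subst (asm) nn_integral_cmult) auto
qed

lemma c_SUP:
  fixes h :: "nat \<Rightarrow> 's \<Rightarrow> ennreal"
  assumes [measurable]: "\<And>i. h i \<in> borel_measurable borel" and inc: "incseq h"
  shows "c (\<lambda>y. SUP i. h i y) t = (SUP i. c (h i) t)"
proof -
  have "incseq (\<lambda>i. a t (h i))"
    using inc by (auto simp: incseq_def le_fun_def intro!: a_mono)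
  then show ?thesis
    unfolding c_def a_SUP[OF assms] by (intro nn_integral_monotone_convergence_SUP) measurable
qed

lemma nn_integral_\<mu>:
  assumes "f \<in> borel_measurable borel"
  shows "(\<integral>\<^sup>+y. f y \<partial>\<mu>) = (SUP j. \<nu> j f)"
  using assms
proof (induction rule: borel_measurable_induct)
  case (cong f g)
  then have "f = g" by auto
  then show ?case using cong by simp
next
  case (set E)
  then show ?case using emeasure_\<mu>[of E] SUP_dyadic[of "indicator E"] by simp
next
  case (mult u k)
  then have "\<nu> j (\<lambda>x. k * u x) = k * \<nu> j u" for j by (simp add: \<nu>_def c_cmult mult.left_commute)
  then show ?case using mult by (simp add: nn_integral_cmult SUP_mult_left_ennreal)
next
  case (add u v)
  have "\<nu> j (\<lambda>x. v x + u x) = \<nu> j v + \<nu> j u" for j using add by (simp add: \<nu>_def c_sum distrib_left)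
  moreover have "(SUP j. \<nu> j v + \<nu> j u) = (SUP j. \<nu> j v) + (SUP j. \<nu> j u)"
    using add by (intro ennreal_SUP_add incseq_\<nu>)
  ultimately show ?case using add by (simp add: nn_integral_add)
next
  case (seq U)
  have eq: "\<nu> j (\<lambda>y. SUP i. U i y) = (SUP i. \<nu> j (U i))" for j
    unfolding \<nu>_def using seq by (simp add: c_SUP SUP_mult_left_ennreal)
  have "(\<integral>\<^sup>+y. (SUP i. U i y) \<partial>\<mu>) = (SUP i. \<integral>\<^sup>+y. U i y \<partial>\<mu>)"
    using seq by (intro nn_integral_monotone_convergence_SUP) auto
  also have "\<dots> = (SUP i. SUP j. \<nu> j (U i))" using seq by simp
  also have "\<dots> = (SUP j. SUP i. \<nu> j (U i))" by (rule SUP_commute)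
  finally have "(\<integral>\<^sup>+y. (SUP i. U i y) \<partial>\<mu>) = (SUP j. \<nu> j (\<lambda>y. SUP i. U i y))" unfolding eq .
  moreover have "(SUP i. U i) = (\<lambda>y. SUP i. U i y)" by (auto simp: fun_eq_iff image_comp)
  ultimately show ?case by simp
qed

lemma \<nu>_le: "f \<in> borel_measurable borel \<Longrightarrow> \<nu> j f \<le> (\<integral>\<^sup>+y. f y \<partial>\<mu>)"
  unfolding nn_integral_\<mu> by (rule SUP_upper) simp

lemma \<nu>_tendsto: "f \<in> borel_measurable borel \<Longrightarrow> (\<lambda>j. \<nu> j f) \<longlonglongrightarrow> (\<integral>\<^sup>+y. f y \<partial>\<mu>)"
  unfolding nn_integral_\<mu> by (rule LIMSEQ_SUP[OF incseq_\<nu>])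

text \<open>Compare \<open>W (unit_cost k)\<close> with the resolvent \<open>R k\<close>, which dominates it. The mass that
\<open>unit_cost k\<close> collects in time \<open>e\<close> is bounded, up to the factor \<open>exp e\<close>, by the defect \<open>\<integral> W (1 - b P\<^sub>e 1) dm\<close>, where \<open>b = exp (-e)\<close>;
this is monotone in the function, and for \<open>R k\<close> the defect is at most \<open>e \<integral> k dm\<close>.\<close>

lemma \<mu>_unit_cost_le:
  assumes k [measurable]: "k \<in> borel_measurable borel" and fin: "(\<integral>\<^sup>+x. k x \<partial>m) < top"
  shows "(\<integral>\<^sup>+y. unit_cost k y \<partial>\<mu>) \<le> ennreal (exp 1) * (\<integral>\<^sup>+x. k x \<partial>m)"
proof -
  let ?W = "W (unit_cost k)" and ?K = "\<integral>\<^sup>+x. k x \<partial>m"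
  have main: "c (unit_cost k) e \<le> ennreal (exp e) * (ennreal e * ?K)" if e: "0 < e" for e
  proof -
    define b where "b = ennreal (exp (- e))"
    have b1: "b \<le> 1" using e by (simp add: b_def flip: ennreal_1)
    define P1 where "P1 y = Pt e (\<lambda>_. 1) y" for y
    have [measurable]: "P1 \<in> borel_measurable borel" unfolding P1_def[abs_def] by measurable
    \<comment> \<open>the loss of mass by killing and discounting; integration against it replaces a difference of
      possibly infinite integrals\<close>
    define th where "th y = 1 - b * P1 y" for y
    have [measurable]: "th \<in> borel_measurable borel" unfolding th_def[abs_def] by measurable
    have bP: "b * P1 y \<le> 1" for y using mult_mono[OF b1, of "P1 y" 1] Pt_le_1[of "\<lambda>_. 1" e y] by (simp add: P1_def)
    have th: "th y + b * P1 y = 1" for y unfolding th_def using bP[of y] by (simp add: diff_add_cancel_ennreal)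
    have split: "(\<integral>\<^sup>+y. h y \<partial>m) = (\<integral>\<^sup>+y. h y * th y \<partial>m) + b * (\<integral>\<^sup>+y. Pt e h y \<partial>m)"
      if [measurable]: "h \<in> borel_measurable borel" for h
    proof -
      have "(\<integral>\<^sup>+y. h y \<partial>m) = (\<integral>\<^sup>+y. h y * th y + b * (P1 y * h y) \<partial>m)"
        using th by (intro nn_integral_cong) (metis distrib_left mult.commute mult.left_commute mult.right_neutral)
      also have "\<dots> = (\<integral>\<^sup>+y. h y * th y \<partial>m) + b * (\<integral>\<^sup>+y. P1 y * h y \<partial>m)"
        by (simp add: nn_integral_add nn_integral_cmult)
      also have "(\<integral>\<^sup>+y. P1 y * h y \<partial>m) = (\<integral>\<^sup>+y. Pt e h y \<partial>m)"
        using Pt_symmetric[of h "\<lambda>_. 1" e] by (simp add: P1_def)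
      finally show ?thesis .
    qed
    have finPt: "b * (\<integral>\<^sup>+y. Pt e h y \<partial>m) < top" if [measurable]: "h \<in> borel_measurable borel" and "\<And>y. h y \<le> R k y" for h
    proof -
      have "(\<integral>\<^sup>+y. Pt e h y \<partial>m) \<le> (\<integral>\<^sup>+y. h y \<partial>m)" by (rule nn_integral_Pt_le) measurable
      also have "\<dots> \<le> (\<integral>\<^sup>+y. R k y \<partial>m)" using that by (intro nn_integral_mono)
      also have "\<dots> \<le> ?K" by (rule nn_integral_R_le) measurable
      finally show ?thesis using fin by (auto simp: b_def ennreal_mult_less_top intro: le_less_trans)
    qed
    have "b * (\<integral>\<^sup>+y. Pt e ?W y \<partial>m) + b * c (unit_cost k) e \<le> (\<integral>\<^sup>+y. ?W y \<partial>m)"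
    proof -
      have "b * (\<integral>\<^sup>+y. Pt e ?W y \<partial>m) + b * c (unit_cost k) e = (\<integral>\<^sup>+y. b * a e (unit_cost k) y + b * Pt e ?W y \<partial>m)"
        unfolding c_def by (simp add: nn_integral_add nn_integral_cmult add.commute)
      also have "\<dots> \<le> (\<integral>\<^sup>+y. ?W y \<partial>m)"
        unfolding b_def by (intro nn_integral_mono W_superharmonic) (use e in measurable)
      finally show ?thesis .
    qed
    also have "\<dots> = b * (\<integral>\<^sup>+y. Pt e ?W y \<partial>m) + (\<integral>\<^sup>+y. ?W y * th y \<partial>m)"
      using split[of ?W] by (simp add: add.commute)
    finally have "b * c (unit_cost k) e \<le> (\<integral>\<^sup>+y. ?W y * th y \<partial>m)"
      by (rule ennreal_add_left_leD) (rule finPt, measurable, rule W_unit_cost_le, measurable)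
    also have "\<dots> \<le> (\<integral>\<^sup>+y. R k y * th y \<partial>m)"
      by (intro nn_integral_mono mult_right_mono W_unit_cost_le) auto
    also have "\<dots> \<le> ennreal e * ?K"
    proof -
      have "b * (\<integral>\<^sup>+y. Pt e (R k) y \<partial>m) + (\<integral>\<^sup>+y. R k y * th y \<partial>m) = (\<integral>\<^sup>+y. R k y \<partial>m)"
        using split[of "R k"] by (simp add: add.commute)
      also have "\<dots> = (\<integral>\<^sup>+y. (\<integral>\<^sup>+s. ennreal (exp (- s)) * Pt s k y * indicator {0<..e} s \<partial>lborel) + b * Pt e (R k) y \<partial>m)"
        unfolding b_def by (intro nn_integral_cong R_split) (use e in measurable)
      also have "\<dots> = (\<integral>\<^sup>+y. (\<integral>\<^sup>+s. ennreal (exp (- s)) * Pt s k y * indicator {0<..e} s \<partial>lborel) \<partial>m) + b * (\<integral>\<^sup>+y. Pt e (R k) y \<partial>m)"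
      proof (subst nn_integral_add)
        have "(\<lambda>w. ennreal (exp (- snd w)) * Pt (snd w) k (fst w) * indicator {0<..e} (snd w)) \<in> borel_measurable (m \<Otimes>\<^sub>M lborel)"
          unfolding greaterThanAtMost_def greaterThan_def atMost_def by measurable
        then show "(\<lambda>y. \<integral>\<^sup>+s. ennreal (exp (- s)) * Pt s k y * indicator {0<..e} s \<partial>lborel) \<in> borel_measurable m"
          by (intro lborel.borel_measurable_nn_integral) (simp add: case_prod_beta)
      qed (auto simp: nn_integral_cmult)
      also have "(\<integral>\<^sup>+y. (\<integral>\<^sup>+s. ennreal (exp (- s)) * Pt s k y * indicator {0<..e} s \<partial>lborel) \<partial>m) \<le> ennreal e * ?K"
      proof -
        interpret pp: pair_sigma_finite m "lborel :: real measure" ..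
        have "(\<integral>\<^sup>+y. (\<integral>\<^sup>+s. ennreal (exp (- s)) * Pt s k y * indicator {0<..e} s \<partial>lborel) \<partial>m) =
            (\<integral>\<^sup>+s. (\<integral>\<^sup>+y. ennreal (exp (- s)) * Pt s k y * indicator {0<..e} s \<partial>m) \<partial>lborel)"
          by (rule pp.Fubini'[symmetric]) (unfold case_prod_beta greaterThanAtMost_def greaterThan_def atMost_def, measurable)
        also have "\<dots> \<le> (\<integral>\<^sup>+s. ?K * indicator {0<..e} s \<partial>lborel)"
        proof (rule nn_integral_mono)
          fix s :: real
          have "(\<integral>\<^sup>+y. ennreal (exp (- s)) * Pt s k y * indicator {0<..e} s \<partial>m) =
              ennreal (exp (- s)) * (\<integral>\<^sup>+y. Pt s k y \<partial>m) * indicator {0<..e} s"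
            by (simp add: nn_integral_multc nn_integral_cmult)
          also have "\<dots> \<le> ?K * indicator {0<..e} s"
          proof (cases "s \<in> {0<..e}")
            case True
            then have "ennreal (exp (- s)) \<le> 1" by (simp flip: ennreal_1)
            then have "ennreal (exp (- s)) * (\<integral>\<^sup>+y. Pt s k y \<partial>m) \<le> 1 * ?K"
              by (intro mult_mono nn_integral_Pt_le) auto
            then show ?thesis using True by simp
          qed simp
          finally show "(\<integral>\<^sup>+y. ennreal (exp (- s)) * Pt s k y * indicator {0<..e} s \<partial>m) \<le> ?K * indicator {0<..e} s" .
        qed
        also have "\<dots> = ennreal e * ?K" using e by (simp add: nn_integral_cmult mult.commute)
        finally show ?thesis .
      qed
      finally have "b * (\<integral>\<^sup>+y. Pt e (R k) y \<partial>m) + (\<integral>\<^sup>+y. R k y * th y \<partial>m) \<le> b * (\<integral>\<^sup>+y. Pt e (R k) y \<partial>m) + ennreal e * ?K"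
        by (simp add: add.commute)
      then show ?thesis by (rule ennreal_add_left_leD) (rule finPt, measurable)
    qed
    finally have "ennreal (exp e) * (b * c (unit_cost k) e) \<le> ennreal (exp e) * (ennreal e * ?K)" by (rule mult_left_mono) simp
    moreover have "ennreal (exp e) * b = 1" by (simp add: b_def exp_minus_inverse flip: ennreal_mult)
    ultimately show ?thesis by (simp add: mult.assoc[symmetric])
  qed
  show ?thesis
    unfolding nn_integral_\<mu>[OF measurable_unit_cost[OF k]]
  proof (rule SUP_least)
    fix j :: nat
    have le1: "1 / 2 ^ j \<le> (1::real)" by simp
    have "\<nu> j (unit_cost k) \<le> ennreal (2 ^ j) * (ennreal (exp (1 / 2 ^ j)) * (ennreal (1 / 2 ^ j) * ?K))"
      unfolding \<nu>_def by (intro mult_left_mono main) auto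
    also have "\<dots> = (ennreal (2 ^ j) * ennreal (1 / 2 ^ j)) * (ennreal (exp (1 / 2 ^ j)) * ?K)" by (simp only: ac_simps)
    also have "ennreal (2 ^ j) * ennreal (1 / 2 ^ j) = 1" by (simp flip: ennreal_mult)
    also have "1 * (ennreal (exp (1 / 2 ^ j)) * ?K) \<le> ennreal (exp 1) * ?K"
      using le1 by (simp add: mult_right_mono ennreal_leI)
    finally show "\<nu> j (unit_cost k) \<le> ennreal (exp 1) * ?K" .
  qed
qed

end

section \<open>Integrated semigroup and small times\<close>

lemma INF_small_times: "(INF j::nat. if s < 1 / 2 ^ j then c else 0) = (if s \<le> (0::real) then c else (0::ennreal))"
proof (cases "s \<le> 0")
  case True
  then have "s < 1 / 2 ^ j" for j :: nat by (auto intro: le_less_trans)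
  then show ?thesis using True by simp
next
  case False
  then obtain j where "(1 / 2) ^ j < s" using real_arch_pow_inv[of s "1/2"] by auto
  then have "(INF j::nat. if s < 1 / 2 ^ j then c else 0) \<le> 0"
    by (intro INF_lower2[of j]) (auto simp: power_one_over)
  then show ?thesis using False by simp
qed

context ac_hunt
begin

text \<open>The rate to which \<open>unit_cost\<close> will be applied; it exists because \<open>m\<close> is \<open>\<sigma>\<close>-finite.\<close>

definition ref_fun :: "'s \<Rightarrow> ennreal" where
  "ref_fun = (SOME k. k \<in> borel_measurable borel \<and> (\<forall>x. 0 < k x \<and> k x \<le> 1) \<and> (\<integral>\<^sup>+x. k x \<partial>m) < \<infinity>)"

lemma ref_fun_props:
  shows measurable_ref_fun [measurable]: "ref_fun \<in> borel_measurable borel" and ref_fun_pos: "0 < ref_fun x" and ref_fun_le: "ref_fun x \<le> 1"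
    and ref_fun_fin: "(\<integral>\<^sup>+x. ref_fun x \<partial>m) < top"
proof -
  have "\<exists>k. k \<in> borel_measurable borel \<and> (\<forall>x. 0 < k x \<and> k x \<le> 1) \<and> (\<integral>\<^sup>+x. k x \<partial>m) < \<infinity>"
    using exists_weight by blast
  from someI_ex[OF this, folded ref_fun_def]
  show "ref_fun \<in> borel_measurable borel" "0 < ref_fun x" "ref_fun x \<le> 1" "(\<integral>\<^sup>+x. ref_fun x \<partial>m) < top" by auto
qed

text \<open>The occupation density before time \<open>t\<close>, seen from the starting measure \<open>g m\<close>.\<close>

definition H :: "real \<Rightarrow> ('s \<Rightarrow> ennreal) \<Rightarrow> 's \<Rightarrow> ennreal" where
  "H t g y = (\<integral>\<^sup>+s. Pt s g y * indicator {0<..t} s \<partial>lborel)"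

lemma measurable_Pt_ind:
  assumes [measurable]: "g \<in> borel_measurable borel"
  shows "(\<lambda>w. Pt (snd w) g (fst w) * indicator {b<..t} (snd w)) \<in> borel_measurable (borel \<Otimes>\<^sub>M lborel)"
  unfolding greaterThanAtMost_def greaterThan_def atMost_def by measurable

lemma measurable_H [measurable]:
  assumes "g \<in> borel_measurable borel"
  shows "H t g \<in> borel_measurable borel"
  unfolding H_def[abs_def] using measurable_Pt_ind[OF assms, of 0 t]
  by (intro lborel.borel_measurable_nn_integral) (simp add: case_prod_beta)

lemma interval_const_integral:
  assumes "b \<le> (d::real)"
  shows "(\<integral>\<^sup>+s. c * indicator {b<..d} s \<partial>lborel) = c * ennreal (d - b)"
  using assms by (simp add: nn_integral_cmult)

context
  fixes g :: "'s \<Rightarrow> ennreal" and G t :: real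
  assumes g [measurable]: "g \<in> borel_measurable borel" and gG: "\<And>y. g y \<le> ennreal G" and G: "0 \<le> G" and t: "0 < t"
begin

lemma Pt_ind_le: "b \<le> d \<Longrightarrow> (\<integral>\<^sup>+s. Pt s g y * indicator {b<..d} s \<partial>lborel) \<le> ennreal ((d - b) * G)"
proof -
  assume bd: "b \<le> d"
  have "(\<integral>\<^sup>+s. Pt s g y * indicator {b<..d} s \<partial>lborel) \<le> (\<integral>\<^sup>+s. ennreal G * indicator {b<..d} s \<partial>lborel)"
    using Pt_le_const[OF gG g] by (intro nn_integral_mono mult_right_mono) auto
  also have "\<dots> = ennreal ((d - b) * G)"
    using bd G by (simp only: interval_const_integral) (simp add: ennreal_mult mult.commute)
  finally show ?thesis .
qed

lemma H_le: "H t g y \<le> ennreal (t * G)"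
  unfolding H_def using Pt_ind_le[of 0 t y] t by simp

text \<open>Applying \<open>Pt r\<close> moves the time window by \<open>r\<close>, so it alters \<open>H t g\<close> by at most \<open>r\<close> times the bound of \<open>g\<close>.\<close>

lemma Pt_H: assumes r: "0 < r" shows "Pt r (H t g) y = (\<integral>\<^sup>+s. Pt s g y * indicator {r<..r+t} s \<partial>lborel)"
proof -
  have "Pt r (H t g) y = (\<integral>\<^sup>+s. Pt r (\<lambda>y. Pt s g y * indicator {0<..t} s) y \<partial>lborel)"
    unfolding H_def[abs_def]
    by (rule Pt_time_integral) (unfold case_prod_beta greaterThanAtMost_def greaterThan_def atMost_def, measurable)
  also have "\<dots> = (\<integral>\<^sup>+s. Pt (r + 1 * s) g y * indicator {r<..r+t} (r + 1 * s) \<partial>lborel)"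
  proof (rule nn_integral_cong)
    fix s :: real
    show "Pt r (\<lambda>y. Pt s g y * indicator {0<..t} s) y = Pt (r + 1 * s) g y * indicator {r<..r+t} (r + 1 * s)"
      using r by (cases "s \<in> {0<..t}") (auto simp: Pt_semigroup Pt_def[of _ "\<lambda>_. 0"])
  qed
  also have "\<dots> = (\<integral>\<^sup>+s. Pt s g y * indicator {r<..r+t} s \<partial>lborel)"
    using nn_integral_real_affine[of "\<lambda>s. Pt s g y * indicator {r<..r+t} s" 1 r] by simp
  finally show ?thesis .
qed

lemma Pt_H_le: "0 < r \<Longrightarrow> Pt r (H t g) y \<le> H t g y + ennreal (r * G)"
proof -
  assume r: "0 < r"
  have "Pt r (H t g) y \<le> (\<integral>\<^sup>+s. Pt s g y * indicator {0<..t} s + Pt s g y * indicator {t<..r+t} s \<partial>lborel)"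
    unfolding Pt_H[OF r] using r t by (intro nn_integral_mono) (auto split: split_indicator)
  also have "\<dots> = H t g y + (\<integral>\<^sup>+s. Pt s g y * indicator {t<..r+t} s \<partial>lborel)"
    unfolding H_def by (rule nn_integral_add) measurable
  also have "\<dots> \<le> H t g y + ennreal (r * G)"
    using Pt_ind_le[of t "r + t" y] r by (intro add_left_mono) simp
  finally show ?thesis .
qed

lemma H_le_Pt: "0 < r \<Longrightarrow> H t g y \<le> Pt r (H t g) y + ennreal (r * G)"
proof -
  assume r: "0 < r"
  have "H t g y \<le> (\<integral>\<^sup>+s. Pt s g y * indicator {r<..r+t} s + Pt s g y * indicator {0<..r} s \<partial>lborel)"
    unfolding H_def using r t by (intro nn_integral_mono) (auto split: split_indicator)
  also have "\<dots> = Pt r (H t g) y + (\<integral>\<^sup>+s. Pt s g y * indicator {0<..r} s \<partial>lborel)"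
    unfolding Pt_H[OF r] by (rule nn_integral_add) measurable
  also have "\<dots> \<le> Pt r (H t g) y + ennreal (r * G)"
    using Pt_ind_le[of 0 r y] r by (intro add_left_mono) simp
  finally show ?thesis .
qed

lemma nn_integral_H_le: "(\<integral>\<^sup>+y. H t g y \<partial>m) \<le> ennreal t * (\<integral>\<^sup>+y. g y \<partial>m)"
proof -
  interpret pp: pair_sigma_finite m "lborel :: real measure" ..
  have "(\<integral>\<^sup>+y. H t g y \<partial>m) = (\<integral>\<^sup>+s. (\<integral>\<^sup>+y. Pt s g y * indicator {0<..t} s \<partial>m) \<partial>lborel)"
    unfolding H_def by (rule pp.Fubini'[symmetric]) (unfold case_prod_beta greaterThanAtMost_def greaterThan_def atMost_def, measurable)
  also have "\<dots> \<le> (\<integral>\<^sup>+s. (\<integral>\<^sup>+y. g y \<partial>m) * indicator {0<..t} s \<partial>lborel)"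
    by (intro nn_integral_mono, subst nn_integral_multc) (auto intro!: mult_right_mono nn_integral_Pt_le)
  also have "\<dots> = ennreal t * (\<integral>\<^sup>+y. g y \<partial>m)"
    using t by (simp only: interval_const_integral) (simp add: mult.commute)
  finally show ?thesis .
qed

text \<open>By symmetry, \<open>E\<^sub>m|h(X\<^sub>e) - h(X\<^sub>0)|\<^sup>2 \<le> 2 \<integral> h (h - P\<^sub>e h) dm\<close>, and \<open>h - P\<^sub>e h\<close> is of order \<open>e\<close> for
\<open>h = H t g\<close>.\<close>

lemma variance_H:
  assumes e: "0 < e" and gfin: "(\<integral>\<^sup>+y. g y \<partial>m) < top"
  shows "(\<integral>\<^sup>+x. (\<integral>\<^sup>+w. ennreal ((enn2real (case_option 0 (H t g) (path X (ennreal e) w)) - enn2real (H t g x))\<^sup>2) \<partial>L (Some x)) \<partial>m)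
     \<le> 2 * (ennreal (e * G) * (\<integral>\<^sup>+y. H t g y \<partial>m))"
proof -
  let ?H = "H t g"
  let ?h = "\<lambda>w. case_option 0 ?H (path X (ennreal e) w)"
  let ?D = "\<lambda>x w. ennreal ((enn2real (?h w) - enn2real (?H x))\<^sup>2)"
  have hle: "?h w \<le> ennreal (t * G)" for w using H_le by (auto split: option.split)
  have [measurable]: "?h \<in> borel_measurable (L (Some x))" for x
    by (intro measurable_L_of_N0 measurable_case_path) measurable
  have mpt: "(\<lambda>x. \<integral>\<^sup>+w. ?D x w \<partial>L (Some x)) \<in> borel_measurable borel"
  proof -
    have [measurable]: "(\<lambda>v. case_option 0 ?H (path X (ennreal e) (snd v))) \<in> borel_measurable (borel \<Otimes>\<^sub>M N0)"
      by (rule measurable_case_path) measurable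
    have "(\<lambda>(x, w). ?D x w) \<in> borel_measurable (borel \<Otimes>\<^sub>M N0)" unfolding case_prod_beta by measurable
    moreover have "(\<lambda>x. L (Some x)) \<in> borel \<rightarrow>\<^sub>M subprob_algebra N0"
      using measurable_comp[OF measurable_Some_borel_Delta measurable_L_subprob] by (simp add: comp_def)
    ultimately show ?thesis by (rule nn_integral_measurable_subprob_algebra2)
  qed
  have pt: "(\<integral>\<^sup>+w. ?D x w \<partial>L (Some x)) + 2 * (?H x * Pt e ?H x) = Pt e (\<lambda>y. ?H y * ?H y) x + ?H x * ?H x" for x
  proof -
    have "(\<integral>\<^sup>+w. ?D x w \<partial>L (Some x)) + 2 * (?H x * Pt e ?H x) =
      (\<integral>\<^sup>+w. ?D x w + 2 * (?H x * ?h w) \<partial>L (Some x))"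
      by (simp add: nn_integral_add nn_integral_cmult nn_integral_path_Some[OF e])
    also have "\<dots> = (\<integral>\<^sup>+w. case_option 0 (\<lambda>y. ?H y * ?H y) (path X (ennreal e) w) + ?H x * ?H x \<partial>L (Some x))"
    proof (rule nn_integral_cong)
      fix w
      obtain b where b: "?h w = ennreal b" "0 \<le> b" using hle[of w] by (cases "?h w") (auto simp: top_unique)
      obtain d where d: "?H x = ennreal d" "0 \<le> d" using H_le[of x] by (cases "?H x") (auto simp: top_unique)
      have "case_option 0 (\<lambda>y. ?H y * ?H y) (path X (ennreal e) w) = ?h w * ?h w" by (auto split: option.split)
      moreover have "ennreal ((b - d)\<^sup>2) + ennreal 2 * (ennreal d * ennreal b) = ennreal b * ennreal b + ennreal d * ennreal d"
      proof -
        have "ennreal ((b - d)\<^sup>2) + ennreal 2 * (ennreal d * ennreal b) = ennreal ((b - d)\<^sup>2 + 2 * (d * b))"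
          using b d by (subst ennreal_plus) (auto simp: ennreal_mult)
        also have "(b - d)\<^sup>2 + 2 * (d * b) = b * b + d * d" by (simp add: power2_eq_square algebra_simps)
        also have "ennreal (b * b + d * d) = ennreal b * ennreal b + ennreal d * ennreal d"
          using b d by (subst ennreal_plus) (auto simp: ennreal_mult)
        finally show ?thesis .
      qed
      ultimately show "?D x w + 2 * (?H x * ?h w) = case_option 0 (\<lambda>y. ?H y * ?H y) (path X (ennreal e) w) + ?H x * ?H x"
        using b d by simp
    qed
    also have "\<dots> = Pt e (\<lambda>y. ?H y * ?H y) x + ?H x * ?H x"
    proof (subst nn_integral_add)
      show "(\<lambda>w. case_option 0 (\<lambda>y. ?H y * ?H y) (path X (ennreal e) w)) \<in> borel_measurable (L (Some x))"
        by (intro measurable_L_of_N0 measurable_case_path) measurable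
    qed (use prob_space.emeasure_space_1[OF prob_space_L[of "Some x"]] in \<open>simp_all add: nn_integral_path_Some[OF e]\<close>)
    finally show ?thesis .
  qed
  have Hfin: "(\<integral>\<^sup>+y. ?H y \<partial>m) < top"
    using nn_integral_H_le gfin by (auto simp: ennreal_mult_less_top intro: le_less_trans)
  have fin: "2 * (\<integral>\<^sup>+x. ?H x * Pt e ?H x \<partial>m) < top"
  proof -
    have "(\<integral>\<^sup>+x. ?H x * Pt e ?H x \<partial>m) \<le> (\<integral>\<^sup>+x. ?H x * ennreal (t * G) \<partial>m)"
      by (intro nn_integral_mono mult_left_mono Pt_le_const H_le) auto
    also have "\<dots> = (\<integral>\<^sup>+x. ?H x \<partial>m) * ennreal (t * G)" by (rule nn_integral_multc) measurable
    also have "\<dots> < top" using Hfin by (simp add: ennreal_mult_less_top)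
    finally show ?thesis by (simp add: ennreal_mult_less_top)
  qed
  have "2 * (\<integral>\<^sup>+x. ?H x * Pt e ?H x \<partial>m) + (\<integral>\<^sup>+x. (\<integral>\<^sup>+w. ?D x w \<partial>L (Some x)) \<partial>m) =
      (\<integral>\<^sup>+x. (\<integral>\<^sup>+w. ?D x w \<partial>L (Some x)) + 2 * (?H x * Pt e ?H x) \<partial>m)"
    using mpt by (simp add: nn_integral_add nn_integral_cmult add.commute)
  also have "\<dots> = (\<integral>\<^sup>+x. Pt e (\<lambda>y. ?H y * ?H y) x \<partial>m) + (\<integral>\<^sup>+x. ?H x * ?H x \<partial>m)"
    unfolding pt by (rule nn_integral_add) measurable
  also have "\<dots> \<le> (\<integral>\<^sup>+x. ?H x * ?H x \<partial>m) + (\<integral>\<^sup>+x. ?H x * ?H x \<partial>m)"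
    by (intro add_right_mono nn_integral_Pt_le) measurable
  also have "\<dots> = 2 * (\<integral>\<^sup>+x. ?H x * ?H x \<partial>m)" by (simp add: mult_2)
  also have "\<dots> \<le> 2 * (\<integral>\<^sup>+x. ?H x * Pt e ?H x + ennreal (e * G) * ?H x \<partial>m)"
  proof (intro mult_left_mono nn_integral_mono)
    fix x
    have "?H x * ?H x \<le> ?H x * (Pt e ?H x + ennreal (e * G))" by (intro mult_left_mono H_le_Pt e) simp
    then show "?H x * ?H x \<le> ?H x * Pt e ?H x + ennreal (e * G) * ?H x" by (simp add: distrib_left mult.commute)
  qed simp
  also have "\<dots> = 2 * (\<integral>\<^sup>+x. ?H x * Pt e ?H x \<partial>m) + 2 * (ennreal (e * G) * (\<integral>\<^sup>+y. ?H y \<partial>m))"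
    by (simp add: nn_integral_add nn_integral_cmult distrib_left)
  finally show ?thesis using fin by (rule ennreal_add_left_leD)
qed

end

end

context strict_pcaf
begin

lemma V_sum:
  assumes "(\<lambda>(s, z). G1 s z) \<in> borel_measurable (borel \<Otimes>\<^sub>M borel_Delta)"
    and "(\<lambda>(s, z). G2 s z) \<in> borel_measurable (borel \<Otimes>\<^sub>M borel_Delta)"
  shows "V (\<lambda>s z. G1 s z + G2 s z) y = V G1 y + V G2 y"
proof -
  have m: "(\<lambda>(s, z). G1 s z + G2 s z) \<in> borel_measurable (borel \<Otimes>\<^sub>M borel_Delta)"
    using assms by (simp add: case_prod_beta)
  show ?thesis
    unfolding V_prod(2)[OF m] V_prod(2)[OF assms(1)] V_prod(2)[OF assms(2)]
    by (subst nn_integral_add[symmetric, OF V_prod(1)[OF assms(1)] V_prod(1)[OF assms(2)]])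
      (auto intro!: nn_integral_cong)
qed

lemma V_time_zero: "V (\<lambda>s z. if s \<le> 0 then g z else 0) y = 0"
proof -
  have "AE w in L y. w \<in> \<Omega> \<and> w \<notin> D"
    using AE_D[of y] AE_space[of "L y"] unfolding P_def AE_completion_iff by eventually_elim simp
  then have "V (\<lambda>s z. if s \<le> 0 then g z else 0) y = (\<integral>\<^sup>+w. 0 \<partial>L y)"
    unfolding V_def
  proof (intro nn_integral_cong_AE, eventually_elim)
    fix w assume w: "w \<in> \<Omega> \<and> w \<notin> D"
    have "(\<integral>\<^sup>+u\<in>{0..}. (if T u w < \<infinity> then if enn2real (T u w) \<le> 0 then g (path X (T u w) w) else 0 else 0) \<partial>lborel) = (\<integral>\<^sup>+u. 0 \<partial>(lborel :: real measure))"
    proof (rule nn_integral_cong_AE, use AE_lborel_neq[of 0] in eventually_elim)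
      fix u :: real assume "u \<noteq> 0"
      have "\<not> enn2real (T u w) \<le> 0" if "0 < u" "T u w < \<infinity>"
        using T_positive[of w u] w that by (cases "T u w") auto
      then show "(if T u w < \<infinity> then if enn2real (T u w) \<le> 0 then g (path X (T u w) w) else 0 else 0) * indicator {0..} u = 0"
        using \<open>u \<noteq> 0\<close> by (auto split: split_indicator)
    qed
    then show "(\<integral>\<^sup>+u\<in>{0..}. (if T u w < \<infinity> then if enn2real (T u w) \<le> 0 then g (path X (T u w) w) else 0 else 0) \<partial>lborel) = 0" by simp
  qed
  then show ?thesis by simp
qed

text \<open>Dominated convergence; the clock has no mass at time 0.\<close>

lemma a_vanish:
  assumes f [measurable]: "f \<in> borel_measurable borel" and fin: "a 1 f x < top"
  shows "(\<lambda>j. a (1 / 2 ^ j) f x) \<longlonglongrightarrow> 0"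
proof -
  let ?g = "\<lambda>j w. if 0 \<le> snd w \<and> T (snd w) (fst w) < \<infinity> then (\<lambda>s z. if s < 1 / 2 ^ j then case_option 0 f z else 0) (enn2real (T (snd w) (fst w))) (path X (T (snd w) (fst w)) (fst w)) else (0::ennreal)"
  have half: "1 / 2 ^ Suc j \<le> (1 / 2 ^ j :: real)" for j :: nat by (simp add: field_simps)
  have dec: "decseq (\<lambda>j. a (1 / 2 ^ j) f x)"
    by (rule decseq_SucI) (rule a_mono_time[OF half])
  have m0: "(\<lambda>(s :: real, z). if s \<le> 0 then case_option 0 f z else (0::ennreal)) \<in> borel_measurable (borel \<Otimes>\<^sub>M borel_Delta)"
  proof -
    have "(\<lambda>w. case_option 0 f (snd w) :: ennreal) \<in> borel_measurable ((borel :: real measure) \<Otimes>\<^sub>M borel_Delta)"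
      by (rule measurable_compose[OF _ borel_measurable_case_option[OF f]]) measurable
    then show ?thesis unfolding case_prod_beta by measurable
  qed
  have aV: "a (1 / 2 ^ j) f x = (\<integral>\<^sup>+w. ?g j w \<partial>(L (Some x) \<Otimes>\<^sub>M lborel))" for j
    unfolding a_def by (rule V_prod(2)[OF measurable_V_integrand[OF f]])
  have "(INF j. a (1 / 2 ^ j) f x) = (\<integral>\<^sup>+w. (INF j. ?g j w) \<partial>(L (Some x) \<Otimes>\<^sub>M lborel))"
    unfolding aV
  proof (rule nn_integral_monotone_convergence_INF_decseq[symmetric, where i=0])
    show "decseq ?g"
      using half by (intro decseq_SucI) (auto simp: le_fun_def intro: less_le_trans split: option.split)
    show "?g j \<in> borel_measurable (L (Some x) \<Otimes>\<^sub>M lborel)" for j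
      by (rule V_prod(1)[OF measurable_V_integrand[OF f]])
    show "(\<integral>\<^sup>+w. ?g 0 w \<partial>(L (Some x) \<Otimes>\<^sub>M lborel)) < \<infinity>"
      using fin aV[of 0] by simp
  qed
  also have "\<dots> = (\<integral>\<^sup>+w. (if 0 \<le> snd w \<and> T (snd w) (fst w) < \<infinity> then (\<lambda>s z. if s \<le> 0 then case_option 0 f z else 0) (enn2real (T (snd w) (fst w))) (path X (T (snd w) (fst w)) (fst w)) else 0)
      \<partial>(L (Some x) \<Otimes>\<^sub>M lborel))"
  proof (rule nn_integral_cong)
    fix w
    show "(INF j. ?g j w) = (if 0 \<le> snd w \<and> T (snd w) (fst w) < \<infinity> then (\<lambda>s z. if s \<le> 0 then case_option 0 f z else 0) (enn2real (T (snd w) (fst w))) (path X (T (snd w) (fst w)) (fst w)) else 0)"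
    proof (cases "0 \<le> snd w \<and> T (snd w) (fst w) < \<infinity>")
      case True
      then show ?thesis by (simp only: if_True INF_small_times simp_thms)
    qed (simp only: if_False INF_constant UNIV_not_empty)
  qed
  also have "\<dots> = 0"
    using V_prod(2)[OF m0, of "Some x"] V_time_zero[of "case_option 0 f" "Some x"] by simp
  finally show ?thesis using LIMSEQ_INF[OF dec] by simp
qed

lemma int_vanish:
  assumes f [measurable]: "f \<in> borel_measurable borel" and bd: "\<And>y. a 1 f y \<le> ennreal K"
    and M: "sets M = sets borel" and h [measurable]: "h \<in> borel_measurable borel" and hfin: "(\<integral>\<^sup>+y. h y \<partial>M) < top"
  shows "(\<lambda>j. \<integral>\<^sup>+y. h y * a (1 / 2 ^ j) f y \<partial>M) \<longlonglongrightarrow> 0"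
proof -
  note [measurable_cong] = M
  have "(\<lambda>j. \<integral>\<^sup>+y. h y * a (1 / 2 ^ j) f y \<partial>M) \<longlonglongrightarrow> (\<integral>\<^sup>+y. 0 \<partial>M)"
  proof (rule nn_integral_dominated_convergence[where w="\<lambda>y. h y * ennreal K"])
    have le: "a (1 / 2 ^ j) f y \<le> ennreal K" for j y
      by (rule order_trans[OF a_mono_time bd]) simp
    show "AE y in M. h y * a (1 / 2 ^ j) f y \<le> h y * ennreal K" for j by (intro AE_I2 mult_left_mono le) simp
    have "(\<integral>\<^sup>+y. h y * ennreal K \<partial>M) = (\<integral>\<^sup>+y. h y \<partial>M) * ennreal K" by (rule nn_integral_multc) measurable
    then show "(\<integral>\<^sup>+y. h y * ennreal K \<partial>M) < \<infinity>" using hfin by (simp add: ennreal_mult_less_top)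
    have "AE y in M. h y \<noteq> \<infinity>" by (rule nn_integral_PInf_AE) (use hfin in auto)
    then show "AE y in M. (\<lambda>j. h y * a (1 / 2 ^ j) f y) \<longlonglongrightarrow> 0"
    proof eventually_elim
      case (elim y)
      have "a 1 f y < top" using bd[of y] by (auto intro: le_less_trans)
      from ennreal_tendsto_cmult[OF _ a_vanish[OF f this], of "h y"] show ?case
        using elim by (simp add: less_top)
    qed
  qed measurable
  then show ?thesis by simp
qed

end

section \<open>The Revuz correspondence\<close>

context revuz_pcaf
begin

text \<open>Such functions have a bounded \<open>a t f\<close> and a finite \<open>\<mu>\<close>-integral.\<close>

definition tame :: "('s \<Rightarrow> ennreal) \<Rightarrow> bool" where
  "tame f \<longleftrightarrow> f \<in> borel_measurable borel \<and> (\<exists>n::nat. \<forall>y. f y \<le> of_nat n * unit_cost ref_fun y)"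

lemma tame_measurable: "tame f \<Longrightarrow> f \<in> borel_measurable borel"
  by (simp add: tame_def)

lemma a_unit_cost_le: "a t (unit_cost ref_fun) x \<le> ennreal (exp t)"
proof -
  have "a t (unit_cost ref_fun) x \<le> ennreal (exp t) * W (unit_cost ref_fun) x" by (rule a_le_W) measurable
  also have "\<dots> \<le> ennreal (exp t) * 1"
    using W_unit_cost_le[OF measurable_ref_fun, of x] R_le_1[OF measurable_ref_fun ref_fun_le, of x] by (intro mult_left_mono) auto
  finally show ?thesis by simp
qed

lemma tame_bounded: assumes "tame f" shows "\<exists>K\<ge>0. \<forall>x. a t f x \<le> ennreal K"
proof -
  obtain n :: nat where n: "\<And>y. f y \<le> of_nat n * unit_cost ref_fun y" using assms by (auto simp: tame_def)
  have "a t f x \<le> ennreal (real n * exp t)" for x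
  proof -
    have "a t f x \<le> a t (\<lambda>y. of_nat n * unit_cost ref_fun y) x" by (rule a_mono[OF n])
    also have "\<dots> = of_nat n * a t (unit_cost ref_fun) x" by (rule a_cmult) measurable
    also have "\<dots> \<le> of_nat n * ennreal (exp t)" by (intro mult_left_mono a_unit_cost_le) simp
    finally show ?thesis by (simp add: ennreal_of_nat_eq_real_of_nat ennreal_mult)
  qed
  then show ?thesis by (intro exI[of _ "real n * exp t"]) auto
qed

lemma unit_cost_\<mu>_fin: "(\<integral>\<^sup>+y. unit_cost ref_fun y \<partial>\<mu>) < top"
  using \<mu>_unit_cost_le[OF measurable_ref_fun ref_fun_fin] ref_fun_fin by (auto simp: ennreal_mult_less_top intro: le_less_trans)

lemma tame_\<mu>: assumes "tame f" shows "(\<integral>\<^sup>+y. f y \<partial>\<mu>) < top"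
proof -
  obtain n :: nat where n: "\<And>y. f y \<le> of_nat n * unit_cost ref_fun y" using assms by (auto simp: tame_def)
  have "(\<integral>\<^sup>+y. f y \<partial>\<mu>) \<le> (\<integral>\<^sup>+y. of_nat n * unit_cost ref_fun y \<partial>\<mu>)" by (intro nn_integral_mono n)
  also have "\<dots> = of_nat n * (\<integral>\<^sup>+y. unit_cost ref_fun y \<partial>\<mu>)" by (rule nn_integral_cmult) measurable
  also have "\<dots> < top" using unit_cost_\<mu>_fin of_nat_less_top[of n] unfolding ennreal_mult_less_top by blast
  finally show ?thesis .
qed

context
  fixes f g :: "'s \<Rightarrow> ennreal" and G t :: real
  assumes f_tame: "tame f"
    and g [measurable]: "g \<in> borel_measurable borel" and gG: "\<And>y. g y \<le> ennreal G" and G: "0 \<le> G" and t: "0 < t"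
    and gfin: "(\<integral>\<^sup>+y. g y \<partial>m) < top"
begin

lemma f_m [measurable]: "f \<in> borel_measurable borel"
  by (rule tame_measurable[OF f_tame])

text \<open>The three quantities that are compared as \<open>e \<rightarrow> 0\<close>: \<open>growth\<close> is one side of the identity,
\<open>increment e\<close> is \<open>E\<^sub>m[H t g(X\<^sub>0) \<integral>\<^sub>0\<^sup>e f(X) dA]\<close>, and \<open>terminal e\<close> has \<open>X\<^sub>e\<close> in place of \<open>X\<^sub>0\<close>.\<close>

definition growth :: "real \<Rightarrow> ennreal" where "growth s = (\<integral>\<^sup>+y. g y * a s f y \<partial>m)"

definition increment :: "real \<Rightarrow> ennreal" where "increment e = (\<integral>\<^sup>+y. H t g y * a e f y \<partial>m)"

definition terminal :: "real \<Rightarrow> ennreal" where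
  "terminal e = (\<integral>\<^sup>+x. (\<integral>\<^sup>+w. case_option 0 (H t g) (path X (ennreal e) w) * C e f w \<partial>L (Some x)) \<partial>m)"

lemma measurable_growth [measurable]: "growth \<in> borel_measurable borel"
  unfolding growth_def[abs_def] by measurable

lemma growth_fin: "growth s < top"
proof -
  obtain K where K: "0 \<le> K" "\<And>x. a s f x \<le> ennreal K" using tame_bounded[OF f_tame] by blast
  have "growth s \<le> (\<integral>\<^sup>+y. g y * ennreal K \<partial>m)" unfolding growth_def by (intro nn_integral_mono mult_left_mono K) simp
  also have "\<dots> = (\<integral>\<^sup>+y. g y \<partial>m) * ennreal K" by (rule nn_integral_multc) measurable
  finally show ?thesis using gfin by (auto simp: ennreal_mult_less_top intro: le_less_trans)
qed

lemma growth_mono: "s \<le> r \<Longrightarrow> growth s \<le> growth r"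
  unfolding growth_def by (intro nn_integral_mono mult_left_mono a_mono_time) auto

text \<open>Additivity in time, and symmetry of the semigroup.\<close>

lemma growth_add: assumes "0 < s" "0 < e" shows "growth (s + e) = growth s + (\<integral>\<^sup>+y. Pt s g y * a e f y \<partial>m)"
proof -
  have "growth (s + e) = (\<integral>\<^sup>+y. g y * a s f y + g y * Pt s (a e f) y \<partial>m)"
    unfolding growth_def using assms by (intro nn_integral_cong) (simp add: a_add distrib_left)
  also have "\<dots> = growth s + (\<integral>\<^sup>+y. g y * Pt s (a e f) y \<partial>m)"
    unfolding growth_def by (rule nn_integral_add) measurable
  finally show ?thesis by (simp add: Pt_symmetric)
qed

text \<open>\<open>growth_add\<close> integrated over \<open>s \<in> (0, t]\<close>, with \<open>growth\<close> on both sides since its monotone integrals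
cannot be subtracted yet.\<close>

lemma increment_eq: assumes e: "0 < e"
  shows "(\<integral>\<^sup>+s. growth s * indicator {0<..t} s \<partial>lborel) + increment e = (\<integral>\<^sup>+s. growth s * indicator {e<..t+e} s \<partial>lborel)"
proof -
  interpret pp: pair_sigma_finite m "lborel :: real measure" ..
  have mm: "(\<lambda>s. (\<integral>\<^sup>+y. Pt s g y * a e f y \<partial>m) * indicator {0<..t} s) \<in> borel_measurable borel" by measurable
  have "increment e = (\<integral>\<^sup>+y. (\<integral>\<^sup>+s. Pt s g y * indicator {0<..t} s * a e f y \<partial>lborel) \<partial>m)"
    unfolding increment_def H_def by (intro nn_integral_cong nn_integral_multc[symmetric]) measurable
  also have "\<dots> = (\<integral>\<^sup>+s. (\<integral>\<^sup>+y. Pt s g y * indicator {0<..t} s * a e f y \<partial>m) \<partial>lborel)"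
    by (rule pp.Fubini'[symmetric]) (unfold case_prod_beta greaterThanAtMost_def greaterThan_def atMost_def, measurable)
  also have "\<dots> = (\<integral>\<^sup>+s. (\<integral>\<^sup>+y. Pt s g y * a e f y \<partial>m) * indicator {0<..t} s \<partial>lborel)"
    by (intro nn_integral_cong) (auto split: split_indicator)
  finally have "(\<integral>\<^sup>+s. growth s * indicator {0<..t} s \<partial>lborel) + increment e =
      (\<integral>\<^sup>+s. growth s * indicator {0<..t} s + (\<integral>\<^sup>+y. Pt s g y * a e f y \<partial>m) * indicator {0<..t} s \<partial>lborel)"
    using mm by (subst nn_integral_add) auto
  also have "\<dots> = (\<integral>\<^sup>+s. growth (e + 1 * s) * indicator {e<..t+e} (e + 1 * s) \<partial>lborel)"
    using e by (intro nn_integral_cong) (auto simp: growth_add add.commute[of e] split: split_indicator)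
  also have "\<dots> = (\<integral>\<^sup>+s. growth s * indicator {e<..t+e} s \<partial>lborel)"
    using nn_integral_real_affine[of "\<lambda>s. growth s * indicator {e<..t+e} s" 1 e] by simp
  finally show ?thesis .
qed

lemma growth_int_le: assumes "b \<le> d" shows "(\<integral>\<^sup>+s. growth s * indicator {b<..d} s \<partial>lborel) \<le> ennreal (d - b) * growth d"
proof -
  have "(\<integral>\<^sup>+s. growth s * indicator {b<..d} s \<partial>lborel) \<le> (\<integral>\<^sup>+s. growth d * indicator {b<..d} s \<partial>lborel)"
    by (intro nn_integral_mono) (auto split: split_indicator intro: growth_mono)
  also have "\<dots> = ennreal (d - b) * growth d"
    using assms by (subst nn_integral_cmult_indicator) (auto simp: mult.commute)
  finally show ?thesis .
qed

lemma growth_int_ge: assumes "b \<le> d" shows "ennreal (d - b) * growth b \<le> (\<integral>\<^sup>+s. growth s * indicator {b<..d} s \<partial>lborel)"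
proof -
  have "ennreal (d - b) * growth b = (\<integral>\<^sup>+s. growth b * indicator {b<..d} s \<partial>lborel)"
    using assms by (subst nn_integral_cmult_indicator) (auto simp: mult.commute)
  also have "\<dots> \<le> (\<integral>\<^sup>+s. growth s * indicator {b<..d} s \<partial>lborel)"
    by (intro nn_integral_mono) (auto split: split_indicator intro: growth_mono)
  finally show ?thesis .
qed

lemma growth_int_fin: "b \<le> d \<Longrightarrow> (\<integral>\<^sup>+s. growth s * indicator {b<..d} s \<partial>lborel) < top"
  by (rule le_less_trans[OF growth_int_le]) (use growth_fin[of d] in \<open>auto simp: ennreal_mult_less_top\<close>)

lemma increment_le: assumes e: "0 < e" shows "increment e \<le> ennreal e * growth (t + e)"
proof (rule ennreal_add_left_leD)
  show "(\<integral>\<^sup>+s. growth s * indicator {0<..t} s \<partial>lborel) < top" using t by (intro growth_int_fin) simp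
  have "(\<integral>\<^sup>+s. growth s * indicator {0<..t} s \<partial>lborel) + increment e \<le>
      (\<integral>\<^sup>+s. growth s * indicator {0<..t} s + growth s * indicator {t<..t+e} s \<partial>lborel)"
    unfolding increment_eq[OF e] using e by (intro nn_integral_mono) (auto split: split_indicator)
  also have "\<dots> = (\<integral>\<^sup>+s. growth s * indicator {0<..t} s \<partial>lborel) + (\<integral>\<^sup>+s. growth s * indicator {t<..t+e} s \<partial>lborel)"
    by (rule nn_integral_add) measurable
  also have "\<dots> \<le> (\<integral>\<^sup>+s. growth s * indicator {0<..t} s \<partial>lborel) + ennreal e * growth (t + e)"
    using growth_int_le[of t "t + e"] e by (intro add_left_mono) simp
  finally show "(\<integral>\<^sup>+s. growth s * indicator {0<..t} s \<partial>lborel) + increment e \<le>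
     (\<integral>\<^sup>+s. growth s * indicator {0<..t} s \<partial>lborel) + ennreal e * growth (t + e)" .
qed

lemma increment_ge: assumes e: "0 < e" shows "ennreal e * growth t \<le> increment e + ennreal e * growth e"
proof (rule ennreal_add_left_leD)
  let ?I = "\<integral>\<^sup>+s. growth s * indicator {0<..t} s \<partial>lborel"
  show "?I < top" using t by (intro growth_int_fin) simp
  have "?I + ennreal e * growth t \<le> ?I + (\<integral>\<^sup>+s. growth s * indicator {t<..t+e} s \<partial>lborel)"
    using growth_int_ge[of t "t + e"] e by (intro add_left_mono) simp
  also have "\<dots> = (\<integral>\<^sup>+s. growth s * indicator {0<..t} s + growth s * indicator {t<..t+e} s \<partial>lborel)"
    by (rule nn_integral_add[symmetric]) measurable
  also have "\<dots> \<le> (\<integral>\<^sup>+s. growth s * indicator {e<..t+e} s + growth s * indicator {0<..e} s \<partial>lborel)"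
    using e t by (intro nn_integral_mono) (auto split: split_indicator)
  also have "\<dots> = (\<integral>\<^sup>+s. growth s * indicator {e<..t+e} s \<partial>lborel) + (\<integral>\<^sup>+s. growth s * indicator {0<..e} s \<partial>lborel)"
    by (rule nn_integral_add) measurable
  also have "\<dots> \<le> (?I + increment e) + ennreal e * growth e"
    unfolding increment_eq[OF e] using growth_int_le[of 0 e] e by (intro add_left_mono) simp
  finally show "?I + ennreal e * growth t \<le> ?I + (increment e + ennreal e * growth e)" by (simp add: add.assoc)
qed

text \<open>The Markov property at the times at which the clock runs.\<close>

lemma terminal_V:
  assumes e: "0 < e"
  shows "(\<integral>\<^sup>+w. case_option 0 (H t g) (path X (ennreal e) w) * C e f w \<partial>L (Some x)) =
    V (\<lambda>s z. case_option 0 (\<lambda>y. (if s < e then f y * Pt (e - s) (H t g) y else 0)) z) (Some x)"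
proof -
  have "(\<integral>\<^sup>+w. case_option 0 (H t g) (path X (ennreal e) w) * C e f w \<partial>L (Some x)) =
    V (\<lambda>s z. if ennreal s < ennreal e then case_option 0 f z * (\<integral>\<^sup>+w. case_option 0 (H t g) (path X (ennreal e - ennreal s) w) \<partial>L z) else 0) (Some x)"
    unfolding C_def by (rule occupation_terminal) (auto intro!: borel_measurable_case_option)
  also have "\<dots> = V (\<lambda>s z. case_option 0 (\<lambda>y. (if s < e then f y * Pt (e - s) (H t g) y else 0)) z) (Some x)"
  proof (rule V_cong)
    fix s :: real and y assume s: "0 \<le> s"
    then show "(if ennreal s < ennreal e then case_option 0 f (Some y) * (\<integral>\<^sup>+w. case_option 0 (H t g) (path X (ennreal e - ennreal s) w) \<partial>L (Some y)) else 0) =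
      case_option 0 (\<lambda>y. (if s < e then f y * Pt (e - s) (H t g) y else 0)) (Some y)"
      by (auto simp: ennreal_less_iff ennreal_minus nn_integral_path_Some)
  qed
  finally show ?thesis .
qed

lemma measurable_terminal:
  "(\<lambda>(s, z). case_option 0 (\<lambda>y. (if s < e then f y * Pt (e - s) (H t g) y else 0)) z) \<in> borel_measurable (borel \<Otimes>\<^sub>M borel_Delta)"
proof -
  have "(\<lambda>(s, y). if s < e then f y * Pt (e - s) (H t g) y else 0) \<in> borel_measurable (borel \<Otimes>\<^sub>M borel)"
    unfolding case_prod_beta by measurable
  from measurable_case_option_borel_Delta[OF this, of "\<lambda>_. 0"] show ?thesis by simp
qed

lemma measurable_terminal_integrand:
  "(\<lambda>x. \<integral>\<^sup>+w. case_option 0 (H t g) (path X (ennreal e) w) * C e f w \<partial>L (Some x)) \<in> borel_measurable borel"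
proof -
  have "(\<lambda>w. case_option 0 (H t g) (path X (ennreal e) w) * C e f w) \<in> borel_measurable N0"
    by (intro borel_measurable_times_ennreal measurable_C measurable_case_path) measurable
  from measurable_compose[OF measurable_comp[OF measurable_Some_borel_Delta measurable_L_subprob] nn_integral_measurable_subprob_algebra[OF this]]
  show ?thesis by simp
qed

lemma terminal_le: assumes e: "0 < e" shows "terminal e \<le> c (\<lambda>y. H t g y * f y) e + ennreal (e * G) * c f e"
proof -
  have "terminal e \<le> (\<integral>\<^sup>+x. a e (\<lambda>y. H t g y * f y + ennreal (e * G) * f y) x \<partial>m)"
    unfolding terminal_def terminal_V[OF e] a_def
  proof (intro nn_integral_mono V_mono)
    fix s :: real and z assume s: "0 \<le> s"
    show "case_option 0 (\<lambda>y. (if s < e then f y * Pt (e - s) (H t g) y else 0)) z \<le>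
      (if s < e then case_option 0 (\<lambda>y. H t g y * f y + ennreal (e * G) * f y) z else 0)"
    proof (cases z)
      case (Some y)
      show ?thesis
      proof (cases "s < e")
        case True
        have "Pt (e - s) (H t g) y \<le> H t g y + ennreal ((e - s) * G)"
          by (rule Pt_H_le[OF g gG G t]) (use True in simp)
        also have "\<dots> \<le> H t g y + ennreal (e * G)" using s G by (intro add_left_mono ennreal_leI mult_right_mono) auto
        finally have "f y * Pt (e - s) (H t g) y \<le> f y * (H t g y + ennreal (e * G))" by (rule mult_left_mono) simp
        then show ?thesis using Some True by (simp add: distrib_left mult.commute)
      qed (use Some in simp)
    qed simp
  qed
  also have "\<dots> = c (\<lambda>y. H t g y * f y + ennreal (e * G) * f y) e" by (simp add: c_def)
  also have "\<dots> = c (\<lambda>y. H t g y * f y) e + ennreal (e * G) * c f e"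
    by (subst c_sum) (auto simp: c_cmult)
  finally show ?thesis .
qed

lemma terminal_ge: assumes e: "0 < e" shows "c (\<lambda>y. H t g y * f y) e \<le> terminal e + ennreal (e * G) * c f e"
proof -
  have fz: "(\<lambda>(s :: real, z). if s < e then case_option 0 f z else (0::ennreal)) \<in> borel_measurable (borel \<Otimes>\<^sub>M borel_Delta)"
    by (rule measurable_V_integrand) measurable
  then have fz': "(\<lambda>(s :: real, z). ennreal (e * G) * (if s < e then case_option 0 f z else 0)) \<in> borel_measurable (borel \<Otimes>\<^sub>M borel_Delta)"
    unfolding case_prod_beta by measurable
  have "a e (\<lambda>y. H t g y * f y) x \<le> V (\<lambda>s z. case_option 0 (\<lambda>y. (if s < e then f y * Pt (e - s) (H t g) y else 0)) z
      + ennreal (e * G) * (if s < e then case_option 0 f z else 0)) (Some x)" for x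
    unfolding a_def
  proof (rule V_mono)
    fix s :: real and z assume s: "0 \<le> s"
    show "(if s < e then case_option 0 (\<lambda>y. H t g y * f y) z else 0) \<le>
      case_option 0 (\<lambda>y. (if s < e then f y * Pt (e - s) (H t g) y else 0)) z + ennreal (e * G) * (if s < e then case_option 0 f z else 0)"
    proof (cases z)
      case (Some y)
      show ?thesis
      proof (cases "s < e")
        case True
        have "H t g y \<le> Pt (e - s) (H t g) y + ennreal ((e - s) * G)"
          by (rule H_le_Pt[OF g gG G t]) (use True in simp)
        also have "\<dots> \<le> Pt (e - s) (H t g) y + ennreal (e * G)" using s G by (intro add_left_mono ennreal_leI mult_right_mono) auto
        finally have "f y * H t g y \<le> f y * (Pt (e - s) (H t g) y + ennreal (e * G))" by (rule mult_left_mono) simp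
        then show ?thesis using Some True by (simp add: distrib_left mult.commute)
      qed (use Some in simp)
    qed simp
  qed
  also have "\<And>x. V (\<lambda>s z. case_option 0 (\<lambda>y. (if s < e then f y * Pt (e - s) (H t g) y else 0)) z
      + ennreal (e * G) * (if s < e then case_option 0 f z else 0)) (Some x) =
    (\<integral>\<^sup>+w. case_option 0 (H t g) (path X (ennreal e) w) * C e f w \<partial>L (Some x)) + ennreal (e * G) * a e f x"
    unfolding terminal_V[OF e] by (subst V_sum[OF measurable_terminal fz']) (simp add: V_cmult[OF fz] a_def)
  finally have "c (\<lambda>y. H t g y * f y) e \<le> (\<integral>\<^sup>+x. (\<integral>\<^sup>+w. case_option 0 (H t g) (path X (ennreal e) w) * C e f w \<partial>L (Some x)) + ennreal (e * G) * a e f x \<partial>m)"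
    unfolding c_def by (rule nn_integral_mono)
  also have "\<dots> = terminal e + ennreal (e * G) * c f e"
    unfolding terminal_def c_def using measurable_terminal_integrand by (subst nn_integral_add) (auto simp: nn_integral_cmult)
  finally show ?thesis .
qed

text \<open>The bound that \<open>amgm_ennreal\<close> with parameter \<open>d\<close>, \<open>C_square_le\<close> and \<open>variance_H\<close> give for the
difference of \<open>terminal e\<close> and \<open>increment e\<close>.\<close>

definition err :: "real \<Rightarrow> real \<Rightarrow> ennreal" where
  "err d e = ennreal (1 / (2 * d)) * (2 * c (\<lambda>y. f y * a e f y) e) + ennreal (d / 2) * (2 * (ennreal (e * G) * (\<integral>\<^sup>+y. H t g y \<partial>m)))"

lemma terminal_increment: assumes e: "0 < e" and d: "0 < d"
  shows "terminal e \<le> increment e + err d e" "increment e \<le> terminal e + err d e"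
proof -
  let ?h = "\<lambda>w. case_option 0 (H t g) (path X (ennreal e) w)"
  let ?D = "\<lambda>x w. ennreal ((enn2real (?h w) - enn2real (H t g x))\<^sup>2)"
  have [measurable]: "?h \<in> borel_measurable (L (Some x))" "C e f \<in> borel_measurable (L (Some x))" for x
    by (intro measurable_L_of_N0 measurable_case_path measurable_C, measurable)+
  have Lm: "(\<lambda>x. L (Some x)) \<in> borel \<rightarrow>\<^sub>M subprob_algebra N0"
    using measurable_comp[OF measurable_Some_borel_Delta measurable_L_subprob] by (simp add: comp_def)
  have [measurable]: "(\<lambda>v. case_option 0 (H t g) (path X (ennreal e) (snd v))) \<in> borel_measurable (borel \<Otimes>\<^sub>M N0)"
    by (rule measurable_case_path) measurable
  have [measurable]: "(\<lambda>v. C e f (snd v)) \<in> borel_measurable ((borel :: 's measure) \<Otimes>\<^sub>M N0)"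
    by (rule measurable_compose[OF measurable_snd measurable_C]) measurable
  have mD: "(\<lambda>x. \<integral>\<^sup>+w. ?D x w \<partial>L (Some x)) \<in> borel_measurable borel"
    by (rule nn_integral_measurable_subprob_algebra2[OF _ Lm]) (unfold case_prod_beta, measurable)
  have mC: "(\<lambda>x. \<integral>\<^sup>+w. C e f w * C e f w \<partial>L (Some x)) \<in> borel_measurable borel"
    by (rule nn_integral_measurable_subprob_algebra2[OF _ Lm]) (unfold case_prod_beta, measurable)
  have hfin: "ennreal (enn2real (?h w)) = ?h w" "ennreal (enn2real (H t g x)) = H t g x" for w x
    using le_less_trans[OF H_le[OF g gG G t] ennreal_less_top] by (auto split: option.split)
  define E where "E x = ennreal (1 / (2 * d)) * (\<integral>\<^sup>+w. C e f w * C e f w \<partial>L (Some x)) + ennreal (d / 2) * (\<integral>\<^sup>+w. ?D x w \<partial>L (Some x))" for x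
  have [measurable]: "E \<in> borel_measurable borel" unfolding E_def[abs_def] using mD mC by measurable
  have E_int: "(\<integral>\<^sup>+w. ennreal (1 / (2 * d)) * (C e f w * C e f w) + ennreal (d / 2) * ?D x w \<partial>L (Some x)) = E x" for x
    unfolding E_def by (subst nn_integral_add) (auto simp: nn_integral_cmult)
  have aC: "(\<integral>\<^sup>+w. C e f w * H t g x \<partial>L (Some x)) = H t g x * a e f x" for x
    by (subst nn_integral_multc) (auto simp: a_eq_C mult.commute)
  have p1: "(\<integral>\<^sup>+w. ?h w * C e f w \<partial>L (Some x)) \<le> H t g x * a e f x + E x" for x
  proof -
    have "(\<integral>\<^sup>+w. ?h w * C e f w \<partial>L (Some x)) \<le> (\<integral>\<^sup>+w. C e f w * H t g x + (ennreal (1 / (2 * d)) * (C e f w * C e f w) + ennreal (d / 2) * ?D x w) \<partial>L (Some x))"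
      using amgm_ennreal[OF enn2real_nonneg enn2real_nonneg d, of "C e f _" "?h _" "H t g x"]
      by (intro nn_integral_mono) (simp only: hfin mult.commute[of "case_option _ _ _" "C e f _"])
    also have "\<dots> = H t g x * a e f x + E x" unfolding aC[symmetric] E_int[symmetric] by (rule nn_integral_add) measurable
    finally show ?thesis .
  qed
  have p2: "H t g x * a e f x \<le> (\<integral>\<^sup>+w. ?h w * C e f w \<partial>L (Some x)) + E x" for x
  proof -
    have "H t g x * a e f x \<le> (\<integral>\<^sup>+w. ?h w * C e f w + (ennreal (1 / (2 * d)) * (C e f w * C e f w) + ennreal (d / 2) * ?D x w) \<partial>L (Some x))"
      unfolding aC[symmetric]
      using amgm_ennreal[OF enn2real_nonneg enn2real_nonneg d, of "C e f _" "H t g x" "?h _"]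
      by (intro nn_integral_mono) (simp only: hfin mult.commute[of "case_option _ _ _" "C e f _"] power2_commute[of "enn2real (H t g x)"])
    also have "\<dots> = (\<integral>\<^sup>+w. ?h w * C e f w \<partial>L (Some x)) + E x" unfolding E_int[symmetric] by (rule nn_integral_add) measurable
    finally show ?thesis .
  qed
  have Eerr: "(\<integral>\<^sup>+x. E x \<partial>m) \<le> err d e"
  proof -
    have "(\<integral>\<^sup>+x. E x \<partial>m) = ennreal (1 / (2 * d)) * (\<integral>\<^sup>+x. (\<integral>\<^sup>+w. C e f w * C e f w \<partial>L (Some x)) \<partial>m) +
        ennreal (d / 2) * (\<integral>\<^sup>+x. (\<integral>\<^sup>+w. ?D x w \<partial>L (Some x)) \<partial>m)"
      unfolding E_def using mD mC by (subst nn_integral_add) (auto simp: nn_integral_cmult)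
    also have "\<dots> \<le> err d e"
      unfolding err_def
    proof (intro add_mono mult_left_mono)
      have "(\<integral>\<^sup>+x. (\<integral>\<^sup>+w. C e f w * C e f w \<partial>L (Some x)) \<partial>m) \<le> (\<integral>\<^sup>+x. 2 * a e (\<lambda>y. f y * a e f y) x \<partial>m)"
        by (intro nn_integral_mono C_square_le) measurable
      also have "\<dots> = 2 * c (\<lambda>y. f y * a e f y) e" unfolding c_def by (rule nn_integral_cmult) measurable
      finally show "(\<integral>\<^sup>+x. (\<integral>\<^sup>+w. C e f w * C e f w \<partial>L (Some x)) \<partial>m) \<le> 2 * c (\<lambda>y. f y * a e f y) e" .
      show "(\<integral>\<^sup>+x. (\<integral>\<^sup>+w. ?D x w \<partial>L (Some x)) \<partial>m) \<le> 2 * (ennreal (e * G) * (\<integral>\<^sup>+y. H t g y \<partial>m))"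
        by (rule variance_H[OF g gG G t e gfin])
    qed auto
    finally show ?thesis .
  qed
  have "terminal e \<le> (\<integral>\<^sup>+x. H t g x * a e f x + E x \<partial>m)" unfolding terminal_def by (intro nn_integral_mono p1)
  also have "\<dots> = increment e + (\<integral>\<^sup>+x. E x \<partial>m)" unfolding increment_def by (rule nn_integral_add) measurable
  finally show "terminal e \<le> increment e + err d e" using Eerr by (auto intro: order_trans add_left_mono)
  have "increment e \<le> (\<integral>\<^sup>+x. (\<integral>\<^sup>+w. ?h w * C e f w \<partial>L (Some x)) + E x \<partial>m)" unfolding increment_def by (intro nn_integral_mono p2)
  also have "\<dots> = terminal e + (\<integral>\<^sup>+x. E x \<partial>m)" unfolding terminal_def using measurable_terminal_integrand by (intro nn_integral_add) auto
  finally show "increment e \<le> terminal e + err d e" using Eerr by (auto intro: order_trans add_left_mono)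
qed

text \<open>Divide all estimates by \<open>e = 2\<^sup>-\<^sup>j\<close> and let \<open>j \<rightarrow> \<infinity>\<close> with \<open>d\<close> fixed: the first part of \<open>err\<close> vanishes and the
second is at most \<open>d G \<integral> H t g dm\<close>. Then let \<open>d \<rightarrow> 0\<close>.\<close>

lemma revuz_identity_tame: "(\<integral>\<^sup>+y. H t g y * f y \<partial>\<mu>) = (\<integral>\<^sup>+y. g y * a t f y \<partial>m)"
proof -
  let ?M = "\<integral>\<^sup>+y. H t g y * f y \<partial>\<mu>" and ?I = "\<integral>\<^sup>+y. H t g y \<partial>m" and ?F = "\<integral>\<^sup>+y. f y \<partial>\<mu>"
  define e where "e j = (1 / 2 ^ j :: real)" for j :: nat
  have e0: "0 < e j" for j by (simp add: e_def)
  have two_e: "ennreal (2 ^ j) * (ennreal (e j) * x) = x" for j x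
    by (simp add: mult.assoc[symmetric] e_def flip: ennreal_mult)
  have hm [measurable]: "(\<lambda>y. H t g y * f y) \<in> borel_measurable borel" by measurable
  have HI: "?I < top" using nn_integral_H_le[OF g gG G t] gfin by (auto simp: ennreal_mult_less_top intro: le_less_trans)
  have Ff: "?F < top" by (rule tame_\<mu>[OF f_tame])
  define r where "r j = (\<integral>\<^sup>+y. f y * a (e j) f y \<partial>\<mu>)" for j
  obtain K where K: "\<And>x. a 1 f x \<le> ennreal K" using tame_bounded[OF f_tame] by blast
  have r0: "r \<longlonglongrightarrow> 0"
    unfolding r_def[abs_def] e_def by (rule int_vanish[OF f_m K sets_\<mu> f_m Ff])
  have D0: "(\<lambda>j. growth (e j)) \<longlonglongrightarrow> 0"
    unfolding growth_def e_def by (rule int_vanish[OF f_m K sets_m g gfin])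
  have Dt: "(\<lambda>j. growth (t + e j)) \<longlonglongrightarrow> growth t"
  proof -
    have "(\<lambda>j. \<integral>\<^sup>+y. Pt t g y * a (e j) f y \<partial>m) \<longlonglongrightarrow> 0"
      unfolding e_def
    proof (rule int_vanish[OF f_m K sets_m])
      show "(\<integral>\<^sup>+y. Pt t g y \<partial>m) < top" using nn_integral_Pt_le[OF g, of t] gfin by (rule le_less_trans)
    qed measurable
    from tendsto_add[OF tendsto_const[of "growth t"] this] show ?thesis
      by (simp add: growth_add[OF t e0])
  qed
  have ep: "(\<lambda>j. ennreal (e j)) \<longlonglongrightarrow> 0"
  proof -
    have "(\<lambda>j. (1/2::real) ^ j) \<longlonglongrightarrow> 0" by (intro LIMSEQ_power_zero) auto
    from tendsto_ennrealI[OF this] show ?thesis by (simp add: e_def power_one_over)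
  qed
  define Z where "Z d j = ennreal (1 / d) * r j + ennreal (d * G) * ?I + ennreal (e j) * (ennreal G * ?F)" for d j
  have err_le: "ennreal (2 ^ j) * err d (e j) \<le> ennreal (1 / d) * r j + ennreal (d * G) * ?I" if d: "0 < d" for d j
  proof -
    have "ennreal (2 ^ j) * err d (e j) = ennreal (1 / (2 * d)) * (2 * \<nu> j (\<lambda>y. f y * a (e j) f y)) +
       ennreal (d / 2) * (2 * (ennreal (2 ^ j) * (ennreal (e j * G) * ?I)))"
      unfolding err_def \<nu>_def e_def[symmetric] by (simp only: distrib_left mult.left_commute)
    also have "ennreal (2 ^ j) * (ennreal (e j * G) * ?I) = ennreal G * ?I"
      using two_e[of j "ennreal G * ?I"] e0[of j] G by (simp add: ennreal_mult mult.assoc)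
    also have "ennreal (1 / (2 * d)) * (2 * \<nu> j (\<lambda>y. f y * a (e j) f y)) \<le> ennreal (1 / (2 * d)) * (2 * r j)"
      unfolding r_def by (intro mult_left_mono \<nu>_le) auto
    also have "ennreal (1 / (2 * d)) * (2 * r j) = ennreal (1 / d) * r j"
    proof -
      have "ennreal (1 / (2 * d)) * ennreal 2 = ennreal (1 / d)" using d by (subst ennreal_mult[symmetric]) auto
      then show ?thesis by (simp add: mult.assoc[symmetric])
    qed
    also have "ennreal (d / 2) * (2 * (ennreal G * ?I)) = ennreal (d * G) * ?I"
    proof -
      have "ennreal (d / 2) * ennreal 2 = ennreal d" using d by (subst ennreal_mult[symmetric]) auto
      then show ?thesis using d G by (simp add: mult.assoc[symmetric] ennreal_mult)
    qed
    finally show ?thesis by (simp add: add_mono)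
  qed
  have eG: "ennreal (2 ^ j) * (ennreal (e j * G) * c f (e j)) \<le> ennreal (e j) * (ennreal G * ?F)" for j
  proof -
    have "ennreal (2 ^ j) * (ennreal (e j * G) * c f (e j)) = ennreal (e j * G) * \<nu> j f"
      unfolding \<nu>_def e_def by (simp only: mult.left_commute)
    also have "\<dots> \<le> ennreal (e j * G) * ?F" by (intro mult_left_mono \<nu>_le) auto
    finally show ?thesis using e0[of j] G by (simp add: ennreal_mult mult.assoc)
  qed
  have up: "\<nu> j (\<lambda>y. H t g y * f y) \<le> growth (t + e j) + Z d j" if d: "0 < d" for d j
  proof -
    have "\<nu> j (\<lambda>y. H t g y * f y) \<le> ennreal (2 ^ j) * ((ennreal (e j) * growth (t + e j) + err d (e j)) + ennreal (e j * G) * c f (e j))"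
      unfolding \<nu>_def e_def[symmetric]
      by (intro mult_left_mono order_trans[OF terminal_ge[OF e0]] add_right_mono order_trans[OF terminal_increment(1)[OF e0 d]] increment_le e0) auto
    also have "\<dots> = growth (t + e j) + ennreal (2 ^ j) * err d (e j) + ennreal (2 ^ j) * (ennreal (e j * G) * c f (e j))"
      by (simp only: distrib_left two_e)
    also have "\<dots> \<le> growth (t + e j) + (ennreal (1 / d) * r j + ennreal (d * G) * ?I) + ennreal (e j) * (ennreal G * ?F)"
      by (intro add_mono err_le[OF d] eG order_refl)
    finally show ?thesis by (simp add: Z_def add.assoc)
  qed
  have lo: "growth t \<le> \<nu> j (\<lambda>y. H t g y * f y) + (Z d j + growth (e j))" if d: "0 < d" for d j
  proof -
    have "ennreal (e j) * growth t \<le> ((c (\<lambda>y. H t g y * f y) (e j) + ennreal (e j * G) * c f (e j)) + err d (e j)) + ennreal (e j) * growth (e j)"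
      by (intro order_trans[OF increment_ge[OF e0]] add_right_mono order_trans[OF terminal_increment(2)[OF e0 d]] terminal_le e0)
    then have "ennreal (2 ^ j) * (ennreal (e j) * growth t) \<le> ennreal (2 ^ j) * (((c (\<lambda>y. H t g y * f y) (e j) + ennreal (e j * G) * c f (e j)) + err d (e j)) + ennreal (e j) * growth (e j))"
      by (rule mult_left_mono) simp
    then have "growth t \<le> \<nu> j (\<lambda>y. H t g y * f y) + ennreal (2 ^ j) * (ennreal (e j * G) * c f (e j)) + ennreal (2 ^ j) * err d (e j) + growth (e j)"
      unfolding \<nu>_def e_def[symmetric] by (simp only: distrib_left two_e)
    also have "\<dots> \<le> \<nu> j (\<lambda>y. H t g y * f y) + ennreal (e j) * (ennreal G * ?F) + (ennreal (1 / d) * r j + ennreal (d * G) * ?I) + growth (e j)"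
      by (intro add_mono err_le[OF d] eG order_refl)
    finally show ?thesis by (simp add: Z_def ac_simps)
  qed
  have Zlim: "(\<lambda>j. Z d j) \<longlonglongrightarrow> ennreal (d * G) * ?I" if d: "0 < d" for d
  proof -
    have 1: "(\<lambda>j. ennreal (1 / d) * r j) \<longlonglongrightarrow> ennreal (1 / d) * 0"
      by (rule ennreal_tendsto_cmult[OF _ r0]) simp
    have 2: "(\<lambda>j. (ennreal G * ?F) * ennreal (e j)) \<longlonglongrightarrow> (ennreal G * ?F) * 0"
      by (rule ennreal_tendsto_cmult[OF _ ep]) (use Ff in \<open>simp add: ennreal_mult_less_top\<close>)
    from tendsto_add[OF tendsto_add[OF 1 tendsto_const[of "ennreal (d * G) * ?I"]] 2]
    show ?thesis unfolding Z_def by (simp add: mult.commute[of "ennreal G * ?F"])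
  qed
  have vlim: "(\<lambda>j. \<nu> j (\<lambda>y. H t g y * f y)) \<longlonglongrightarrow> ?M" by (rule \<nu>_tendsto[OF hm])
  have small: "a' \<le> b'" if "\<And>d. 0 < d \<Longrightarrow> a' \<le> b' + ennreal (d * G) * ?I" for a' b' :: ennreal
  proof (rule ennreal_le_epsilon)
    fix \<epsilon> :: real assume \<epsilon>: "0 < \<epsilon>"
    obtain i where i: "?I = ennreal i" "0 \<le> i" using HI by (cases ?I) auto
    define d where "d = \<epsilon> / (G * i + 1)"
    have gi: "0 \<le> G * i" using G i by simp
    have "0 < d" using \<epsilon> gi by (simp add: d_def)
    have "d * G * i = \<epsilon> * (G * i) / (G * i + 1)" by (simp add: d_def)
    also have "\<dots> \<le> \<epsilon>" using \<epsilon> gi by (simp add: pos_divide_le_eq)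
    finally have "ennreal (d * G) * ?I \<le> ennreal \<epsilon>"
      using i G \<open>0 < d\<close> by (simp add: ennreal_leI flip: ennreal_mult)
    then show "a' \<le> b' + ennreal \<epsilon>"
      using that[OF \<open>0 < d\<close>] by (meson add_left_mono order_trans)
  qed
  have "?M \<le> growth t"
  proof (rule small)
    fix d :: real assume d: "0 < d"
    show "?M \<le> growth t + ennreal (d * G) * ?I"
      by (rule LIMSEQ_le[OF vlim tendsto_add[OF Dt Zlim[OF d]]]) (use up[OF d] in auto)
  qed
  moreover have "growth t \<le> ?M"
  proof (rule small)
    fix d :: real assume d: "0 < d"
    have "(\<lambda>j. \<nu> j (\<lambda>y. H t g y * f y) + (Z d j + growth (e j))) \<longlonglongrightarrow> ?M + (ennreal (d * G) * ?I + 0)"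
      by (intro tendsto_add vlim Zlim d D0)
    then show "growth t \<le> ?M + ennreal (d * G) * ?I"
      using LIMSEQ_le_const[of "\<lambda>j. \<nu> j (\<lambda>y. H t g y * f y) + (Z d j + growth (e j))"] lo[OF d] by auto
  qed
  ultimately show ?thesis by (simp add: growth_def)
qed

end

end

section \<open>Space-time densities\<close>

context revuz_pcaf
begin

lemma measurable_unit_cost_ref_fun [measurable]: "unit_cost ref_fun \<in> borel_measurable borel"
  by (rule measurable_unit_cost[OF measurable_ref_fun])

definition weight :: "'s \<Rightarrow> ennreal" where
  "weight y = min 1 (unit_cost ref_fun y)"

lemma measurable_weight [measurable]: "weight \<in> borel_measurable borel"
  unfolding weight_def[abs_def] by measurable

lemma weight_pos: "0 < weight y" and weight_le: "weight y \<le> 1" and weight_le_unit_cost: "weight y \<le> unit_cost ref_fun y"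
  using unit_cost_positive[OF measurable_ref_fun ref_fun_pos] by (auto simp: weight_def)

lemma tame_weight: assumes [measurable]: "h \<in> borel_measurable borel" and h: "\<And>y. h y \<le> 1"
  shows "tame (\<lambda>y. h y * weight y)"
  unfolding tame_def
proof (intro conjI exI allI)
  fix y
  have "h y * weight y \<le> 1 * unit_cost ref_fun y" by (intro mult_mono h weight_le_unit_cost) auto
  then show "h y * weight y \<le> of_nat 1 * unit_cost ref_fun y" by simp
qed measurable

text \<open>A strictly positive function has a finite integral.\<close>

lemma sigma_finite_\<mu>: "sigma_finite_measure \<mu>"
proof
  let ?S = "\<lambda>n. {y. ennreal (1 / Suc n) < weight y}"
  have S [measurable]: "?S n \<in> sets borel" for n by measurable
  have fin: "emeasure \<mu> (?S n) \<noteq> \<infinity>" for n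
  proof -
    have "ennreal (1 / Suc n) * emeasure \<mu> (?S n) = (\<integral>\<^sup>+y. ennreal (1 / Suc n) * indicator (?S n) y \<partial>\<mu>)"
      by (subst nn_integral_cmult_indicator) auto
    also have "\<dots> \<le> (\<integral>\<^sup>+y. weight y \<partial>\<mu>)" by (intro nn_integral_mono) (auto split: split_indicator)
    also have "\<dots> < top" using tame_\<mu>[OF tame_weight[of "\<lambda>_. 1"]] by simp
    finally show ?thesis by (auto simp: ennreal_mult_less_top)
  qed
  have cov: "\<exists>n. y \<in> ?S n" for y
  proof -
    obtain r where r: "0 < r" "ennreal r < weight y"
      using ennreal_Ex_less_of_nat weight_pos[of y] dense[of 0 "weight y"] by (metis ennreal_less_zero_iff less_top_ennreal order_less_trans top.not_eq_extremum top_greatest ennreal_cases ennreal_0 le_less_trans zero_le)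
    obtain n where "1 / Suc n < r" using r(1) by (metis nat_approx_posE)
    then have "ennreal (1 / Suc n) < ennreal r" by (intro ennreal_lessI) (use r in auto)
    then show ?thesis using r(2) by (intro exI[of _ n]) auto
  qed
  show "\<exists>A. countable A \<and> A \<subseteq> sets \<mu> \<and> \<Union> A = space \<mu> \<and> (\<forall>a\<in>A. emeasure \<mu> a \<noteq> \<infinity>)"
    using fin cov by (intro exI[of _ "range ?S"]) auto
qed

sublocale mu: sigma_finite_measure \<mu>
  by (rule sigma_finite_\<mu>)

lemma H_SUP:
  assumes [measurable]: "\<And>n. g n \<in> borel_measurable borel" and inc: "incseq g"
  shows "H t (\<lambda>y. SUP n::nat. g n y) y = (SUP n. H t (g n) y)"
proof -
  have mono: "g i z \<le> g j z" if "i \<le> j" for i j z using inc that by (auto simp: incseq_def le_fun_def)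
  have "H t (\<lambda>y. SUP n. g n y) y = (\<integral>\<^sup>+s. (SUP n. Pt s (g n) y * indicator {0<..t} s) \<partial>lborel)"
    unfolding H_def
  proof (rule nn_integral_cong)
    fix s
    have "Pt s (\<lambda>y. SUP n. g n y) y = (\<integral>\<^sup>+z. (SUP n. q s y z * g n z) \<partial>m)"
      unfolding Pt_def by (intro nn_integral_cong SUP_mult_left_ennreal)
    also have "\<dots> = (SUP n. Pt s (g n) y)"
      unfolding Pt_def
      by (rule nn_integral_monotone_convergence_SUP) (auto simp: incseq_def le_fun_def intro!: mult_left_mono mono)
    finally show "Pt s (\<lambda>y. SUP n. g n y) y * indicator {0<..t} s = (SUP n. Pt s (g n) y * indicator {0<..t} s)"
      by (simp add: SUP_mult_right_ennreal)
  qed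
  also have "\<dots> = (SUP n. H t (g n) y)"
    unfolding H_def
  proof (rule nn_integral_monotone_convergence_SUP)
    show "incseq (\<lambda>n s. Pt s (g n) y * indicator {0<..t} s)"
      by (auto simp: incseq_def le_fun_def intro!: mult_right_mono Pt_mono mono)
    show "(\<lambda>s. Pt s (g n) y * indicator {0<..t} s) \<in> borel_measurable lborel" for n by measurable
  qed
  finally show ?thesis .
qed

text \<open>Truncate \<open>g\<close>; densities \<open>p\<^sub>e(x,\<cdot>)\<close> need not be bounded.\<close>

lemma revuz_identity:
  assumes f: "tame f" and t: "0 < t" and g [measurable]: "g \<in> borel_measurable borel" and gfin: "(\<integral>\<^sup>+y. g y \<partial>m) < top"
  shows "(\<integral>\<^sup>+y. H t g y * f y \<partial>\<mu>) = (\<integral>\<^sup>+y. g y * a t f y \<partial>m)"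
proof -
  note fm [measurable] = tame_measurable[OF f]
  let ?g = "\<lambda>n y. min (g y) (of_nat n)"
  have sup: "(SUP n::nat. ?g n y) = g y" for y
  proof (cases "g y")
    case (real r)
    obtain n :: nat where n: "r \<le> real n" using real_arch_simple by blast
    show ?thesis
    proof (rule antisym)
      show "(SUP n::nat. ?g n y) \<le> g y" by (rule SUP_least) simp
      have "?g n y = g y" using n real by (simp add: min_def ennreal_of_nat_eq_real_of_nat)
      then show "g y \<le> (SUP n::nat. ?g n y)" by (metis SUP_upper UNIV_I)
    qed
  next
    case top
    then show ?thesis by (simp add: ennreal_SUP_of_nat_eq_top)
  qed
  have inc: "?g i y \<le> ?g j y" if "i \<le> j" for i j y using that by (auto simp: min_le_iff_disj)
  have eq: "(\<integral>\<^sup>+y. H t (?g n) y * f y \<partial>\<mu>) = (\<integral>\<^sup>+y. ?g n y * a t f y \<partial>m)" for n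
  proof (rule revuz_identity_tame[OF f])
    show "?g n y \<le> ennreal (real n)" for y by (simp add: ennreal_of_nat_eq_real_of_nat)
    show "(\<integral>\<^sup>+y. ?g n y \<partial>m) < top"
      by (rule le_less_trans[OF _ gfin]) (intro nn_integral_mono, simp)
  qed (use t in auto)
  have iH: "H t (?g i) y \<le> H t (?g j) y" if "i \<le> j" for i j y
    unfolding H_def by (intro nn_integral_mono mult_right_mono Pt_mono inc that) simp
  have "(\<integral>\<^sup>+y. H t g y * f y \<partial>\<mu>) = (\<integral>\<^sup>+y. (SUP n. H t (?g n) y * f y) \<partial>\<mu>)"
  proof (rule nn_integral_cong)
    fix y
    have "H t g y = (SUP n. H t (?g n) y)"
      using H_SUP[of ?g t y] inc by (simp add: sup incseq_def le_fun_def)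
    then show "H t g y * f y = (SUP n. H t (?g n) y * f y)" by (simp add: SUP_mult_right_ennreal)
  qed
  also have "\<dots> = (SUP n. \<integral>\<^sup>+y. H t (?g n) y * f y \<partial>\<mu>)"
    by (rule nn_integral_monotone_convergence_SUP) (auto simp: incseq_def le_fun_def intro!: mult_right_mono iH)
  also have "\<dots> = (SUP n. \<integral>\<^sup>+y. ?g n y * a t f y \<partial>m)" by (simp add: eq)
  also have "\<dots> = (\<integral>\<^sup>+y. (SUP n. ?g n y * a t f y) \<partial>m)"
    by (rule nn_integral_monotone_convergence_SUP[symmetric]) (auto simp: incseq_def le_fun_def intro!: mult_right_mono inc)
  also have "\<dots> = (\<integral>\<^sup>+y. g y * a t f y \<partial>m)"
    by (simp add: SUP_mult_right_ennreal[symmetric] sup)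
  finally show ?thesis .
qed

text \<open>After time \<open>e\<close> the process started at \<open>x\<close> looks like the one started from the density \<open>q e x\<close>, to
which the Revuz identity applies; then \<open>e \<rightarrow> 0\<close>.\<close>

lemma occupation_density_tame:
  assumes f: "tame f" and t: "0 < t"
  shows "a t f x = (\<integral>\<^sup>+y. (\<integral>\<^sup>+s. q s x y * indicator {0<..t} s \<partial>lborel) * f y \<partial>\<mu>)"
proof -
  note fm [measurable] = tame_measurable[OF f]
  have mq: "(\<lambda>w. q (snd w) x (fst w) * indicator {b<..t} (snd w)) \<in> borel_measurable (borel \<Otimes>\<^sub>M lborel)" for b
    unfolding greaterThanAtMost_def greaterThan_def atMost_def by measurable
  define U where "U b y = (\<integral>\<^sup>+s. q s x y * indicator {b<..t} s \<partial>lborel)" for b y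
  have [measurable]: "U b \<in> borel_measurable borel" for b
    unfolding U_def[abs_def] using mq by (intro lborel.borel_measurable_nn_integral) (simp add: case_prod_beta)
  have step: "a t f x = a e f x + (\<integral>\<^sup>+y. U e y * f y \<partial>\<mu>)" if e: "0 < e" "e < t" for e
  proof -
    have [measurable]: "q e x \<in> borel_measurable borel" by measurable
    have "(\<integral>\<^sup>+y. q e x y \<partial>m) = Pt e (\<lambda>_. 1) x" by (simp add: Pt_def)
    also have "\<dots> \<le> 1" by (rule Pt_le_const) auto
    finally have qfin: "(\<integral>\<^sup>+y. q e x y \<partial>m) < top" by (auto intro: le_less_trans)
    have "a t f x = a e f x + Pt e (a (t - e) f) x" using a_add[of e "t - e" f x] e by simp
    also have "Pt e (a (t - e) f) x = (\<integral>\<^sup>+y. H (t - e) (q e x) y * f y \<partial>\<mu>)"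
      unfolding Pt_def using e by (intro revuz_identity[symmetric] f qfin) auto
    also have "\<dots> = (\<integral>\<^sup>+y. U e y * f y \<partial>\<mu>)"
    proof (intro nn_integral_cong arg_cong2[where f="(*)"] refl)
      fix y
      have "H (t - e) (q e x) y = (\<integral>\<^sup>+s. q (e + 1 * s) x y * indicator {e<..t} (e + 1 * s) \<partial>lborel)"
        unfolding H_def
      proof (rule nn_integral_cong)
        fix s :: real
        have "Pt s (q e x) y = q (e + s) x y" if "0 < s"
        proof -
          have "q (e + s) x y = (\<integral>\<^sup>+z. q e x z * q s z y \<partial>m)" by (rule q_semigroup) (use that e in auto)
          then show ?thesis unfolding Pt_def by (simp add: q_sym[of s y] mult.commute)
        qed
        then show "Pt s (q e x) y * indicator {0<..t-e} s = q (e + 1 * s) x y * indicator {e<..t} (e + 1 * s)"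
          by (auto split: split_indicator)
      qed
      also have "\<dots> = U e y"
      proof -
        have "(\<lambda>s. q s x y * indicator {e<..t} s) \<in> borel_measurable borel" by measurable
        from nn_integral_real_affine[OF this, of 1 e] show ?thesis by (simp add: U_def)
      qed
      finally show "H (t - e) (q e x) y = U e y" .
    qed
    finally show ?thesis .
  qed
  define e where "e j = (1 / 2 ^ j :: real)" for j :: nat
  have e0: "0 < e j" for j by (simp add: e_def)
  have edec: "e j \<le> e i" if "i \<le> j" for i j unfolding e_def using that by (intro divide_left_mono power_increasing) auto
  have elim: "e \<longlonglongrightarrow> 0"
  proof -
    have "(\<lambda>j. (1/2::real) ^ j) \<longlonglongrightarrow> 0" by (intro LIMSEQ_power_zero) auto
    then show ?thesis by (simp add: e_def[abs_def] power_one_over)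
  qed
  have Uinc: "incseq (\<lambda>j y. U (e j) y * f y)"
    unfolding incseq_def le_fun_def U_def
    by (intro allI impI mult_right_mono nn_integral_mono mult_left_mono) (auto split: split_indicator dest: edec)
  have Usup: "(SUP j. U (e j) y) = U 0 y" for y
  proof -
    have "(SUP j. U (e j) y) = (\<integral>\<^sup>+s. (SUP j. q s x y * indicator {e j<..t} s) \<partial>lborel)"
      unfolding U_def
    proof (rule nn_integral_monotone_convergence_SUP[symmetric])
      show "incseq (\<lambda>j s. q s x y * indicator {e j<..t} s)"
        unfolding incseq_def le_fun_def
        by (intro allI impI mult_left_mono) (auto split: split_indicator dest: edec)
      show "(\<lambda>s. q s x y * indicator {e j<..t} s) \<in> borel_measurable lborel" for j by measurable
    qed
    also have "\<dots> = U 0 y"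
      unfolding U_def
    proof (rule nn_integral_cong)
      fix s
      have "(SUP j. indicator {e j<..t} s) = (indicator {0<..t} s :: ennreal)"
      proof (cases "0 < s \<and> s \<le> t")
        case True
        have "eventually (\<lambda>j. e j < s) sequentially" using elim True by (intro order_tendstoD) auto
        then obtain j where "e j < s" by (auto simp: eventually_sequentially)
        then have "indicator {e j<..t} s = (1::ennreal)" using True by simp
        then have "1 \<le> (SUP j. indicator {e j<..t} s :: ennreal)" by (metis SUP_upper UNIV_I)
        moreover have "(SUP j. indicator {e j<..t} s :: ennreal) \<le> 1" by (intro SUP_least) (auto split: split_indicator)
        ultimately show ?thesis using True by auto
      next
        case False
        then have "indicator {e j<..t} s = (0::ennreal)" for j using e0[of j] by (auto split: split_indicator)
        then show ?thesis using False by (auto split: split_indicator)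
      qed
      then show "(SUP j. q s x y * indicator {e j<..t} s) = q s x y * indicator {0<..t} s"
        by (simp add: SUP_mult_left_ennreal[symmetric])
    qed
    finally show ?thesis .
  qed
  have "(\<lambda>j. \<integral>\<^sup>+y. U (e j) y * f y \<partial>\<mu>) \<longlonglongrightarrow> (SUP j. \<integral>\<^sup>+y. U (e j) y * f y \<partial>\<mu>)"
    by (rule LIMSEQ_SUP) (use Uinc in \<open>auto simp: incseq_def le_fun_def intro!: nn_integral_mono\<close>)
  also have "(SUP j. \<integral>\<^sup>+y. U (e j) y * f y \<partial>\<mu>) = (\<integral>\<^sup>+y. (SUP j. U (e j) y * f y) \<partial>\<mu>)"
    by (rule nn_integral_monotone_convergence_SUP[symmetric, OF Uinc]) measurable
  also have "\<dots> = (\<integral>\<^sup>+y. U 0 y * f y \<partial>\<mu>)" by (simp add: SUP_mult_right_ennreal[symmetric] Usup)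
  finally have lim: "(\<lambda>j. \<integral>\<^sup>+y. U (e j) y * f y \<partial>\<mu>) \<longlonglongrightarrow> (\<integral>\<^sup>+y. U 0 y * f y \<partial>\<mu>)" .
  have "a 1 f x < top"
  proof -
    obtain K where "\<And>x. a 1 f x \<le> ennreal K" using tame_bounded[OF f] by blast
    from le_less_trans[OF this ennreal_less_top] show ?thesis .
  qed
  then have "(\<lambda>j. a (e j) f x) \<longlonglongrightarrow> 0" unfolding e_def by (rule a_vanish[OF fm])
  from tendsto_add[OF this lim] have "(\<lambda>j. a (e j) f x + (\<integral>\<^sup>+y. U (e j) y * f y \<partial>\<mu>)) \<longlonglongrightarrow> (\<integral>\<^sup>+y. U 0 y * f y \<partial>\<mu>)" by simp
  moreover have "eventually (\<lambda>j. a (e j) f x + (\<integral>\<^sup>+y. U (e j) y * f y \<partial>\<mu>) = a t f x) sequentially"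
  proof -
    have "eventually (\<lambda>j. e j < t) sequentially" using elim t by (intro order_tendstoD) auto
    then show ?thesis by eventually_elim (rule step[OF e0, symmetric])
  qed
  ultimately have "(\<lambda>j. a t f x) \<longlonglongrightarrow> (\<integral>\<^sup>+y. U 0 y * f y \<partial>\<mu>)" by (rule Lim_transform_eventually)
  then show ?thesis unfolding U_def by (simp add: LIMSEQ_const_iff)
qed

lemma occupation_density_Fubini:
  assumes [measurable]: "f \<in> borel_measurable borel"
  shows "(\<integral>\<^sup>+y. (\<integral>\<^sup>+s. q s x y * indicator {0<..t} s \<partial>lborel) * f y \<partial>\<mu>) =
    (\<integral>\<^sup>+s. (\<integral>\<^sup>+y. q s x y * (if s < t then f y else 0) \<partial>\<mu>) \<partial>lborel)"
proof -
  interpret pm: pair_sigma_finite \<mu> "lborel :: real measure" ..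
  have "(\<integral>\<^sup>+y. (\<integral>\<^sup>+s. q s x y * indicator {0<..t} s \<partial>lborel) * f y \<partial>\<mu>) =
     (\<integral>\<^sup>+y. (\<integral>\<^sup>+s. q s x y * (if s < t then f y else 0) \<partial>lborel) \<partial>\<mu>)"
  proof (rule nn_integral_cong)
    fix y
    have "(\<integral>\<^sup>+s. q s x y * indicator {0<..t} s \<partial>lborel) * f y = (\<integral>\<^sup>+s. q s x y * indicator {0<..t} s * f y \<partial>lborel)"
      by (rule nn_integral_multc[symmetric]) measurable
    also have "\<dots> = (\<integral>\<^sup>+s. q s x y * (if s < t then f y else 0) \<partial>lborel)"
      by (rule nn_integral_cong_AE, use AE_lborel_neq[of t] in eventually_elim) (auto simp: q_def split: split_indicator)
    finally show "(\<integral>\<^sup>+s. q s x y * indicator {0<..t} s \<partial>lborel) * f y = (\<integral>\<^sup>+s. q s x y * (if s < t then f y else 0) \<partial>lborel)" .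
  qed
  also have "\<dots> = (\<integral>\<^sup>+s. (\<integral>\<^sup>+y. q s x y * (if s < t then f y else 0) \<partial>\<mu>) \<partial>lborel)"
    by (rule pm.Fubini'[symmetric]) (unfold case_prod_beta, measurable)
  finally show ?thesis .
qed

text \<open>Both sides of the density formula as measures on space-time. The weight keeps the mass of
\<open>{..<t} \<times> S\<close> finite.\<close>

definition occ :: "'s \<Rightarrow> (real \<times> 's option) measure" where
  "occ x = distr (density (L (Some x) \<Otimes>\<^sub>M lborel)
      (\<lambda>w. if 0 \<le> snd w \<and> T (snd w) (fst w) < \<infinity> then case_option 0 weight (path X (T (snd w) (fst w)) (fst w)) else 0))
    (borel \<Otimes>\<^sub>M borel_Delta) (\<lambda>w. (enn2real (T (snd w) (fst w)), path X (T (snd w) (fst w)) (fst w)))"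

definition occ' :: "'s \<Rightarrow> (real \<times> 's option) measure" where
  "occ' x = distr (density (lborel \<Otimes>\<^sub>M \<mu>) (\<lambda>(s, y). q s x y * weight y)) (borel \<Otimes>\<^sub>M borel_Delta) (\<lambda>(s, y). (s, Some y))"

lemma measurable_weight_option: "(\<lambda>(s :: real, z). case_option 0 weight z :: ennreal) \<in> borel_measurable (borel \<Otimes>\<^sub>M borel_Delta)"
  unfolding case_prod_beta by (rule measurable_compose[OF _ borel_measurable_case_option[OF measurable_weight]]) measurable

lemma nn_integral_occ:
  assumes G: "(\<lambda>(s, z). G s z) \<in> borel_measurable (borel \<Otimes>\<^sub>M borel_Delta)"
  shows "(\<integral>\<^sup>+w. G (fst w) (snd w) \<partial>occ x) = V (\<lambda>s z. case_option 0 weight z * G s z) (Some x)"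
proof -
  let ?M = "L (Some x) \<Otimes>\<^sub>M (lborel :: real measure)"
  have f: "fst \<in> ?M \<rightarrow>\<^sub>M N0"
    using measurable_fst[of "L (Some x)" "lborel :: real measure"] by (simp cong: measurable_cong_sets)
  note [measurable] = f
  have p: "(\<lambda>w. path X (T (snd w) (fst w)) (fst w)) \<in> ?M \<rightarrow>\<^sub>M borel_Delta"
    by (rule measurable_path_compose) measurable
  note [measurable] = p
  have map: "(\<lambda>w. (enn2real (T (snd w) (fst w)), path X (T (snd w) (fst w)) (fst w))) \<in> ?M \<rightarrow>\<^sub>M borel \<Otimes>\<^sub>M borel_Delta" by measurable
  have Gm: "(\<lambda>w. G (fst w) (snd w)) \<in> borel_measurable (borel \<Otimes>\<^sub>M borel_Delta)" using G by (simp add: case_prod_beta)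
  have Gc: "(\<lambda>w. G (enn2real (T (snd w) (fst w))) (path X (T (snd w) (fst w)) (fst w))) \<in> borel_measurable ?M"
    using measurable_compose[OF map Gm] by simp
  have FG: "(\<lambda>(s, z). case_option 0 weight z * G s z) \<in> borel_measurable (borel \<Otimes>\<^sub>M borel_Delta)"
    using measurable_weight_option G by (simp add: case_prod_beta)
  have d: "(\<lambda>w. if 0 \<le> snd w \<and> T (snd w) (fst w) < \<infinity> then case_option 0 weight (path X (T (snd w) (fst w)) (fst w)) else (0::ennreal)) \<in> borel_measurable ?M"
    using V_prod(1)[OF measurable_weight_option] by simp
  show ?thesis
    unfolding occ_def V_prod(2)[OF FG]
    using map Gm Gc d by (subst nn_integral_distr) (auto simp: nn_integral_density intro!: nn_integral_cong)
qed

lemma nn_integral_occ':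
  assumes G: "(\<lambda>(s, z). G s z) \<in> borel_measurable (borel \<Otimes>\<^sub>M borel_Delta)"
  shows "(\<integral>\<^sup>+w. G (fst w) (snd w) \<partial>occ' x) = (\<integral>\<^sup>+s. (\<integral>\<^sup>+y. q s x y * (weight y * G s (Some y)) \<partial>\<mu>) \<partial>lborel)"
proof -
  have Gm: "(\<lambda>w. G (fst w) (snd w)) \<in> borel_measurable (borel \<Otimes>\<^sub>M borel_Delta)" using G by (simp add: case_prod_beta)
  have map: "(\<lambda>w. (fst w, Some (snd w))) \<in> lborel \<Otimes>\<^sub>M \<mu> \<rightarrow>\<^sub>M borel \<Otimes>\<^sub>M borel_Delta" by measurable
  have Gc: "(\<lambda>w. G (fst w) (Some (snd w))) \<in> borel_measurable (lborel \<Otimes>\<^sub>M \<mu>)"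
    using measurable_compose[OF map Gm] by simp
  have d: "(\<lambda>w. q (fst w) x (snd w) * weight (snd w)) \<in> borel_measurable (lborel \<Otimes>\<^sub>M \<mu>)" by measurable
  have "(\<integral>\<^sup>+w. G (fst w) (snd w) \<partial>occ' x) = (\<integral>\<^sup>+w. q (fst w) x (snd w) * weight (snd w) * G (fst w) (Some (snd w)) \<partial>(lborel \<Otimes>\<^sub>M \<mu>))"
    unfolding occ'_def case_prod_beta using map Gm Gc d
    by (subst nn_integral_distr) (auto simp: nn_integral_density)
  also have "\<dots> = (\<integral>\<^sup>+s. (\<integral>\<^sup>+y. q s x y * (weight y * G s (Some y)) \<partial>\<mu>) \<partial>lborel)"
    using mu.nn_integral_fst[OF borel_measurable_times_ennreal[OF d Gc]] by (simp add: mult.assoc)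
  finally show ?thesis .
qed

lemma a_eq_density:
  assumes f: "tame f"
  shows "a t f x = (\<integral>\<^sup>+s. (\<integral>\<^sup>+y. q s x y * (if s < t then f y else 0) \<partial>\<mu>) \<partial>lborel)"
proof (cases "0 < t")
  case True
  show ?thesis
    unfolding occupation_density_tame[OF f True] by (rule occupation_density_Fubini[OF tame_measurable[OF f]])
next
  case False
  have "a t f x = V (\<lambda>s z. 0) (Some x)"
    unfolding a_def by (rule V_cong) (use False in auto)
  also have "\<dots> = 0" by (simp add: V_def cong: if_cong)
  finally have "a t f x = 0" .
  moreover have "q s x y * (if s < t then f y else 0) = 0" for s y using False by (auto simp: q_def)
  ultimately show ?thesis by (simp only: nn_integral_const mult_zero_left)
qed

lemma occ_eq: "occ x = occ' x"
proof -
  let ?B = "borel \<Otimes>\<^sub>M borel_Delta :: (real \<times> 's option) measure"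
  let ?E = "{ a \<times> b | a b. a \<in> range (lessThan :: real \<Rightarrow> real set) \<and> b \<in> sets (borel_Delta :: 's option measure) }"
  have sp: "space (borel_Delta :: 's option measure) = UNIV" by (simp add: borel_Delta_def)
  have gen: "sets ?B = sets (sigma (space (borel::real measure) \<times> space (borel_Delta :: 's option measure)) ?E)"
  proof (rule sets_pair_eq)
    show "sets (borel :: real measure) = sigma_sets (space borel) (range lessThan)"
      by (subst borel_Iio) simp
    show "countable (range (\<lambda>n::nat. {..<real n}))" by simp
    show "range (\<lambda>n::nat. {..<real n}) \<subseteq> range lessThan" by auto
    show "\<Union> (range (\<lambda>n::nat. {..<real n})) = space borel" using reals_Archimedean2 by auto
    show "countable {UNIV :: 's option set}" by simp
    show "{UNIV :: 's option set} \<subseteq> sets borel_Delta" using sets.top[of "borel_Delta :: 's option measure"] by (simp add: sp)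
    show "sets (borel_Delta :: 's option measure) = sigma_sets (space borel_Delta) (sets borel_Delta)" using sets.sigma_sets_eq[of "borel_Delta :: 's option measure"] by (simp add: sp)
  qed (auto simp: sp sets.space_closed)
  then have gen': "sets ?B = sigma_sets UNIV ?E" by (simp add: sp)
  have val: "emeasure (occ x) ({..<t} \<times> E) = a t (\<lambda>y. indicator E (Some y) * weight y) x"
    "emeasure (occ' x) ({..<t} \<times> E) = a t (\<lambda>y. indicator E (Some y) * weight y) x" if E: "E \<in> sets borel_Delta" for t E
  proof -
    have [measurable]: "(\<lambda>y. indicator E (Some y) :: ennreal) \<in> borel_measurable (borel :: 's measure)"
      using measurable_compose[OF measurable_Some_borel_Delta borel_measurable_indicator[OF E]] by simp
    have nc: "tame (\<lambda>y. indicator E (Some y) * weight y)" by (rule tame_weight) (auto split: split_indicator)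
    have G: "(\<lambda>(s, z). indicator ({..<t} \<times> E) (s, z) :: ennreal) \<in> borel_measurable ?B"
      using E by simp
    have s1: "sets (occ x) = sets ?B" "sets (occ' x) = sets ?B" by (simp_all add: occ_def occ'_def)
    have mE: "{..<t} \<times> E \<in> sets ?B" using E by simp
    have "emeasure (occ x) ({..<t} \<times> E) = (\<integral>\<^sup>+w. indicator ({..<t} \<times> E) (fst w, snd w) \<partial>occ x)" using mE s1 by simp
    also have "\<dots> = a t (\<lambda>y. indicator E (Some y) * weight y) x"
      unfolding a_def nn_integral_occ[OF G] by (rule V_cong) (auto split: split_indicator)
    finally show "emeasure (occ x) ({..<t} \<times> E) = a t (\<lambda>y. indicator E (Some y) * weight y) x" .
    have "emeasure (occ' x) ({..<t} \<times> E) = (\<integral>\<^sup>+w. indicator ({..<t} \<times> E) (fst w, snd w) \<partial>occ' x)" using mE s1 by simp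
    also have "\<dots> = a t (\<lambda>y. indicator E (Some y) * weight y) x"
      unfolding a_eq_density[OF nc] nn_integral_occ'[OF G] by (intro nn_integral_cong) (auto split: split_indicator)
    finally show "emeasure (occ' x) ({..<t} \<times> E) = a t (\<lambda>y. indicator E (Some y) * weight y) x" .
  qed
  show ?thesis
  proof (rule measure_eqI_generator_eq[where E="?E" and \<Omega>=UNIV and A="\<lambda>n. {..<real n} \<times> UNIV"])
    show "Int_stable ?E"
    proof (rule Int_stableI)
      fix A B assume "A \<in> ?E" "B \<in> ?E"
      then obtain u v E1 E2 where "A = {..<u} \<times> E1" "B = {..<v} \<times> E2" "E1 \<in> sets borel_Delta" "E2 \<in> sets borel_Delta" by auto
      then show "A \<inter> B \<in> ?E"
        by (intro CollectI exI[of _ "{..<min u v}"] exI[of _ "E1 \<inter> E2"]) auto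
    qed
    show "emeasure (occ x) A = emeasure (occ' x) A" if "A \<in> ?E" for A using that val by auto
    show "sets (occ x) = sigma_sets UNIV ?E" "sets (occ' x) = sigma_sets UNIV ?E"
      using gen' by (simp_all add: occ_def occ'_def)
    have U: "UNIV \<in> sets (borel_Delta :: 's option measure)" using sets.top[of "borel_Delta :: 's option measure"] by (simp add: sp)
    then show "range (\<lambda>n. {..<real n} \<times> (UNIV :: 's option set)) \<subseteq> ?E" by auto
    show "(\<Union>n. {..<real n} \<times> (UNIV :: 's option set)) = UNIV" using reals_Archimedean2 by auto
    fix n
    obtain K where "\<And>x. a (real n) (\<lambda>y. 1 * weight y) x \<le> ennreal K" using tame_bounded[OF tame_weight[of "\<lambda>_. 1"]] by auto
    from le_less_trans[OF this ennreal_less_top] show "emeasure (occ x) ({..<real n} \<times> UNIV) \<noteq> \<infinity>"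
      unfolding val(1)[OF U] by (auto simp: less_top[symmetric])
  qed auto
qed

text \<open>The occupation measure of the clock has the space-time density \<open>p\<close> with respect to \<open>ds \<mu>(dy)\<close>.\<close>

theorem V_eq_density:
  assumes G: "(\<lambda>(s, z). G s z) \<in> borel_measurable (borel \<Otimes>\<^sub>M borel_Delta)"
  shows "V G (Some x) = (\<integral>\<^sup>+s. (\<integral>\<^sup>+y. q s x y * G s (Some y) \<partial>\<mu>) \<partial>lborel)"
proof -
  have inv: "weight y * (inverse (weight y) * c) = c" for y c
  proof -
    have "weight y * inverse (weight y) = 1"
      using weight_pos[of y] le_less_trans[OF weight_le[of y] ennreal_one_less_top] ennreal_divide_self[of "weight y"]
      by (simp add: divide_ennreal_def)
    then show ?thesis by (simp add: mult.assoc[symmetric])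
  qed
  define G' where "G' s z = case_option 0 (\<lambda>y. inverse (weight y)) z * G s z" for s z
  have "(\<lambda>(s :: real, z). case_option 0 (\<lambda>y. inverse (weight y)) z :: ennreal) \<in> borel_measurable (borel \<Otimes>\<^sub>M borel_Delta)"
    unfolding case_prod_beta by (rule measurable_compose[OF _ borel_measurable_case_option]) measurable
  then have G': "(\<lambda>(s, z). G' s z) \<in> borel_measurable (borel \<Otimes>\<^sub>M borel_Delta)"
    using G by (simp add: case_prod_beta G'_def)
  have "V G (Some x) = V (\<lambda>s z. case_option 0 weight z * G' s z) (Some x)"
    by (rule V_cong) (simp add: G'_def inv)
  also have "\<dots> = (\<integral>\<^sup>+s. (\<integral>\<^sup>+y. q s x y * (weight y * G' s (Some y)) \<partial>\<mu>) \<partial>lborel)"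
    unfolding nn_integral_occ[OF G', symmetric] occ_eq by (rule nn_integral_occ'[OF G'])
  also have "\<dots> = (\<integral>\<^sup>+s. (\<integral>\<^sup>+y. q s x y * G s (Some y) \<partial>\<mu>) \<partial>lborel)"
    by (simp add: G'_def inv)
  finally show ?thesis .
qed

end

section \<open>Terminal values and moments\<close>

lemma emeasure_m_Delta:
  fixes m :: "'s::{metric_space, second_countable_topology} measure"
  assumes m: "sets m = sets borel" and E: "E \<in> sets borel_Delta"
  shows "emeasure (m_Delta m) E = emeasure m (Some -` E) + indicator E \<Delta>"
proof (rule emeasure_measure_of[OF m_Delta_def])
  let ?e = "\<lambda>E. emeasure m (Some -` E) + indicator E \<Delta>"
  have M: "Some -` B \<in> sets m" if "B \<in> sets borel_Delta" for B using that m by (simp add: sets_borel_Delta_iff)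
  show "sets (borel_Delta :: 's option measure) \<subseteq> Pow UNIV" by simp
  show "E \<in> sets (m_Delta m)"
    using E sets.sigma_sets_eq[of "borel_Delta :: 's option measure"] by (simp add: m_Delta_def)
  show "positive (sets (m_Delta m)) ?e" by (simp add: positive_def)
  show "countably_additive (sets (m_Delta m)) ?e"
  proof (rule countably_additiveI)
    fix B :: "nat \<Rightarrow> 's option set"
    assume "range B \<subseteq> sets (m_Delta m)" and disj: "disjoint_family B"
    then have B: "range B \<subseteq> sets borel_Delta"
      using sets.sigma_sets_eq[of "borel_Delta :: 's option measure"] by (simp add: m_Delta_def)
    have d: "disjoint_family (\<lambda>i. Some -` B i)" using disj by (auto simp: disjoint_family_on_def)
    have "(\<Sum>i. ?e (B i)) = (\<Sum>i. emeasure m (Some -` B i)) + (\<Sum>i. indicator (B i) \<Delta>)"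
      by (rule suminf_add[symmetric]) auto
    also have "(\<Sum>i. emeasure m (Some -` B i)) = emeasure m (\<Union>i. Some -` B i)"
      by (rule suminf_emeasure[OF _ d]) (use B M in auto)
    also have "(\<Sum>i. indicator (B i) \<Delta> :: ennreal) = indicator (\<Union>i. B i) \<Delta>"
      by (rule suminf_indicator[OF disj])
    finally show "(\<Sum>i. ?e (B i)) = ?e (\<Union>i. B i)" by (simp add: vimage_UN)
  qed
qed

lemma sets_m_Delta [simp, measurable_cong]: "sets (m_Delta m) = sets (borel_Delta :: 's::{metric_space, second_countable_topology} option measure)"
  using sets.sigma_sets_eq[of "borel_Delta :: 's option measure"] by (simp add: m_Delta_def)

lemma nn_integral_m_Delta:
  fixes m :: "'s::{metric_space, second_countable_topology} measure"
  assumes m [measurable_cong]: "sets m = sets borel" and g: "g \<in> borel_measurable borel_Delta"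
  shows "(\<integral>\<^sup>+z. g z \<partial>m_Delta m) = (\<integral>\<^sup>+y. g (Some y) \<partial>m) + g \<Delta>"
  using g
proof (induction rule: borel_measurable_induct)
  case (cong f g)
  from cong show ?case by (simp cong: nn_integral_cong)
next
  case (set E)
  have "(\<integral>\<^sup>+y. indicator E (Some y) \<partial>m) = (\<integral>\<^sup>+y. indicator (Some -` E) y \<partial>m)"
    by (intro nn_integral_cong) (auto split: split_indicator)
  also have "\<dots> = emeasure m (Some -` E)" using set m by (intro nn_integral_indicator) (simp add: sets_borel_Delta_iff)
  finally show ?case using set emeasure_m_Delta[OF m set] by (simp add: sets_m_Delta)
next
  case (mult u c)
  have [measurable]: "(\<lambda>y. u (Some y)) \<in> borel_measurable m" using mult(2) by measurable
  show ?case using mult by (simp add: nn_integral_cmult distrib_left)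
next
  case (add u v)
  have [measurable]: "(\<lambda>y. u (Some y)) \<in> borel_measurable m" "(\<lambda>y. v (Some y)) \<in> borel_measurable m" using add by (auto intro!: measurable_compose[OF measurable_Some_borel_Delta])
  show ?case using add by (simp add: nn_integral_add ac_simps)
next
  case (seq U)
  have [measurable]: "(\<lambda>y. U i (Some y)) \<in> borel_measurable m" for i by (rule measurable_compose[OF _ seq(1)]) measurable
  have inc: "U i z \<le> U j z" if "i \<le> j" for i j z using \<open>incseq U\<close> that by (auto simp: incseq_def le_fun_def)
  have "(\<integral>\<^sup>+z. (SUP i. U i) z \<partial>m_Delta m) = (SUP i. \<integral>\<^sup>+z. U i z \<partial>m_Delta m)"
    unfolding SUP_apply using seq(1) \<open>incseq U\<close> by (intro nn_integral_monotone_convergence_SUP) auto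
  also have "\<dots> = (SUP i. (\<integral>\<^sup>+y. U i (Some y) \<partial>m) + U i \<Delta>)" using seq by simp
  also have "\<dots> = (SUP i. \<integral>\<^sup>+y. U i (Some y) \<partial>m) + (SUP i. U i \<Delta>)"
    by (rule ennreal_SUP_add) (auto simp: incseq_def intro!: nn_integral_mono inc)
  also have "(SUP i. \<integral>\<^sup>+y. U i (Some y) \<partial>m) = (\<integral>\<^sup>+y. (SUP i. U i (Some y)) \<partial>m)"
    by (rule nn_integral_monotone_convergence_SUP[symmetric]) (auto simp: incseq_def le_fun_def inc)
  finally show ?case by (simp add: SUP_apply image_image)
qed

context ac_hunt
begin

lemma expected_terminal:
  assumes r: "0 < r" and f [measurable]: "f \<in> borel_measurable borel_Delta"
  shows "(\<integral>\<^sup>+w. f (path X r w) \<partial>L (Some y)) = (\<integral>\<^sup>+z. extended_density m p r y z * f z \<partial>m_Delta m)"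
proof (cases r)
  case (real s)
  then have s: "0 < s" using r by simp
  have eq: "extended_density m p r y z = case_option (1 - Pt s (\<lambda>_. 1) y) (q s y) z" for z
    using real s by (simp add: extended_density_def Pt_def q_def split: option.split)
  have qm: "q s y \<in> borel_measurable borel" by measurable
  have "(\<lambda>z. case_option (1 - Pt s (\<lambda>_. 1) y) (q s y) z * f z) \<in> borel_measurable borel_Delta"
    using borel_measurable_case_option[OF qm] by measurable
  from nn_integral_m_Delta[OF sets_m this]
  have "(\<integral>\<^sup>+z. extended_density m p r y z * f z \<partial>m_Delta m) = Pt s (\<lambda>y. f (Some y)) y + f \<Delta> * (1 - Pt s (\<lambda>_. 1) y)"
    unfolding eq by (simp add: Pt_def mult.commute)
  then show ?thesis unfolding real(2) by (simp add: nn_integral_path_general[OF s f])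
next
  case top
  have "(\<integral>\<^sup>+w. f (path X r w) \<partial>L (Some y)) = (\<integral>\<^sup>+w. f \<Delta> \<partial>L (Some y))"
    unfolding top by (intro nn_integral_cong) simp
  also have "\<dots> = f \<Delta>" using prob_space.emeasure_space_1[of "L (Some y)"] by simp
  finally show ?thesis
    using nn_integral_m_Delta[OF sets_m, of "\<lambda>z. indicator {\<Delta>} z * f z"]
    by (simp add: extended_density_def top)
qed

end

text \<open>The recursion behind the moment formula: applied to \<open>n = A\<^sub>t\<close>, the difference \<open>n - u\<close> is the clock
of the path shifted by \<open>T u\<close>. It also holds for \<open>n = \<infinity>\<close>.\<close>

lemma power_eq_integral:
  fixes n :: ennreal
  shows "n ^ Suc k = of_nat (Suc k) * (\<integral>\<^sup>+u\<in>{0..}. (if ennreal u < n then (n - ennreal u) ^ k else 0) \<partial>lborel)"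
proof (cases n)
  case (real r)
  have "(\<integral>\<^sup>+u\<in>{0..}. (if ennreal u < n then (n - ennreal u) ^ k else 0) \<partial>lborel) =
     (\<integral>\<^sup>+u. ennreal ((r - u) ^ k) * indicator {0..r} u \<partial>lborel)"
    by (rule nn_integral_cong_AE, use AE_lborel_neq[of r] in eventually_elim)
      (use real in \<open>auto simp: ennreal_less_iff ennreal_minus ennreal_power split: split_indicator\<close>)
  also have "\<dots> = ennreal (- ((r - r) ^ Suc k / Suc k) - - ((r - 0) ^ Suc k / Suc k))"
  proof (rule nn_integral_FTC_Icc[where F="\<lambda>u. - ((r - u) ^ Suc k / Suc k)" and f="\<lambda>u. (r - u) ^ k"])
    show "((\<lambda>u. - ((r - u) ^ Suc k / real (Suc k))) has_real_derivative (r - u) ^ k) (at u)" for u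
      by (auto intro!: derivative_eq_intros simp del: power_Suc of_nat_Suc)
  qed (use real in auto)
  also have "\<dots> = ennreal (r ^ Suc k / Suc k)" by simp
  finally have "of_nat (Suc k) * (\<integral>\<^sup>+u\<in>{0..}. (if ennreal u < n then (n - ennreal u) ^ k else 0) \<partial>lborel) =
     ennreal (real (Suc k)) * ennreal (r ^ Suc k / Suc k)"
    by (simp only: ennreal_of_nat_eq_real_of_nat)
  also have "\<dots> = ennreal (r ^ Suc k)"
    using real by (subst ennreal_mult[symmetric]) (auto simp: field_simps)
  finally show ?thesis using real by (simp add: ennreal_power del: power_Suc)
next
  case top
  have c: "1 \<le> (n - ennreal u) ^ k" for u by (cases k) (auto simp: top ennreal_top_minus ennreal_top_mult power_le_one)
  have "(\<integral>\<^sup>+u. 1 * indicator {0::real..} u \<partial>lborel) \<le> (\<integral>\<^sup>+u\<in>{0..}. (if ennreal u < n then (n - ennreal u) ^ k else 0) \<partial>lborel)"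
    using c by (intro nn_integral_mono) (auto simp: top split: split_indicator)
  moreover have "(\<integral>\<^sup>+u. 1 * indicator {0::real..} u \<partial>lborel) = top" using lborel_clock_value[of top] by simp
  ultimately have "(\<integral>\<^sup>+u\<in>{0..}. (if ennreal u < n then (n - ennreal u) ^ k else 0) \<partial>lborel) = top" by (simp add: top_unique)
  then show ?thesis by (simp add: top ennreal_mult_top ennreal_top_mult power_eq_top_ennreal)
qed

lemma ennreal_diff_diff: "(t - ennreal a) - ennreal s = t - ennreal (a + s)" if "0 \<le> a" "0 \<le> s"
  using that by (cases t) (auto simp: ennreal_minus ennreal_top_minus algebra_simps simp del: ennreal_plus)

lemma ennreal_less_diff: "0 \<le> a \<Longrightarrow> 0 \<le> s \<Longrightarrow> ennreal s < t - ennreal a \<longleftrightarrow> ennreal (a + s) < t"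
  by (cases t) (auto simp: ennreal_minus ennreal_less_iff ennreal_top_minus simp del: ennreal_plus)

context strict_pcaf
begin

definition clock :: "ennreal \<Rightarrow> 'w \<Rightarrow> ennreal" where
  "clock t w = (\<integral>\<^sup>+u\<in>{0..}. (if T u w < t then 1 else 0) \<partial>lborel)"

lemma measurable_clock [measurable (raw)]:
  assumes [measurable]: "f \<in> borel_measurable M" "g \<in> M \<rightarrow>\<^sub>M N0"
  shows "(\<lambda>w. clock (f w) (g w)) \<in> borel_measurable M"
proof -
  have "(\<lambda>w. (if T (snd w) (g (fst w)) < f (fst w) then 1 else 0) * indicator {0..} (snd w) :: ennreal) \<in> borel_measurable (M \<Otimes>\<^sub>M lborel)"
    unfolding atLeast_def by measurable
  then show ?thesis
    unfolding clock_def[abs_def] by (intro lborel.borel_measurable_nn_integral) (simp add: case_prod_beta)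
qed

lemma pcaf_at_clock: "w \<in> \<Omega> \<Longrightarrow> w \<notin> D \<Longrightarrow> pcaf_at A t w = clock t w"
  unfolding clock_def by (rule pcaf_at_eq)

lemma AE_pcaf_at_clock: "AE w in P y. pcaf_at A t w = clock t w"
  using AE_D[of y] AE_space[of "P y"] by eventually_elim (simp add: pcaf_at_clock)

lemma moment_recursion:
  "(\<integral>\<^sup>+w. clock t w ^ Suc k \<partial>L y) =
    of_nat (Suc k) * V (\<lambda>s z. \<integral>\<^sup>+w. (if ennreal s < t then clock (t - ennreal s) w ^ k else 0) \<partial>L z) y"
proof -
  define \<Phi> where "\<Phi> s w = (if s < t then clock (t - s) w ^ k else 0)" for s w
  define \<Psi> where "\<Psi> u w = (if ennreal u < clock t w then (clock t w - ennreal u) ^ k else 0)" for u w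
  have m\<Phi>: "(\<lambda>(s, w). \<Phi> s w) \<in> borel_measurable (borel \<Otimes>\<^sub>M N0)"
    unfolding \<Phi>_def case_prod_beta by measurable
  have m\<Psi>: "(\<lambda>(u, w). \<Psi> u w) \<in> borel_measurable (borel \<Otimes>\<^sub>M N0)"
    unfolding \<Psi>_def case_prod_beta by measurable
  have "(\<lambda>v. \<Psi> (snd v) (fst v) * indicator {0..} (snd v)) \<in> borel_measurable (N0 \<Otimes>\<^sub>M lborel)"
    unfolding \<Psi>_def atLeast_def by measurable
  then have [measurable]: "(\<lambda>w. \<integral>\<^sup>+u\<in>{0..}. \<Psi> u w \<partial>lborel) \<in> borel_measurable N0"
    by (intro lborel.borel_measurable_nn_integral) (simp add: case_prod_beta)
  have "(\<integral>\<^sup>+w. clock t w ^ Suc k \<partial>L y) = (\<integral>\<^sup>+w. of_nat (Suc k) * (\<integral>\<^sup>+u\<in>{0..}. \<Psi> u w \<partial>lborel) \<partial>L y)"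
    unfolding \<Psi>_def by (simp only: power_eq_integral)
  also have "\<dots> = of_nat (Suc k) * (\<integral>\<^sup>+w. (\<integral>\<^sup>+u\<in>{0..}. \<Psi> u w \<partial>lborel) \<partial>L y)"
    by (rule nn_integral_cmult) (intro measurable_L_of_N0, measurable)
  also have "(\<integral>\<^sup>+w. (\<integral>\<^sup>+u\<in>{0..}. \<Psi> u w \<partial>lborel) \<partial>L y) = V (\<lambda>s z. \<integral>\<^sup>+w. \<Phi> (ennreal s) w \<partial>L z) y"
  proof (rule additive_functional_eq[OF m\<Phi> m\<Psi>])
    fix u :: real and w assume u: "0 \<le> u" and w: "w \<in> \<Omega>" "w \<notin> D" and sh: "T u w < \<infinity> \<Longrightarrow> \<theta> (T u w) w \<in> \<Omega> - D"
    have iff: "ennreal u < clock t w \<longleftrightarrow> T u w < t" using T_less_iff[OF w] by (simp add: pcaf_at_clock[OF w])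
    show "\<Psi> u w = (if T u w < \<infinity> then \<Phi> (T u w) (\<theta> (T u w) w) else 0)"
    proof (cases "T u w < t")
      case True
      then have fin: "T u w < \<infinity>" by (auto intro: less_le_trans)
      have s: "\<theta> (T u w) w \<in> \<Omega>" "\<theta> (T u w) w \<notin> D" using sh[OF fin] by auto
      have "clock t w = ennreal u + clock (t - T u w) (\<theta> (T u w) w)"
        using pcaf_at_shift_T[OF w s(2) u True] by (simp add: pcaf_at_clock w s)
      then have "clock t w - ennreal u = clock (t - T u w) (\<theta> (T u w) w)" by simp
      then show ?thesis using True fin iff by (simp add: \<Psi>_def \<Phi>_def)
    qed (simp add: \<Psi>_def \<Phi>_def iff)
  qed
  finally show ?thesis by (simp only: \<Phi>_def)
qed

end

primrec ordered_from :: "real \<Rightarrow> real list \<Rightarrow> bool" where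
  "ordered_from a [] \<longleftrightarrow> True"
| "ordered_from a (s # ts) \<longleftrightarrow> a < s \<and> ordered_from s ts"

lemma time_integral_cong:
  "(\<And>ts. length ts = k \<Longrightarrow> ordered_from a ts \<Longrightarrow> G ts = G' ts) \<Longrightarrow> time_integral t k a G = time_integral t k a G'"
proof (induction k arbitrary: a G G')
  case (Suc k)
  have "time_integral t k s (\<lambda>ts. G (s # ts)) = time_integral t k s (\<lambda>ts. G' (s # ts))" if "a < s" for s
    by (rule Suc.IH) (use Suc.prems that in auto)
  then show ?case by (auto intro!: nn_integral_cong split: split_indicator)
qed simp

lemma space_integral_cong:
  "(\<And>ys. length ys = k \<Longrightarrow> G ys = G' ys) \<Longrightarrow> space_integral \<mu> k G = space_integral \<mu> k G'"
proof (induction k arbitrary: G G')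
  case (Suc k)
  show ?case unfolding space_integral.simps by (intro nn_integral_cong Suc.IH Suc.prems) simp
qed simp

context revuz_pcaf
begin

theorem terminal_value_formula:
  assumes t: "0 < t" and f [measurable]: "f \<in> borel_measurable borel_Delta"
  shows "expect X x (\<lambda>w. f (path X t w) * pcaf_at A t w) =
        (\<integral>\<^sup>+s\<in>times_between 0 t.
          (\<integral>\<^sup>+y. p s x y *
            (\<integral>\<^sup>+z. extended_density m p (t - ennreal s) y z * f z \<partial>m_Delta m) \<partial>\<mu>) \<partial>lborel)"
proof -
  have fp: "(\<lambda>w. f (path X t w)) \<in> borel_measurable N0" using measurable_compose[OF measurable_path f] .
  have "(\<lambda>v. path X (t - fst v) (snd v)) \<in> borel \<Otimes>\<^sub>M N0 \<rightarrow>\<^sub>M borel_Delta"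
    by (rule measurable_path_compose) measurable
  note [measurable] = fp measurable_compose[OF this f]
  define \<Phi> where "\<Phi> s w = (if s < t then f (path X (t - s) w) else 0)" for s w
  have m\<Phi>: "(\<lambda>(s, w). \<Phi> s w) \<in> borel_measurable (borel \<Otimes>\<^sub>M N0)"
    unfolding \<Phi>_def case_prod_beta by measurable
  have "expect X x (\<lambda>w. f (path X t w) * pcaf_at A t w) = (\<integral>\<^sup>+w. f (path X t w) * clock t w \<partial>L (Some x))"
  proof (rule expect_eq_N0)
    show "(\<lambda>w. f (path X t w) * clock t w) \<in> borel_measurable N0" by measurable
    show "AE w in P (Some x). f (path X t w) * pcaf_at A t w = f (path X t w) * clock t w"
      using AE_pcaf_at_clock[of t "Some x"] by eventually_elim simp
  qed
  also have "\<dots> = V (\<lambda>s z. if ennreal s < t then 1 * (\<integral>\<^sup>+w. f (path X (t - ennreal s) w) \<partial>L z) else 0) (Some x)"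
    unfolding clock_def by (rule occupation_terminal) auto
  also have "(\<lambda>s z. if ennreal s < t then 1 * (\<integral>\<^sup>+w. f (path X (t - ennreal s) w) \<partial>L z) else 0) = (\<lambda>s z. \<integral>\<^sup>+w. \<Phi> (ennreal s) w \<partial>L z)"
    by (auto simp: \<Phi>_def fun_eq_iff)
  also have "V (\<lambda>s z. \<integral>\<^sup>+w. \<Phi> (ennreal s) w \<partial>L z) (Some x) = (\<integral>\<^sup>+s. (\<integral>\<^sup>+y. q s x y * (\<integral>\<^sup>+w. \<Phi> (ennreal s) w \<partial>L (Some y)) \<partial>\<mu>) \<partial>lborel)"
    by (rule V_eq_density[OF kernel_section_measurable[OF m\<Phi>]])
  also have "\<dots> = (\<integral>\<^sup>+s\<in>times_between 0 t.
          (\<integral>\<^sup>+y. p s x y *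
            (\<integral>\<^sup>+z. extended_density m p (t - ennreal s) y z * f z \<partial>m_Delta m) \<partial>\<mu>) \<partial>lborel)"
  proof (rule nn_integral_cong)
    fix s :: real
    show "(\<integral>\<^sup>+y. q s x y * (\<integral>\<^sup>+w. \<Phi> (ennreal s) w \<partial>L (Some y)) \<partial>\<mu>) =
      (\<integral>\<^sup>+y. p s x y * (\<integral>\<^sup>+z. extended_density m p (t - ennreal s) y z * f z \<partial>m_Delta m) \<partial>\<mu>) * indicator (times_between 0 t) s"
    proof (cases "0 < s \<and> ennreal s < t")
      case True
      then have "0 < t - ennreal s" by (simp add: diff_gr0_ennreal)
      from expected_terminal[OF this f] True show ?thesis by (simp add: \<Phi>_def q_def)
    next
      case False
      then have "q s x y * (\<integral>\<^sup>+w. \<Phi> (ennreal s) w \<partial>L (Some y)) = 0" for y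
        by (cases "0 < s") (auto simp: \<Phi>_def q_def)
      then show ?thesis using False by (simp only: nn_integral_const mult_zero_left) auto
    qed
  qed
  finally show ?thesis .
qed

text \<open>The product of densities in recursive form, with a variable starting time \<open>b\<close>; \<open>spatial_mass\<close> is
its integral over all positions.\<close>

primrec path_weight :: "real \<Rightarrow> 's \<Rightarrow> real list \<Rightarrow> 's list \<Rightarrow> ennreal" where
  "path_weight b x [] ys = 1"
| "path_weight b x (s # ts) ys = q (s - b) x (hd ys) * path_weight s (hd ys) ts (tl ys)"

lemma path_weight_eq_prod:
  "ordered_from b ts \<Longrightarrow> length ys = length ts \<Longrightarrow>
    (\<Prod>i<length ts. p (ts ! i - (b # ts) ! i) ((x # ys) ! i) (ys ! i)) = path_weight b x ts ys"
proof (induction ts arbitrary: b x ys)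
  case (Cons s ts)
  then obtain y ys' where ys: "ys = y # ys'" "length ys' = length ts" by (cases ys) auto
  show ?case using Cons.prems Cons.IH[of s ys' y] ys by (simp add: prod.lessThan_Suc_shift q_def del: prod.lessThan_Suc)
qed simp

primrec spatial_mass :: "real \<Rightarrow> 's \<Rightarrow> real list \<Rightarrow> ennreal" where
  "spatial_mass b x [] = 1"
| "spatial_mass b x (s # ts) = (\<integral>\<^sup>+y. q (s - b) x y * spatial_mass s y ts \<partial>\<mu>)"

lemma measurable_spatial_mass [measurable]: "(\<lambda>x. spatial_mass b x ts) \<in> borel_measurable borel"
proof (induction ts arbitrary: b)
  case (Cons s ts)
  note [measurable] = Cons.IH[of s]
  have "(\<lambda>w. q (s - b) (fst w) (snd w) * spatial_mass s (snd w) ts) \<in> borel_measurable (borel \<Otimes>\<^sub>M \<mu>)" by measurable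
  then show ?case by (simp add: mu.borel_measurable_nn_integral case_prod_beta)
qed simp

lemma space_integral_path_weight:
  "space_integral \<mu> (length ts) (\<lambda>ys. d * path_weight b x ts ys) = d * spatial_mass b x ts"
proof (induction ts arbitrary: b x d)
  case (Cons s ts)
  have "space_integral \<mu> (length (s # ts)) (\<lambda>ys. d * path_weight b x (s # ts) ys) = (\<integral>\<^sup>+y. (d * q (s - b) x y) * spatial_mass s y ts \<partial>\<mu>)"
    by (simp add: Cons.IH flip: mult.assoc)
  also have "\<dots> = d * (\<integral>\<^sup>+y. q (s - b) x y * spatial_mass s y ts \<partial>\<mu>)"
    by (subst nn_integral_cmult[symmetric]) (auto simp: mult.assoc)
  finally show ?case by simp
qed simp

text \<open>The iterated integral with time and space integrations interleaved, which is the order that the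
moment recursion produces.\<close>

primrec moment_kernel :: "ennreal \<Rightarrow> nat \<Rightarrow> real \<Rightarrow> 's \<Rightarrow> ennreal" where
  "moment_kernel t 0 b x = 1"
| "moment_kernel t (Suc k) b x =
     (\<integral>\<^sup>+s\<in>times_between b t. (\<integral>\<^sup>+y. q (s - b) x y * moment_kernel t k s y \<partial>\<mu>) \<partial>lborel)"

lemma measurable_moment_kernel: "(\<lambda>(b, x). moment_kernel t k b x) \<in> borel_measurable (borel \<Otimes>\<^sub>M borel)"
proof (induction k)
  case (Suc k)
  have [measurable]: "(\<lambda>w. moment_kernel t k (snd (fst w)) (snd w)) \<in> borel_measurable (((borel \<Otimes>\<^sub>M borel) \<Otimes>\<^sub>M lborel) \<Otimes>\<^sub>M \<mu>)"
    using measurable_compose[OF measurable_Pair[of "\<lambda>w. snd (fst w)" _ borel snd borel] Suc.IH, of "((borel \<Otimes>\<^sub>M borel) \<Otimes>\<^sub>M lborel) \<Otimes>\<^sub>M \<mu>"]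
    by simp
  have "(\<lambda>w. q (snd (fst w) - fst (fst (fst w))) (snd (fst (fst w))) (snd w) * moment_kernel t k (snd (fst w)) (snd w))
     \<in> borel_measurable (((borel \<Otimes>\<^sub>M borel) \<Otimes>\<^sub>M lborel) \<Otimes>\<^sub>M \<mu>)" by measurable
  then have [measurable]: "(\<lambda>w. \<integral>\<^sup>+y. q (snd w - fst (fst w)) (snd (fst w)) y * moment_kernel t k (snd w) y \<partial>\<mu>) \<in> borel_measurable ((borel \<Otimes>\<^sub>M borel) \<Otimes>\<^sub>M lborel)"
    by (intro mu.borel_measurable_nn_integral) (simp add: case_prod_beta)
  have "(\<lambda>w. (\<integral>\<^sup>+y. q (snd w - fst (fst w)) (snd (fst w)) y * moment_kernel t k (snd w) y \<partial>\<mu>) *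
     (if fst (fst w) < snd w \<and> ennreal (snd w) < t then 1 else 0)) \<in> borel_measurable ((borel \<Otimes>\<^sub>M borel) \<Otimes>\<^sub>M lborel)"
    by measurable
  then have "(\<lambda>v. \<integral>\<^sup>+s. (\<integral>\<^sup>+y. q (s - fst v) (snd v) y * moment_kernel t k s y \<partial>\<mu>) *
     (if fst v < s \<and> ennreal s < t then 1 else 0) \<partial>lborel) \<in> borel_measurable (borel \<Otimes>\<^sub>M borel)"
    by (intro lborel.borel_measurable_nn_integral) (simp add: case_prod_beta)
  then show ?case by (simp add: case_prod_beta indicator_def of_bool_def cong: if_cong)
qed simp

lemma measurable_moment_kernel_section [measurable]: "moment_kernel t k b \<in> borel_measurable borel"
  using measurable_compose[OF measurable_Pair1'[of b borel] measurable_moment_kernel[of t k]] by simp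

lemma moment_kernel_Fubini:
  assumes [measurable]: "w \<in> borel_measurable borel"
  shows "(\<integral>\<^sup>+s\<in>times_between b t. (\<integral>\<^sup>+x. w x * (\<integral>\<^sup>+y. q (s - b) x y * moment_kernel t k s y \<partial>\<mu>) \<partial>\<mu>) \<partial>lborel) =
    (\<integral>\<^sup>+x. w x * moment_kernel t (Suc k) b x \<partial>\<mu>)"
proof -
  interpret pm: pair_sigma_finite \<mu> "lborel :: real measure" ..
  have mk: "(\<lambda>w. moment_kernel t k (snd (fst w)) (snd w)) \<in> borel_measurable ((\<mu> \<Otimes>\<^sub>M lborel) \<Otimes>\<^sub>M \<mu>)"
    using measurable_compose[OF measurable_Pair[of "\<lambda>w. snd (fst w)" _ borel snd borel] measurable_moment_kernel[of t k], of "(\<mu> \<Otimes>\<^sub>M lborel) \<Otimes>\<^sub>M \<mu>"]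
    by simp
  have "(\<lambda>v. q (snd (fst v) - b) (fst (fst v)) (snd v) * moment_kernel t k (snd (fst v)) (snd v)) \<in> borel_measurable ((\<mu> \<Otimes>\<^sub>M lborel) \<Otimes>\<^sub>M \<mu>)"
    using mk by measurable
  then have I [measurable]: "(\<lambda>v. \<integral>\<^sup>+y. q (snd v - b) (fst v) y * moment_kernel t k (snd v) y \<partial>\<mu>) \<in> borel_measurable (\<mu> \<Otimes>\<^sub>M lborel)"
    by (intro mu.borel_measurable_nn_integral) (simp add: case_prod_beta)
  have ind [measurable]: "(\<lambda>s. indicator (times_between b t) s :: ennreal) \<in> borel_measurable borel" by measurable
  have "(\<integral>\<^sup>+s\<in>times_between b t. (\<integral>\<^sup>+x. w x * (\<integral>\<^sup>+y. q (s - b) x y * moment_kernel t k s y \<partial>\<mu>) \<partial>\<mu>) \<partial>lborel) =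
    (\<integral>\<^sup>+s. (\<integral>\<^sup>+x. w x * ((\<integral>\<^sup>+y. q (s - b) x y * moment_kernel t k s y \<partial>\<mu>) * indicator (times_between b t) s) \<partial>\<mu>) \<partial>lborel)"
    by (intro nn_integral_cong) (auto split: split_indicator)
  also have "\<dots> = (\<integral>\<^sup>+x. (\<integral>\<^sup>+s. w x * ((\<integral>\<^sup>+y. q (s - b) x y * moment_kernel t k s y \<partial>\<mu>) * indicator (times_between b t) s) \<partial>lborel) \<partial>\<mu>)"
    by (rule pm.Fubini') (unfold case_prod_beta, measurable)
  also have "\<dots> = (\<integral>\<^sup>+x. w x * moment_kernel t (Suc k) b x \<partial>\<mu>)"
  proof (rule nn_integral_cong)
    fix x
    have "(\<lambda>s. \<integral>\<^sup>+y. q (s - b) x y * moment_kernel t k s y \<partial>\<mu>) \<in> borel_measurable borel"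
      using measurable_compose[OF measurable_Pair1'[of x \<mu> lborel] I] by simp
    then show "(\<integral>\<^sup>+s. w x * ((\<integral>\<^sup>+y. q (s - b) x y * moment_kernel t k s y \<partial>\<mu>) * indicator (times_between b t) s) \<partial>lborel) = w x * moment_kernel t (Suc k) b x"
      by (simp add: nn_integral_cmult)
  qed
  finally show ?thesis .
qed

text \<open>Moving the space integrals inside, one at a time, replaces the weight \<open>w\<close> by its
image under the kernel \<open>q (s - b)\<close>; hence the general \<open>w\<close> in the induction.\<close>

lemma time_integral_spatial_mass_weighted:
  assumes "w \<in> borel_measurable borel"
  shows "time_integral t k b (\<lambda>ts. \<integral>\<^sup>+x. w x * spatial_mass b x ts \<partial>\<mu>) = (\<integral>\<^sup>+x. w x * moment_kernel t k b x \<partial>\<mu>)"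
  using assms
proof (induction k arbitrary: b w)
  case (Suc k)
  note w [measurable] = Suc.prems
  interpret mm: pair_sigma_finite \<mu> \<mu> ..
  have "time_integral t k s (\<lambda>ts. \<integral>\<^sup>+x. w x * spatial_mass b x (s # ts) \<partial>\<mu>) =
      (\<integral>\<^sup>+x. w x * (\<integral>\<^sup>+y. q (s - b) x y * moment_kernel t k s y \<partial>\<mu>) \<partial>\<mu>)" for s
  proof -
    have swap: "(\<integral>\<^sup>+x. w x * (\<integral>\<^sup>+y. q (s - b) x y * h y \<partial>\<mu>) \<partial>\<mu>) = (\<integral>\<^sup>+y. (\<integral>\<^sup>+x. w x * q (s - b) x y \<partial>\<mu>) * h y \<partial>\<mu>)"
      if [measurable]: "h \<in> borel_measurable borel" for h
    proof -
      have "(\<integral>\<^sup>+x. w x * (\<integral>\<^sup>+y. q (s - b) x y * h y \<partial>\<mu>) \<partial>\<mu>) = (\<integral>\<^sup>+x. (\<integral>\<^sup>+y. w x * q (s - b) x y * h y \<partial>\<mu>) \<partial>\<mu>)"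
        by (intro nn_integral_cong) (simp add: nn_integral_cmult[symmetric] mult.assoc)
      also have "\<dots> = (\<integral>\<^sup>+y. (\<integral>\<^sup>+x. w x * q (s - b) x y * h y \<partial>\<mu>) \<partial>\<mu>)"
        by (rule mm.Fubini') (unfold case_prod_beta, measurable)
      also have "\<dots> = (\<integral>\<^sup>+y. (\<integral>\<^sup>+x. w x * q (s - b) x y \<partial>\<mu>) * h y \<partial>\<mu>)"
        by (intro nn_integral_cong nn_integral_multc) measurable
      finally show ?thesis .
    qed
    have "(\<lambda>v. w (snd v) * q (s - b) (snd v) (fst v)) \<in> borel_measurable (borel \<Otimes>\<^sub>M \<mu>)" by measurable
    then have wm: "(\<lambda>y. \<integral>\<^sup>+x. w x * q (s - b) x y \<partial>\<mu>) \<in> borel_measurable borel"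
      by (intro mu.borel_measurable_nn_integral) (simp add: case_prod_beta)
    show ?thesis
      using Suc.IH[OF wm, of s] by (simp add: swap)
  qed
  then have "time_integral t (Suc k) b (\<lambda>ts. \<integral>\<^sup>+x. w x * spatial_mass b x ts \<partial>\<mu>) =
     (\<integral>\<^sup>+s\<in>times_between b t. (\<integral>\<^sup>+x. w x * (\<integral>\<^sup>+y. q (s - b) x y * moment_kernel t k s y \<partial>\<mu>) \<partial>\<mu>) \<partial>lborel)"
    by simp
  also note moment_kernel_Fubini[OF w]
  finally show ?case .
qed simp

lemma time_integral_spatial_mass: "time_integral t k b (\<lambda>ts. spatial_mass b x ts) = moment_kernel t k b x"
proof (cases k)
  case (Suc j)
  have "q (s - b) x \<in> borel_measurable borel" for s by measurable
  from time_integral_spatial_mass_weighted[OF this, of t j] show ?thesis by (simp add: Suc)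
qed simp

lemma time_integral_path_density:
  "time_integral t k 0 (\<lambda>ts. space_integral \<mu> k (\<lambda>ys. path_density p x ts ys)) = moment_kernel t k 0 x"
proof -
  have "time_integral t k 0 (\<lambda>ts. space_integral \<mu> k (\<lambda>ys. path_density p x ts ys)) = time_integral t k 0 (\<lambda>ts. spatial_mass 0 x ts)"
  proof (rule time_integral_cong)
    fix ts :: "real list" assume ts: "length ts = k" "ordered_from 0 ts"
    have "space_integral \<mu> k (\<lambda>ys. path_density p x ts ys) = space_integral \<mu> k (\<lambda>ys. 1 * path_weight 0 x ts ys)"
    proof (rule space_integral_cong)
      fix ys :: "'s list" assume "length ys = k"
      then show "path_density p x ts ys = 1 * path_weight 0 x ts ys"
        using path_weight_eq_prod[OF ts(2), of ys x] ts(1) by (simp add: path_density_def)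
    qed
    also have "\<dots> = spatial_mass 0 x ts" using space_integral_path_weight[of ts 1 0 x] ts by simp
    finally show "space_integral \<mu> k (\<lambda>ys. path_density p x ts ys) = spatial_mass 0 x ts" .
  qed
  then show ?thesis by (simp add: time_integral_spatial_mass)
qed

text \<open>The kernel with starting time \<open>b\<close> corresponds to the remaining time \<open>t - b\<close>.\<close>

lemma moment_eq_kernel:
  "0 \<le> b \<Longrightarrow> (\<integral>\<^sup>+w. clock (t - ennreal b) w ^ k \<partial>L (Some x)) = of_nat (fact k) * moment_kernel t k b x"
proof (induction k arbitrary: b x)
  case 0
  then show ?case using prob_space.emeasure_space_1[of "L (Some x)"] by simp
next
  case (Suc k)
  define \<Phi> where "\<Phi> s w = (if s < t - ennreal b then clock (t - ennreal b - s) w ^ k else 0)" for s w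
  have m\<Phi>: "(\<lambda>(s, w). \<Phi> s w) \<in> borel_measurable (borel \<Otimes>\<^sub>M N0)"
    unfolding \<Phi>_def case_prod_beta by measurable
  define I where "I s = (\<integral>\<^sup>+y. q (s - b) x y * moment_kernel t k s y \<partial>\<mu>) * indicator (times_between b t) s" for s
  have mk: "(\<lambda>v. moment_kernel t k (fst v) (snd v)) \<in> borel_measurable (borel \<Otimes>\<^sub>M \<mu>)"
    using measurable_moment_kernel[of t k] by (simp add: case_prod_beta cong: measurable_cong_sets)
  have "(\<lambda>v. q (fst v - b) x (snd v) * moment_kernel t k (fst v) (snd v)) \<in> borel_measurable (borel \<Otimes>\<^sub>M \<mu>)"
    using mk by measurable
  then have "(\<lambda>s. \<integral>\<^sup>+y. q (s - b) x y * moment_kernel t k s y \<partial>\<mu>) \<in> borel_measurable borel"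
    by (intro mu.borel_measurable_nn_integral) (simp add: case_prod_beta)
  moreover have "(\<lambda>s. indicator (times_between b t) s :: ennreal) \<in> borel_measurable borel" by measurable
  ultimately have Im: "I \<in> borel_measurable borel" unfolding I_def[abs_def] by measurable
  have "(\<integral>\<^sup>+w. clock (t - ennreal b) w ^ Suc k \<partial>L (Some x)) = of_nat (Suc k) * V (\<lambda>s z. \<integral>\<^sup>+w. \<Phi> (ennreal s) w \<partial>L z) (Some x)"
    unfolding \<Phi>_def by (rule moment_recursion)
  also have "V (\<lambda>s z. \<integral>\<^sup>+w. \<Phi> (ennreal s) w \<partial>L z) (Some x) = (\<integral>\<^sup>+s. (\<integral>\<^sup>+y. q s x y * (\<integral>\<^sup>+w. \<Phi> (ennreal s) w \<partial>L (Some y)) \<partial>\<mu>) \<partial>lborel)"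
    by (rule V_eq_density[OF kernel_section_measurable[OF m\<Phi>]])
  also have "\<dots> = (\<integral>\<^sup>+s. of_nat (fact k) * I (b + 1 * s) \<partial>lborel)"
  proof (rule nn_integral_cong)
    fix s :: real
    show "(\<integral>\<^sup>+y. q s x y * (\<integral>\<^sup>+w. \<Phi> (ennreal s) w \<partial>L (Some y)) \<partial>\<mu>) = of_nat (fact k) * I (b + 1 * s)"
    proof (cases "0 < s \<and> ennreal (b + s) < t")
      case True
      then have "ennreal s < t - ennreal b" using ennreal_less_diff[of b s t] Suc.prems by (simp del: ennreal_plus)
      moreover have "t - ennreal b - ennreal s = t - ennreal (b + s)" using True Suc.prems by (intro ennreal_diff_diff) auto
      ultimately have "(\<integral>\<^sup>+w. \<Phi> (ennreal s) w \<partial>L (Some y)) = of_nat (fact k) * moment_kernel t k (b + s) y" for y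
        using Suc.IH[of "b + s" y] True Suc.prems by (simp add: \<Phi>_def)
      then have "(\<integral>\<^sup>+y. q s x y * (\<integral>\<^sup>+w. \<Phi> (ennreal s) w \<partial>L (Some y)) \<partial>\<mu>) = (\<integral>\<^sup>+y. of_nat (fact k) * (q s x y * moment_kernel t k (b + s) y) \<partial>\<mu>)"
        by (simp add: mult.left_commute)
      also have "\<dots> = of_nat (fact k) * (\<integral>\<^sup>+y. q s x y * moment_kernel t k (b + s) y \<partial>\<mu>)"
        by (rule nn_integral_cmult) measurable
      finally show ?thesis using True by (simp add: I_def)
    next
      case False
      have "q s x y * (\<integral>\<^sup>+w. \<Phi> (ennreal s) w \<partial>L (Some y)) = 0" for y
      proof (cases "0 < s")
        case True
        then have "\<not> ennreal s < t - ennreal b" using False ennreal_less_diff[of b s t] Suc.prems by simp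
        then show ?thesis by (simp add: \<Phi>_def)
      qed (simp add: q_def)
      moreover have "I (b + 1 * s) = 0" using False by (auto simp: I_def)
      ultimately show ?thesis by (simp only: nn_integral_const mult_zero_left mult_zero_right)
    qed
  qed
  also have "\<dots> = (\<integral>\<^sup>+s. of_nat (fact k) * I s \<partial>lborel)"
    using nn_integral_real_affine[of "\<lambda>s. of_nat (fact k) * I s" 1 b] Im by simp
  also have "\<dots> = of_nat (fact k) * moment_kernel t (Suc k) b x"
    using Im by (subst nn_integral_cmult) (auto simp: I_def[abs_def])
  finally show ?case by (simp add: algebra_simps)
qed

theorem moment_formula:
  "expect X x (\<lambda>w. pcaf_at A t w ^ k) =
    of_nat (fact k) * time_integral t k 0 (\<lambda>ts. space_integral \<mu> k (\<lambda>ys. path_density p x ts ys))"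
proof -
  have "expect X x (\<lambda>w. pcaf_at A t w ^ k) = (\<integral>\<^sup>+w. clock t w ^ k \<partial>L (Some x))"
  proof (rule expect_eq_N0)
    show "(\<lambda>w. clock t w ^ k) \<in> borel_measurable N0" by measurable
    show "AE w in P (Some x). pcaf_at A t w ^ k = clock t w ^ k"
      using AE_pcaf_at_clock[of t "Some x"] by eventually_elim simp
  qed
  then show ?thesis using moment_eq_kernel[where b=0 and t=t and k=k and x=x] by (simp add: time_integral_path_density)
qed

end

section \<open>Products of two additive functionals\<close>

locale revuz_pair = ac_hunt X m p + A: revuz_pcaf X m p A \<mu> + B: revuz_pcaf X m p B \<nu>
  for X :: "('w, 's::{metric_space, second_countable_topology}) process" and m p A \<mu> B \<nu>
begin

text \<open>For fixed \<open>u\<close>, the increment of \<open>B\<close> between \<open>T\<^sub>u\<close> (the inverse clock of \<open>A\<close>) and \<open>t\<close>.\<close>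

definition pairs :: "ennreal \<Rightarrow> real \<Rightarrow> 'w \<Rightarrow> ennreal" where
  "pairs t u w = (\<integral>\<^sup>+v\<in>{0..}. (if A.T u w \<le> B.T v w \<and> B.T v w < t then 1 else 0) \<partial>lborel)"

lemma measurable_pairs [measurable]: "(\<lambda>(u, w). pairs t u w) \<in> borel_measurable (borel \<Otimes>\<^sub>M N0)"
proof -
  have "(\<lambda>v. (if A.T (fst (fst v)) (snd (fst v)) \<le> B.T (snd v) (snd (fst v)) \<and> B.T (snd v) (snd (fst v)) < t then 1 else 0) * indicator {0..} (snd v) :: ennreal)
      \<in> borel_measurable ((borel \<Otimes>\<^sub>M N0) \<Otimes>\<^sub>M lborel)"
    unfolding atLeast_def by measurable
  then show ?thesis
    unfolding pairs_def by (simp add: case_prod_beta lborel.borel_measurable_nn_integral)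
qed

lemma measurable_pairs_integral [measurable]: "(\<lambda>w. \<integral>\<^sup>+u\<in>{0..}. pairs t u w \<partial>lborel) \<in> borel_measurable N0"
proof -
  have "(\<lambda>v. pairs t (snd v) (fst v) * indicator {0..} (snd v)) \<in> borel_measurable (N0 \<Otimes>\<^sub>M lborel)"
    using measurable_compose[OF measurable_Pair[of snd _ borel fst] measurable_pairs[of t], of "N0 \<Otimes>\<^sub>M lborel"]
    unfolding atLeast_def by simp
  then show ?thesis by (intro lborel.borel_measurable_nn_integral) (simp add: case_prod_beta)
qed

lemma pairs_shift:
  assumes w: "w \<in> \<Omega>" "w \<notin> B.D" "\<theta> (A.T u w) w \<notin> B.D" and fin: "A.T u w < \<infinity>"
  shows "pairs t u w = (if A.T u w < t then B.clock (t - A.T u w) (\<theta> (A.T u w) w) else 0)"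
proof (cases "A.T u w < t")
  case True
  obtain s where s: "A.T u w = ennreal s" "0 \<le> s" using fin by (cases "A.T u w") auto
  let ?f = "\<lambda>r. if r < t then 1 else 0 :: ennreal"
  have "pairs t u w = (\<integral>\<^sup>+v\<in>{0..}. (if ennreal s \<le> B.T v w \<and> B.T v w < \<infinity> then ?f (B.T v w) else 0) \<partial>lborel)"
    unfolding pairs_def s(1)
    by (intro nn_integral_cong arg_cong2[where f="(*)"] refl) (auto intro: less_le_trans)
  also have "\<dots> = (\<integral>\<^sup>+z\<in>{0..}. (if B.T z (\<theta> (ennreal s) w) < \<infinity> then ?f (ennreal s + B.T z (\<theta> (ennreal s) w)) else 0) \<partial>lborel)"
    by (rule B.T_shift_integral) (use w s in auto)
  also have "\<dots> = B.clock (t - ennreal s) (\<theta> (ennreal s) w)"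
    unfolding B.clock_def
  proof (intro nn_integral_cong arg_cong2[where f="(*)"] refl)
    fix z
    show "(if B.T z (\<theta> (ennreal s) w) < \<infinity> then ?f (ennreal s + B.T z (\<theta> (ennreal s) w)) else 0) =
      (if B.T z (\<theta> (ennreal s) w) < t - ennreal s then 1 else 0)"
    proof (cases "B.T z (\<theta> (ennreal s) w) < \<infinity>")
      case True
      then show ?thesis using \<open>A.T u w < t\<close> s by (simp add: less_diff_eq_ennreal add.commute)
    next
      case False
      then have "B.T z (\<theta> (ennreal s) w) = top" by (simp add: less_top[symmetric])
      then show ?thesis by simp
    qed
  qed
  finally show ?thesis using True s by simp
next
  case False
  then have "(if A.T u w \<le> B.T v w \<and> B.T v w < t then 1 else 0) = (0::ennreal)" for v by (auto intro: le_less_trans)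
  then show ?thesis using False unfolding pairs_def by (simp only: mult_zero_left nn_integral_const) simp
qed

lemma expected_pairs:
  "(\<integral>\<^sup>+w. (\<integral>\<^sup>+u\<in>{0..}. pairs t u w \<partial>lborel) \<partial>L (Some x)) =
    (\<integral>\<^sup>+t1\<in>times_between 0 t. (\<integral>\<^sup>+t2\<in>times_between t1 t.
          (\<integral>\<^sup>+y1. (\<integral>\<^sup>+y2. p t1 x y1 * p (t2 - t1) y1 y2 \<partial>\<nu>) \<partial>\<mu>) \<partial>lborel) \<partial>lborel)"
proof -
  interpret pm: pair_sigma_finite \<mu> "lborel :: real measure" ..
  define \<Phi> where "\<Phi> s w = (if s < t then B.clock (t - s) w else 0)" for s w
  have m\<Phi>: "(\<lambda>(s, w). \<Phi> s w) \<in> borel_measurable (borel \<Otimes>\<^sub>M N0)"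
    unfolding \<Phi>_def case_prod_beta by measurable
  have "(\<integral>\<^sup>+w. (\<integral>\<^sup>+u\<in>{0..}. pairs t u w \<partial>lborel) \<partial>L (Some x)) = A.V (\<lambda>s z. \<integral>\<^sup>+w. \<Phi> (ennreal s) w \<partial>L z) (Some x)"
  proof (rule A.additive_functional_AE[OF m\<Phi> measurable_pairs])
    fix u :: real
    show "AE w in P (Some x). pairs t u w = (if A.T u w < \<infinity> then \<Phi> (A.T u w) (\<theta> (A.T u w) w) else 0)"
      using A.AE_D[of "Some x"] B.AE_D[of "Some x"] AE_space[of "P (Some x)"] B.AE_shift_D[OF A.stopping_\<tau>, of u "Some x"]
    proof eventually_elim
      fix w assume "w \<notin> A.D" "w \<notin> B.D" "w \<in> space (P (Some x))" "\<theta> (A.\<tau> u w) w \<notin> B.D"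
      then have w: "w \<in> \<Omega>" "w \<notin> B.D" "\<theta> (A.T u w) w \<notin> B.D" by (auto simp: A.not_D)
      show "pairs t u w = (if A.T u w < \<infinity> then \<Phi> (A.T u w) (\<theta> (A.T u w) w) else 0)"
      proof (cases "A.T u w < \<infinity>")
        case True
        then show ?thesis by (simp add: pairs_shift[OF w True] \<Phi>_def)
      next
        case False
        then have "A.T u w = top" by (simp add: less_top[symmetric])
        then have "(if A.T u w \<le> B.T v w \<and> B.T v w < t then 1 else 0) = (0::ennreal)" for v by (simp add: top_unique)
        then have "pairs t u w = 0" unfolding pairs_def by (simp only: mult_zero_left nn_integral_const)
        then show ?thesis using False by simp
      qed
    qed
  qed
  also have "\<dots> = (\<integral>\<^sup>+s. (\<integral>\<^sup>+y. q s x y * (\<integral>\<^sup>+w. \<Phi> (ennreal s) w \<partial>L (Some y)) \<partial>\<mu>) \<partial>lborel)"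
    by (rule A.V_eq_density[OF A.kernel_section_measurable[OF m\<Phi>]])
  also have "\<dots> = (\<integral>\<^sup>+t1\<in>times_between 0 t. (\<integral>\<^sup>+t2\<in>times_between t1 t.
          (\<integral>\<^sup>+y1. (\<integral>\<^sup>+y2. p t1 x y1 * p (t2 - t1) y1 y2 \<partial>\<nu>) \<partial>\<mu>) \<partial>lborel) \<partial>lborel)"
  proof (rule nn_integral_cong)
    fix s :: real
    show "(\<integral>\<^sup>+y. q s x y * (\<integral>\<^sup>+w. \<Phi> (ennreal s) w \<partial>L (Some y)) \<partial>\<mu>) =
      (\<integral>\<^sup>+t2\<in>times_between s t. (\<integral>\<^sup>+y1. (\<integral>\<^sup>+y2. p s x y1 * p (t2 - s) y1 y2 \<partial>\<nu>) \<partial>\<mu>) \<partial>lborel) * indicator (times_between 0 t) s"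
    proof (cases "0 < s \<and> ennreal s < t")
      case True
      have inner: "(\<integral>\<^sup>+w. \<Phi> (ennreal s) w \<partial>L (Some y)) = (\<integral>\<^sup>+r. (\<integral>\<^sup>+y2. q (r - s) y y2 \<partial>\<nu>) * indicator (times_between s t) r \<partial>lborel)" for y
        using B.moment_eq_kernel[where b=s and t=t and k=1 and x=y] True by (simp add: \<Phi>_def)
      have "(\<lambda>v. q (snd (fst v) - s) (fst (fst v)) (snd v)) \<in> borel_measurable ((\<mu> \<Otimes>\<^sub>M lborel) \<Otimes>\<^sub>M \<nu>)" by measurable
      then have I [measurable]: "(\<lambda>v. \<integral>\<^sup>+y2. q (snd v - s) (fst v) y2 \<partial>\<nu>) \<in> borel_measurable (\<mu> \<Otimes>\<^sub>M lborel)"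
        by (intro B.mu.borel_measurable_nn_integral) (simp add: case_prod_beta)
      have ind [measurable]: "(\<lambda>r. indicator (times_between s t) r :: ennreal) \<in> borel_measurable borel" by measurable
      have sec [measurable]: "(\<lambda>r. \<integral>\<^sup>+y2. q (r - s) y y2 \<partial>\<nu>) \<in> borel_measurable borel" for y
        using measurable_compose[OF measurable_Pair1'[of y \<mu> lborel] I] by simp
      have "(\<integral>\<^sup>+y. q s x y * (\<integral>\<^sup>+w. \<Phi> (ennreal s) w \<partial>L (Some y)) \<partial>\<mu>) =
        (\<integral>\<^sup>+y. (\<integral>\<^sup>+r. q s x y * ((\<integral>\<^sup>+y2. q (r - s) y y2 \<partial>\<nu>) * indicator (times_between s t) r) \<partial>lborel) \<partial>\<mu>)"
        unfolding inner by (intro nn_integral_cong nn_integral_cmult[symmetric]) measurable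
      also have "\<dots> = (\<integral>\<^sup>+r. (\<integral>\<^sup>+y. q s x y * ((\<integral>\<^sup>+y2. q (r - s) y y2 \<partial>\<nu>) * indicator (times_between s t) r) \<partial>\<mu>) \<partial>lborel)"
        by (rule pm.Fubini'[symmetric]) (unfold case_prod_beta, measurable)
      also have "\<dots> = (\<integral>\<^sup>+r\<in>times_between s t. (\<integral>\<^sup>+y1. (\<integral>\<^sup>+y2. p s x y1 * p (r - s) y1 y2 \<partial>\<nu>) \<partial>\<mu>) \<partial>lborel)"
      proof (rule nn_integral_cong)
        fix r :: real
        show "(\<integral>\<^sup>+y. q s x y * ((\<integral>\<^sup>+y2. q (r - s) y y2 \<partial>\<nu>) * indicator (times_between s t) r) \<partial>\<mu>) =
          (\<integral>\<^sup>+y1. (\<integral>\<^sup>+y2. p s x y1 * p (r - s) y1 y2 \<partial>\<nu>) \<partial>\<mu>) * indicator (times_between s t) r"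
        proof (cases "r \<in> times_between s t")
          case r: True
          have "q s x y * (\<integral>\<^sup>+y2. q (r - s) y y2 \<partial>\<nu>) = (\<integral>\<^sup>+y2. q s x y * q (r - s) y y2 \<partial>\<nu>)" for y
            by (rule nn_integral_cmult[symmetric]) measurable
          then show ?thesis using r True by (simp add: q_def)
        qed simp
      qed
      finally show ?thesis using True by simp
    next
      case False
      then have "q s x y * (\<integral>\<^sup>+w. \<Phi> (ennreal s) w \<partial>L (Some y)) = 0" for y
        by (cases "0 < s") (auto simp: \<Phi>_def q_def)
      then show ?thesis using False by (simp only: nn_integral_const mult_zero_left) auto
    qed
  qed
  finally show ?thesis .
qed

end

context revuz_pair
begin

text \<open>Split the pairs \<open>(u, v)\<close> of clock levels according to which one is reached first. For given \<open>v\<close> there is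
at most one \<open>u\<close> that is reached at the same time, because the inverse clocks are strictly increasing.\<close>

lemma clock_product:
  assumes w: "w \<in> \<Omega>" "w \<notin> A.D"
  shows "A.clock t w * B.clock t w =
    (\<integral>\<^sup>+u\<in>{0..}. pairs t u w \<partial>lborel) +
    (\<integral>\<^sup>+v\<in>{0..}. (\<integral>\<^sup>+u\<in>{0..}. (if B.T v w \<le> A.T u w \<and> A.T u w < t then 1 else 0) \<partial>lborel) \<partial>lborel)"
proof -
  note [measurable] = A.T_section_measurable[OF w(1)] B.T_section_measurable[OF w(1)]
  define f where "f u = (if A.T u w < t then 1 else 0 :: ennreal) * indicator {0..} u" for u :: real
  define g where "g v = (if B.T v w < t then 1 else 0 :: ennreal) * indicator {0..} v" for v :: real
  define before where "before u v = (if A.T u w \<le> B.T v w then 1 else 0 :: ennreal)" for u v :: real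
  define after where "after u v = (if B.T v w < A.T u w then 1 else 0 :: ennreal)" for u v :: real
  have [measurable]: "f \<in> borel_measurable borel" "g \<in> borel_measurable borel"
    unfolding f_def[abs_def] g_def[abs_def] atLeast_def by measurable
  have mb [measurable]: "(\<lambda>z. before (fst z) (snd z)) \<in> borel_measurable (lborel \<Otimes>\<^sub>M lborel)"
    "(\<lambda>z. after (fst z) (snd z)) \<in> borel_measurable (lborel \<Otimes>\<^sub>M lborel)"
    unfolding before_def after_def by measurable
  have [measurable]: "before u \<in> borel_measurable borel" "after u \<in> borel_measurable borel" for u
    unfolding before_def[abs_def] after_def[abs_def] by measurable
  have [measurable]: "(\<lambda>u. \<integral>\<^sup>+v. f u * g v * before u v \<partial>lborel) \<in> borel_measurable lborel"
    "(\<lambda>u. \<integral>\<^sup>+v. f u * g v * after u v \<partial>lborel) \<in> borel_measurable lborel"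
    by (intro lborel.borel_measurable_nn_integral; simp add: case_prod_beta)+
  have split1: "f u * g v = f u * g v * before u v + f u * g v * after u v" for u v
    by (auto simp: before_def after_def)
  have "A.clock t w * B.clock t w = (\<integral>\<^sup>+u. f u \<partial>lborel) * (\<integral>\<^sup>+v. g v \<partial>lborel)"
    by (simp add: A.clock_def B.clock_def f_def g_def)
  also have "\<dots> = (\<integral>\<^sup>+u. (\<integral>\<^sup>+v. f u * g v \<partial>lborel) \<partial>lborel)"
    by (simp add: nn_integral_cmult nn_integral_multc)
  also have "\<dots> = (\<integral>\<^sup>+u. (\<integral>\<^sup>+v. f u * g v * before u v \<partial>lborel) + (\<integral>\<^sup>+v. f u * g v * after u v \<partial>lborel) \<partial>lborel)"
    by (intro nn_integral_cong, subst split1, rule nn_integral_add) measurable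
  also have "\<dots> = (\<integral>\<^sup>+u. (\<integral>\<^sup>+v. f u * g v * before u v \<partial>lborel) \<partial>lborel) + (\<integral>\<^sup>+u. (\<integral>\<^sup>+v. f u * g v * after u v \<partial>lborel) \<partial>lborel)"
    by (rule nn_integral_add) measurable
  also have "(\<integral>\<^sup>+u. (\<integral>\<^sup>+v. f u * g v * before u v \<partial>lborel) \<partial>lborel) = (\<integral>\<^sup>+u\<in>{0..}. pairs t u w \<partial>lborel)"
  proof (rule nn_integral_cong)
    fix u :: real
    have "pairs t u w * indicator {0..} u =
      (\<integral>\<^sup>+v. (if A.T u w \<le> B.T v w \<and> B.T v w < t then 1 else 0) * indicator {0..} v * indicator {0..} u \<partial>lborel)"
      unfolding pairs_def by (rule nn_integral_multc[symmetric]) (unfold atLeast_def, measurable)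
    also have "\<dots> = (\<integral>\<^sup>+v. f u * g v * before u v \<partial>lborel)"
      by (intro nn_integral_cong) (auto simp: f_def g_def before_def split: split_indicator dest: le_less_trans)
    finally show "(\<integral>\<^sup>+v. f u * g v * before u v \<partial>lborel) = pairs t u w * indicator {0..} u" by simp
  qed
  also have "(\<integral>\<^sup>+u. (\<integral>\<^sup>+v. f u * g v * after u v \<partial>lborel) \<partial>lborel) = (\<integral>\<^sup>+v. (\<integral>\<^sup>+u. f u * g v * after u v \<partial>lborel) \<partial>lborel)"
    by (rule lborel_pair.Fubini'[symmetric]) (unfold case_prod_beta, measurable)
  also have "\<dots> = (\<integral>\<^sup>+v\<in>{0..}. (\<integral>\<^sup>+u\<in>{0..}. (if B.T v w \<le> A.T u w \<and> A.T u w < t then 1 else 0) \<partial>lborel) \<partial>lborel)"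
  proof (rule nn_integral_cong)
    fix v :: real
    have ties: "AE u in lborel. \<not> (0 \<le> u \<and> A.T u w = B.T v w \<and> A.T u w < t)"
    proof (cases "\<exists>u\<ge>0. A.T u w = B.T v w \<and> A.T u w < t")
      case True
      then obtain u0 where u0: "0 \<le> u0" "A.T u0 w = B.T v w" "A.T u0 w < t" by auto
      then have fin: "A.T u0 w < \<infinity>" by (auto intro: less_le_trans)
      have "u = u0" if "0 \<le> u" "A.T u w = B.T v w" for u
        using A.T_strict_mono[OF w, of u u0] A.T_strict_mono[OF w, of u0 u] that u0 fin
        by (metis less_irrefl linorder_neqE)
      then show ?thesis using AE_lborel_neq[of u0] by (auto elim!: eventually_mono)
    qed auto
    have "(\<integral>\<^sup>+u\<in>{0..}. (if B.T v w \<le> A.T u w \<and> A.T u w < t then 1 else 0) \<partial>lborel) * indicator {0..} v =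
      (\<integral>\<^sup>+u. (if B.T v w \<le> A.T u w \<and> A.T u w < t then 1 else 0) * indicator {0..} u * indicator {0..} v \<partial>lborel)"
      by (rule nn_integral_multc[symmetric]) (unfold atLeast_def, measurable)
    also have "\<dots> = (\<integral>\<^sup>+u. f u * g v * after u v \<partial>lborel)"
      by (rule nn_integral_cong_AE, use ties in eventually_elim)
        (auto simp: f_def g_def after_def order_le_less split: split_indicator dest: le_less_trans less_trans)
    finally show "(\<integral>\<^sup>+u. f u * g v * after u v \<partial>lborel) =
      (\<integral>\<^sup>+u\<in>{0..}. (if B.T v w \<le> A.T u w \<and> A.T u w < t then 1 else 0) \<partial>lborel) * indicator {0..} v" by simp
  qed
  finally show ?thesis .
qed

theorem product_formula:
  "expect X x (\<lambda>w. pcaf_at A t w * pcaf_at B t w) =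
        (\<integral>\<^sup>+t1\<in>times_between 0 t. (\<integral>\<^sup>+t2\<in>times_between t1 t.
          (\<integral>\<^sup>+y1. (\<integral>\<^sup>+y2. p t1 x y1 * p (t2 - t1) y1 y2 \<partial>\<nu>) \<partial>\<mu>) \<partial>lborel) \<partial>lborel) +
        (\<integral>\<^sup>+t1\<in>times_between 0 t. (\<integral>\<^sup>+t2\<in>times_between t1 t.
          (\<integral>\<^sup>+y1. (\<integral>\<^sup>+y2. p t1 x y1 * p (t2 - t1) y1 y2 \<partial>\<mu>) \<partial>\<nu>) \<partial>lborel) \<partial>lborel)"
proof -
  interpret BA: revuz_pair X m p B \<nu> A \<mu> ..
  let ?g = "\<lambda>w. (\<integral>\<^sup>+u\<in>{0..}. pairs t u w \<partial>lborel) + (\<integral>\<^sup>+v\<in>{0..}. BA.pairs t v w \<partial>lborel)"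
  have "expect X x (\<lambda>w. pcaf_at A t w * pcaf_at B t w) = (\<integral>\<^sup>+w. ?g w \<partial>L (Some x))"
  proof (rule expect_eq_N0)
    show "?g \<in> borel_measurable N0"
      using measurable_pairs_integral[of t] BA.measurable_pairs_integral[of t] by measurable
    show "AE w in P (Some x). pcaf_at A t w * pcaf_at B t w = ?g w"
      using A.AE_pcaf_at_clock[of t "Some x"] B.AE_pcaf_at_clock[of t "Some x"] A.AE_D[of "Some x"] AE_space[of "P (Some x)"]
    proof eventually_elim
      fix w assume h: "pcaf_at A t w = A.clock t w" "pcaf_at B t w = B.clock t w" "w \<notin> A.D" "w \<in> space (P (Some x))"
      then show "pcaf_at A t w * pcaf_at B t w = ?g w"
        unfolding h(1,2) by (subst clock_product) (auto simp: BA.pairs_def)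
    qed
  qed
  also have "\<dots> = (\<integral>\<^sup>+w. (\<integral>\<^sup>+u\<in>{0..}. pairs t u w \<partial>lborel) \<partial>L (Some x)) + (\<integral>\<^sup>+w. (\<integral>\<^sup>+v\<in>{0..}. BA.pairs t v w \<partial>lborel) \<partial>L (Some x))"
    by (rule nn_integral_add) (intro measurable_L_of_N0 measurable_pairs_integral BA.measurable_pairs_integral)+
  also note expected_pairs
  also note BA.expected_pairs
  finally show ?thesis .
qed

end

theorem corollary2p10:
  fixes X :: "('w, 's::{metric_space, second_countable_topology}) process"
    and m \<mu> \<nu> :: "'s measure"
    and \<E> :: "('s \<Rightarrow> real) \<Rightarrow> ('s \<Rightarrow> real) \<Rightarrow> real"
    and \<F> :: "('s \<Rightarrow> real) set"
    and p :: "real \<Rightarrow> 's \<Rightarrow> 's \<Rightarrow> ennreal"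
    and A B :: "real \<Rightarrow> 'w \<Rightarrow> ennreal"
  assumes "locally_compact_space (euclidean :: 's topology)"
    and "radon_measure m" and "full_support m"
    and "dirichlet_form m \<E> \<F>" and "regular_form m \<E> \<F>"
    and "hunt_process X" and "symmetric_process X m"
    and "dirichlet_form_of_process X m \<E> \<F>"
    and "absolute_continuity_condition X m"
    and "transition_density X m p"
    and "pcaf X A" and "revuz_measure X m A \<mu>"
    and "pcaf X B" and "revuz_measure X m B \<nu>"
  shows
    "(\<forall>t x. \<forall>f\<in>borel_measurable borel_Delta. 0 < t \<longrightarrow>
        expect X x (\<lambda>\<omega>. f (path X t \<omega>) * pcaf_at A t \<omega>) =
        (\<integral>\<^sup>+s\<in>times_between 0 t.
          (\<integral>\<^sup>+y. p s x y *
            (\<integral>\<^sup>+z. extended_density m p (t - ennreal s) y z * f z \<partial>m_Delta m) \<partial>\<mu>) \<partial>lborel)) \<and>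
     (\<forall>t x. \<forall>k\<ge>1. 0 < t \<longrightarrow>
        expect X x (\<lambda>\<omega>. pcaf_at A t \<omega> ^ k) =
        of_nat (fact k) *
        time_integral t k 0 (\<lambda>ts. space_integral \<mu> k (\<lambda>ys. path_density p x ts ys))) \<and>
     (\<forall>t x. 0 < t \<longrightarrow>
        expect X x (\<lambda>\<omega>. pcaf_at A t \<omega> * pcaf_at B t \<omega>) =
        (\<integral>\<^sup>+t1\<in>times_between 0 t. (\<integral>\<^sup>+t2\<in>times_between t1 t.
          (\<integral>\<^sup>+y1. (\<integral>\<^sup>+y2. p t1 x y1 * p (t2 - t1) y1 y2 \<partial>\<nu>) \<partial>\<mu>) \<partial>lborel) \<partial>lborel) +
        (\<integral>\<^sup>+t1\<in>times_between 0 t. (\<integral>\<^sup>+t2\<in>times_between t1 t.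
          (\<integral>\<^sup>+y1. (\<integral>\<^sup>+y2. p t1 x y1 * p (t2 - t1) y1 y2 \<partial>\<mu>) \<partial>\<nu>) \<partial>lborel) \<partial>lborel))"
proof -
  interpret revuz_pair X m p A \<mu> B \<nu> by unfold_locales fact+
  show ?thesis using A.terminal_value_formula A.moment_formula product_formula by blast
qed

end
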